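(* Let $1\le r\le\infty$, let $\mathcal{F}$ and $\mathcal{F}'$ be $C^r$ foliations on manifolds $M$ and $M'$, and let $A$ be a regular $C^r$ submanifold of $M'$ whose intersection with $\mathcal{F}'$ is clean. If $A$ is closed in $M'$, then the set $$\{\phi\in C^r(\mathcal{F},\mathcal{F}')\ :\ \phi\text{ is ls-transverse to }A\}$$ is residual in $C^r_{SP}(\mathcal{F},\mathcal{F}';A)$.
   Context: Foliations. A $C^r$ foliation of dimension $p$ and codimension $q$ has foliation charts $\theta:U\to T\times B$ with $T\subset\mathbb{R}^q$ open and $B\subset\mathbb{R}^p$ convex open; the composite $U\to T$ is the local projection. $T\mathcal{F}$ is the tangent bundle to the leaves. For $V$ open, $\mathcal{F}|_V$ has as leaves the connected components (in the leaf topology) of the intersections of leaves of $\mathcal{F}$ with $V$. $C^r(\mathcal{F},\mathcal{F}')$ is the set of $C^r$ foliation maps, i.e. $C^r$ maps $M\to M'$ sending each leaf of $\mathcal{F}$ into a leaf of $\mathcal{F}'$. Residual means containing a countable intersection of dense open subsets. Regular submanifold means embedded submanifold. Clean intersection and good local saturations. The intersection of $A$ and $\mathcal{F}'$ is clean if around each point of $A$ there is a foliation chart $\theta:U\to T\times B$ of $\mathcal{F}'$ with $\theta(U\cap A)=T_0\times B_0$ for regular $C^r$ submanifolds $T_0\subset T$, $B_0\subset B$. Then the connected components of the intersections of $A$ with leaves of $\mathcal{F}'$ are the leaves of a $C^r$ foliation $\mathcal{F}'|_A$ of $A$. A local saturation of $A$ is the saturation (union of leaves meeting $A$) of $A$ with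 respect to $\mathcal{F}'|_V$ for some open neighbourhood $V$ of $A$. A local saturation $S$ is good if it is a regular $C^r$ submanifold of $M'$, $\mathcal{F}'|_S$ is a $C^r$ foliation whose leaves are open subsets of leaves of $\mathcal{F}'$, and for each $x\in A$ the inclusion $T_x\mathcal{F}'\hookrightarrow T_xS$ induces an isomorphism $T_x\mathcal{F}'/T_x(\mathcal{F}'|_A)\cong T_xS/T_xA$. $C^r(\mathcal{F},\mathcal{F}';A)$ is the set of $\phi\in C^r(\mathcal{F},\mathcal{F}')$ for which there is a good local saturation $S$ of $A$ such that $\phi^{-1}(S)$ is a neighbourhood of $\phi^{-1}(A)$ in $M$. A map $\phi\in C^r(\mathcal{F},\mathcal{F}')$ is ls-transverse to $A$ if there are an open neighbourhood $U$ of $\phi^{-1}(A)$ and a good local saturation $S$ of $A$ such that $\phi(U)\subset S$ and $\phi:U\to S$ is transverse to $A$ (such maps lie in $C^r(\mathcal{F},\mathcal{F}';A)$). $C^r_{SP}(\mathcal{F},\mathcal{F}';A)$ has the subspace topology from the strong plaquewise topology (sp-topology) of $C^r(\mathcal{F},\mathcal{F}')$: for $r$ finite, a base is given by the sets $\mathcal{N}^r(\phi,\Theta,\Theta',\mathcal{K},\mathcal{E})$, where $\phi\in C^r(\mathcal{F},\mathcal{F}')$, $\Theta=\{(U_i,\theta_i)\}$ is a locally finite family of foliation charts of $\mathcal{F}$, $\Theta'=\{(U'_i,\theta'_i)\}$ is a family of foliation charts of $\mathcal{F}'$ with the same index set and with local projections $\pi'_i$, $\mathcal{K}=\{K_i\}$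 is a family of compact sets with $K_i\subset U_i$ and $\phi(K_i)\subset U'_i$, and $\mathcal{E}=\{\epsilon_i\}$ is a family of positive numbers. It consists of the $\psi\in C^r(\mathcal{F},\mathcal{F}')$ such that, for all $i$, $x\in K_i$ and $0\le k\le r$: $\psi(K_i)\subset U'_i$, $\pi'_i\psi(x)=\pi'_i\phi(x)$, and $\|D^k(\theta'_i\psi\theta_i^{-1})(\theta_i(x))-D^k(\theta'_i\phi\theta_i^{-1})(\theta_i(x))\|<\epsilon_i$. For $r=\infty$, a base is given by all sets $C^\infty(\mathcal{F},\mathcal{F}')\cap\mathcal{N}^s(\phi,\Theta,\Theta',\mathcal{K},\mathcal{E})$ with $s\in\mathbb{N}$ arbitrary. *)

theory Defs
  imports "HOL-Analysis.Analysis"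
begin

section \<open>Maps of class $C^r$ between open subsets of Euclidean spaces\<close>

text \<open>
  Dimensions are natural numbers (possibly 0) and vary inside the statement, so that
  $R^n$ is the library's \<^const>\<open>Euclidean_space\<close> \<open>n\<close>, whose points are the
  functions \<open>z :: nat \<Rightarrow> real\<close> with \<open>z i = 0\<close> for \<open>i \<ge> n\<close>.  In particular $R^d$ is literally a
  subset of $R^n$ when \<open>d \<le> n\<close>.
\<close>

type_synonym point = "nat \<Rightarrow> real"

definition partial_deriv :: "nat \<Rightarrow> (point \<Rightarrow> real) \<Rightarrow> point \<Rightarrow> real" where
  "partial_deriv i g z = deriv (\<lambda>t. g (z(i := t))) (z i)"

primrec iter_partial :: "nat list \<Rightarrow> (point \<Rightarrow> real) \<Rightarrow> point \<Rightarrow> real" where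
  "iter_partial [] g = g"
| "iter_partial (i # is) g = partial_deriv i (iter_partial is g)"

text \<open>\<open>f\<close> is of class $C^r$ on the open subset \<open>U\<close> of $R^n$, with values in $R^m$: all iterated
  partial derivatives of order at most \<open>r\<close> of the components of \<open>f\<close> exist and are continuous.\<close>

definition Cr_on :: "enat \<Rightarrow> nat \<Rightarrow> nat \<Rightarrow> point set \<Rightarrow> (point \<Rightarrow> point) \<Rightarrow> bool" where
  "Cr_on r n m U f \<longleftrightarrow>
     (\<forall>j<m. \<forall>is. set is \<subseteq> {..<n} \<and> enat (length is) \<le> r \<longrightarrow>
        continuous_map (subtopology (Euclidean_space n) U) euclideanreal
          (iter_partial is (\<lambda>z. f z j)) \<and>
        (enat (length is) < r \<longrightarrow>
           (\<forall>i<n. \<forall>z\<in>U. (\<lambda>t. iter_partial is (\<lambda>y. f y j) (z(i := t))) differentiable (at (z i)))))"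

text \<open>$\|D^kf(z)-D^kg(z)\|$ for maps from $R^n$ to $R^m$; the norm on
  $k$-linear maps is the Euclidean (Hilbert-Schmidt) norm of the array of components.\<close>

definition deriv_dist ::
    "nat \<Rightarrow> nat \<Rightarrow> nat \<Rightarrow> (point \<Rightarrow> point) \<Rightarrow> (point \<Rightarrow> point) \<Rightarrow> point \<Rightarrow> real" where
  "deriv_dist k n m f g z =
     sqrt (\<Sum>is\<in>{is. length is = k \<and> set is \<subseteq> {..<n}}. \<Sum>j<m.
       (iter_partial is (\<lambda>y. f y j) z - iter_partial is (\<lambda>y. g y j) z)\<^sup>2)"

section \<open>Manifolds\<close>

text \<open>A chart is a pair \<open>(U, \<theta>)\<close>; only the values of \<open>\<theta>\<close> on \<open>U\<close> matter.\<close>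

type_synonym 'a chart = "'a set \<times> ('a \<Rightarrow> point)"

definition is_chart :: "'a topology \<Rightarrow> nat \<Rightarrow> 'a chart \<Rightarrow> bool" where
  "is_chart X n = (\<lambda>(U, \<theta>).
     openin X U \<and> openin (Euclidean_space n) (\<theta> ` U) \<and>
     homeomorphic_map (subtopology X U) (subtopology (Euclidean_space n) (\<theta> ` U)) \<theta>)"

definition Cr_compatible :: "enat \<Rightarrow> nat \<Rightarrow> 'a chart \<Rightarrow> 'a chart \<Rightarrow> bool" where
  "Cr_compatible r n = (\<lambda>(U, \<theta>) (U', \<theta>').
     Cr_on r n n (\<theta> ` (U \<inter> U')) (\<theta>' \<circ> inv_into U \<theta>) \<and>
     Cr_on r n n (\<theta>' ` (U \<inter> U')) (\<theta> \<circ> inv_into U' \<theta>'))"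

record 'a manifold =
  base_space :: "'a topology"
  mdim :: nat
  atlas :: "'a chart set"

text \<open>The atlas is maximal, i.e. it is the $C^r$ structure itself.\<close>

definition Cr_manifold :: "enat \<Rightarrow> ('a, 'b) manifold_scheme \<Rightarrow> bool" where
  "Cr_manifold r M \<longleftrightarrow>
     Hausdorff_space (base_space M) \<and> second_countable (base_space M) \<and>
     (\<forall>c\<in>atlas M. is_chart (base_space M) (mdim M) c) \<and>
     \<Union> (fst ` atlas M) = topspace (base_space M) \<and>
     (\<forall>c\<in>atlas M. \<forall>c'\<in>atlas M. Cr_compatible r (mdim M) c c') \<and>
     (\<forall>c. is_chart (base_space M) (mdim M) c \<and> (\<forall>c'\<in>atlas M. Cr_compatible r (mdim M) c c')
        \<longrightarrow> c \<in> atlas M)"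

definition Cr_map ::
    "enat \<Rightarrow> ('a, 'c) manifold_scheme \<Rightarrow> ('b, 'd) manifold_scheme \<Rightarrow> ('a \<Rightarrow> 'b) \<Rightarrow> bool" where
  "Cr_map r M N f \<longleftrightarrow>
     continuous_map (base_space M) (base_space N) f \<and>
     (\<forall>(U, \<theta>)\<in>atlas M. \<forall>(U', \<theta>')\<in>atlas N.
        Cr_on r (mdim M) (mdim N) (\<theta> ` {x\<in>U. f x \<in> U'}) (\<theta>' \<circ> f \<circ> inv_into U \<theta>))"

definition Euclidean_manifold :: "enat \<Rightarrow> nat \<Rightarrow> point manifold" where
  "Euclidean_manifold r n =
     \<lparr>base_space = Euclidean_space n, mdim = n,
      atlas = {c. is_chart (Euclidean_space n) n c \<and>
                  Cr_compatible r n c (topspace (Euclidean_space n), \<lambda>z. z)}\<rparr>"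

section \<open>Regular submanifolds\<close>

definition slice_charts :: "('a, 'b) manifold_scheme \<Rightarrow> nat \<Rightarrow> 'a set \<Rightarrow> 'a chart set" where
  "slice_charts M d A =
     {(U, \<theta>) \<in> atlas M. \<theta> ` (U \<inter> A) = \<theta> ` U \<inter> {z. \<forall>i\<ge>d. z i = 0}}"

definition regular_submanifold :: "('a, 'b) manifold_scheme \<Rightarrow> nat \<Rightarrow> 'a set \<Rightarrow> bool" where
  "regular_submanifold M d A \<longleftrightarrow>
     d \<le> mdim M \<and> A \<subseteq> topspace (base_space M) \<and>
     (\<forall>x\<in>A. \<exists>(U, \<theta>)\<in>slice_charts M d A. x \<in> U)"

text \<open>A regular submanifold as a $C^r$ manifold; if \<open>(U, \<theta>)\<close> is a slice chart, then
  \<open>(U \<inter> A, \<theta>)\<close> is a chart with values in $R^d$.\<close>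

definition submanifold :: "enat \<Rightarrow> ('a, 'b) manifold_scheme \<Rightarrow> nat \<Rightarrow> 'a set \<Rightarrow> 'a manifold" where
  "submanifold r M d A =
     \<lparr>base_space = subtopology (base_space M) A, mdim = d,
      atlas = {c. is_chart (subtopology (base_space M) A) d c \<and>
                  (\<forall>(U, \<theta>)\<in>slice_charts M d A. Cr_compatible r d c (U \<inter> A, \<theta>))}\<rparr>"

section \<open>Tangent vectors\<close>

text \<open>\<open>C1_curve M X \<gamma>\<close>: \<open>\<gamma>\<close> is a $C^1$ curve in \<open>M\<close>, parametrized by $(-1,1)$, which moreover is
  continuous as a curve in \<open>X\<close>.  Here \<open>X\<close> is a topology on a subset of \<open>M\<close>, finer than the subspace
  topology; it serves to single out the curves in a subset or along the leaves.\<close>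

definition C1_curve :: "('a, 'b) manifold_scheme \<Rightarrow> 'a topology \<Rightarrow> (real \<Rightarrow> 'a) \<Rightarrow> bool" where
  "C1_curve M X \<gamma> \<longleftrightarrow>
     continuous_map (top_of_set {-1<..<1}) (base_space M) \<gamma> \<and>
     continuous_map (top_of_set {-1<..<1}) X \<gamma> \<and>
     (\<forall>(U, \<theta>)\<in>atlas M. \<forall>i<mdim M.
        let J = {t\<in>{-1<..<1}. \<gamma> t \<in> U} in
          (\<forall>t\<in>J. (\<lambda>s. \<theta> (\<gamma> s) i) differentiable (at t)) \<and>
          continuous_on J (deriv (\<lambda>s. \<theta> (\<gamma> s) i)))"

text \<open>A tangent vector at \<open>x\<close> is given by its components in all the charts around \<open>x\<close>
  (and by 0 in the other charts).\<close>

type_synonym 'a tangent = "'a chart \<Rightarrow> point"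

definition velocity :: "('a, 'b) manifold_scheme \<Rightarrow> (real \<Rightarrow> 'a) \<Rightarrow> 'a tangent" where
  "velocity M \<gamma> =
     (\<lambda>c i. if c \<in> atlas M \<and> \<gamma> 0 \<in> fst c \<and> i < mdim M then deriv (\<lambda>t. snd c (\<gamma> t) i) 0 else 0)"

text \<open>With \<open>X = base_space M\<close> this is $T_xM$; with the subspace topology of a regular submanifold
  \<open>A\<close> it is $T_xA$, as a subspace of $T_xM$.\<close>

definition tangent_space :: "('a, 'b) manifold_scheme \<Rightarrow> 'a topology \<Rightarrow> 'a \<Rightarrow> 'a tangent set" where
  "tangent_space M X x = {velocity M \<gamma> |\<gamma>. C1_curve M X \<gamma> \<and> \<gamma> 0 = x}"

definition tangent_coset :: "'a tangent \<Rightarrow> 'a tangent set \<Rightarrow> 'a tangent set" where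
  "tangent_coset v W = {(\<lambda>c i. v c i + w c i) |w. w \<in> W}"

definition quotient_space :: "'a tangent set \<Rightarrow> 'a tangent set \<Rightarrow> 'a tangent set set" where
  "quotient_space V W = {tangent_coset v W |v. v \<in> V}"

text \<open>The inclusion of \<open>V\<close> into \<open>V'\<close> induces an isomorphism $V/W \cong V'/W'$ (a well-defined
  induced map is automatically linear).\<close>

definition inclusion_induces_iso ::
    "'a tangent set \<Rightarrow> 'a tangent set \<Rightarrow> 'a tangent set \<Rightarrow> 'a tangent set \<Rightarrow> bool" where
  "inclusion_induces_iso V W V' W' \<longleftrightarrow>
     V \<subseteq> V' \<and>
     (\<exists>f. (\<forall>v\<in>V. f (tangent_coset v W) = tangent_coset v W') \<and>
          bij_betw f (quotient_space V W) (quotient_space V' W'))"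

text \<open>The restriction of \<open>\<phi>\<close> to the open set \<open>U\<close> takes values in the submanifold \<open>S\<close> and is
  transverse, as a map to \<open>S\<close>, to \<open>A \<subseteq> S\<close>: $d\phi(T_xU) + T_{\phi(x)}A = T_{\phi(x)}S$ for every
  $x \in U$ with $\phi(x) \in A$.\<close>

definition transverse_into ::
    "('a, 'c) manifold_scheme \<Rightarrow> ('b, 'd) manifold_scheme \<Rightarrow> ('a \<Rightarrow> 'b) \<Rightarrow> 'a set \<Rightarrow> 'b set
       \<Rightarrow> 'b set \<Rightarrow> bool" where
  "transverse_into M N \<phi> U S A \<longleftrightarrow>
     \<phi> ` U \<subseteq> S \<and>
     (\<forall>x\<in>U. \<phi> x \<in> A \<longrightarrow>
        {(\<lambda>c i. v c i + w c i) |v w.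
           v \<in> {velocity N (\<phi> \<circ> \<gamma>) |\<gamma>. C1_curve M (subtopology (base_space M) U) \<gamma> \<and> \<gamma> 0 = x} \<and>
           w \<in> tangent_space N (subtopology (base_space N) A) (\<phi> x)}
        = tangent_space N (subtopology (base_space N) S) (\<phi> x))"

section \<open>Foliations\<close>

text \<open>For a foliation of codimension \<open>q\<close> and dimension \<open>p\<close>, $R^q \times R^p$ is identified with
  $R^{q+p}$, the first \<open>q\<close> coordinates being the transverse ones.\<close>

definition first_coords :: "nat \<Rightarrow> point \<Rightarrow> point" where
  "first_coords q z = (\<lambda>i. if i < q then z i else 0)"

definition last_coords :: "nat \<Rightarrow> point \<Rightarrow> point" where
  "last_coords q z = (\<lambda>i. z (q + i))"

definition coord_product :: "nat \<Rightarrow> point set \<Rightarrow> point set \<Rightarrow> point set" where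
  "coord_product q T B = {z. first_coords q z \<in> T \<and> last_coords q z \<in> B}"

text \<open>The library's \<^const>\<open>convex\<close> does not apply to \<open>nat \<Rightarrow> real\<close>.\<close>

definition convex_points :: "point set \<Rightarrow> bool" where
  "convex_points B \<longleftrightarrow>
     (\<forall>y\<in>B. \<forall>z\<in>B. \<forall>u\<in>{0..1}. (\<lambda>i. (1 - u) * y i + u * z i) \<in> B)"

record 'a foliated = "'a manifold" +
  codim :: nat
  ldim :: nat
  fcharts :: "'a chart set"

definition local_projection :: "'a foliated \<Rightarrow> 'a chart \<Rightarrow> 'a \<Rightarrow> point" where
  "local_projection M c x = first_coords (codim M) (snd c x)"

definition product_image :: "'a foliated \<Rightarrow> 'a chart \<Rightarrow> point set \<Rightarrow> point set \<Rightarrow> bool" where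
  "product_image M = (\<lambda>(U, \<theta>) T B.
     openin (Euclidean_space (codim M)) T \<and>
     openin (Euclidean_space (ldim M)) B \<and> convex_points B \<and>
     \<theta> ` U = coord_product (codim M) T B)"

text \<open>The transverse part of the change of coordinates from \<open>c\<close> to \<open>c'\<close> locally depends only on the
  transverse coordinates of \<open>c\<close>.\<close>

definition plaque_compatible :: "'a foliated \<Rightarrow> 'a chart \<Rightarrow> 'a chart \<Rightarrow> bool" where
  "plaque_compatible M c c' \<longleftrightarrow>
     (\<forall>x\<in>fst c \<inter> fst c'. \<exists>W. openin (base_space M) W \<and> x \<in> W \<and> W \<subseteq> fst c \<inter> fst c' \<and>
        (\<forall>y\<in>W. \<forall>z\<in>W. local_projection M c y = local_projection M c z \<longrightarrow>
           local_projection M c' y = local_projection M c' z))"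

text \<open>\<open>M\<close> is a $C^r$ manifold with a $C^r$ foliation; \<open>fcharts M\<close> is the (maximal) set of
  foliation charts.\<close>

definition Cr_foliation :: "enat \<Rightarrow> 'a foliated \<Rightarrow> bool" where
  "Cr_foliation r M \<longleftrightarrow>
     Cr_manifold r M \<and> mdim M = codim M + ldim M \<and>
     fcharts M \<subseteq> atlas M \<and>
     (\<forall>c\<in>fcharts M. \<exists>T B. product_image M c T B) \<and>
     \<Union> (fst ` fcharts M) = topspace (base_space M) \<and>
     (\<forall>c\<in>fcharts M. \<forall>c'\<in>fcharts M. plaque_compatible M c c') \<and>
     (\<forall>c\<in>atlas M. (\<exists>T B. product_image M c T B) \<and>
        (\<forall>c'\<in>fcharts M. plaque_compatible M c c' \<and> plaque_compatible M c' c)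
        \<longrightarrow> c \<in> fcharts M)"

text \<open>The leaf topology is generated by the open subsets of the plaques; its connected components
  are the leaves.\<close>

definition leaf_topology :: "'a foliated \<Rightarrow> 'a topology" where
  "leaf_topology M = topology_generated_by
     {W \<inter> {x \<in> fst c. local_projection M c x = t} |W c t. openin (base_space M) W \<and> c \<in> fcharts M}"

definition leaves :: "'a foliated \<Rightarrow> 'a set set" where
  "leaves M = connected_components_of (leaf_topology M)"

definition leaves_on :: "'a foliated \<Rightarrow> 'a set \<Rightarrow> 'a set set" where
  "leaves_on M V =
     {C. \<exists>L\<in>leaves M. C \<in> connected_components_of (subtopology (leaf_topology M) (L \<inter> V))}"

definition foliation_maps :: "enat \<Rightarrow> 'a foliated \<Rightarrow> 'b foliated \<Rightarrow> ('a \<Rightarrow> 'b) set" where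
  "foliation_maps r M N =
     {\<phi> \<in> extensional (topspace (base_space M)).
        Cr_map r M N \<phi> \<and> (\<forall>L\<in>leaves M. \<exists>L'\<in>leaves N. \<phi> ` L \<subseteq> L')}"

section \<open>Clean intersections and good local saturations\<close>

definition clean_intersection :: "enat \<Rightarrow> 'a foliated \<Rightarrow> 'a set \<Rightarrow> bool" where
  "clean_intersection r N A \<longleftrightarrow>
     (\<forall>x\<in>A. \<exists>(U, \<theta>)\<in>fcharts N. x \<in> U \<and>
        (\<exists>T B T0 B0 dT dB. product_image N (U, \<theta>) T B \<and> T0 \<subseteq> T \<and> B0 \<subseteq> B \<and>
           regular_submanifold (Euclidean_manifold r (codim N)) dT T0 \<and>
           regular_submanifold (Euclidean_manifold r (ldim N)) dB B0 \<and>
           \<theta> ` (U \<inter> A) = coord_product (codim N) T0 B0))"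

definition local_saturation :: "'a foliated \<Rightarrow> 'a set \<Rightarrow> 'a set \<Rightarrow> bool" where
  "local_saturation N A S \<longleftrightarrow>
     (\<exists>V. openin (base_space N) V \<and> A \<subseteq> V \<and> S = \<Union> {C \<in> leaves_on N V. C \<inter> A \<noteq> {}})"

text \<open>The tangent spaces $T_x\mathcal{F}'$ and $T_x(\mathcal{F}'|_A)$ consist of the velocities of
  the curves that are continuous for the leaf topology, resp. for its restriction to \<open>A\<close>.\<close>

definition good_local_saturation :: "enat \<Rightarrow> 'a foliated \<Rightarrow> 'a set \<Rightarrow> 'a set \<Rightarrow> bool" where
  "good_local_saturation r N A S \<longleftrightarrow>
     local_saturation N A S \<and>
     (\<exists>d. regular_submanifold N d S \<and>
        (\<exists>G. Cr_foliation r G \<and> manifold.truncate G = submanifold r N d S \<and>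
             leaves G = leaves_on N S)) \<and>
     (\<forall>C\<in>leaves_on N S. \<exists>L\<in>leaves N. openin (subtopology (leaf_topology N) L) C) \<and>
     (\<forall>x\<in>A. inclusion_induces_iso
        (tangent_space N (leaf_topology N) x)
        (tangent_space N (subtopology (leaf_topology N) A) x)
        (tangent_space N (subtopology (base_space N) S) x)
        (tangent_space N (subtopology (base_space N) A) x))"

definition foliation_maps_rel ::
    "enat \<Rightarrow> 'a foliated \<Rightarrow> 'b foliated \<Rightarrow> 'b set \<Rightarrow> ('a \<Rightarrow> 'b) set" where
  "foliation_maps_rel r M N A =
     {\<phi> \<in> foliation_maps r M N. \<exists>S W. good_local_saturation r N A S \<and> openin (base_space M) W \<and>
        {x \<in> topspace (base_space M). \<phi> x \<in> A} \<subseteq> W \<and> W \<subseteq> {x \<in> topspace (base_space M). \<phi> x \<in> S}}"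

definition ls_transverse ::
    "enat \<Rightarrow> 'a foliated \<Rightarrow> 'b foliated \<Rightarrow> 'b set \<Rightarrow> ('a \<Rightarrow> 'b) \<Rightarrow> bool" where
  "ls_transverse r M N A \<phi> \<longleftrightarrow>
     (\<exists>U S. openin (base_space M) U \<and> {x \<in> topspace (base_space M). \<phi> x \<in> A} \<subseteq> U \<and>
        good_local_saturation r N A S \<and> transverse_into M N \<phi> U S A)"

section \<open>The strong plaquewise topology\<close>

text \<open>Families are indexed by sets \<open>I\<close> of natural numbers.  This is no restriction: in a
  locally finite family of open subsets of a second countable space, only countably many members
  are nonempty, and the empty ones impose no condition (as then \<open>K i\<close> is empty as well).\<close>

definition sp_data ::
    "'a foliated \<Rightarrow> 'b foliated \<Rightarrow> ('a \<Rightarrow> 'b) \<Rightarrow> nat set \<Rightarrow> (nat \<Rightarrow> 'a chart) \<Rightarrow> (nat \<Rightarrow> 'b chart)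
       \<Rightarrow> (nat \<Rightarrow> 'a set) \<Rightarrow> (nat \<Rightarrow> real) \<Rightarrow> bool" where
  "sp_data M N \<phi> I \<Theta> \<Theta>' K \<epsilon> \<longleftrightarrow>
     (\<forall>x\<in>topspace (base_space M). \<exists>W. openin (base_space M) W \<and> x \<in> W \<and>
        finite {i\<in>I. fst (\<Theta> i) \<inter> W \<noteq> {}}) \<and>
     (\<forall>i\<in>I. \<Theta> i \<in> fcharts M \<and> \<Theta>' i \<in> fcharts N \<and>
        compactin (base_space M) (K i) \<and> K i \<subseteq> fst (\<Theta> i) \<and> \<phi> ` K i \<subseteq> fst (\<Theta>' i) \<and> 0 < \<epsilon> i)"

definition sp_nbhd ::
    "nat \<Rightarrow> 'a foliated \<Rightarrow> 'b foliated \<Rightarrow> ('a \<Rightarrow> 'b) \<Rightarrow> nat set \<Rightarrow> (nat \<Rightarrow> 'a chart)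
       \<Rightarrow> (nat \<Rightarrow> 'b chart) \<Rightarrow> (nat \<Rightarrow> 'a set) \<Rightarrow> (nat \<Rightarrow> real) \<Rightarrow> ('a \<Rightarrow> 'b) set" where
  "sp_nbhd s M N \<phi> I \<Theta> \<Theta>' K \<epsilon> =
     {\<psi> \<in> foliation_maps (enat s) M N. \<forall>i\<in>I.
        \<psi> ` K i \<subseteq> fst (\<Theta>' i) \<and>
        (\<forall>x\<in>K i.
           local_projection N (\<Theta>' i) (\<psi> x) = local_projection N (\<Theta>' i) (\<phi> x) \<and>
           (\<forall>k\<le>s. deriv_dist k (mdim M) (mdim N)
                (snd (\<Theta>' i) \<circ> \<psi> \<circ> inv_into (fst (\<Theta> i)) (snd (\<Theta> i)))
                (snd (\<Theta>' i) \<circ> \<phi> \<circ> inv_into (fst (\<Theta> i)) (snd (\<Theta> i)))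
                (snd (\<Theta> i) x) < \<epsilon> i))}"

text \<open>For finite \<open>r\<close> the only admissible order is \<open>s = r\<close>; for $r = \infty$ every \<open>s\<close> is.\<close>

definition sp_base :: "enat \<Rightarrow> 'a foliated \<Rightarrow> 'b foliated \<Rightarrow> ('a \<Rightarrow> 'b) set set" where
  "sp_base r M N =
     {foliation_maps r M N \<inter> sp_nbhd s M N \<phi> I \<Theta> \<Theta>' K \<epsilon> |s \<phi> I \<Theta> \<Theta>' K \<epsilon>.
        (r = \<infinity> \<or> r = enat s) \<and> \<phi> \<in> foliation_maps (enat s) M N \<and> sp_data M N \<phi> I \<Theta> \<Theta>' K \<epsilon>}"

text \<open>The members of \<open>sp_base\<close> form a base, not merely a subbase, of the topology they generate: by
  compactness of the \<open>K i\<close> each of them contains a set of the same kind centred at any given member,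
  and two locally finite families can be merged into one.\<close>

definition sp_topology :: "enat \<Rightarrow> 'a foliated \<Rightarrow> 'b foliated \<Rightarrow> ('a \<Rightarrow> 'b) topology" where
  "sp_topology r M N = topology_generated_by (sp_base r M N)"

lemma foliation_maps_mono:
  assumes "s \<le> r" shows "foliation_maps r M N \<subseteq> foliation_maps s M N"
proof -
  have "Cr_on r n m U f \<Longrightarrow> Cr_on s n m U f" for n m U f
    unfolding Cr_on_def using assms by (meson order_less_le_trans order_trans)
  then show ?thesis
    unfolding foliation_maps_def Cr_map_def by fast
qed

lemma topspace_sp_topology: "topspace (sp_topology r M N) = foliation_maps r M N"
proof -
  obtain s where s: "r = \<infinity> \<or> r = enat s"
    by (cases r) auto
  then have sub: "foliation_maps r M N \<subseteq> foliation_maps (enat s) M N"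
    by (auto intro!: foliation_maps_mono)
  have "\<phi> \<in> \<Union> (sp_base r M N)" if "\<phi> \<in> foliation_maps r M N" for \<phi>
  proof -
    define O' where "O' = foliation_maps r M N \<inter>
      sp_nbhd s M N \<phi> {} (\<lambda>_. undefined) (\<lambda>_. undefined) (\<lambda>_. {}) (\<lambda>_. 1)"
    have "sp_data M N \<phi> {} (\<lambda>_. undefined) (\<lambda>_. undefined) (\<lambda>_. {}) (\<lambda>_. 1)"
      unfolding sp_data_def by (auto intro: openin_topspace)
    then have "O' \<in> sp_base r M N"
      unfolding sp_base_def O'_def using s sub that by blast
    moreover have "\<phi> \<in> O'"
      unfolding O'_def sp_nbhd_def using sub that by auto
    ultimately show ?thesis by blast
  qed
  then show ?thesis
    unfolding sp_topology_def topology_generated_by_topspace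
    by (auto simp: sp_base_def)
qed

definition residual_in :: "'a topology \<Rightarrow> 'a set \<Rightarrow> bool" where
  "residual_in X R \<longleftrightarrow>
     R \<subseteq> topspace X \<and>
     (\<exists>\<D>. countable \<D> \<and> (\<forall>D\<in>\<D>. openin X D \<and> X closure_of D = topspace X) \<and>
          topspace X \<inter> \<Inter>\<D> \<subseteq> R)"

end

theory Submission
  imports Defs
begin

text \<open>
  Near a point of \<open>A\<close> there is a foliation chart of \<open>M'\<close> in which \<open>A\<close> is the product of a set of
  transverse coordinates with a coordinate subspace of the leafwise coordinates.  Since
  $T_yS = T_y\mathcal{F}' + T_yA$ for a good local saturation \<open>S\<close>, transversality of \<open>\<phi>\<close> to \<open>A\<close> in \<open>S\<close> follows
  if the Jacobian matrix of the remaining leafwise coordinates of \<open>\<phi>\<close> has full rank.  Cover \<open>M\<close> and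
  \<open>A\<close> by countably many compact sets in such charts.  For each pair of these sets the rank condition
  is open, and it is dense: in one pair of charts add to the leafwise coordinates in question a cut off
  affine map $v + Lz$ (after smoothing them if $r = 1$).  This moves points in their plaques only, so the
  result is again a foliation map, and for generic small $(v, L)$ the rank condition holds.
\<close>

section \<open>Functions of class $C^k$ on $R^n$\<close>


text \<open>The good local saturation in the definition of ls-transversality varies with the map, so
  transversality inside \<open>S\<close> cannot be split directly into countably many conditions.
  The rank condition is free of \<open>S\<close>: it reads leafwise coordinates in a straight chart,
  and any \<open>S\<close> witnessing membership in $C^r(F, F'; A)$ turns it into transversality.
  Density must therefore be proved inside that space, and the perturbed map keeps the same
  \<open>S\<close>. The topology dictates the shape of the perturbation. Basic neighbourhoods
  prescribe local projections exactly, so only leafwise coordinates may move; they control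
  derivatives in possibly infinitely many charts, of which a compactly supported perturbation meets
  only finitely many. For r = 1 the entries of the Jacobian matrix are merely continuous, whereas
  the counting argument for genericity needs them Lipschitz; this is the reason for the smoothing.
  Closedness of \<open>A\<close> makes the tested pieces of \<open>A\<close> closed, so that a point
  sent off such a piece stays off it under small changes of the map.\<close>

definition Rn :: "nat \<Rightarrow> point set" where
  "Rn n = {x. \<forall>i\<ge>n. x i = 0}"

lemma Euclidean_space_eq: "Euclidean_space n = top_of_set (Rn n)"
  by (simp add: Euclidean_space_def euclidean_product_topology Rn_def)

lemma topspace_Euclidean_space_Rn [simp]: "topspace (Euclidean_space n) = Rn n"
  by (simp add: Euclidean_space_eq)

lemma Rn_upd: "x \<in> Rn n \<Longrightarrow> i < n \<Longrightarrow> x(i := t) \<in> Rn n"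
  by (auto simp: Rn_def)

text \<open>Boxes play the role of balls. Only the first \<open>n\<close> coordinates are
  constrained; membership in \<open>Rn n\<close> fixes all the others at 0.\<close>

definition box_nbhd :: "nat \<Rightarrow> point \<Rightarrow> real \<Rightarrow> point set" where
  "box_nbhd n z e = {w \<in> Rn n. \<forall>i<n. \<bar>w i - z i\<bar> < e}"

lemma openin_box_nbhd: "openin (Euclidean_space n) (box_nbhd n z e)"
proof -
  have "open (\<Inter>i\<in>{..<n}. {w::point. \<bar>w i - z i\<bar> < e})"
    by (intro open_INT finite_lessThan ballI open_Collect_less continuous_on_rabs
        continuous_on_diff continuous_on_const continuous_on_product_coordinates)
  moreover have "box_nbhd n z e = Rn n \<inter> (\<Inter>i\<in>{..<n}. {w. \<bar>w i - z i\<bar> < e})"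
    by (auto simp: box_nbhd_def)
  ultimately show ?thesis
    unfolding Euclidean_space_eq openin_open by (intro exI conjI)
qed

lemma tendsto_pointwise:
  fixes f :: "'a \<Rightarrow> point"
  assumes "\<And>i. ((\<lambda>s. f s i) \<longlongrightarrow> l i) F"
  shows "(f \<longlongrightarrow> l) F"
  using assms limitin_componentwise[of "\<lambda>_. euclideanreal" UNIV f l F]
  by (simp add: euclidean_product_topology)

text \<open>Only the coordinates below \<open>n\<close> need a radius: from \<open>n\<close> on, any
  two points of \<open>Rn n\<close> agree.\<close>

lemma open_contains_box:
  assumes "openin (Euclidean_space n) U" "z \<in> U"
  obtains e where "e > 0" "box_nbhd n z e \<subseteq> U"
proof -
  from assms obtain T where T: "open T" "U = Rn n \<inter> T"
    unfolding Euclidean_space_eq by (metis openin_open)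
  then have zT: "z \<in> T" "z \<in> Rn n" using assms by auto
  have "openin (product_topology (\<lambda>i. euclideanreal) UNIV) T"
    using T by (simp add: euclidean_product_topology)
  from product_topology_open_contains_basis[OF this zT(1)] obtain X where
    X: "z \<in> (\<Pi>\<^sub>E i\<in>UNIV. X i)" "\<And>i. open (X i)" "(\<Pi>\<^sub>E i\<in>UNIV. X i) \<subseteq> T"
      and fin: "finite {i. X i \<noteq> UNIV}"
    by (simp only: topspace_euclidean flip: open_openin) blast
  have "\<exists>e>0. \<forall>x. \<bar>x - z i\<bar> < e \<longrightarrow> x \<in> X i" for i
    using X(1) X(2)[of i] by (metis (no_types, lifting) PiE_mem UNIV_I dist_real_def open_dist)
  then obtain e where e: "\<And>i. e i > 0" "\<And>i x. \<bar>x - z i\<bar> < e i \<Longrightarrow> x \<in> X i" by metis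
  \<comment> \<open>The inserted 1 keeps the set nonempty when \<open>n = 0\<close>.\<close>
  define d where "d = Min (insert 1 (e ` {..<n}))"
  have d: "d > 0" unfolding d_def using e(1) by (subst Min_gr_iff) auto
  have de: "d \<le> e i" if "i < n" for i unfolding d_def using that by (intro Min_le) auto
  have "box_nbhd n z d \<subseteq> U"
  proof
    fix w assume w: "w \<in> box_nbhd n z d"
    have "w i \<in> X i" for i
    proof (cases "i < n")
      case True
      then show ?thesis using w de[OF True] by (intro e(2)) (auto simp: box_nbhd_def intro: less_le_trans)
    next
      case False
      then have "w i = z i" using w zT(2) by (auto simp: box_nbhd_def Rn_def)
      then show ?thesis using e by simp
    qed
    then show "w \<in> U" using X(3) T w by (auto simp: box_nbhd_def)
  qed
  with d that show ?thesis by blast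
qed

lemma open_Rn_subset: "openin (Euclidean_space n) U \<Longrightarrow> U \<subseteq> Rn n"
  using openin_subset by fastforce

lemma eventually_upd_in:
  assumes "openin (Euclidean_space n) U" "z \<in> U" "i < n"
  shows "\<forall>\<^sub>F t in nhds (z i). z(i := t) \<in> U"
proof -
  obtain e where e: "e > 0" "box_nbhd n z e \<subseteq> U" using open_contains_box[OF assms(1,2)] .
  have "\<forall>\<^sub>F t in nhds (z i). dist t (z i) < e"
    using e(1) by (metis eventually_nhds_metric)
  then show ?thesis
  proof eventually_elim
    case (elim t)
    have "z(i := t) \<in> Rn n"
      using assms open_Rn_subset[OF assms(1)] by (intro Rn_upd) auto
    then have "z(i := t) \<in> box_nbhd n z e"
      using e(1) elim by (auto simp: box_nbhd_def dist_real_def)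
    then show ?case using e by blast
  qed
qed

lemma continuous_map_Rn:
  "U \<subseteq> Rn n \<Longrightarrow> continuous_map (subtopology (Euclidean_space n) U) euclideanreal g \<longleftrightarrow> continuous_on U g"
  by (simp add: Euclidean_space_eq subtopology_subtopology inf.absorb2)

text \<open>One component of \<open>Cr_on\<close>, rearranged for induction on the order:
  \<open>Ck\<close> removes the derivative that is taken first, whereas \<open>iter_partial\<close>
  removes the one taken last.\<close>

primrec Ck :: "nat \<Rightarrow> nat \<Rightarrow> point set \<Rightarrow> (point \<Rightarrow> real) \<Rightarrow> bool" where
  "Ck 0 n U g \<longleftrightarrow> continuous_on U g"
| "Ck (Suc k) n U g \<longleftrightarrow> continuous_on U g \<and>
     (\<forall>i<n. (\<forall>z\<in>U. (\<lambda>t. g (z(i := t))) differentiable (at (z i))) \<and> Ck k n U (partial_deriv i g))"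

lemma iter_partial_append: "iter_partial (is @ js) g = iter_partial is (iter_partial js g)"
  by (induction "is") auto

lemma Ck_iff:
  "Ck k n U g \<longleftrightarrow> (\<forall>is. set is \<subseteq> {..<n} \<and> length is \<le> k \<longrightarrow>
      continuous_on U (iter_partial is g) \<and>
      (length is < k \<longrightarrow> (\<forall>i<n. \<forall>z\<in>U. (\<lambda>t. iter_partial is g (z(i := t))) differentiable (at (z i)))))"
proof (induction k arbitrary: g)
  case 0
  then show ?case by simp
next
  case (Suc k)
  let ?P = "\<lambda>k g is. continuous_on U (iter_partial is g) \<and>
      (length is < k \<longrightarrow> (\<forall>i<n. \<forall>z\<in>U. (\<lambda>t. iter_partial is g (z(i := t))) differentiable (at (z i))))"
  show ?case
  proof (intro iffI allI impI)
    fix "is" assume C: "Ck (Suc k) n U g" and "is": "set is \<subseteq> {..<n} \<and> length is \<le> Suc k"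
    show "?P (Suc k) g is"
    \<comment> \<open>The last entry of the list is the derivative taken first, the one that
      \<open>Ck\<close> unfolds.\<close>
    proof (cases "is" rule: rev_cases)
      case Nil
      then show ?thesis using C by simp
    next
      case (snoc js i)
      have "Ck k n U (partial_deriv i g)" using C "is" snoc by simp
      then have "?P k (partial_deriv i g) js"
        using "is" snoc by (subst (asm) Suc) simp
      then show ?thesis unfolding snoc iter_partial_append by simp
    qed
  next
    assume A: "\<forall>is. set is \<subseteq> {..<n} \<and> length is \<le> Suc k \<longrightarrow> ?P (Suc k) g is"
    have "Ck k n U (partial_deriv i g)" if "i < n" for i
      unfolding Suc
    proof (intro allI impI)
      fix js assume "set js \<subseteq> {..<n} \<and> length js \<le> k"
      then show "?P k (partial_deriv i g) js"
        using A[rule_format, of "js @ [i]"] that unfolding iter_partial_append by simp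
    qed
    then show "Ck (Suc k) n U g" using A[rule_format, of "[]"] by simp
  qed
qed

lemma Cr_on_iff:
  assumes "U \<subseteq> Rn n"
  shows "Cr_on r n m U f \<longleftrightarrow> (\<forall>j<m. \<forall>k. enat k \<le> r \<longrightarrow> Ck k n U (\<lambda>z. f z j))"
proof
  assume "Cr_on r n m U f"
  then show "\<forall>j<m. \<forall>k. enat k \<le> r \<longrightarrow> Ck k n U (\<lambda>z. f z j)"
    unfolding Cr_on_def Ck_iff continuous_map_Rn[OF assms]
    by (meson enat_ord_simps order_less_le_trans order_trans)
next
  assume A: "\<forall>j<m. \<forall>k. enat k \<le> r \<longrightarrow> Ck k n U (\<lambda>z. f z j)"
  show "Cr_on r n m U f"
    unfolding Cr_on_def continuous_map_Rn[OF assms]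
  proof (intro allI impI)
    fix j "is" assume j: "j < m" and "is": "set is \<subseteq> {..<n} \<and> enat (length is) \<le> r"
    then have "Ck (length is) n U (\<lambda>z. f z j)" using A by auto
    then have "continuous_on U (iter_partial is (\<lambda>z. f z j))" using "is" unfolding Ck_iff by blast
    moreover have "\<forall>i<n. \<forall>z\<in>U. (\<lambda>t. iter_partial is (\<lambda>y. f y j) (z(i := t))) differentiable (at (z i))"
      if "enat (length is) < r"
    proof -
      \<comment> \<open>Differentiability of a derivative of order \<open>length is\<close> is part
        of \<open>Ck\<close> only one order higher, which \<open>length is < r\<close> provides for
        infinite \<open>r\<close> too.\<close>
      have "enat (Suc (length is)) \<le> r" using Suc_ile_eq that by auto
      then have "Ck (Suc (length is)) n U (\<lambda>z. f z j)" using A j by blast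
      then show ?thesis
        using "is" unfolding Ck_iff[of "Suc _"] by (metis le_SucI lessI order_refl)
    qed
    ultimately show "continuous_on U (iter_partial is (\<lambda>z. f z j)) \<and> (enat (length is) < r \<longrightarrow>
      (\<forall>i<n. \<forall>z\<in>U. (\<lambda>t. iter_partial is (\<lambda>y. f y j) (z(i := t))) differentiable (at (z i))))"
      by blast
  qed
qed

lemma Ck_mono: "Ck k n U g \<Longrightarrow> l \<le> k \<Longrightarrow> Ck l n U g"
  unfolding Ck_iff by (meson order_less_le_trans order_trans)

lemma Ck_continuous: "Ck k n U g \<Longrightarrow> continuous_on U g"
  by (cases k) auto

lemma Ck_subset: "Ck k n U g \<Longrightarrow> V \<subseteq> U \<Longrightarrow> Ck k n V g"
  by (induction k arbitrary: g) (auto intro: continuous_on_subset)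

lemma Ck_partial: "Ck (Suc k) n U g \<Longrightarrow> i < n \<Longrightarrow> Ck k n U (partial_deriv i g)"
  by simp

lemma Ck_has_partial:
  assumes "Ck k n U g" "k > 0" "i < n" "z \<in> U"
  shows "((\<lambda>t. g (z(i := t))) has_real_derivative partial_deriv i g z) (at (z i))"
  using assms unfolding partial_deriv_def
  by (cases k) (auto simp: DERIV_deriv_iff_real_differentiable)

lemma partial_derivI:
  "((\<lambda>t. g (z(i := t))) has_real_derivative d) (at (z i)) \<Longrightarrow> partial_deriv i g z = d"
  unfolding partial_deriv_def by (rule DERIV_imp_deriv)

lemma partial_deriv_cong:
  assumes "openin (Euclidean_space n) U" "z \<in> U" "i < n" "\<And>w. w \<in> U \<Longrightarrow> f w = g w"
  shows "partial_deriv i f z = partial_deriv i g z"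
  unfolding partial_deriv_def
  by (rule deriv_cong_ev) (use eventually_upd_in[OF assms(1-3)] assms(4) in \<open>auto elim!: eventually_mono\<close>)

lemma iter_partial_cong:
  assumes "openin (Euclidean_space n) U" "z \<in> U" "set is \<subseteq> {..<n}" "\<And>w. w \<in> U \<Longrightarrow> f w = g w"
  shows "iter_partial is f z = iter_partial is g z"
  using assms(2,3)
proof (induction "is" arbitrary: z)
  case Nil
  then show ?case using assms by simp
next
  case (Cons i "is")
  show ?case unfolding iter_partial.simps
    by (rule partial_deriv_cong[OF assms(1)]) (use Cons in auto)
qed

lemma Ck_cong:
  assumes "openin (Euclidean_space n) U" "\<And>w. w \<in> U \<Longrightarrow> f w = g w" "Ck k n U f"
  shows "Ck k n U g"
  using assms(2,3)
proof (induction k arbitrary: f g)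
  case 0
  then show ?case by (simp add: continuous_on_eq)
next
  case (Suc k)
  have "(\<lambda>t. g (z(i := t))) differentiable (at (z i))" if "i < n" "z \<in> U" for i z
  proof -
    have "((\<lambda>t. f (z(i := t))) has_real_derivative partial_deriv i f z) (at (z i))"
      by (rule Ck_has_partial[OF Suc.prems(2)]) (use that in auto)
    moreover have "\<forall>\<^sub>F t in nhds (z i). f (z(i := t)) = g (z(i := t))"
      using eventually_upd_in[OF assms(1) that(2,1)] Suc.prems(1) by (auto elim!: eventually_mono)
    ultimately have "((\<lambda>t. g (z(i := t))) has_real_derivative partial_deriv i f z) (at (z i))"
      using DERIV_cong_ev[of "z i" "z i" "\<lambda>t. f (z(i := t))" "\<lambda>t. g (z(i := t))"] by metis
    then show ?thesis using real_differentiable_def by blast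
  qed
  moreover have "Ck k n U (partial_deriv i g)" if "i < n" for i
    by (rule Suc.IH[of "partial_deriv i f"])
      (use Suc.prems that partial_deriv_cong[OF assms(1) _ that, of _ f g] in auto)
  moreover have "continuous_on U g" using Suc.prems by (auto intro: continuous_on_eq)
  ultimately show ?case by simp
qed

lemma Ck_local:
  assumes "\<And>z. z \<in> U \<Longrightarrow> \<exists>V. openin (Euclidean_space n) V \<and> z \<in> V \<and> Ck k n (U \<inter> V) g"
    "U \<subseteq> Rn n"
  shows "Ck k n U g"
  using assms(1)
proof (induction k arbitrary: g)
  case 0
  have "continuous_on U g"
  proof (clarsimp simp: continuous_on_eq_continuous_within)
    fix z assume z: "z \<in> U"
    obtain V where V: "openin (Euclidean_space n) V" "z \<in> V" "continuous_on (U \<inter> V) g"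
      using 0[OF z] by auto
    then have c: "continuous (at z within U \<inter> V) g"
      using z continuous_on_eq_continuous_within by blast
    obtain T where T: "open T" "V = Rn n \<inter> T" using V(1) unfolding Euclidean_space_eq openin_open by auto
    have "at z within U \<inter> V = at z within U"
      by (rule at_within_nhd[of z T]) (use T V assms(2) in auto)
    then show "continuous (at z within U) g"
      using c by (simp add: continuous_within)
  qed
  then show ?case by simp
next
  case (Suc k)
  have "Ck 0 n U g"
  proof -
    have "Ck k n U g" by (rule Suc.IH) (use Suc.prems Ck_mono in \<open>meson le_SucI order_refl\<close>)
    then show ?thesis using Ck_mono by blast
  qed
  moreover have "(\<lambda>t. g (z(i := t))) differentiable (at (z i))" if "i < n" "z \<in> U" for i z
    using Suc.prems[OF that(2)] that by auto
  moreover have "Ck k n U (partial_deriv i g)" if "i < n" for i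
    by (rule Suc.IH) (use Suc.prems that in force)
  ultimately show ?case by simp
qed


section \<open>Mean value theorem and chain rule\<close>

lemma MVT_abs:
  fixes g :: "real \<Rightarrow> real"
  assumes "\<And>x. \<bar>x - a\<bar> \<le> \<bar>b - a\<bar> \<Longrightarrow> (g has_real_derivative g' x) (at x)"
  shows "\<exists>\<xi>. \<bar>\<xi> - a\<bar> \<le> \<bar>b - a\<bar> \<and> g b - g a = (b - a) * g' \<xi>"
proof -
  consider "a < b" | "b < a" | "a = b" by linarith
  then show ?thesis
  proof cases
    case 1
    then obtain x where "a < x" "x < b" "g b - g a = (b - a) * g' x"
      using MVT2[of a b g g'] assms by auto
    then show ?thesis by (intro exI[of _ x]) auto
  next
    case 2
    then obtain x where "b < x" "x < a" "g a - g b = (a - b) * g' x"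
      using MVT2[of b a g g'] assms by auto
    then show ?thesis by (intro exI[of _ x]) (auto simp: algebra_simps)
  qed auto
qed

text \<open>Partial derivatives alone do not give a chain rule; continuous ones do. The increment of
  \<open>f\<close> along \<open>c\<close> is telescoped over the coordinates, each summand is a mean
  value in one variable, and the intermediate points tend to \<open>c t\<close>.\<close>

lemma chain_rule_curve:
  assumes V: "openin (Euclidean_space n) V" and f: "Ck 1 n V f" and z: "c t \<in> V"
    and ev: "\<forall>\<^sub>F s in nhds t. c s \<in> V"
    and d: "\<And>j. j < n \<Longrightarrow> ((\<lambda>s. c s j) has_real_derivative d j) (at t)"
  shows "((\<lambda>s. f (c s)) has_real_derivative (\<Sum>j<n. partial_deriv j f (c t) * d j)) (at t)"
proof -
  define z where "z = c t"
  have zR: "z \<in> Rn n" using open_Rn_subset[OF V] z z_def by auto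
  obtain e where e: "e > 0" "box_nbhd n z e \<subseteq> V"
    using open_contains_box[OF V z] unfolding z_def by blast
  have cont: "((\<lambda>s. c s j) \<longlongrightarrow> z j) (at t)" if "j < n" for j
    using DERIV_isCont[OF d[OF that]] by (simp add: isCont_def z_def)
  have "\<forall>\<^sub>F s in at t. \<forall>j\<in>{..<n}. \<bar>c s j - z j\<bar> < e"
    by (intro eventually_ball_finite ballI)
      (use tendstoD[OF cont e(1)] in \<open>auto simp: dist_real_def\<close>)
  then have good: "\<forall>\<^sub>F s in at t. (\<forall>j<n. \<bar>c s j - z j\<bar> < e) \<and> c s \<in> V"
    using ev unfolding eventually_at_filter by eventually_elim auto
  \<comment> \<open>\<open>m j s\<close> takes its first \<open>j\<close> coordinates from
    \<open>c s\<close> and the rest from \<open>c t\<close>, so it leads from \<open>c t\<close> to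
    \<open>c s\<close> as \<open>j\<close> grows.\<close>
  define m where "m j s = (\<lambda>i. if i < j then c s i else z i)" for j s
  \<comment> \<open>The bound on \<open>x\<close> is claimed for every \<open>s\<close>, and only
    the equation depends on \<open>s\<close> being close to \<open>t\<close>; so \<xi> converges by
    comparison alone.\<close>
  have ex: "\<exists>x. \<bar>x - z j\<bar> \<le> \<bar>c s j - z j\<bar> \<and>
      ((\<forall>j<n. \<bar>c s j - z j\<bar> < e) \<longrightarrow>
        f (m (Suc j) s) - f (m j s) = (c s j - z j) * partial_deriv j f ((m j s)(j := x)))"
    if "j < n" for j s
  proof (cases "\<forall>j<n. \<bar>c s j - z j\<bar> < e")
    case True
    have "\<exists>x. \<bar>x - z j\<bar> \<le> \<bar>c s j - z j\<bar> \<and> f ((m j s)(j := c s j)) - f ((m j s)(j := z j)) =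
        (c s j - z j) * partial_deriv j f ((m j s)(j := x))"
    proof (rule MVT_abs)
      fix x assume x: "\<bar>x - z j\<bar> \<le> \<bar>c s j - z j\<bar>"
      have "\<bar>x - z j\<bar> < e" using x True that le_less_trans by blast
      then have "(m j s)(j := x) \<in> box_nbhd n z e"
        using zR that True e(1) by (auto simp: box_nbhd_def m_def Rn_def)
      then have "(m j s)(j := x) \<in> V" using e(2) by blast
      from Ck_has_partial[OF f _ that this]
      show "((\<lambda>x. f ((m j s)(j := x))) has_real_derivative partial_deriv j f ((m j s)(j := x))) (at x)"
        by simp
    qed
    moreover have "(m j s)(j := c s j) = m (Suc j) s" by (auto simp: m_def less_Suc_eq)
    moreover have "(m j s)(j := z j) = m j s" by (auto simp: m_def)
    ultimately show ?thesis by auto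
  qed auto
  define \<xi> where "\<xi> j s = (if j < n then SOME x. \<bar>x - z j\<bar> \<le> \<bar>c s j - z j\<bar> \<and>
      ((\<forall>j<n. \<bar>c s j - z j\<bar> < e) \<longrightarrow>
        f (m (Suc j) s) - f (m j s) = (c s j - z j) * partial_deriv j f ((m j s)(j := x))) else 0)"
    for j s
  have \<xi>: "\<bar>\<xi> j s - z j\<bar> \<le> \<bar>c s j - z j\<bar> \<and>
      ((\<forall>j<n. \<bar>c s j - z j\<bar> < e) \<longrightarrow>
        f (m (Suc j) s) - f (m j s) = (c s j - z j) * partial_deriv j f ((m j s)(j := \<xi> j s)))"
    if "j < n" for j s
    using someI_ex[OF ex[OF that, of s]] that unfolding \<xi>_def by auto
  have u: "((\<lambda>s. (m j s)(j := \<xi> j s)) \<longlongrightarrow> z) (at t)" if j: "j < n" for j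
  proof (rule tendsto_pointwise)
    fix i
    show "((\<lambda>s. ((m j s)(j := \<xi> j s)) i) \<longlongrightarrow> z i) (at t)"
    proof (cases "i = j")
      case True
      have "((\<lambda>s. \<bar>c s j - z j\<bar>) \<longlongrightarrow> 0) (at t)"
        using cont[OF j] by (simp add: LIM_zero tendsto_rabs_zero)
      then have "((\<lambda>s. \<xi> j s - z j) \<longlongrightarrow> 0) (at t)"
        by (rule Lim_null_comparison[rotated]) (use \<xi>[OF j] in auto)
      then show ?thesis using True by (simp add: LIM_zero_cancel)
    next
      case False
      then show ?thesis using cont[of i] j by (cases "i < j") (auto simp: m_def)
    qed
  qed
  have uV: "\<forall>\<^sub>F s in at t. (m j s)(j := \<xi> j s) \<in> V" if j: "j < n" for j
    using good
  proof eventually_elim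
    case (elim s)
    have "\<bar>\<xi> j s - z j\<bar> < e" using \<xi>[OF j, of s] elim j by (metis le_less_trans)
    then have "(m j s)(j := \<xi> j s) \<in> box_nbhd n z e"
      using elim zR j e(1) by (auto simp: box_nbhd_def m_def Rn_def)
    then show ?case using e(2) by blast
  qed
  have pd: "((\<lambda>s. partial_deriv j f ((m j s)(j := \<xi> j s))) \<longlongrightarrow> partial_deriv j f z) (at t)"
    if j: "j < n" for j
    by (rule continuous_on_tendsto_compose[OF _ u[OF j] _ uV[OF j]])
      (use f j z z_def in auto)
  have q: "((\<lambda>s. (c s j - z j) / (s - t)) \<longlongrightarrow> d j) (at t)" if "j < n" for j
    using d[OF that] by (simp add: has_field_derivative_iff z_def)
  have "((\<lambda>s. \<Sum>j<n. partial_deriv j f ((m j s)(j := \<xi> j s)) * ((c s j - z j) / (s - t)))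
      \<longlongrightarrow> (\<Sum>j<n. partial_deriv j f z * d j)) (at t)"
    by (intro tendsto_sum tendsto_mult pd q) auto
  moreover have "\<forall>\<^sub>F s in at t. (\<Sum>j<n. partial_deriv j f ((m j s)(j := \<xi> j s)) * ((c s j - z j) / (s - t)))
      = (f (c s) - f (c t)) / (s - t)"
    using good
  proof eventually_elim
    case (elim s)
    have "c s \<in> Rn n" using elim open_Rn_subset[OF V] by auto
    then have mn: "m n s = c s" "m 0 s = z" using zR by (auto simp: m_def Rn_def fun_eq_iff)
    have "(\<Sum>j<n. partial_deriv j f ((m j s)(j := \<xi> j s)) * ((c s j - z j) / (s - t)))
        = (\<Sum>j<n. (f (m (Suc j) s) - f (m j s)) / (s - t))"
      using \<xi> elim by (intro sum.cong refl) (auto simp: field_simps)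
    also have "\<dots> = (f (c s) - f (c t)) / (s - t)"
      unfolding sum_divide_distrib[symmetric] sum_lessThan_telescope[of "\<lambda>j. f (m j s)"] mn z_def[symmetric] ..
    finally show ?case .
  qed
  ultimately show ?thesis
    unfolding has_field_derivative_iff z_def[symmetric]
    by (rule Lim_transform_eventually)
qed

lemma continuous_on_RnI:
  assumes "\<And>j. j < m \<Longrightarrow> continuous_on U (\<lambda>z. g z j)" "\<And>z. z \<in> U \<Longrightarrow> g z \<in> Rn m"
  shows "continuous_on U g"
proof (rule continuous_on_coordinatewise_then_product)
  fix i
  show "continuous_on U (\<lambda>x. g x i)"
  proof (cases "i < m")
    case False
    then have "0 = g x i" if "x \<in> U" for x using assms(2)[OF that] by (auto simp: Rn_def)
    then show ?thesis using continuous_on_eq[OF continuous_on_const[of U 0]] by auto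
  qed (use assms in auto)
qed

lemma has_partial_compose:
  assumes U: "openin (Euclidean_space n) U" and V: "openin (Euclidean_space m) V"
    and gV: "\<And>w. w \<in> U \<Longrightarrow> g w \<in> V" and g: "\<And>j. j < m \<Longrightarrow> Ck 1 n U (\<lambda>w. g w j)"
    and f: "Ck 1 m V f" and z: "z \<in> U" and i: "i < n"
  shows "((\<lambda>t. f (g (z(i := t)))) has_real_derivative
      (\<Sum>j<m. partial_deriv j f (g z) * partial_deriv i (\<lambda>w. g w j) z)) (at (z i))"
proof -
  have "((\<lambda>t. f (g (z(i := t)))) has_real_derivative
      (\<Sum>j<m. partial_deriv j f (g (z(i := z i))) * partial_deriv i (\<lambda>w. g w j) z)) (at (z i))"
  proof (rule chain_rule_curve[OF V f])
    show "g (z(i := z i)) \<in> V" using gV z by simp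
    show "\<forall>\<^sub>F s in nhds (z i). g (z(i := s)) \<in> V"
      using eventually_upd_in[OF U z i] by eventually_elim (use gV in auto)
    show "((\<lambda>s. g (z(i := s)) j) has_real_derivative partial_deriv i (\<lambda>w. g w j) z) (at (z i))"
      if "j < m" for j
      by (rule Ck_has_partial[OF g[OF that] _ i z]) simp
  qed
  then show ?thesis by simp
qed

text \<open>Reduces the class of \<open>g\<close> to that of any formula \<open>d\<close> for its
  partial derivatives. Openness of \<open>U\<close> allows \<open>d\<close> to replace
  \<open>partial_deriv\<close>.\<close>

lemma CkSucI:
  assumes U: "openin (Euclidean_space n) U" and "continuous_on U g"
    and "\<And>i z. i < n \<Longrightarrow> z \<in> U \<Longrightarrow> ((\<lambda>t. g (z(i := t))) has_real_derivative d i z) (at (z i))"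
    and "\<And>i. i < n \<Longrightarrow> Ck k n U (d i)"
  shows "Ck (Suc k) n U g"
proof -
  have "partial_deriv i g z = d i z" if "i < n" "z \<in> U" for i z
    by (rule partial_derivI) (use assms that in blast)
  then have "Ck k n U (partial_deriv i g)" if "i < n" for i
    by (intro Ck_cong[OF U _ assms(4)[OF that]]) (use that in auto)
  then show ?thesis
    using assms(2,3) unfolding Ck.simps real_differentiable_def by blast
qed

section \<open>Closure properties of the classes\<close>

lemma Ck_const: "Ck k n U (\<lambda>z. c)"
proof (induction k arbitrary: c)
  case (Suc k)
  have "partial_deriv i (\<lambda>z. c) = (\<lambda>z. 0)" for i
    by (rule ext, rule partial_derivI) simp
  then show ?case using Suc by simp
qed simp

lemma Ck_coord:
  assumes "openin (Euclidean_space n) U" shows "Ck k n U (\<lambda>z. z j)"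
proof (cases k)
  case 0
  then show ?thesis
    by (auto intro: continuous_on_subset[OF continuous_on_product_coordinates])
next
  case (Suc l)
  show ?thesis unfolding Suc
    by (rule CkSucI[OF assms, where d = "\<lambda>i z. if i = j then 1 else 0"])
      (auto intro!: Ck_const derivative_eq_intros continuous_on_subset[OF continuous_on_product_coordinates])
qed

lemma Ck_add:
  assumes U: "openin (Euclidean_space n) U"
  shows "Ck k n U f \<Longrightarrow> Ck k n U g \<Longrightarrow> Ck k n U (\<lambda>z. f z + g z)"
proof (induction k arbitrary: f g)
  case 0
  then show ?case by (simp add: continuous_on_add)
next
  case (Suc k)
  show ?case
  proof (rule CkSucI[OF U])
    show "((\<lambda>t. f (z(i := t)) + g (z(i := t))) has_real_derivative
        partial_deriv i f z + partial_deriv i g z) (at (z i))" if "i < n" "z \<in> U" for i z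
      by (intro DERIV_add; rule Ck_has_partial[OF _ _ that]) (use Suc.prems in auto)
  qed (use Suc in \<open>auto intro: continuous_on_add\<close>)
qed

lemma Ck_mult:
  assumes U: "openin (Euclidean_space n) U"
  shows "Ck k n U f \<Longrightarrow> Ck k n U g \<Longrightarrow> Ck k n U (\<lambda>z. f z * g z)"
proof (induction k arbitrary: f g)
  case 0
  then show ?case by (simp add: continuous_on_mult)
next
  case (Suc k)
  show ?case
  proof (rule CkSucI[OF U])
    show "((\<lambda>t. f (z(i := t)) * g (z(i := t))) has_real_derivative
        partial_deriv i f z * g z + partial_deriv i g z * f z) (at (z i))" if "i < n" "z \<in> U" for i z
      using DERIV_mult[OF Ck_has_partial[OF Suc.prems(1) _ that] Ck_has_partial[OF Suc.prems(2) _ that]]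
      unfolding fun_upd_triv by blast
    show "Ck k n U (\<lambda>z. partial_deriv i f z * g z + partial_deriv i g z * f z)" if "i < n" for i
      by (intro Ck_add[OF U] Suc.IH) (use Suc.prems that Ck_mono[of "Suc k"] in auto)
  qed (use Suc in \<open>auto intro: continuous_on_mult\<close>)
qed

lemma Ck_sum:
  assumes U: "openin (Euclidean_space n) U" and "\<And>i. i \<in> I \<Longrightarrow> Ck k n U (f i)"
  shows "Ck k n U (\<lambda>z. \<Sum>i\<in>I. f i z)"
  using assms(2) by (induction I rule: infinite_finite_induct) (auto intro: Ck_const Ck_add[OF U])

lemma Ck_diff:
  assumes U: "openin (Euclidean_space n) U" and "Ck k n U f" "Ck k n U g"
  shows "Ck k n U (\<lambda>z. f z - g z)"
  using Ck_add[OF U assms(2) Ck_mult[OF U Ck_const[of _ _ _ "-1"] assms(3)]] by simp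

lemma Ck_compose:
  assumes U: "openin (Euclidean_space n) U" and V: "openin (Euclidean_space m) V"
    and gV: "\<And>w. w \<in> U \<Longrightarrow> g w \<in> V"
  shows "(\<And>j. j < m \<Longrightarrow> Ck k n U (\<lambda>w. g w j)) \<Longrightarrow> Ck k m V f \<Longrightarrow> Ck k n U (\<lambda>w. f (g w))"
proof (induction k arbitrary: f)
  case 0
  have g: "continuous_on U g"
    by (rule continuous_on_RnI[of m]) (use 0 gV open_Rn_subset[OF V] in auto)
  have "continuous_on U (\<lambda>w. f (g w))"
    by (rule continuous_on_compose2[of V f, OF _ g]) (use 0 gV in auto)
  then show ?case by simp
next
  case (Suc k)
  have g: "continuous_on U g"
    by (rule continuous_on_RnI[of m]) (use Suc gV open_Rn_subset[OF V] in auto)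
  have c: "continuous_on U (\<lambda>w. f (g w))"
    by (rule continuous_on_compose2[of V f, OF _ g]) (use Suc.prems(2) gV in auto)
  show ?case
  proof (rule CkSucI[OF U c])
    show "((\<lambda>t. f (g (z(i := t)))) has_real_derivative
        (\<Sum>j<m. partial_deriv j f (g z) * partial_deriv i (\<lambda>w. g w j) z)) (at (z i))"
      if "i < n" "z \<in> U" for i z
      by (rule has_partial_compose[OF U V gV _ _ that(2,1)])
        (use Suc.prems Ck_mono[of "Suc k"] in \<open>auto simp del: Ck.simps\<close>)
    show "Ck k n U (\<lambda>z. \<Sum>j<m. partial_deriv j f (g z) * partial_deriv i (\<lambda>w. g w j) z)"
      if "i < n" for i
    proof (intro Ck_sum[OF U] Ck_mult[OF U])
      fix j assume "j \<in> {..<m}"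
      then have j: "j < m" by simp
      show "Ck k n U (\<lambda>z. partial_deriv j f (g z))"
        by (rule Suc.IH[OF Ck_mono[OF Suc.prems(1)] Ck_partial[OF Suc.prems(2) j]]) auto
      show "Ck k n U (partial_deriv i (\<lambda>w. g w j))"
        by (rule Ck_partial[OF Suc.prems(1)[OF j] that])
    qed
  qed
qed

section \<open>Smooth bump functions\<close>


text \<open>The family is closed under differentiation up to linear combinations, so one induction
  over the order, with \<open>j\<close> arbitrary, gives smoothness at 0 as well.\<close>

definition flat_fun :: "nat \<Rightarrow> real \<Rightarrow> real" where
  "flat_fun j t = (if t > 0 then exp (- 1 / t) / t ^ j else 0)"

lemma flat_fun_tendsto_0: "(flat_fun j \<longlongrightarrow> 0) (at 0)"
proof (rule filterlim_split_at)
  show "(flat_fun j \<longlongrightarrow> 0) (at_left 0)"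
    by (rule tendsto_eventually)
      (auto simp: flat_fun_def eventually_at_left_field intro: exI[of _ "-1"])
  have "((\<lambda>t. (inverse t) ^ j / exp (inverse t)) \<longlongrightarrow> (0::real)) (at_right 0)"
    by (rule filterlim_compose[OF tendsto_power_div_exp_0 filterlim_inverse_at_top_right])
  moreover have "\<forall>\<^sub>F t in at_right 0. (inverse t) ^ j / exp (inverse t) = flat_fun j t"
    by (auto simp: flat_fun_def eventually_at_right_field field_simps exp_minus intro!: exI[of _ 1])
  ultimately show "(flat_fun j \<longlongrightarrow> 0) (at_right 0)"
    by (rule Lim_transform_eventually)
qed

lemma flat_fun_DERIV:
  "(flat_fun j has_real_derivative flat_fun (j + 2) t - real j * flat_fun (j + 1) t) (at t)"
proof -
  consider "t < 0" | "t = 0" | "t > 0" by linarith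
  then show ?thesis
  proof cases
    case 1
    have "\<forall>\<^sub>F s in nhds t. flat_fun j s = 0"
      using eventually_nhds_in_open[of "{..<0}" t] 1
      by (auto elim!: eventually_mono simp: flat_fun_def)
    then have "(flat_fun j has_real_derivative 0) (at t)"
      by (subst DERIV_cong_ev[OF refl _ refl, of _ "\<lambda>_. 0"]) auto
    then show ?thesis using 1 by (simp add: flat_fun_def)
  next
    case 2
    \<comment> \<open>At 0 the difference quotient of \<open>flat_fun j\<close> is
      \<open>flat_fun (j + 1)\<close>, which tends to 0.\<close>
    have "\<forall>\<^sub>F s in at 0. flat_fun (j + 1) s = (flat_fun j s - flat_fun j 0) / (s - 0)"
      by (auto simp: flat_fun_def eventually_at_filter)
    then have "((\<lambda>s. (flat_fun j s - flat_fun j 0) / (s - 0)) \<longlongrightarrow> 0) (at 0)"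
      by (rule Lim_transform_eventually[OF flat_fun_tendsto_0])
    then show ?thesis using 2 by (simp add: has_field_derivative_iff flat_fun_def)
  next
    case 3
    have "\<forall>\<^sub>F s in nhds t. exp (- 1 / s) / s ^ j = flat_fun j s"
      using eventually_nhds_in_open[of "{0<..}" t] 3
      by (auto elim!: eventually_mono simp: flat_fun_def)
    moreover have "((\<lambda>s. exp (- 1 / s) / s ^ j) has_real_derivative
        exp (- 1 / t) / t ^ (j + 2) - real j * (exp (- 1 / t) / t ^ (j + 1))) (at t)"
    proof (cases j)
      case 0
      then show ?thesis using 3
        by (auto intro!: derivative_eq_intros simp: power2_eq_square divide_simps)
    next
      case (Suc l)
      have *: "real j * t ^ (j - 1) = real j * t ^ j / t" using 3 Suc by (simp add: field_simps)
      have "((\<lambda>s. exp (- 1 / s)) has_real_derivative exp (- 1 / t) * (1 / t\<^sup>2)) (at t)"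
        using 3 by (auto intro!: derivative_eq_intros simp: power2_eq_square)
      moreover have "((\<lambda>s. s ^ j) has_real_derivative real j * t ^ (j - 1)) (at t)"
        using DERIV_pow[of j t] by simp
      ultimately have "((\<lambda>s. exp (- 1 / s) / s ^ j) has_real_derivative
          (exp (- 1 / t) * (1 / t\<^sup>2) * t ^ j - exp (- 1 / t) * (real j * t ^ (j - 1))) / (t ^ j * t ^ j)) (at t)"
        using 3 by (intro DERIV_divide) auto
      moreover have "(exp (- 1 / t) * (1 / t\<^sup>2) * t ^ j - exp (- 1 / t) * (real j * t ^ (j - 1))) / (t ^ j * t ^ j)
          = exp (- 1 / t) / t ^ (j + 2) - real j * (exp (- 1 / t) / t ^ (j + 1))"
        unfolding * using 3 by (simp add: field_simps power2_eq_square)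
      ultimately show ?thesis by simp
    qed
    ultimately have "(flat_fun j has_real_derivative
        exp (- 1 / t) / t ^ (j + 2) - real j * (exp (- 1 / t) / t ^ (j + 1))) (at t)"
      using DERIV_cong_ev[OF refl _ refl, of "\<lambda>s. exp (- 1 / s) / s ^ j" "flat_fun j" t] by auto
    then show ?thesis using 3 by (simp add: flat_fun_def)
  qed
qed

lemma Ck_flat_fun:
  assumes U: "openin (Euclidean_space n) U"
  shows "Ck k n U g \<Longrightarrow> Ck k n U (\<lambda>z. flat_fun j (g z))"
proof (induction k arbitrary: j)
  case 0
  have "continuous_on UNIV (flat_fun j)" 
    using flat_fun_DERIV by (meson DERIV_isCont continuous_at_imp_continuous_on)
  then have "continuous_on U (\<lambda>z. flat_fun j (g z))"
    by (rule continuous_on_compose2) (use 0 in auto)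
  then show ?case by simp
next
  case (Suc k)
  have "continuous_on UNIV (flat_fun j)" 
    using flat_fun_DERIV by (meson DERIV_isCont continuous_at_imp_continuous_on)
  then have c: "continuous_on U (\<lambda>z. flat_fun j (g z))"
    by (rule continuous_on_compose2) (use Suc.prems in auto)
  let ?d = "\<lambda>z. flat_fun (j + 2) (g z) - real j * flat_fun (j + 1) (g z)"
  show ?case
  proof (rule CkSucI[OF U c])
    show "((\<lambda>t. flat_fun j (g (z(i := t)))) has_real_derivative ?d z * partial_deriv i g z) (at (z i))"
      if "i < n" "z \<in> U" for i z
    proof -
      have "(flat_fun j has_real_derivative ?d (z(i := z i))) (at (g (z(i := z i))))"
        unfolding fun_upd_triv by (rule flat_fun_DERIV)
      from DERIV_chain2[OF this Ck_has_partial[OF Suc.prems _ that]]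
      show ?thesis unfolding fun_upd_triv by blast
    qed
    show "Ck k n U (\<lambda>z. ?d z * partial_deriv i g z)" if "i < n" for i
      by (intro Ck_mult[OF U] Ck_diff[OF U] Ck_const Suc.IH)
        (use Suc.prems Ck_mono[OF Suc.prems, of k] that in auto)
  qed
qed

text \<open>For $t \ge 1$ the inner \<open>flat_fun\<close> vanishes, so that the quotient is 1; for $t \le 0$ it is at least
  \<open>exp (- 1)\<close>, so that the outer argument is not positive and the quotient is 0.\<close>

definition smooth_step :: "real \<Rightarrow> real" where
  "smooth_step t = flat_fun 0 (exp (- 1) - flat_fun 0 (1 - t)) / flat_fun 0 (exp (- 1))"

lemma smooth_step_1: "t \<ge> 1 \<Longrightarrow> smooth_step t = 1"
  by (simp add: smooth_step_def flat_fun_def)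

lemma smooth_step_0:
  assumes "t \<le> 0" shows "smooth_step t = 0"
proof -
  have "1 / (1 - t) \<le> 1" using assms by (auto simp: divide_simps)
  then have "exp (- 1) \<le> flat_fun 0 (1 - t)" using assms by (simp add: flat_fun_def)
  then show ?thesis by (simp add: smooth_step_def flat_fun_def)
qed

lemma smooth_step_nonneg: "smooth_step t \<ge> 0"
  by (simp add: smooth_step_def flat_fun_def)

lemma Ck_smooth_step:
  assumes U: "openin (Euclidean_space n) U" and "Ck k n U g"
  shows "Ck k n U (\<lambda>z. smooth_step (g z))"
  unfolding smooth_step_def divide_inverse
  by (intro Ck_mult[OF U] Ck_const Ck_flat_fun[OF U] Ck_diff[OF U] assms(2))

section \<open>Cut-off functions with compact support\<close>

lemma compact_closed_box: "compact {z\<in>Rn m. \<forall>i<m. \<bar>z i - x i\<bar> \<le> e}"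
proof -
  \<comment> \<open>Tychonoff's theorem, with the factor {0} in all coordinates from
    \<open>m\<close> on.\<close>
  have "compactin (product_topology (\<lambda>_. euclideanreal) UNIV)
      (PiE UNIV (\<lambda>i. if i < m then {x i - e..x i + e} else {0}))"
    by (subst compactin_PiE) auto
  also have "PiE UNIV (\<lambda>i. if i < m then {x i - e..x i + e} else {0}) =
      {z\<in>Rn m. \<forall>i<m. \<bar>z i - x i\<bar> \<le> e}"
  proof (intro set_eqI iffI)
    fix z assume "z \<in> PiE UNIV (\<lambda>i. if i < m then {x i - e..x i + e} else {0})"
    then have "z i \<in> (if i < m then {x i - e..x i + e} else {0})" for i
      by (rule PiE_mem) simp
    then show "z \<in> {z\<in>Rn m. \<forall>i<m. \<bar>z i - x i\<bar> \<le> e}"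
      unfolding Rn_def by (simp add: abs_le_iff if_split_mem2) (smt (verit, best))
  next
    fix z assume "z \<in> {z\<in>Rn m. \<forall>i<m. \<bar>z i - x i\<bar> \<le> e}"
    then have "z i \<in> (if i < m then {x i - e..x i + e} else {0})" for i
      by (auto simp: Rn_def abs_le_iff algebra_simps)
    then show "z \<in> PiE UNIV (\<lambda>i. if i < m then {x i - e..x i + e} else {0})" by auto
  qed
  finally show ?thesis by (simp add: euclidean_product_topology)
qed

lemma openin_Rn: "openin (Euclidean_space m) (Rn m)"
  by (metis openin_topspace topspace_Euclidean_space_Rn)

lemma ex_local_bump:
  assumes "openin (Euclidean_space m) \<Omega>" "x \<in> \<Omega>"
  obtains b Q O' where "\<And>k. Ck k m (Rn m) b" "compact Q" "Q \<subseteq> \<Omega>"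
    "openin (Euclidean_space m) O'" "x \<in> O'" "O' \<subseteq> Q"
    "\<And>z. z \<in> Rn m \<Longrightarrow> z \<notin> Q \<Longrightarrow> b z = 0" "\<And>z. z \<in> O' \<Longrightarrow> b z = 1" "\<And>z. b z \<ge> 0"
proof -
  obtain e where e: "e > 0" "box_nbhd m x e \<subseteq> \<Omega>" using open_contains_box[OF assms] .
  define s where "s z = (\<Sum>i<m. (z i - x i) * (z i - x i))" for z
  \<comment> \<open>The argument is at least 1 where \<open>s z\<close> is at most $e^2/8$, and at
    most 0 where \<open>s z\<close> is at least $e^2/4$. The ball of radius \<open>e / 2\<close>
    lies in the box \<open>Q\<close>.\<close>
  define b where "b z = smooth_step (2 - 8 / e\<^sup>2 * s z)" for z
  define Q where "Q = {z\<in>Rn m. \<forall>i<m. \<bar>z i - x i\<bar> \<le> e / 2}"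
  define O' where "O' = {z\<in>Rn m. s z < e\<^sup>2 / 8}"
  have xR: "x \<in> Rn m" using assms open_Rn_subset by auto
  have Ckb: "Ck k m (Rn m) b" for k
    unfolding b_def s_def
    by (intro Ck_smooth_step[OF openin_Rn] Ck_diff[OF openin_Rn] Ck_const Ck_mult[OF openin_Rn]
        Ck_sum[OF openin_Rn] Ck_coord[OF openin_Rn])
  have sq: "\<bar>z i - x i\<bar> \<le> e / 2" if "s z \<le> e\<^sup>2 / 4" "i < m" for z i
  proof -
    have "(z i - x i) * (z i - x i) \<le> s z"
      unfolding s_def by (rule member_le_sum) (use that in auto)
    then have "(z i - x i)\<^sup>2 \<le> (e / 2)\<^sup>2" using that by (simp add: power2_eq_square field_simps)
    then have "\<bar>z i - x i\<bar> \<le> \<bar>e / 2\<bar>" using abs_le_square_iff by blast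
    then show ?thesis using e by auto
  qed
  have "openin (Euclidean_space m) O'"
  proof -
    have "continuous_on (Rn m) s" unfolding s_def
      by (intro continuous_intros continuous_on_subset[OF continuous_on_product_coordinates]) auto
    then have "openin (top_of_set (Rn m)) (Rn m \<inter> s -` {..<e\<^sup>2 / 8})"
      using continuous_on_open_gen[of s "Rn m" UNIV] by (metis continuous_openin_preimage_gen open_lessThan)
    moreover have "Rn m \<inter> s -` {..<e\<^sup>2 / 8} = O'" by (auto simp: O'_def)
    ultimately show ?thesis by (simp add: Euclidean_space_eq)
  qed
  moreover have "Q \<subseteq> \<Omega>"
    using e by (auto simp: Q_def box_nbhd_def intro!: subsetD[OF e(2)]) (smt (verit) field_sum_of_halves)
  moreover have "x \<in> O'" using xR e by (auto simp: O'_def s_def)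
  moreover have "O' \<subseteq> Q"
    using sq e by (auto simp: O'_def Q_def) (smt (verit, best) divide_strict_left_mono zero_less_power)
  moreover have "b z = 0" if "z \<in> Rn m" "z \<notin> Q" for z
  proof -
    have "s z > e\<^sup>2 / 4" using that sq[of z] by (auto simp: Q_def not_le[symmetric])
    then have "2 - 8 / e\<^sup>2 * s z \<le> 0" using e by (simp add: field_simps)
    then show ?thesis unfolding b_def by (rule smooth_step_0)
  qed
  moreover have "b z = 1" if "z \<in> O'" for z
  proof -
    have "2 - 8 / e\<^sup>2 * s z \<ge> 1" using e that by (simp add: field_simps O'_def)
    then show ?thesis unfolding b_def by (rule smooth_step_1)
  qed
  moreover have "b z \<ge> 0" for z unfolding b_def by (rule smooth_step_nonneg)
  moreover have "compact Q" unfolding Q_def by (rule compact_closed_box)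
  ultimately show ?thesis using that Ckb by blast
qed

text \<open>Finitely many local bumps are added. As they are nonnegative, the sum is at least 1
  wherever one of them is 1, and a second \<open>smooth_step\<close> flattens it to exactly 1
  there.\<close>

lemma ex_bump:
  assumes \<Omega>: "openin (Euclidean_space m) \<Omega>" and C: "compact C" "C \<subseteq> \<Omega>"
  obtains b Q O' where "\<And>k. Ck k m (Rn m) b" "compact Q" "Q \<subseteq> \<Omega>"
    "openin (Euclidean_space m) O'" "C \<subseteq> O'" "O' \<subseteq> Q"
    "\<And>z. z \<in> Rn m \<Longrightarrow> z \<notin> Q \<Longrightarrow> b z = 0" "\<And>z. z \<in> O' \<Longrightarrow> b z = 1"
proof -
  define P where "P x b Q O' \<longleftrightarrow> (\<forall>k. Ck k m (Rn m) b) \<and> compact Q \<and> Q \<subseteq> \<Omega> \<and>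
    openin (Euclidean_space m) O' \<and> x \<in> O' \<and> O' \<subseteq> Q \<and>
    (\<forall>z. z \<in> Rn m \<longrightarrow> z \<notin> Q \<longrightarrow> b z = 0) \<and> (\<forall>z. z \<in> O' \<longrightarrow> b z = 1) \<and> (\<forall>z. b z \<ge> 0)"
    for x b Q O'
  have "\<exists>b Q O'. P x b Q O'" if "x \<in> C" for x
    unfolding P_def using ex_local_bump[OF \<Omega>, of x] that C by (smt (verit, best) subsetD)
  then obtain b Q O' where P: "\<And>x. x \<in> C \<Longrightarrow> P x (b x) (Q x) (O' x)" by metis
  note P = P[unfolded P_def]
  have b: "\<And>x k. x \<in> C \<Longrightarrow> Ck k m (Rn m) (b x)"
    and Q: "\<And>x. x \<in> C \<Longrightarrow> compact (Q x)" "\<And>x. x \<in> C \<Longrightarrow> Q x \<subseteq> \<Omega>"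
    and O: "\<And>x. x \<in> C \<Longrightarrow> openin (Euclidean_space m) (O' x)" "\<And>x. x \<in> C \<Longrightarrow> x \<in> O' x"
      "\<And>x. x \<in> C \<Longrightarrow> O' x \<subseteq> Q x"
    and b0: "\<And>x z. x \<in> C \<Longrightarrow> z \<in> Rn m \<Longrightarrow> z \<notin> Q x \<Longrightarrow> b x z = 0"
    and b1: "\<And>x z. x \<in> C \<Longrightarrow> z \<in> O' x \<Longrightarrow> b x z = 1" and bn: "\<And>x z. x \<in> C \<Longrightarrow> b x z \<ge> 0"
    using P by blast+
  have "compactin (Euclidean_space m) C"
    using C open_Rn_subset[OF \<Omega>] by (auto simp: Euclidean_space_eq compactin_subtopology)
  then obtain F where F: "finite F" "F \<subseteq> C" "C \<subseteq> (\<Union>x\<in>F. O' x)"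
    unfolding compactin_def
    by (smt (verit, ccfv_threshold) O(1,2) UN_I finite_subset_image imageE subsetI Union_iff image_iff)
  define B where "B z = smooth_step (\<Sum>x\<in>F. b x z)" for z
  show ?thesis
  proof
    show "Ck k m (Rn m) B" for k
      unfolding B_def using b F by (intro Ck_smooth_step[OF openin_Rn] Ck_sum[OF openin_Rn]) auto
    show "compact (\<Union>x\<in>F. Q x)" using F Q by (intro compact_UN) auto
    show "(\<Union>x\<in>F. Q x) \<subseteq> \<Omega>" using F(2) Q(2) by blast
    show "openin (Euclidean_space m) (\<Union>x\<in>F. O' x)" using F O by (intro openin_Union) auto
    show "C \<subseteq> (\<Union>x\<in>F. O' x)" by fact
    show "(\<Union>x\<in>F. O' x) \<subseteq> (\<Union>x\<in>F. Q x)" using F(2) O(3) by blast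
    show "B z = 0" if "z \<in> Rn m" "z \<notin> (\<Union>x\<in>F. Q x)" for z
    proof -
      have "(\<Sum>x\<in>F. b x z) = 0" using that b0 F by (intro sum.neutral) auto
      then show ?thesis by (simp add: B_def smooth_step_0)
    qed
    show "B z = 1" if z: "z \<in> (\<Union>x\<in>F. O' x)" for z
    proof -
      obtain x where x: "x \<in> F" "z \<in> O' x" using z by blast
      then have "b x z \<le> (\<Sum>x\<in>F. b x z)" using F bn by (intro member_le_sum) auto
      moreover have "b x z = 1" using x F(2) b1 by blast
      ultimately show ?thesis unfolding B_def by (intro smooth_step_1) auto
    qed
  qed
qed

section \<open>Generic affine perturbations\<close>


text \<open>Full row rank, stated through relations between the rows because its failure then hands
  out the coefficients that the counting argument discretises.\<close>

definition indep_rows :: "nat set \<Rightarrow> nat \<Rightarrow> (nat \<Rightarrow> nat \<Rightarrow> real) \<Rightarrow> bool" where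
  "indep_rows I m a \<longleftrightarrow> (\<forall>c. (\<forall>j<m. (\<Sum>i\<in>I. c i * a i j) = 0) \<longrightarrow> (\<forall>i\<in>I. c i = 0))"

text \<open>A right inverse of the matrix is built row by row: a vector dual to the new row is found
  in the common kernel of the old rows, and the old dual vectors are corrected by multiples of
  it.\<close>

lemma indep_rows_dual:
  assumes "finite I" "indep_rows I m a"
  shows "\<exists>X. \<forall>i\<in>I. \<forall>l\<in>I. (\<Sum>j<m. a i j * X l j) = (if i = l then 1 else (0::real))"
  using assms
proof (induction I rule: finite_induct)
  case (insert i0 I)
  have "indep_rows I m a"
    unfolding indep_rows_def
  proof (intro allI impI)
    fix c assume c: "\<forall>j<m. (\<Sum>i\<in>I. c i * a i j) = 0"
    have "\<forall>j<m. (\<Sum>i\<in>insert i0 I. (c(i0 := 0)) i * a i j) = 0"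
    proof (intro allI impI)
      fix j assume "j < m"
      have "(\<Sum>i\<in>insert i0 I. (c(i0 := 0)) i * a i j) = (\<Sum>i\<in>I. c i * a i j)"
        using insert by (simp add: sum.insert) (intro sum.cong, auto)
      then show "(\<Sum>i\<in>insert i0 I. (c(i0 := 0)) i * a i j) = 0" using c \<open>j < m\<close> by simp
    qed
    then have "\<forall>i\<in>insert i0 I. (c(i0 := 0)) i = 0"
      using insert.prems unfolding indep_rows_def by blast
    then show "\<forall>i\<in>I. c i = 0" using insert.hyps by (metis fun_upd_other insertCI)
  qed
  then obtain X where X: "\<And>i l. i \<in> I \<Longrightarrow> l \<in> I \<Longrightarrow> (\<Sum>j<m. a i j * X l j) = (if i = l then 1 else 0)"
    using insert.IH by blast
  \<comment> \<open>\<open>pr\<close> is the projection onto the common kernel of the old rows along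
    the span of their dual vectors.\<close>
  define pr where "pr b = (\<lambda>j. b j - (\<Sum>l\<in>I. (\<Sum>j'<m. a l j' * b j') * X l j))" for b :: "nat \<Rightarrow> real"
  have pr: "(\<Sum>j<m. a i j * pr b j) = 0" if "i \<in> I" for b i
  proof -
    have "(\<Sum>j<m. a i j * pr b j) = (\<Sum>j<m. a i j * b j) - (\<Sum>j<m. \<Sum>l\<in>I. (\<Sum>j'<m. a l j' * b j') * (a i j * X l j))"
      unfolding pr_def by (simp add: right_diff_distrib sum_subtractf sum_distrib_left mult.left_commute)
    also have "(\<Sum>j<m. \<Sum>l\<in>I. (\<Sum>j'<m. a l j' * b j') * (a i j * X l j))
        = (\<Sum>l\<in>I. (\<Sum>j'<m. a l j' * b j') * (\<Sum>j<m. a i j * X l j))"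
      by (subst sum.swap) (simp add: sum_distrib_left)
    also have "\<dots> = (\<Sum>l\<in>I. if i = l then (\<Sum>j'<m. a l j' * b j') else 0)"
      by (intro sum.cong refl) (simp add: X that)
    also have "\<dots> = (\<Sum>j'<m. a i j' * b j')" using insert.hyps that by simp
    finally show ?thesis by simp
  qed
  \<comment> \<open>\<open>r\<close> is the new row composed with \<open>pr\<close>. It is the new
    row minus a combination of the old ones, hence not zero.\<close>
  define r where "r j = a i0 j - (\<Sum>l\<in>I. (\<Sum>j'<m. a i0 j' * X l j') * a l j)" for j
  have ri0: "(\<Sum>j<m. a i0 j * pr b j) = (\<Sum>j<m. r j * b j)" for b
  proof -
    have "(\<Sum>j<m. a i0 j * pr b j) = (\<Sum>j<m. a i0 j * b j) -
        (\<Sum>j<m. \<Sum>l\<in>I. (\<Sum>j'<m. a l j' * b j') * (a i0 j * X l j))"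
      unfolding pr_def by (simp add: right_diff_distrib sum_subtractf sum_distrib_left mult.left_commute)
    also have "(\<Sum>j<m. \<Sum>l\<in>I. (\<Sum>j'<m. a l j' * b j') * (a i0 j * X l j)) =
        (\<Sum>l\<in>I. (\<Sum>j'<m. a l j' * b j') * (\<Sum>j<m. a i0 j * X l j))"
      by (subst sum.swap) (simp add: sum_distrib_left)
    also have "\<dots> = (\<Sum>l\<in>I. \<Sum>j'<m. (\<Sum>j<m. a i0 j * X l j) * a l j' * b j')"
    proof -
      have "(\<Sum>j<m. f j * g j) * k = (\<Sum>j<m. k * f j * g j)" for f g :: "nat \<Rightarrow> real" and k
        by (simp add: sum_distrib_left mult_ac)
      then show ?thesis by (intro sum.cong refl)
    qed
    also have "\<dots> = (\<Sum>j'<m. \<Sum>l\<in>I. (\<Sum>j<m. a i0 j * X l j) * a l j' * b j')"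
      by (rule sum.swap)
    also have "\<dots> = (\<Sum>j'<m. (\<Sum>l\<in>I. (\<Sum>j<m. a i0 j * X l j) * a l j') * b j')"
      by (simp add: sum_distrib_right)
    finally show ?thesis unfolding r_def by (simp add: left_diff_distrib sum_subtractf)
  qed
  have "\<exists>j<m. r j \<noteq> 0"
  proof (rule ccontr)
    assume "\<not> ?thesis"
    then have r0: "\<And>j. j < m \<Longrightarrow> r j = 0" by auto
    define c where "c i = (if i = i0 then 1 else - (\<Sum>j'<m. a i0 j' * X i j'))" for i
    have "\<forall>j<m. (\<Sum>i\<in>insert i0 I. c i * a i j) = 0"
    proof (intro allI impI)
      fix j assume "j < m"
      have "(\<Sum>i\<in>I. c i * a i j) = (\<Sum>l\<in>I. - ((\<Sum>j'<m. a i0 j' * X l j') * a l j))"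
        using insert.hyps by (intro sum.cong) (auto simp: c_def)
      then show "(\<Sum>i\<in>insert i0 I. c i * a i j) = 0"
        using insert.hyps r0[OF \<open>j < m\<close>] by (simp add: c_def r_def sum_negf)
    qed
    then have "c i0 = 0" using insert.prems unfolding indep_rows_def by blast
    then show False by (simp add: c_def)
  qed
  then obtain j0 where "j0 < m" "r j0 \<noteq> 0" by auto
  then have rr: "(\<Sum>j<m. r j * r j) > 0"
    by (intro sum_pos2[of _ j0]) (auto simp: zero_less_mult_iff)
  \<comment> \<open>The old rows kill \<open>pr r\<close>, and the new row sends it to the sum of
    the squares of the entries of \<open>r\<close>, which is positive.\<close>
  define x0 where "x0 j = pr r j / (\<Sum>j<m. r j * r j)" for j
  have x0: "(\<Sum>j<m. a i j * x0 j) = (if i = i0 then 1 else 0)" if "i \<in> insert i0 I" for i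
  proof -
    have "(\<Sum>j<m. a i j * x0 j) = (\<Sum>j<m. a i j * pr r j) / (\<Sum>j<m. r j * r j)"
      by (simp add: x0_def sum_divide_distrib)
    then show ?thesis using that rr pr[of i r] ri0[of r] insert.hyps by auto
  qed
  define Y where "Y l j = (if l = i0 then x0 j else X l j - (\<Sum>j'<m. a i0 j' * X l j') * x0 j)" for l j
  have "(\<Sum>j<m. a i j * Y l j) = (if i = l then 1 else 0)"
    if "i \<in> insert i0 I" "l \<in> insert i0 I" for i l
  proof (cases "l = i0")
    case True
    then show ?thesis using x0[OF that(1)] by (simp add: Y_def)
  next
    case False
    then have "(\<Sum>j<m. a i j * Y l j) = (\<Sum>j<m. a i j * X l j) -
        (\<Sum>j'<m. a i0 j' * X l j') * (\<Sum>j<m. a i j * x0 j)"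
      by (simp add: Y_def right_diff_distrib sum_subtractf sum_distrib_left mult.left_commute)
    then show ?thesis using x0[OF that(1)] X[of i l] that False insert.hyps by auto
  qed
  then show ?case by blast
qed simp

lemma indep_rows_onto:
  assumes "finite I" "indep_rows I m a"
  shows "\<exists>x. \<forall>i\<in>I. (\<Sum>j<m. a i j * x j) = (u i :: real)"
proof -
  obtain X where X: "\<And>i l. i \<in> I \<Longrightarrow> l \<in> I \<Longrightarrow> (\<Sum>j<m. a i j * X l j) = (if i = l then 1 else 0)"
    using indep_rows_dual[OF assms] by blast
  have "(\<Sum>j<m. a i j * (\<Sum>l\<in>I. u l * X l j)) = u i" if "i \<in> I" for i
  proof -
    have "(\<Sum>j<m. a i j * (\<Sum>l\<in>I. u l * X l j)) = (\<Sum>l\<in>I. u l * (\<Sum>j<m. a i j * X l j))"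
      unfolding sum_distrib_left by (subst sum.swap) (simp add: mult.left_commute)
    also have "\<dots> = (\<Sum>l\<in>I. if i = l then u l else 0)"
      by (intro sum.cong refl) (simp add: X that)
    finally show ?thesis using assms that by simp
  qed
  then show ?thesis by (intro exI[of _ "\<lambda>j. \<Sum>l\<in>I. u l * X l j"]) blast
qed

text \<open>If \<open>X\<close> is a right inverse of \<open>a\<close>, then \<open>b\<close> times
  \<open>X\<close> is close to the identity. A relation between the rows of \<open>b\<close>, paired
  with the dual vector belonging to its largest coefficient, bounds that coefficient by a fraction
  of itself.\<close>

lemma indep_rows_open:
  assumes I: "finite I" "indep_rows I m a"
  shows "\<exists>e>0. \<forall>b. (\<forall>i\<in>I. \<forall>j<m. \<bar>b i j - a i j\<bar> < e) \<longrightarrow> indep_rows I m b"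
proof -
  obtain X where X: "\<And>i l. i \<in> I \<Longrightarrow> l \<in> I \<Longrightarrow> (\<Sum>j<m. a i j * X l j) = (if i = l then 1 else 0)"
    using indep_rows_dual[OF assms] by blast
  define s where "s = (\<Sum>l\<in>I. \<Sum>j<m. \<bar>X l j\<bar>)"
  have s0: "s \<ge> 0" unfolding s_def by (intro sum_nonneg) auto
  have sl: "(\<Sum>j<m. \<bar>X l j\<bar>) \<le> s" if "l \<in> I" for l
    unfolding s_def by (rule member_le_sum[of l I "\<lambda>l. \<Sum>j<m. \<bar>X l j\<bar>"]) (use that I in \<open>auto intro: sum_nonneg\<close>)
  \<comment> \<open>Chosen so that \<open>card I * (e * s) < 1\<close>; the summands 1 keep the
    denominator positive.\<close>
  define e where "e = 1 / (2 * (real (card I) + 1) * (s + 1))"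
  have e: "e > 0" unfolding e_def using s0 by auto
  have small: "real (card I) * (e * s) < 1"
  proof -
    have "real (card I) * s \<le> (real (card I) + 1) * (s + 1)" using s0 by (intro mult_mono) auto
    also have "\<dots> < 2 * (real (card I) + 1) * (s + 1)" using s0 by (simp add: add_pos_nonneg)
    finally have "real (card I) * s / (2 * (real (card I) + 1) * (s + 1)) < 1"
      using s0 by (subst divide_less_eq_1_pos) auto
    then show ?thesis unfolding e_def by simp
  qed
  show ?thesis
  proof (intro exI[of _ e] conjI e allI impI)
    fix b assume b: "\<forall>i\<in>I. \<forall>j<m. \<bar>b i j - a i j\<bar> < e"
    show "indep_rows I m b"
      unfolding indep_rows_def
    proof (intro allI impI)
      fix c assume c: "\<forall>j<m. (\<Sum>i\<in>I. c i * b i j) = 0"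
      show "\<forall>i\<in>I. c i = 0"
      proof (cases "I = {}")
        case False
        have "\<exists>l\<in>I. \<forall>i\<in>I. \<bar>c i\<bar> \<le> \<bar>c l\<bar>"
        proof -
          have "Max ((\<lambda>i. \<bar>c i\<bar>) ` I) \<in> (\<lambda>i. \<bar>c i\<bar>) ` I" using I False by (intro Max_in) auto
          then obtain l where "l \<in> I" "\<bar>c l\<bar> = Max ((\<lambda>i. \<bar>c i\<bar>) ` I)" by auto
          then show ?thesis using I by (metis Max_ge finite_imageI imageI)
        qed
        then obtain l where l: "l \<in> I" "\<And>i. i \<in> I \<Longrightarrow> \<bar>c i\<bar> \<le> \<bar>c l\<bar>" by blast
        have "(\<Sum>i\<in>I. c i * (\<Sum>j<m. b i j * X l j)) = (\<Sum>j<m. (\<Sum>i\<in>I. c i * b i j) * X l j)"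
          unfolding sum_distrib_left sum_distrib_right by (subst sum.swap) (simp add: mult.assoc)
        also have "\<dots> = 0" using c by simp
        finally have 0: "(\<Sum>i\<in>I. c i * (\<Sum>j<m. b i j * X l j)) = 0" .
        have "(\<Sum>i\<in>I. c i * (\<Sum>j<m. a i j * X l j)) = (\<Sum>i\<in>I. if i = l then c i else 0)"
          by (intro sum.cong refl) (simp add: X l)
        also have "\<dots> = c l" using I l by simp
        finally have 1: "(\<Sum>i\<in>I. c i * (\<Sum>j<m. a i j * X l j)) = c l" .
        have "(\<Sum>i\<in>I. c i * (\<Sum>j<m. (b i j - a i j) * X l j)) =
            (\<Sum>i\<in>I. c i * (\<Sum>j<m. b i j * X l j)) - (\<Sum>i\<in>I. c i * (\<Sum>j<m. a i j * X l j))"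
          by (simp only: left_diff_distrib right_diff_distrib sum_subtractf)
        then have "\<bar>c l\<bar> = \<bar>\<Sum>i\<in>I. c i * (\<Sum>j<m. (b i j - a i j) * X l j)\<bar>"
          using 0 1 by simp
        also have "\<dots> \<le> (\<Sum>i\<in>I. \<bar>c i * (\<Sum>j<m. (b i j - a i j) * X l j)\<bar>)"
          by (rule sum_abs)
        also have "\<dots> \<le> (\<Sum>i\<in>I. \<bar>c l\<bar> * (e * s))"
        proof (rule sum_mono)
          fix i assume i: "i \<in> I"
          have "\<bar>\<Sum>j<m. (b i j - a i j) * X l j\<bar> \<le> (\<Sum>j<m. e * \<bar>X l j\<bar>)"
            by (rule order_trans[OF sum_abs], rule sum_mono)
              (use b i in \<open>auto simp: abs_mult less_imp_le intro!: mult_right_mono\<close>)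
          also have "\<dots> = e * (\<Sum>j<m. \<bar>X l j\<bar>)" by (rule sum_distrib_left[symmetric])
          also have "\<dots> \<le> e * s" using sl[OF l(1)] e by (intro mult_left_mono) auto
          finally show "\<bar>c i * (\<Sum>j<m. (b i j - a i j) * X l j)\<bar> \<le> \<bar>c l\<bar> * (e * s)"
            unfolding abs_mult using l(2)[OF i] by (intro mult_mono) auto
        qed
        also have "\<dots> = \<bar>c l\<bar> * (real (card I) * (e * s))" by simp
        finally have "\<bar>c l\<bar> * (1 - real (card I) * (e * s)) \<le> 0" by (simp add: algebra_simps)
        then have "\<bar>c l\<bar> = 0" using small by (simp add: mult_le_0_iff)
        then show ?thesis using l(2) by fastforce
      qed simp
    qed
  qed
qed

text \<open>Division by the largest coefficient. The coefficient 1 lets one row be expressed through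
  the others, and the bound confines the remaining coefficients to a fixed interval.\<close>

lemma not_indep_rows_normalized:
  assumes "finite I" "\<not> indep_rows I m a"
  shows "\<exists>c. \<exists>i0\<in>I. c i0 = 1 \<and> (\<forall>i\<in>I. \<bar>c i\<bar> \<le> (1::real)) \<and> (\<forall>j<m. (\<Sum>i\<in>I. c i * a i j) = 0)"
proof -
  obtain c i1 where c: "\<And>j. j < m \<Longrightarrow> (\<Sum>i\<in>I. c i * a i j) = 0" and i1: "i1 \<in> I" "c i1 \<noteq> 0"
    using assms(2) unfolding indep_rows_def by auto
  have "Max ((\<lambda>i. \<bar>c i\<bar>) ` I) \<in> (\<lambda>i. \<bar>c i\<bar>) ` I" using assms i1 by (intro Max_in) auto
  then obtain l where "l \<in> I" "\<bar>c l\<bar> = Max ((\<lambda>i. \<bar>c i\<bar>) ` I)" by auto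
  then have l: "l \<in> I" "\<And>i. i \<in> I \<Longrightarrow> \<bar>c i\<bar> \<le> \<bar>c l\<bar>"
    using assms(1) by (metis Max_ge finite_imageI imageI)+
  have cl: "c l \<noteq> 0" using l(2)[OF i1(1)] i1 by auto
  show ?thesis
  proof (intro exI[of _ "\<lambda>i. c i / c l"] bexI[OF _ l(1)] conjI ballI allI impI)
    show "c l / c l = 1" using cl by simp
    show "\<bar>c i / c l\<bar> \<le> 1" if "i \<in> I" for i using l(2)[OF that] cl by (simp add: divide_le_eq_1)
    show "(\<Sum>i\<in>I. c i / c l * a i j) = 0" if "j < m" for j
    proof -
      have "(\<Sum>i\<in>I. c i / c l * a i j) = (\<Sum>i\<in>I. c i * a i j) / c l"
        by (simp add: sum_divide_distrib)
      then show ?thesis using c[OF that] by simp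
    qed
  qed
qed

section \<open>Counting parameters on a grid\<close>

lemma floor_scaled_close:
  fixes x y :: real
  assumes "\<lfloor>real K * x\<rfloor> = \<lfloor>real K * y\<rfloor>" "K > 0"
  shows "\<bar>x - y\<bar> \<le> 1 / real K"
proof -
  have "\<bar>real K * x - real K * y\<bar> \<le> 1" using assms(1) by linarith
  then have "real K * \<bar>x - y\<bar> \<le> 1" by (simp add: abs_mult flip: right_diff_distrib)
  then show ?thesis using assms(2) by (simp add: field_simps)
qed

lemma floor_scaled_range:
  assumes "\<bar>x\<bar> \<le> real R"
  shows "\<lfloor>real K * x\<rfloor> \<in> {- int (R * K)..int (R * K)}"
proof -
  have "\<bar>real K * x\<bar> \<le> real (R * K)" 
    using mult_left_mono[OF assms, of "real K"] by (simp add: abs_mult mult.commute)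
  then show ?thesis by (auto simp: le_floor_iff floor_le_iff abs_le_iff)
qed


text \<open>The parameters \<open>(v, L)\<close> that are bad at \<open>z\<close> are determined, in a Lipschitz way, by \<open>z\<close>, by all rows
  of \<open>L\<close> but one, and by the coefficients that express this row of \<open>p + L\<close> through the others.  With
  $k$ rows these are $m + (k-1)m + (k-1) = km + k - 1$ numbers, one less than the number of
  parameters.  So in a sufficiently fine grid of parameters the bad points are too few to fill the
  grid; this pigeonhole argument replaces Sard's theorem.\<close>

lemma generic_affine:
  fixes f :: "nat \<Rightarrow> point \<Rightarrow> real" and p :: "nat \<Rightarrow> nat \<Rightarrow> point \<Rightarrow> real" and \<Lambda> \<delta> :: real
  assumes I: "finite I" and \<delta>: "\<delta> > 0" and \<Lambda>: "\<Lambda> \<ge> 0"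
    and Q: "\<And>z j. z \<in> Q \<Longrightarrow> j < m \<Longrightarrow> \<bar>z j\<bar> \<le> real R"
    and f: "\<And>i z w. i \<in> I \<Longrightarrow> z \<in> Q \<Longrightarrow> w \<in> Q \<Longrightarrow> \<bar>f i z - f i w\<bar> \<le> \<Lambda> * (\<Sum>j<m. \<bar>z j - w j\<bar>)"
    and p: "\<And>i j z w. i \<in> I \<Longrightarrow> j < m \<Longrightarrow> z \<in> Q \<Longrightarrow> w \<in> Q \<Longrightarrow> \<bar>p i j z - p i j w\<bar> \<le> \<Lambda> * (\<Sum>j<m. \<bar>z j - w j\<bar>)"
    and pb: "\<And>i j z. i \<in> I \<Longrightarrow> j < m \<Longrightarrow> z \<in> Q \<Longrightarrow> \<bar>p i j z\<bar> \<le> \<Lambda>"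
  shows "\<exists>v L. (\<forall>i. \<bar>v i\<bar> < \<delta>) \<and> (\<forall>i j. \<bar>L i j\<bar> < \<delta>) \<and>
    (\<forall>z\<in>Q. (\<forall>i\<in>I. f i z + (v i + (\<Sum>j<m. L i j * z j)) = 0) \<longrightarrow> indep_rows I m (\<lambda>i j. p i j z + L i j))"
proof (rule ccontr)
  assume neg: "\<not> ?thesis"
  define k where "k = card I"
  \<comment> \<open>At least 1, so that the range \<open>J\<close> below also accommodates the
    normalised coefficients.\<close>
  define R' where "R' = R + 1"
  \<comment> \<open>\<open>C1 * \<eta>\<close> bounds the errors of both reconstructions below, of a
    row of \<open>L\<close> and of an entry of \<open>v\<close>; the choice of \<open>K\<close>
    makes this less than the grid spacing \<open>\<delta> / real N\<close>.\<close>
  define C1 where "C1 = \<Lambda> * m + k * ((\<Lambda> + \<delta>) + \<Lambda> * m) + \<Lambda> * m + \<delta> * m"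
  have C1: "C1 \<ge> 0" unfolding C1_def using \<Lambda> \<delta> by auto
  obtain K :: nat where K: "real K > C1 / \<delta>" using reals_Archimedean2 by blast
  then have K0: "K > 0" using C1 \<delta> by (metis divide_nonneg_pos le_less_trans of_nat_0_less_iff)
  have K1: "C1 < \<delta> * real K" using K \<delta> by (simp add: field_simps)
  \<comment> \<open>One more than the factor that stands in front of the power of \<open>N\<close>
    in the bound for \<open>card T\<close>.\<close>
  define N where "N = k * (3 * R' * K) ^ (m + (k - 1)) + 1"
  have N0: "N > 0" by (simp add: N_def)
  define G where "G = PiE (I \<times> {..m}) (\<lambda>_. {..<N})"
  have finG: "finite G" unfolding G_def using I by (intro finite_PiE) auto
  have cardG: "card G = N ^ (k * (m + 1))"
    unfolding G_def using I by (subst card_PiE) (auto simp: k_def)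
  \<comment> \<open>Column \<open>m\<close> of a grid point stands for \<open>v\<close>, the other
    columns for \<open>L\<close>.\<close>
  define par where "par g i j = (if i \<in> I \<and> j \<le> m then \<delta> * real (g (i, j)) / real N else 0)" for g :: "nat \<times> nat \<Rightarrow> nat" and i j
  have par: "\<bar>par g i j\<bar> < \<delta>" if "g \<in> G" for g i j
  proof (cases "i \<in> I \<and> j \<le> m")
    case True
    then have "g (i, j) < N" using that unfolding G_def by (auto dest: PiE_mem)
    then show ?thesis using True \<delta> N0 unfolding par_def by (simp add: field_simps abs_mult)
  qed (auto simp: par_def \<delta>)
  have neg': "\<exists>z\<in>Q. (\<forall>i\<in>I. f i z + (v i + (\<Sum>j<m. L i j * z j)) = 0) \<and>
      \<not> indep_rows I m (\<lambda>i j. p i j z + L i j)"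
    if "\<forall>i. \<bar>v i\<bar> < \<delta>" "\<forall>i j. \<bar>L i j\<bar> < \<delta>" for v L
    using neg that by blast
  define P where "P g z c i0 \<longleftrightarrow> z \<in> Q \<and> i0 \<in> I \<and> c i0 = 1 \<and> (\<forall>i\<in>I. \<bar>c i\<bar> \<le> (1::real)) \<and>
      (\<forall>i\<in>I. f i z + (par g i m + (\<Sum>j<m. par g i j * z j)) = 0) \<and>
      (\<forall>j<m. (\<Sum>i\<in>I. c i * (p i j z + par g i j)) = 0)" for g z c i0
  have "\<exists>z c i0. P g z c i0" if g: "g \<in> G" for g
  proof -
    have "\<forall>i. \<bar>par g i m\<bar> < \<delta>" "\<forall>i j. \<bar>par g i j\<bar> < \<delta>" using par[OF g] by auto
    from neg'[OF this] obtain z where z: "z \<in> Q" "\<forall>i\<in>I. f i z + (par g i m + (\<Sum>j<m. par g i j * z j)) = 0"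
      "\<not> indep_rows I m (\<lambda>i j. p i j z + par g i j)"
      by blast
    from not_indep_rows_normalized[OF I z(3)] z(1,2) show ?thesis unfolding P_def by blast
  qed
  then obtain Z c i0 where P: "\<And>g. g \<in> G \<Longrightarrow> P g (Z g) (c g) (i0 g)" by metis
  note P = P[unfolded P_def]
  have Z: "\<And>g. g \<in> G \<Longrightarrow> Z g \<in> Q" and i0: "\<And>g. g \<in> G \<Longrightarrow> i0 g \<in> I"
    and c1: "\<And>g. g \<in> G \<Longrightarrow> c g (i0 g) = 1"
    and cb: "\<And>g i. g \<in> G \<Longrightarrow> i \<in> I \<Longrightarrow> \<bar>c g i\<bar> \<le> (1::real)"
    and fz: "\<And>g i. g \<in> G \<Longrightarrow> i \<in> I \<Longrightarrow> f i (Z g) + (par g i m + (\<Sum>j<m. par g i j * Z g j)) = 0"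
    and cz: "\<And>g j. g \<in> G \<Longrightarrow> j < m \<Longrightarrow> (\<Sum>i\<in>I. c g i * (p i j (Z g) + par g i j)) = 0"
    using P by blast+
  define fl where "fl x = \<lfloor>real (K * N) * x\<rfloor>" for x :: real
  define J where "J = {- int (R' * (K * N))..int (R' * (K * N))}"
  \<comment> \<open>All that is remembered of a grid point: the index of the row with coefficient 1,
    the cells of the bad point and of the other coefficients, and the other rows of \<open>L\<close>
    exactly. The vector \<open>v\<close> and the distinguished row are left out and have to be
    reconstructed.\<close>
  define key where "key g = (i0 g, restrict (\<lambda>j. fl (Z g j)) {..<m},
      restrict (\<lambda>i. fl (c g i)) (I - {i0 g}), restrict g ((I - {i0 g}) \<times> {..<m}))" for g
  define T where "T = (SIGMA i:I. PiE {..<m} (\<lambda>_. J) \<times> PiE (I - {i}) (\<lambda>_. J) \<times>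
      PiE ((I - {i}) \<times> {..<m}) (\<lambda>_. {..<N}))"
  have flJ: "fl x \<in> J" if "\<bar>x\<bar> \<le> real R'" for x
    unfolding fl_def J_def using that by (rule floor_scaled_range)
  have RR: "real R \<le> real R'" "1 \<le> real R'" by (auto simp: R'_def)
  have keyT: "key ` G \<subseteq> T"
  proof (rule image_subsetI)
    fix g assume g: "g \<in> G"
    have 1: "restrict (\<lambda>j. fl (Z g j)) {..<m} \<in> PiE {..<m} (\<lambda>_. J)"
      unfolding restrict_PiE_iff using flJ order_trans[OF Q[OF Z[OF g]] RR(1)] by blast
    have 2: "restrict (\<lambda>i. fl (c g i)) (I - {i0 g}) \<in> PiE (I - {i0 g}) (\<lambda>_. J)"
      unfolding restrict_PiE_iff using flJ order_trans[OF cb[OF g] RR(2)] by blast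
    have 3: "restrict g ((I - {i0 g}) \<times> {..<m}) \<in> PiE ((I - {i0 g}) \<times> {..<m}) (\<lambda>_. {..<N})"
      unfolding restrict_PiE_iff using PiE_mem[OF g[unfolded G_def]] by auto
    show "key g \<in> T" unfolding key_def T_def using 1 2 3 i0[OF g] by simp
  qed
  have inj: "inj_on key G"
  proof (rule inj_onI)
    fix g h assume g: "g \<in> G" and h: "h \<in> G" and k: "key g = key h"
    define \<eta> where "\<eta> = 1 / real (K * N)"
    have ie: "i0 g = i0 h" using k by (simp add: key_def)
    let ?i = "i0 h"
    have zz: "\<bar>Z g j - Z h j\<bar> \<le> \<eta>" if "j < m" for j
    proof -
      have "restrict (\<lambda>j. fl (Z g j)) {..<m} j = restrict (\<lambda>j. fl (Z h j)) {..<m} j"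
        using k by (simp add: key_def)
      then show ?thesis unfolding \<eta>_def using that K0 N0
        by (intro floor_scaled_close) (auto simp: fl_def)
    qed
    have cc: "\<bar>c g i - c h i\<bar> \<le> \<eta>" if "i \<in> I - {?i}" for i
    proof -
      have "restrict (\<lambda>i. fl (c g i)) (I - {i0 g}) i = restrict (\<lambda>i. fl (c h i)) (I - {i0 h}) i"
        using k unfolding key_def prod.inject by metis
      then show ?thesis unfolding \<eta>_def using that K0 N0 ie
        by (intro floor_scaled_close) (auto simp: fl_def)
    qed
    have gh: "g (i, j) = h (i, j)" if "i \<in> I - {?i}" "j < m" for i j
    proof -
      have "restrict g ((I - {i0 g}) \<times> {..<m}) (i, j) = restrict h ((I - {i0 h}) \<times> {..<m}) (i, j)"
        using k unfolding key_def prod.inject by metis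
      then show ?thesis using that ie by auto
    qed
    have \<eta>: "\<eta> > 0" unfolding \<eta>_def using K0 N0 by simp
    have C1\<eta>: "C1 * \<eta> < \<delta> / real N" unfolding \<eta>_def using K1 K0 N0 by (simp add: field_simps)
    have sz: "(\<Sum>j<m. \<bar>Z g j - Z h j\<bar>) \<le> m * \<eta>"
      using sum_mono[of "{..<m}" "\<lambda>j. \<bar>Z g j - Z h j\<bar>" "\<lambda>_. \<eta>"] zz by simp
    \<comment> \<open>Grid entries are integers, so two parameters closer than the spacing
      coincide.\<close>
    have eq: "g (i, j) = h (i, j)" if ij: "i \<in> I" "j \<le> m" and lt: "\<bar>par g i j - par h i j\<bar> < \<delta> / real N" for i j
    proof -
      have "par g i j - par h i j = \<delta> / real N * (real (g (i, j)) - real (h (i, j)))"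
        using ij by (simp add: par_def diff_divide_distrib right_diff_distrib)
      then have "\<delta> / real N * \<bar>real (g (i, j)) - real (h (i, j))\<bar> < \<delta> / real N * 1"
        using lt \<delta> N0 by (simp add: abs_mult)
      then have "\<bar>real (g (i, j)) - real (h (i, j))\<bar> < 1" using \<delta> N0
        by (metis divide_pos_pos mult_less_cancel_left_pos of_nat_0_less_iff)
      then show ?thesis by linarith
    qed
    \<comment> \<open>The relation with coefficients \<open>c\<close> expresses this row of
      \<open>p + L\<close> through the others, so equal keys determine it up to less than the grid
      spacing.\<close>
    have row: "g (?i, j) = h (?i, j)" if j: "j < m" for j
    proof (rule eq)
      show "?i \<in> I" using i0 h by auto
      show "j \<le> m" using j by simp
      define I' where "I' = I - {?i}"
      have split: "(\<Sum>i\<in>I. u i) = u ?i + (\<Sum>i\<in>I'. u i)" for u :: "nat \<Rightarrow> real"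
        unfolding I'_def using I \<open>?i \<in> I\<close> by (simp add: sum.remove)
      have pg: "par g ?i j = - p ?i j (Z g) - (\<Sum>i\<in>I'. c g i * (p i j (Z g) + par g i j))"
        using cz[OF g j] c1[OF g] unfolding split ie by simp
      have ph: "par h ?i j = - p ?i j (Z h) - (\<Sum>i\<in>I'. c h i * (p i j (Z h) + par h i j))"
        using cz[OF h j] c1[OF h] unfolding split by simp
      have lip: "\<bar>p i j (Z g) - p i j (Z h)\<bar> \<le> \<Lambda> * (m * \<eta>)" if "i \<in> I" for i
        using p[OF that j Z[OF g] Z[OF h]] mult_left_mono[OF sz \<Lambda>] by linarith
      have termb: "\<bar>c g i * (p i j (Z g) + par g i j) - c h i * (p i j (Z h) + par h i j)\<bar>
          \<le> ((\<Lambda> + \<delta>) + \<Lambda> * m) * \<eta>" if i: "i \<in> I'" for i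
      proof -
        have iI: "i \<in> I" "i \<in> I - {?i}" using i by (auto simp: I'_def)
        have pe: "par g i j = par h i j" using gh[OF iI(2) j] by (simp add: par_def)
        have e2: "c g i * (p i j (Z g) + par g i j) - c h i * (p i j (Z h) + par h i j) =
            (c g i - c h i) * (p i j (Z g) + par g i j) + c h i * (p i j (Z g) - p i j (Z h))"
          by (simp add: pe algebra_simps)
        have "\<bar>c g i * (p i j (Z g) + par g i j) - c h i * (p i j (Z h) + par h i j)\<bar> \<le> \<bar>c g i - c h i\<bar> * \<bar>p i j (Z g) + par g i j\<bar> + \<bar>c h i\<bar> * \<bar>p i j (Z g) - p i j (Z h)\<bar>"
          unfolding e2 by (metis abs_mult abs_triangle_ineq)
        also have "\<dots> \<le> \<eta> * (\<Lambda> + \<delta>) + 1 * (\<Lambda> * (m * \<eta>))"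
        proof (intro add_mono mult_mono)
          show "\<bar>p i j (Z g) + par g i j\<bar> \<le> \<Lambda> + \<delta>"
            using pb[OF iI(1) j Z[OF g]] par[OF g, of i j] by linarith
        qed (use cc[OF iI(2)] cb[OF h iI(1)] lip[OF iI(1)] \<eta> in auto)
        finally show ?thesis by (simp add: algebra_simps)
      qed
      have e1: "par g ?i j - par h ?i j = - (p ?i j (Z g) - p ?i j (Z h)) -
          (\<Sum>i\<in>I'. c g i * (p i j (Z g) + par g i j) - c h i * (p i j (Z h) + par h i j))"
        unfolding pg ph sum_subtractf by simp
      have "\<bar>par g ?i j - par h ?i j\<bar> \<le> \<bar>p ?i j (Z g) - p ?i j (Z h)\<bar> +
          \<bar>\<Sum>i\<in>I'. c g i * (p i j (Z g) + par g i j) - c h i * (p i j (Z h) + par h i j)\<bar>"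
        unfolding e1 by linarith
      also have "\<dots> \<le> \<Lambda> * (m * \<eta>) + (\<Sum>i\<in>I'. ((\<Lambda> + \<delta>) + \<Lambda> * m) * \<eta>)"
        by (rule add_mono[OF lip[OF \<open>?i \<in> I\<close>] order_trans[OF sum_abs sum_mono[OF termb]]])
      also have "\<dots> \<le> \<Lambda> * (m * \<eta>) + k * (((\<Lambda> + \<delta>) + \<Lambda> * m) * \<eta>)"
      proof -
        have "real (card I') \<le> k" unfolding k_def I'_def using I by (simp add: card_mono)
        then show ?thesis using \<Lambda> \<delta> \<eta> by (simp add: mult_right_mono)
      qed
      also have "\<dots> \<le> C1 * \<eta>"
        unfolding C1_def using \<Lambda> \<delta> \<eta> by (simp add: distrib_right mult.assoc)
      also note C1\<eta>
      finally show "\<bar>par g ?i j - par h ?i j\<bar> < \<delta> / real N" .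
    qed
    have L: "par g i j = par h i j" if "i \<in> I" "j < m" for i j
      using gh[of i j] row[of j] that by (cases "i = ?i") (auto simp: par_def)
    \<comment> \<open>With \<open>L\<close> known, \<open>v i\<close> is read off from the vanishing
      of the function with index \<open>i\<close>.\<close>
    have "g (i, m) = h (i, m)" if i: "i \<in> I" for i
    proof (rule eq[OF i])
      have e3: "par g i m - par h i m = - (f i (Z g) - f i (Z h)) - (\<Sum>j<m. par h i j * (Z g j - Z h j))"
      proof -
        have "(\<Sum>j<m. par g i j * Z g j) = (\<Sum>j<m. par h i j * Z g j)"
          using L[OF i] by simp
        then show ?thesis using fz[OF g i] fz[OF h i] by (simp add: right_diff_distrib sum_subtractf)
      qed
      have "\<bar>par g i m - par h i m\<bar> \<le> \<bar>f i (Z g) - f i (Z h)\<bar> + \<bar>\<Sum>j<m. par h i j * (Z g j - Z h j)\<bar>"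
        unfolding e3 by linarith
      also have "\<dots> \<le> \<Lambda> * (m * \<eta>) + (\<Sum>j<m. \<delta> * \<eta>)"
      proof (rule add_mono[OF _ order_trans[OF sum_abs sum_mono]])
        show "\<bar>f i (Z g) - f i (Z h)\<bar> \<le> \<Lambda> * (m * \<eta>)"
          using f[OF i Z[OF g] Z[OF h]] mult_left_mono[OF sz \<Lambda>] by linarith
        show "\<bar>par h i j * (Z g j - Z h j)\<bar> \<le> \<delta> * \<eta>" if "j \<in> {..<m}" for j
          unfolding abs_mult using par[OF h, of i j] zz[of j] that \<delta> by (intro mult_mono) auto
      qed
      also have "\<dots> \<le> C1 * \<eta>"
        unfolding C1_def using \<Lambda> \<delta> \<eta> by (simp add: distrib_right mult.assoc)
      also note C1\<eta>
      finally show "\<bar>par g i m - par h i m\<bar> < \<delta> / real N" .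
    qed simp
    then have "g x = h x" if "x \<in> I \<times> {..m}" for x
      using that gh row by (cases x) (metis DiffI atMost_iff le_neq_implies_less mem_Sigma_iff singletonD)
    then show "g = h" using g h unfolding G_def by (rule PiE_ext[rotated 2])
  qed
  have finT: "finite T" unfolding T_def J_def using I by (intro finite_SigmaI finite_PiE finite_cartesian_product) auto
  have cardJ: "card J \<le> 3 * R' * K * N"
  proof -
    have "card J = 2 * (R' * (K * N)) + 1" unfolding J_def by (simp add: nat_add_distrib nat_mult_distrib)
    moreover have "0 < R' * (K * N)" unfolding R'_def using K0 N0 by simp
    ultimately show ?thesis by (simp add: algebra_simps)
  qed
  have "card T = (\<Sum>i\<in>I. card J ^ m * (card J ^ (k - 1) * N ^ ((k - 1) * m)))"
    unfolding T_def using I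
    by (subst card_SigmaI) (auto simp: card_cartesian_product card_PiE k_def J_def intro!: finite_PiE sum.cong)
  also have "\<dots> = k * (card J ^ (m + (k - 1)) * N ^ ((k - 1) * m))"
    by (simp add: k_def power_add)
  also have "\<dots> \<le> k * ((3 * R' * K * N) ^ (m + (k - 1)) * N ^ ((k - 1) * m))"
    using cardJ by (intro mult_le_mono power_mono le_refl) auto
  also have "\<dots> = k * (3 * R' * K) ^ (m + (k - 1)) * N ^ (m + (k - 1) + (k - 1) * m)"
    by (simp add: power_mult_distrib power_add mult_ac)
  finally have T: "card T \<le> k * (3 * R' * K) ^ (m + (k - 1)) * N ^ (m + (k - 1) + (k - 1) * m)" .
  have "card G \<le> card T" using card_inj_on_le[OF inj keyT finT] .
  then have le: "N ^ (k * (m + 1)) \<le> k * (3 * R' * K) ^ (m + (k - 1)) * N ^ (m + (k - 1) + (k - 1) * m)"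
    using T cardG by linarith
  \<comment> \<open>Every grid point is bad and supplies a row index, so \<open>k\<close> is
    positive and \<open>k - 1\<close> is not truncated.\<close>
  have "G \<noteq> {}"
  proof -
    have "card G > 0" using cardG N0 by simp
    then show ?thesis by auto
  qed
  then have "I \<noteq> {}" using i0 by auto
  then have "k > 0" using I by (simp add: k_def card_gt_0_iff)
  then obtain l where l: "k = Suc l" using gr0_conv_Suc by auto
  \<comment> \<open>The grid has exactly one factor \<open>N\<close> more than the bound for the
    keys.\<close>
  have "k * (m + 1) = Suc (m + (k - 1) + (k - 1) * m)" unfolding l by simp
  then have "N * N ^ (m + (k - 1) + (k - 1) * m) \<le> k * (3 * R' * K) ^ (m + (k - 1)) * N ^ (m + (k - 1) + (k - 1) * m)"
    using le by simp
  then have "N \<le> k * (3 * R' * K) ^ (m + (k - 1))" using N0 by simp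
  then show False unfolding N_def by simp
qed

section \<open>Smoothing by averaging\<close>


lemma partial_bound_Lipschitz:
  assumes F: "Ck 1 m (Rn m) F" and B: "\<And>j z. j < m \<Longrightarrow> z \<in> Rn m \<Longrightarrow> \<bar>partial_deriv j F z\<bar> \<le> B"
    and zw: "z \<in> Rn m" "w \<in> Rn m"
  shows "\<bar>F z - F w\<bar> \<le> B * (\<Sum>j<m. \<bar>z j - w j\<bar>)"
proof -
  define u where "u j = (\<lambda>i. if i < j then z i else w i)" for j
  have uR: "u j \<in> Rn m" if "j \<le> m" for j using zw that by (auto simp: u_def Rn_def)
  have step: "\<bar>F (u (Suc j)) - F (u j)\<bar> \<le> B * \<bar>z j - w j\<bar>" if j: "j < m" for j
  proof -
    have "\<exists>x. \<bar>x - w j\<bar> \<le> \<bar>z j - w j\<bar> \<and> F ((u j)(j := z j)) - F ((u j)(j := w j)) =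
        (z j - w j) * partial_deriv j F ((u j)(j := x))"
    proof (rule MVT_abs)
      fix x
      have "(u j)(j := x) \<in> Rn m" using uR[of j] j by (simp add: Rn_upd)
      from Ck_has_partial[OF F _ j this]
      show "((\<lambda>x. F ((u j)(j := x))) has_real_derivative partial_deriv j F ((u j)(j := x))) (at x)"
        by simp
    qed
    moreover have "(u j)(j := z j) = u (Suc j)" by (auto simp: u_def less_Suc_eq)
    moreover have "(u j)(j := w j) = u j" by (auto simp: u_def)
    ultimately obtain x where x: "F (u (Suc j)) - F (u j) = (z j - w j) * partial_deriv j F ((u j)(j := x))"
      by auto
    have "(u j)(j := x) \<in> Rn m" using uR[of j] j by (simp add: Rn_upd)
    from mult_left_mono[OF B[OF j this], of "\<bar>z j - w j\<bar>"] show ?thesis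
      unfolding x abs_mult by (simp add: mult.commute)
  qed
  have "u m = z" "u 0 = w" using zw by (auto simp: u_def Rn_def fun_eq_iff)
  then have "F z - F w = (\<Sum>j<m. F (u (Suc j)) - F (u j))"
    using sum_lessThan_telescope[of "\<lambda>j. F (u j)" m] by simp
  then have "\<bar>F z - F w\<bar> \<le> (\<Sum>j<m. \<bar>F (u (Suc j)) - F (u j)\<bar>)" by simp
  also have "\<dots> \<le> (\<Sum>j<m. B * \<bar>z j - w j\<bar>)" by (intro sum_mono step) auto
  finally show ?thesis by (simp add: sum_distrib_left)
qed

lemma closed_diff_openin:
  assumes "closed Q" shows "openin (Euclidean_space m) (Rn m - Q)"
  using assms unfolding Euclidean_space_eq openin_open
  by (intro exI[of _ "- Q"]) auto

lemma partial_zero_outside: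
  assumes "compact Q" "\<And>z. z \<in> Rn m \<Longrightarrow> z \<notin> Q \<Longrightarrow> F z = 0" "z \<in> Rn m" "z \<notin> Q" "j < m"
  shows "partial_deriv j F z = 0"
proof -
  have "partial_deriv j F z = partial_deriv j (\<lambda>_. 0) z"
    by (rule partial_deriv_cong[OF closed_diff_openin[OF compact_imp_closed[OF assms(1)]], of z m])
      (use assms in auto)
  also have "\<dots> = 0" by (rule partial_derivI) simp
  finally show ?thesis .
qed

lemma compact_support_Lipschitz:
  assumes F: "Ck 1 m (Rn m) F" and Q: "compact Q" "Q \<subseteq> Rn m"
    and 0: "\<And>z. z \<in> Rn m \<Longrightarrow> z \<notin> Q \<Longrightarrow> F z = 0"
  obtains \<Lambda> where "\<Lambda> \<ge> 0" "\<And>z w. z \<in> Rn m \<Longrightarrow> w \<in> Rn m \<Longrightarrow> \<bar>F z - F w\<bar> \<le> \<Lambda> * (\<Sum>j<m. \<bar>z j - w j\<bar>)"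
proof -
  have "\<exists>B. \<forall>z\<in>Q. \<bar>partial_deriv j F z\<bar> \<le> B" if "j < m" for j
  proof -
    have "continuous_on Q (partial_deriv j F)"
      using F that Q by (auto intro: continuous_on_subset)
    then have "bounded (partial_deriv j F ` Q)"
      using Q compact_continuous_image compact_imp_bounded by blast
    then show ?thesis unfolding bounded_iff by auto
  qed
  then obtain B where B: "\<And>j z. j < m \<Longrightarrow> z \<in> Q \<Longrightarrow> \<bar>partial_deriv j F z\<bar> \<le> B j" by metis
  define \<Lambda> where "\<Lambda> = (\<Sum>j<m. \<bar>B j\<bar>)"
  have L: "\<Lambda> \<ge> 0" unfolding \<Lambda>_def by (intro sum_nonneg) auto
  have "\<bar>partial_deriv j F z\<bar> \<le> \<Lambda>" if "j < m" "z \<in> Rn m" for j z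
  proof (cases "z \<in> Q")
    case True
    have "\<bar>B j\<bar> \<le> \<Lambda>" unfolding \<Lambda>_def using that by (intro member_le_sum) auto
    then show ?thesis using B[OF that(1) True] by linarith
  next
    case False
    then have "partial_deriv j F z = 0"
      by (intro partial_zero_outside[OF Q(1) 0]) (use that in auto)
    then show ?thesis using L by simp
  qed
  from partial_bound_Lipschitz[OF F this] show ?thesis using that L by blast
qed

text \<open>\<open>avg m l\<close> averages in the direction of the coordinate \<open>l\<close> over an interval whose length is
  the last coordinate \<open>y m\<close>, which thereby becomes a smoothing parameter.\<close>

definition shear :: "nat \<Rightarrow> nat \<Rightarrow> point \<Rightarrow> real \<Rightarrow> point" where
  "shear m l y t = y(l := y l + t * y m)"

definition avg :: "nat \<Rightarrow> nat \<Rightarrow> (point \<Rightarrow> real) \<Rightarrow> point \<Rightarrow> real" where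
  "avg m l g y = integral (cbox 0 1) (\<lambda>t. g (shear m l y t))"

lemma shear_Rn: "y \<in> Rn (Suc m) \<Longrightarrow> l < m \<Longrightarrow> shear m l y t \<in> Rn (Suc m)"
  by (auto simp: shear_def Rn_def)

lemma continuous_on_shear: "continuous_on S (\<lambda>(y, t). shear m l y t)"
proof -
  have "continuous_on S (\<lambda>p. fst p i)" for i
    by (rule continuous_on_compose2[OF continuous_on_product_coordinates[of i] continuous_on_fst])
      (auto intro: continuous_intros)
  then have "continuous_on S (\<lambda>p. ((fst p)(l := fst p l + snd p * fst p m)) i)" for i
    by (cases "i = l") (auto intro!: continuous_intros)
  then show ?thesis
    unfolding case_prod_beta shear_def
    by (intro continuous_on_coordinatewise_then_product)
qed

lemma continuous_on_compose_shear:
  assumes "continuous_on (Rn (Suc m)) g" "l < m"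
  shows "continuous_on (Rn (Suc m) \<times> T) (\<lambda>(y, t). g (shear m l y t))"
proof -
  have "continuous_on (Rn (Suc m) \<times> T) (\<lambda>p. g ((\<lambda>(y, t). shear m l y t) p))"
    by (rule continuous_on_compose2[OF assms(1) continuous_on_shear])
      (use shear_Rn assms(2) in auto)
  then show ?thesis by (simp add: case_prod_beta)
qed

lemma integrable_shear:
  fixes g :: "point \<Rightarrow> real"
  assumes "continuous_on (Rn (Suc m)) g" "l < m" "y \<in> Rn (Suc m)"
  shows "(\<lambda>t. g (shear m l y t)) integrable_on cbox 0 (1::real)"
proof (rule Henstock_Kurzweil_Integration.integrable_continuous)
  have "continuous_on (cbox 0 1) (\<lambda>t. (\<lambda>(y, t). g (shear m l y t)) (y, t))"
    by (rule continuous_on_compose2[OF continuous_on_compose_shear[OF assms(1,2), of UNIV]])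
      (use assms(3) in \<open>auto intro: continuous_intros\<close>)
  then show "continuous_on (cbox 0 1) (\<lambda>t. g (shear m l y t))" by simp
qed

lemma continuous_on_avg:
  assumes "continuous_on (Rn (Suc m)) g" "l < m"
  shows "continuous_on (Rn (Suc m)) (avg m l g)"
  unfolding avg_def
  by (rule integral_continuous_on_param)
    (use continuous_on_compose_shear[OF assms] in \<open>simp\<close>)

text \<open>The integrand of a partial derivative of \<open>avg\<close>. For \<open>i = m\<close> a
  second term appears because \<open>y m\<close> also moves the coordinate \<open>l\<close>, at
  speed \<open>t\<close>.\<close>

definition davg :: "nat \<Rightarrow> nat \<Rightarrow> (point \<Rightarrow> real) \<Rightarrow> nat \<Rightarrow> point \<Rightarrow> real \<Rightarrow> real" where
  "davg m l g i y t = partial_deriv i g (shear m l y t) +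
     (if i = m then t * partial_deriv l g (shear m l y t) else 0)"

lemma continuous_on_davg:
  assumes "Ck 1 (Suc m) (Rn (Suc m)) g" "l < m" "i < Suc m"
  shows "continuous_on (Rn (Suc m) \<times> T) (\<lambda>(y, t). davg m l g i y t)"
proof -
  have "continuous_on (Rn (Suc m)) (partial_deriv j g)" if "j < Suc m" for j
    using assms that by simp
  note * = continuous_on_compose_shear[OF this assms(2), of _ T, unfolded case_prod_beta]
  show ?thesis
    unfolding davg_def case_prod_beta
    using assms by (cases "i = m") (auto intro!: continuous_intros *)
qed

lemma avg_has_partial:
  assumes g: "Ck 1 (Suc m) (Rn (Suc m)) g" and l: "l < m" and i: "i < Suc m" and y: "y \<in> Rn (Suc m)"
  shows "((\<lambda>s. avg m l g (y(i := s))) has_real_derivative integral (cbox 0 1) (davg m l g i y)) (at (y i))"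
proof -
  have yR: "y(i := s) \<in> Rn (Suc m)" for s using Rn_upd[OF y i] .
  have D: "((\<lambda>s. g (shear m l (y(i := s)) t)) has_real_derivative davg m l g i (y(i := s)) t) (at s)" for s t
  proof -
    have "((\<lambda>s. g (shear m l (y(i := s)) t)) has_real_derivative
        (\<Sum>j<Suc m. partial_deriv j g (shear m l (y(i := s)) t) *
           ((if j = i then 1 else 0) + (if j = l \<and> i = m then t else 0)))) (at s)"
    proof (rule chain_rule_curve[OF openin_Rn g])
      show "shear m l (y(i := s)) t \<in> Rn (Suc m)" using shear_Rn[OF yR l] .
      show "\<forall>\<^sub>F s in nhds s. shear m l (y(i := s)) t \<in> Rn (Suc m)" using shear_Rn[OF yR l] by simp
      show "((\<lambda>s. shear m l (y(i := s)) t j) has_real_derivative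
          (if j = i then 1 else 0) + (if j = l \<and> i = m then t else 0)) (at s)" for j
        unfolding shear_def using l
        by (cases "j = l"; cases "j = i"; cases "i = m") (auto intro!: derivative_eq_intros)
    qed
    also have "(\<Sum>j<Suc m. partial_deriv j g (shear m l (y(i := s)) t) *
           ((if j = i then 1 else 0) + (if j = l \<and> i = m then t else 0))) = davg m l g i (y(i := s)) t"
    proof -
      have "(\<Sum>j<Suc m. P j * ((if j = i then 1 else 0) + (if j = l \<and> i = m then t else 0))) =
          P i + (if i = m then t * P l else 0)" for P :: "nat \<Rightarrow> real"
      proof -
        have "(\<Sum>j<Suc m. P j * ((if j = i then 1 else 0) + (if j = l \<and> i = m then t else 0))) =
          (\<Sum>j<Suc m. (if j = i then P j else 0)) + (\<Sum>j<Suc m. (if j = l then (if i = m then t * P j else 0) else 0))"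
          unfolding sum.distrib[symmetric] by (intro sum.cong refl) (auto simp: algebra_simps)
        then show ?thesis using i l by (simp add: sum.delta)
      qed
      then show ?thesis unfolding davg_def .
    qed
    finally show ?thesis .
  qed
  have "((\<lambda>s. integral (cbox 0 1) (\<lambda>t. g (shear m l (y(i := s)) t))) has_real_derivative
      integral (cbox 0 1) (davg m l g i (y(i := y i)))) (at (y i) within UNIV)"
  proof (rule leibniz_rule_field_derivative)
    show "((\<lambda>s. g (shear m l (y(i := s)) t)) has_real_derivative davg m l g i (y(i := s)) t) (at s within UNIV)" for s t
      using D by simp
    show "(\<lambda>t. g (shear m l (y(i := s)) t)) integrable_on cbox 0 1" for s
      by (rule integrable_shear[OF Ck_continuous[OF g] l yR])
    have "continuous_on (UNIV \<times> cbox 0 1) (\<lambda>p. (\<lambda>(y, t). davg m l g i y t) (y(i := fst p), snd p))"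
    proof (rule continuous_on_compose2[OF continuous_on_davg[OF g l i, of UNIV]])
      have "continuous_on (UNIV \<times> cbox 0 1) (\<lambda>p :: real \<times> real. y(i := fst p))"
      proof (rule continuous_on_coordinatewise_then_product)
        show "continuous_on (UNIV \<times> cbox 0 1) (\<lambda>p :: real \<times> real. (y(i := fst p)) j)" for j
          by (cases "j = i") (auto intro!: continuous_intros)
      qed
      then show "continuous_on (UNIV \<times> cbox 0 1) (\<lambda>p :: real \<times> real. (y(i := fst p), snd p))"
        by (rule continuous_on_Pair) (rule continuous_on_snd[OF continuous_on_id])
    qed (use yR in auto)
    then show "continuous_on (UNIV \<times> cbox 0 1) (\<lambda>(s, t). davg m l g i (y(i := s)) t)"
      by (simp add: case_prod_beta)
  qed auto
  then show ?thesis unfolding avg_def by simp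
qed

lemma Ck1_avg:
  assumes g: "Ck 1 (Suc m) (Rn (Suc m)) g" and l: "l < m"
  shows "Ck 1 (Suc m) (Rn (Suc m)) (avg m l g)"
proof -
  have "Ck (Suc 0) (Suc m) (Rn (Suc m)) (avg m l g)"
  proof (rule CkSucI[OF openin_Rn])
    show "continuous_on (Rn (Suc m)) (avg m l g)" by (rule continuous_on_avg[OF Ck_continuous[OF g] l])
    show "((\<lambda>t. avg m l g (z(i := t))) has_real_derivative integral (cbox 0 1) (davg m l g i z)) (at (z i))"
      if "i < Suc m" "z \<in> Rn (Suc m)" for i z
      by (rule avg_has_partial[OF g l that])
    show "Ck 0 (Suc m) (Rn (Suc m)) (\<lambda>z. integral (cbox 0 1) (davg m l g i z))" if "i < Suc m" for i
      using integral_continuous_on_param[OF continuous_on_davg[OF g l that, of "cbox 0 1"]] by simp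
  qed
  then show ?thesis by simp
qed

lemma partial_avg:
  assumes g: "Ck 1 (Suc m) (Rn (Suc m)) g" and "l < m" "i < m" "y \<in> Rn (Suc m)"
  shows "partial_deriv i (avg m l g) y = avg m l (partial_deriv i g) y"
proof -
  have "davg m l g i y = (\<lambda>t. partial_deriv i g (shear m l y t))"
    using assms(3) by (auto simp: davg_def)
  then show ?thesis
    using partial_derivI[OF avg_has_partial[OF g assms(2) _ assms(4), of i]] assms(3)
    unfolding avg_def[of m l "partial_deriv i g"] by simp
qed

text \<open>By the fundamental theorem of calculus the derivative in the averaged direction is a
  difference quotient of \<open>g\<close>. It inherits a Lipschitz bound from \<open>g\<close>
  itself, without one for the derivatives of \<open>g\<close>: this is the whole gain of
  averaging.\<close>

lemma partial_avg_same:
  assumes g: "Ck 1 (Suc m) (Rn (Suc m)) g" and l: "l < m" and y: "y \<in> Rn (Suc m)" "y m \<noteq> 0"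
  shows "partial_deriv l (avg m l g) y = (g (y(l := y l + y m)) - g y) / y m"
proof -
  have D: "((\<lambda>t. g (shear m l y t)) has_real_derivative y m * partial_deriv l g (shear m l y t)) (at t)" for t
  proof -
    have "shear m l y t \<in> Rn (Suc m)" by (rule shear_Rn[OF y(1) l])
    from Ck_has_partial[OF g _ _ this, of l] l
    have "((\<lambda>s. g ((shear m l y t)(l := s))) has_real_derivative partial_deriv l g (shear m l y t))
        (at (y l + t * y m))" by (simp add: shear_def)
    moreover have "((\<lambda>t. y l + t * y m) has_real_derivative y m) (at t)"
      by (auto intro!: derivative_eq_intros)
    ultimately have "((\<lambda>u. g ((shear m l y t)(l := y l + u * y m))) has_real_derivative
        partial_deriv l g (shear m l y t) * y m) (at t)"
      by (rule DERIV_chain2)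
    moreover have "(shear m l y t)(l := y l + u * y m) = shear m l y u" for u by (simp add: shear_def)
    ultimately show ?thesis by (simp add: mult.commute)
  qed
  have "((\<lambda>t. y m * partial_deriv l g (shear m l y t)) has_integral
      g (shear m l y 1) - g (shear m l y 0)) {0..1}"
    by (rule fundamental_theorem_of_calculus)
      (use D in \<open>auto intro: has_field_derivative_at_within simp flip: has_real_derivative_iff_has_vector_derivative\<close>)
  then have "integral {0..1} (\<lambda>t. y m * partial_deriv l g (shear m l y t)) = g (shear m l y 1) - g (shear m l y 0)"
    by (rule integral_unique)
  also have "\<dots> = g (y(l := y l + y m)) - g y" by (simp add: shear_def)
  finally have "integral {0..1} (\<lambda>t. y m * partial_deriv l g (shear m l y t)) = g (y(l := y l + y m)) - g y" .
  moreover have "integral {0..1} (\<lambda>t. y m * partial_deriv l g (shear m l y t)) = y m * avg m l (partial_deriv l g) y"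
    by (simp add: avg_def)
  ultimately show ?thesis using partial_avg[OF g l l y(1)] y(2) by (simp add: field_simps)
qed

text \<open>The smoothing parameter is frozen at \<open>h\<close>, because the constants obtained
  for the derivatives grow like the inverse of \<open>\<bar>h\<bar>\<close>. Averaging in a
  direction \<open>l < m\<close> does not leave such a slice.\<close>

definition slice_Lipschitz :: "nat \<Rightarrow> real \<Rightarrow> real \<Rightarrow> (point \<Rightarrow> real) \<Rightarrow> bool" where
  "slice_Lipschitz m h \<Lambda> g \<longleftrightarrow> (\<forall>y\<in>Rn (Suc m). \<forall>w\<in>Rn (Suc m). y m = h \<longrightarrow> w m = h \<longrightarrow>
     \<bar>g y - g w\<bar> \<le> \<Lambda> * (\<Sum>j<m. \<bar>y j - w j\<bar>))"

lemma slice_Lipschitz_avg: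
  assumes g: "continuous_on (Rn (Suc m)) g" and l: "l < m" and L: "slice_Lipschitz m h \<Lambda> g"
  shows "slice_Lipschitz m h \<Lambda> (avg m l g)"
  unfolding slice_Lipschitz_def
proof (intro ballI impI)
  fix y w assume yw: "y \<in> Rn (Suc m)" "w \<in> Rn (Suc m)" "y m = h" "w m = h"
  have *: "\<bar>g (shear m l y t) - g (shear m l w t)\<bar> \<le> \<Lambda> * (\<Sum>j<m. \<bar>y j - w j\<bar>)" for t
  proof -
    have "\<bar>g (shear m l y t) - g (shear m l w t)\<bar> \<le> \<Lambda> * (\<Sum>j<m. \<bar>shear m l y t j - shear m l w t j\<bar>)"
    proof -
      have "shear m l y t m = h" "shear m l w t m = h" using yw l by (auto simp: shear_def)
      then show ?thesis
        using L shear_Rn[OF yw(1) l, of t] shear_Rn[OF yw(2) l, of t]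
        unfolding slice_Lipschitz_def by blast
    qed
    also have "(\<Sum>j<m. \<bar>shear m l y t j - shear m l w t j\<bar>) = (\<Sum>j<m. \<bar>y j - w j\<bar>)"
      by (intro sum.cong refl) (auto simp: shear_def yw)
    finally show ?thesis .
  qed
  have "avg m l g y - avg m l g w = integral (cbox 0 1) (\<lambda>t. g (shear m l y t) - g (shear m l w t))"
    unfolding avg_def by (rule integral_diff[symmetric]) (intro integrable_shear g l yw)+
  also have "norm \<dots> \<le> integral (cbox 0 1) (\<lambda>t::real. \<Lambda> * (\<Sum>j<m. \<bar>y j - w j\<bar>))"
    by (rule integral_norm_bound_integral[OF Henstock_Kurzweil_Integration.integrable_diff
          [OF integrable_shear[OF g l yw(1)] integrable_shear[OF g l yw(2)]] integrable_const])
      (use * in simp)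
  finally show "\<bar>avg m l g y - avg m l g w\<bar> \<le> \<Lambda> * (\<Sum>j<m. \<bar>y j - w j\<bar>)" by simp
qed

text \<open>One averaging per direction. Later averages commute with the derivatives in earlier
  directions (\<open>partial_avg\<close>), so a Lipschitz bound once gained is kept. For
  \<open>y m = 0\<close> the average is over a single point, and \<open>F\<close> is
  recovered.\<close>

lemma smoothing_family_C1:
  assumes F: "Ck 1 m (Rn m) F" and L: "\<And>z w. z \<in> Rn m \<Longrightarrow> w \<in> Rn m \<Longrightarrow> \<bar>F z - F w\<bar> \<le> \<Lambda> * (\<Sum>j<m. \<bar>z j - w j\<bar>)"
    and l: "l \<le> m"
  shows "\<exists>g. Ck 1 (Suc m) (Rn (Suc m)) g \<and> (\<forall>y\<in>Rn (Suc m). y m = 0 \<longrightarrow> g y = F y) \<and>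
    (\<forall>h. slice_Lipschitz m h \<Lambda> g) \<and>
    (\<forall>h j. h \<noteq> 0 \<longrightarrow> j < l \<longrightarrow> (\<exists>\<Lambda>'. slice_Lipschitz m h \<Lambda>' (partial_deriv j g)))"
  using l
proof (induction l)
  case 0
  define g where "g y = F (first_coords m y)" for y
  have fc: "first_coords m y \<in> Rn m" for y by (auto simp: first_coords_def Rn_def)
  have "Ck 1 (Suc m) (Rn (Suc m)) g"
    unfolding g_def
  proof (rule Ck_compose[OF openin_Rn openin_Rn fc _ F])
    fix j assume "j < m"
    then have "(\<lambda>w. first_coords m w j) = (\<lambda>w. w j)" by (simp add: first_coords_def)
    then show "Ck 1 (Suc m) (Rn (Suc m)) (\<lambda>w. first_coords m w j)" using Ck_coord[OF openin_Rn] by simp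
  qed
  moreover have "g y = F y" if "y \<in> Rn (Suc m)" "y m = 0" for y
  proof -
    have "first_coords m y i = y i" for i
      using that by (cases "i < m"; cases "i = m") (auto simp: first_coords_def Rn_def)
    then have "first_coords m y = y" by auto
    then show ?thesis by (simp add: g_def)
  qed
  moreover have "slice_Lipschitz m h \<Lambda> g" for h
    unfolding slice_Lipschitz_def g_def
  proof (intro ballI impI)
    fix y w
    have "\<bar>F (first_coords m y) - F (first_coords m w)\<bar> \<le> \<Lambda> * (\<Sum>j<m. \<bar>first_coords m y j - first_coords m w j\<bar>)"
      by (rule L[OF fc fc])
    then show "\<bar>F (first_coords m y) - F (first_coords m w)\<bar> \<le> \<Lambda> * (\<Sum>j<m. \<bar>y j - w j\<bar>)"
      by (simp add: first_coords_def)
  qed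
  ultimately show ?case by blast
next
  case (Suc l)
  then obtain g where g: "Ck 1 (Suc m) (Rn (Suc m)) g" "\<And>y. y \<in> Rn (Suc m) \<Longrightarrow> y m = 0 \<Longrightarrow> g y = F y"
    "\<And>h. slice_Lipschitz m h \<Lambda> g"
    "\<And>h j. h \<noteq> 0 \<Longrightarrow> j < l \<Longrightarrow> \<exists>\<Lambda>'. slice_Lipschitz m h \<Lambda>' (partial_deriv j g)"
    by auto
  have l: "l < m" using Suc by simp
  have "\<exists>\<Lambda>'. slice_Lipschitz m h \<Lambda>' (partial_deriv j (avg m l g))" if h: "h \<noteq> 0" and j: "j < Suc l" for h j
  proof (cases "j = l")
    case True
    show ?thesis
    proof (intro exI[of _ "2 * \<bar>\<Lambda>\<bar> / \<bar>h\<bar>"], unfold slice_Lipschitz_def, intro ballI impI)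
      fix y w assume yw: "y \<in> Rn (Suc m)" "w \<in> Rn (Suc m)" "y m = h" "w m = h"
      let ?s = "\<Sum>j<m. \<bar>y j - w j\<bar>"
      have s: "?s \<ge> 0" by (intro sum_nonneg) auto
      have a: "\<bar>g y - g w\<bar> \<le> \<bar>\<Lambda>\<bar> * ?s"
        using g(3)[of h] yw mult_right_mono[OF abs_ge_self[of \<Lambda>] s] unfolding slice_Lipschitz_def by fastforce
      let ?y = "y(l := y l + h)" and ?w = "w(l := w l + h)"
      have "?y \<in> Rn (Suc m)" "?w \<in> Rn (Suc m)" "?y m = h" "?w m = h" using yw l by (auto simp: Rn_upd)
      then have "\<bar>g ?y - g ?w\<bar> \<le> \<Lambda> * (\<Sum>j<m. \<bar>?y j - ?w j\<bar>)" using g(3)[of h] unfolding slice_Lipschitz_def by blast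
      also have "(\<Sum>j<m. \<bar>?y j - ?w j\<bar>) = ?s" by (intro sum.cong) auto
      also have "\<Lambda> * ?s \<le> \<bar>\<Lambda>\<bar> * ?s" using s by (intro mult_right_mono) auto
      finally have b: "\<bar>g ?y - g ?w\<bar> \<le> \<bar>\<Lambda>\<bar> * ?s" .
      have "partial_deriv j (avg m l g) y - partial_deriv j (avg m l g) w = ((g ?y - g ?w) - (g y - g w)) / h"
        using partial_avg_same[OF g(1) l yw(1)] partial_avg_same[OF g(1) l yw(2)] yw h True
        by (simp add: diff_divide_distrib)
      then have "\<bar>partial_deriv j (avg m l g) y - partial_deriv j (avg m l g) w\<bar> = \<bar>(g ?y - g ?w) - (g y - g w)\<bar> / \<bar>h\<bar>"
        by simp
      also have "\<dots> \<le> (2 * \<bar>\<Lambda>\<bar> * ?s) / \<bar>h\<bar>" using a b by (intro divide_right_mono) linarith+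
      finally show "\<bar>partial_deriv j (avg m l g) y - partial_deriv j (avg m l g) w\<bar> \<le> 2 * \<bar>\<Lambda>\<bar> / \<bar>h\<bar> * ?s" by simp
    qed
  next
    case False
    then have jl: "j < l" using j by simp
    then have jm: "j < m" using l by simp
    obtain \<Lambda>' where "slice_Lipschitz m h \<Lambda>' (partial_deriv j g)" using g(4)[OF h jl] by blast
    moreover have "continuous_on (Rn (Suc m)) (partial_deriv j g)" using g(1) jm by simp
    ultimately have "slice_Lipschitz m h \<Lambda>' (avg m l (partial_deriv j g))" using slice_Lipschitz_avg l by blast
    then show ?thesis unfolding slice_Lipschitz_def using partial_avg[OF g(1) l jm] by (intro exI[of _ \<Lambda>']) simp
  qed
  moreover have "avg m l g y = F y" if "y \<in> Rn (Suc m)" "y m = 0" for y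
    using g(2)[OF that] that(2) by (simp add: avg_def shear_def)
  ultimately show ?case
    using Ck1_avg[OF g(1) l] slice_Lipschitz_avg[OF Ck_continuous[OF g(1)] l g(3)] by blast
qed


lemma first_coords_Rn: "first_coords m y \<in> Rn m"
  by (auto simp: first_coords_def Rn_def)

lemma Ck_compose_first_coords:
  assumes U: "openin (Euclidean_space n) U" and V: "openin (Euclidean_space m) V"
    and "\<And>y. y \<in> U \<Longrightarrow> first_coords m y \<in> V" and f: "Ck k m V f"
  shows "Ck k n U (\<lambda>y. f (first_coords m y))"
proof (rule Ck_compose[OF U V _ _ f])
  fix j assume "j < m"
  then have "(\<lambda>w. first_coords m w j) = (\<lambda>w. w j)" by (simp add: first_coords_def)
  then show "Ck k n U (\<lambda>w. first_coords m w j)" using Ck_coord[OF U] by simp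
qed (use assms in auto)

lemma partial_compose_first_coords:
  assumes "j < m" shows "partial_deriv j (\<lambda>y. f (first_coords m y)) y = partial_deriv j f (first_coords m y)"
proof -
  have "first_coords m (y(j := t)) = (first_coords m y)(j := t)" for t
    using assms by (auto simp: first_coords_def)
  moreover have "first_coords m y j = y j" using assms by (simp add: first_coords_def)
  ultimately show ?thesis unfolding partial_deriv_def by simp
qed

text \<open>Lipschitz continuous first derivatives are all that \<open>generic_affine\<close> requires.  A function of
  class $C^2$ has them anyway, so that averaging is only needed for $r = 1$.\<close>

lemma smoothing_family:
  assumes r: "1 \<le> r" and F: "\<And>k. enat k \<le> r \<Longrightarrow> Ck k m (Rn m) F" and Q: "compact Q" "Q \<subseteq> Rn m"
    and 0: "\<And>z. z \<in> Rn m \<Longrightarrow> z \<notin> Q \<Longrightarrow> F z = 0"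
  shows "\<exists>g. (\<forall>k. enat k \<le> r \<longrightarrow> Ck k (Suc m) (Rn (Suc m)) g) \<and>
    (\<forall>y\<in>Rn (Suc m). y m = 0 \<longrightarrow> g y = F y) \<and>
    (\<forall>h. h \<noteq> 0 \<longrightarrow> (\<exists>\<Lambda>. slice_Lipschitz m h \<Lambda> g) \<and> (\<forall>j<m. \<exists>\<Lambda>. slice_Lipschitz m h \<Lambda> (partial_deriv j g)))"
proof (cases "enat 2 \<le> r")
  case False
  have F1: "Ck 1 m (Rn m) F" using F[of 1] r by (simp add: one_enat_def)
  obtain \<Lambda> where "\<Lambda> \<ge> 0" and L: "\<And>z w. z \<in> Rn m \<Longrightarrow> w \<in> Rn m \<Longrightarrow> \<bar>F z - F w\<bar> \<le> \<Lambda> * (\<Sum>j<m. \<bar>z j - w j\<bar>)"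
    by (rule compact_support_Lipschitz[OF F1 Q]) (erule (1) 0, rule that)
  have k: "k \<le> 1" if "enat k \<le> r" for k
  proof (rule ccontr)
    assume "\<not> k \<le> 1"
    then have "enat 2 \<le> enat k" by simp
    then show False using that False order_trans by blast
  qed
  obtain g where g: "Ck 1 (Suc m) (Rn (Suc m)) g" "\<forall>y\<in>Rn (Suc m). y m = 0 \<longrightarrow> g y = F y"
      "\<forall>h. slice_Lipschitz m h \<Lambda> g"
      "\<forall>h j. h \<noteq> 0 \<longrightarrow> j < m \<longrightarrow> (\<exists>\<Lambda>'. slice_Lipschitz m h \<Lambda>' (partial_deriv j g))"
    using smoothing_family_C1[OF F1 L order_refl] by blast
  have "Ck k (Suc m) (Rn (Suc m)) g" if "enat k \<le> r" for k
    using Ck_mono[OF g(1) k[OF that]] .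
  then show ?thesis using g(2-4) by blast
next
  case True
  let ?g = "\<lambda>y. F (first_coords m y)"
  have lip: "\<exists>\<Lambda>. slice_Lipschitz m h \<Lambda> (\<lambda>y. f (first_coords m y))"
    if f: "Ck 1 m (Rn m) f" "\<And>z. z \<in> Rn m \<Longrightarrow> z \<notin> Q \<Longrightarrow> f z = 0" for f h
  proof -
    obtain \<Lambda> where "\<Lambda> \<ge> 0" and L: "\<And>z w. z \<in> Rn m \<Longrightarrow> w \<in> Rn m \<Longrightarrow> \<bar>f z - f w\<bar> \<le> \<Lambda> * (\<Sum>j<m. \<bar>z j - w j\<bar>)"
      by (rule compact_support_Lipschitz[OF f(1) Q]) (erule (1) f(2), rule that)
    have "\<bar>f (first_coords m y) - f (first_coords m w)\<bar> \<le> \<Lambda> * (\<Sum>j<m. \<bar>y j - w j\<bar>)" for y w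
      using L[OF first_coords_Rn[of m y] first_coords_Rn[of m w]] by (simp add: first_coords_def)
    then show ?thesis unfolding slice_Lipschitz_def by blast
  qed
  show ?thesis
  proof (intro exI[of _ ?g] conjI allI impI ballI)
    show "Ck k (Suc m) (Rn (Suc m)) ?g" if "enat k \<le> r" for k
      by (rule Ck_compose_first_coords[OF openin_Rn openin_Rn first_coords_Rn F[OF that]])
    show "F (first_coords m y) = F y" if "y \<in> Rn (Suc m)" "y m = 0" for y
    proof -
      have "first_coords m y i = y i" for i
        using that by (cases "i < m"; cases "i = m") (auto simp: first_coords_def Rn_def)
      then have "first_coords m y = y" by auto
      then show ?thesis by simp
    qed
    show "\<exists>\<Lambda>. slice_Lipschitz m h \<Lambda> ?g" for h
      by (rule lip[OF _ 0]) (use F[of 1] r in \<open>auto simp: one_enat_def\<close>)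
    show "\<exists>\<Lambda>. slice_Lipschitz m h \<Lambda> (partial_deriv j ?g)" if j: "j < m" for h j
    proof -
      have "Ck 2 m (Rn m) F" using F True by blast
      then have "Ck 1 m (Rn m) (partial_deriv j F)"
        using Ck_partial[of 1 m "Rn m" F j] j by (simp add: numeral_2_eq_2)
      from lip[OF this partial_zero_outside[OF Q(1) 0 _ _ j]]
      show ?thesis unfolding partial_compose_first_coords[OF j, abs_def] by blast
    qed
  qed
qed

section \<open>Charts and the leaf topology\<close>


lemma is_chartD:
  assumes "is_chart X n (U, \<theta>)"
  shows chart_openin: "openin X U" and chart_image_openin: "openin (Euclidean_space n) (\<theta> ` U)"
    and chart_inj: "inj_on \<theta> U"
    and chart_continuous: "continuous_map (subtopology X U) (Euclidean_space n) \<theta>"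
    and chart_inv_continuous: "continuous_map (subtopology (Euclidean_space n) (\<theta> ` U)) X (inv_into U \<theta>)"
proof -
  have h: "openin X U" "openin (Euclidean_space n) (\<theta> ` U)"
    "homeomorphic_map (subtopology X U) (subtopology (Euclidean_space n) (\<theta> ` U)) \<theta>"
    using assms unfolding is_chart_def by auto
  have tU: "topspace (subtopology X U) = U" 
    using openin_subset[OF h(1)] by (rule topspace_subtopology_subset)
  show "openin X U" "openin (Euclidean_space n) (\<theta> ` U)" using h by auto
  show inj: "inj_on \<theta> U" using h(3) tU unfolding homeomorphic_map_def by auto
  show "continuous_map (subtopology X U) (Euclidean_space n) \<theta>"
    using homeomorphic_imp_continuous_map[OF h(3)] continuous_map_into_fulltopology by blast
  obtain g where g: "homeomorphic_maps (subtopology X U) (subtopology (Euclidean_space n) (\<theta> ` U)) \<theta> g"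
    using h(3) homeomorphic_map_maps by blast
  then have "continuous_map (subtopology (Euclidean_space n) (\<theta> ` U)) (subtopology X U) g"
    "\<And>x. x \<in> U \<Longrightarrow> g (\<theta> x) = x"
    using tU unfolding homeomorphic_maps_def by auto
  then have "continuous_map (subtopology (Euclidean_space n) (\<theta> ` U)) (subtopology X U) (inv_into U \<theta>)"
    by (elim continuous_map_eq) (auto simp: inj)
  then show "continuous_map (subtopology (Euclidean_space n) (\<theta> ` U)) X (inv_into U \<theta>)"
    using continuous_map_into_fulltopology by blast
qed

lemma chart_image_open:
  assumes c: "is_chart X n (U, \<theta>)" and W: "openin X W" "W \<subseteq> U"
  shows "openin (Euclidean_space n) (\<theta> ` W)"
proof -
  have "openin (subtopology (Euclidean_space n) (\<theta> ` U)) {z \<in> topspace (subtopology (Euclidean_space n) (\<theta> ` U)). inv_into U \<theta> z \<in> W}"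
    by (rule openin_continuous_map_preimage[OF chart_inv_continuous[OF c] W(1)])
  then have "openin (Euclidean_space n) {z \<in> topspace (subtopology (Euclidean_space n) (\<theta> ` U)). inv_into U \<theta> z \<in> W}"
    using openin_trans_full chart_image_openin[OF c] by blast
  moreover have "{z \<in> topspace (subtopology (Euclidean_space n) (\<theta> ` U)). inv_into U \<theta> z \<in> W} = \<theta> ` W"
    using chart_inj[OF c] W(2) open_Rn_subset[OF chart_image_openin[OF c]] by (auto simp: subset_iff)
  ultimately show ?thesis by simp
qed

lemma chart_preimage_open:
  assumes c: "is_chart X n (U, \<theta>)" and W: "openin (Euclidean_space n) W"
  shows "openin X {x \<in> U. \<theta> x \<in> W}"
proof -
  have "openin (subtopology X U) {x \<in> topspace (subtopology X U). \<theta> x \<in> W}"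
    by (rule openin_continuous_map_preimage[OF chart_continuous[OF c] W])
  then have "openin X {x \<in> topspace (subtopology X U). \<theta> x \<in> W}"
    using openin_trans_full chart_openin[OF c] by blast
  moreover have "{x \<in> topspace (subtopology X U). \<theta> x \<in> W} = {x \<in> U. \<theta> x \<in> W}"
    using openin_subset[OF chart_openin[OF c]] by auto
  ultimately show ?thesis by simp
qed

lemma atlas_is_chart:
  assumes "Cr_manifold r M" "(U, \<theta>) \<in> atlas M"
  shows "is_chart (base_space M) (mdim M) (U, \<theta>)"
proof -
  have "\<forall>c\<in>atlas M. is_chart (base_space M) (mdim M) c"
    using assms(1)[unfolded Cr_manifold_def] by (elim conjE)
  then show ?thesis using assms(2) by blast
qed

lemma atlas_cover:
  assumes "Cr_manifold r M" "x \<in> topspace (base_space M)"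
  obtains U \<theta> where "(U, \<theta>) \<in> atlas M" "x \<in> U"
proof -
  have "\<Union> (fst ` atlas M) = topspace (base_space M)"
    using assms(1) by (simp only: Cr_manifold_def)
  then have "x \<in> \<Union> (fst ` atlas M)" using assms(2) by simp
  then obtain c where "c \<in> atlas M" "x \<in> fst c" by blast
  then show ?thesis using that[of "fst c" "snd c"] by simp
qed

lemma transition_Ck:
  assumes M: "Cr_manifold r M" and c: "(U, \<theta>) \<in> atlas M" "(U1, \<theta>1) \<in> atlas M"
    and k: "enat k \<le> r" and j: "j < mdim M"
  shows "Ck k (mdim M) (\<theta> ` (U \<inter> U1)) (\<lambda>z. \<theta>1 (inv_into U \<theta> z) j)"
proof -
  have "Cr_compatible r (mdim M) (U, \<theta>) (U1, \<theta>1)"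
    using M c unfolding Cr_manifold_def by blast
  then have "Cr_on r (mdim M) (mdim M) (\<theta> ` (U \<inter> U1)) (\<theta>1 \<circ> inv_into U \<theta>)"
    by (simp add: Cr_compatible_def)
  moreover have "\<theta> ` (U \<inter> U1) \<subseteq> Rn (mdim M)"
    using open_Rn_subset[OF chart_image_openin[OF atlas_is_chart[OF M c(1)]]] by auto
  ultimately show ?thesis using Cr_on_iff k j by (fastforce simp: o_def)
qed

lemma transition_openin:
  assumes M: "Cr_manifold r M" and c: "(U, \<theta>) \<in> atlas M" "(U1, \<theta>1) \<in> atlas M"
  shows "openin (Euclidean_space (mdim M)) (\<theta> ` (U \<inter> U1))"
  using chart_image_open[OF atlas_is_chart[OF M c(1)]] chart_openin[OF atlas_is_chart[OF M c(1)]]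
    chart_openin[OF atlas_is_chart[OF M c(2)]] by (simp add: openin_Int)

lemma Cr_map_dom_openin:
  assumes M: "Cr_manifold r M" and N: "Cr_manifold r N" and f: "Cr_map s M N f"
    and c: "(U, \<theta>) \<in> atlas M" "(U', \<theta>') \<in> atlas N"
  shows "openin (base_space M) {x \<in> U. f x \<in> U'}"
    "openin (Euclidean_space (mdim M)) (\<theta> ` {x \<in> U. f x \<in> U'})"
proof -
  show "openin (base_space M) {x \<in> U. f x \<in> U'}"
    using openin_continuous_map_preimage_gen[of "base_space M" "base_space N" f U U'] f
      chart_openin[OF atlas_is_chart[OF M c(1)]] chart_openin[OF atlas_is_chart[OF N c(2)]]
    unfolding Cr_map_def by blast
  then show "openin (Euclidean_space (mdim M)) (\<theta> ` {x \<in> U. f x \<in> U'})"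
    using chart_image_open[OF atlas_is_chart[OF M c(1)]] by auto
qed

lemma Cr_map_Ck:
  assumes M: "Cr_manifold r M" and f: "Cr_map s M N f"
    and c: "(U, \<theta>) \<in> atlas M" "(U', \<theta>') \<in> atlas N" and k: "enat k \<le> s" and j: "j < mdim N"
  shows "Ck k (mdim M) (\<theta> ` {x \<in> U. f x \<in> U'}) (\<lambda>z. \<theta>' (f (inv_into U \<theta> z)) j)"
proof -
  have "Cr_on s (mdim M) (mdim N) (\<theta> ` {x \<in> U. f x \<in> U'}) (\<theta>' \<circ> f \<circ> inv_into U \<theta>)"
    using f c unfolding Cr_map_def by fast
  moreover have "\<theta> ` {x \<in> U. f x \<in> U'} \<subseteq> Rn (mdim M)"
    using open_Rn_subset[OF chart_image_openin[OF atlas_is_chart[OF M c(1)]]] by auto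
  ultimately show ?thesis using Cr_on_iff k j by (fastforce simp: o_def)
qed

section \<open>Plaques and the leaf topology\<close>

lemma Cr_foliationD:
  assumes "Cr_foliation r M"
  shows foliation_manifold: "Cr_manifold r M" and foliation_dim: "mdim M = codim M + ldim M"
    and fcharts_atlas: "fcharts M \<subseteq> atlas M"
    and fcharts_plaque: "\<And>c c'. c \<in> fcharts M \<Longrightarrow> c' \<in> fcharts M \<Longrightarrow> plaque_compatible M c c'"
    and fcharts_cover: "\<Union> (fst ` fcharts M) = topspace (base_space M)"
  using assms unfolding Cr_foliation_def by blast+

lemma topspace_leaf_topology:
  assumes "Cr_foliation r M" shows "topspace (leaf_topology M) = topspace (base_space M)"
proof -
  let ?S = "{W \<inter> {x \<in> fst c. local_projection M c x = t} |W c t. openin (base_space M) W \<and> c \<in> fcharts M}"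
  have "x \<in> \<Union> ?S" if x: "x \<in> topspace (base_space M)" for x
  proof -
    have "x \<in> \<Union> (fst ` fcharts M)" using x fcharts_cover[OF assms] by simp
    then obtain c where c: "c \<in> fcharts M" "x \<in> fst c" by blast
    then have "x \<in> topspace (base_space M) \<inter> {y \<in> fst c. local_projection M c y = local_projection M c x}"
      using x by simp
    moreover have "topspace (base_space M) \<inter> {y \<in> fst c. local_projection M c y = local_projection M c x} \<in> ?S"
      using c(1) openin_topspace by blast
    ultimately show ?thesis by (rule UnionI[rotated])
  qed
  moreover have "\<Union> ?S \<subseteq> topspace (base_space M)"
    using openin_subset by fast
  ultimately show ?thesis unfolding leaf_topology_def topology_generated_by_topspace by (intro equalityI) auto
qed

lemma plaque_openin_leaf:
  assumes "Cr_foliation r M" "c \<in> fcharts M"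
  shows "openin (leaf_topology M) {x \<in> fst c. local_projection M c x = t}"
proof -
  have "fst c \<subseteq> \<Union> (fst ` fcharts M)" using assms(2) by blast
  then have "fst c \<subseteq> topspace (base_space M)" unfolding fcharts_cover[OF assms(1)] .
  then have eq: "topspace (base_space M) \<inter> {x \<in> fst c. local_projection M c x = t} =
      {x \<in> fst c. local_projection M c x = t}" by auto
  have "openin (leaf_topology M) (topspace (base_space M) \<inter> {x \<in> fst c. local_projection M c x = t})"
    unfolding leaf_topology_def
    by (rule topology_generated_by_Basis) (use assms(2) openin_topspace in blast)
  then show ?thesis unfolding eq .
qed

text \<open>A continuous map that stays in one plaque is continuous for the leaf topology, because by
  plaque compatibility the other local projections are locally constant along it.\<close>

lemma continuous_map_into_plaque:
  assumes N: "Cr_foliation r N" and \<gamma>: "continuous_map T (base_space N) \<gamma>" and c: "c \<in> fcharts N"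
    and pl: "\<And>t. t \<in> topspace T \<Longrightarrow> \<gamma> t \<in> fst c \<and> local_projection N c (\<gamma> t) = p"
  shows "continuous_map T (leaf_topology N) \<gamma>"
  unfolding leaf_topology_def continuous_on_generated_topo_iff
proof (intro conjI allI impI)
  fix S assume "S \<in> {W \<inter> {x \<in> fst c. local_projection N c x = t} |W c t. openin (base_space N) W \<and> c \<in> fcharts N}"
  then obtain W c' t where S: "S = W \<inter> {x \<in> fst c'. local_projection N c' x = t}"
    and W: "openin (base_space N) W" and c': "c' \<in> fcharts N" by blast
  show "openin T (\<gamma> -` S \<inter> topspace T)"
  proof (subst openin_subopen, intro ballI)
    fix s assume s: "s \<in> \<gamma> -` S \<inter> topspace T"
    then have "\<gamma> s \<in> fst c \<inter> fst c'" using pl S by auto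
    then obtain V where V: "openin (base_space N) V" "\<gamma> s \<in> V" "V \<subseteq> fst c \<inter> fst c'"
      "\<And>y z. y \<in> V \<Longrightarrow> z \<in> V \<Longrightarrow> local_projection N c y = local_projection N c z \<Longrightarrow>
           local_projection N c' y = local_projection N c' z"
      using fcharts_plaque[OF N c c', unfolded plaque_compatible_def, rule_format, of "\<gamma> s"] by blast
    have "openin T {u \<in> topspace T. \<gamma> u \<in> V \<inter> W}"
      by (rule openin_continuous_map_preimage[OF \<gamma> openin_Int[OF V(1) W]])
    moreover have "{u \<in> topspace T. \<gamma> u \<in> V \<inter> W} \<subseteq> \<gamma> -` S \<inter> topspace T"
    proof (rule subsetI)
      fix u assume "u \<in> {u \<in> topspace T. \<gamma> u \<in> V \<inter> W}"
      then have u: "u \<in> topspace T" "\<gamma> u \<in> V" "\<gamma> u \<in> W" by auto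
      have "local_projection N c' (\<gamma> u) = local_projection N c' (\<gamma> s)"
        using V(4)[OF u(2) V(2)] pl[OF u(1)] pl[of s] s by simp
      moreover have "local_projection N c' (\<gamma> s) = t" using S s by simp
      moreover have "\<gamma> u \<in> fst c'" using u V(3) by blast
      ultimately show "u \<in> \<gamma> -` S \<inter> topspace T" using u by (simp add: S)
    qed
    moreover have "s \<in> {u \<in> topspace T. \<gamma> u \<in> V \<inter> W}" using s S V(2) by auto
    ultimately show "\<exists>Ta. openin T Ta \<and> s \<in> Ta \<and> Ta \<subseteq> \<gamma> -` S \<inter> topspace T" by blast
  qed
next
  have "\<gamma> ` topspace T \<subseteq> topspace (leaf_topology N)"
    unfolding topspace_leaf_topology[OF N] using \<gamma> continuous_map_image_subset_topspace by blast
  then show "\<gamma> ` topspace T \<subseteq> \<Union> {W \<inter> {x \<in> fst c. local_projection N c x = t} |W c t. openin (base_space N) W \<and> c \<in> fcharts N}"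
    unfolding leaf_topology_def topology_generated_by_topspace .
qed

text \<open>The plaques of a chart are disjoint, cover its domain and are open in the leaf topology,
  so a connected family inside the domain cannot leave its plaque.\<close>

lemma local_projection_constant:
  assumes N: "Cr_foliation r N" and c: "c \<in> fcharts N"
    and \<gamma>: "continuous_map T (leaf_topology N) \<gamma>" and T: "connected_space T"
    and U: "\<And>t. t \<in> topspace T \<Longrightarrow> \<gamma> t \<in> fst c"
    and st: "s \<in> topspace T" "t \<in> topspace T"
  shows "local_projection N c (\<gamma> s) = local_projection N c (\<gamma> t)"
proof (rule ccontr)
  assume ne: "local_projection N c (\<gamma> s) \<noteq> local_projection N c (\<gamma> t)"
  define A where "A = {u \<in> topspace T. \<gamma> u \<in> {x \<in> fst c. local_projection N c x = local_projection N c (\<gamma> s)}}"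
  define B where "B = (\<Union>p\<in>- {local_projection N c (\<gamma> s)}. {u \<in> topspace T. \<gamma> u \<in> {x \<in> fst c. local_projection N c x = p}})"
  have "openin T A" unfolding A_def
    by (rule openin_continuous_map_preimage[OF \<gamma> plaque_openin_leaf[OF N c]])
  moreover have "openin T B" unfolding B_def
    
    using openin_continuous_map_preimage[OF \<gamma> plaque_openin_leaf[OF N c]] by (intro openin_Union) blast
  moreover have "A \<inter> B = {}" unfolding A_def B_def by auto
  moreover have "topspace T \<subseteq> A \<union> B" unfolding A_def B_def using U by auto
  moreover have "s \<in> A" unfolding A_def using U st by auto
  moreover have "t \<in> B" unfolding B_def using U st ne by auto
  ultimately show False using T unfolding connected_space_def by blast
qed

section \<open>Leafwise perturbations\<close>


text \<open>Identifies pairs of a point in $R^m$ and a parameter in $R^d$ with points of $R^{m+d}$,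
  so that regularity in both together is \<open>Ck\<close> on a single space.\<close>

definition glue :: "nat \<Rightarrow> point \<Rightarrow> point \<Rightarrow> point" where
  "glue m z t = (\<lambda>i. if i < m then z i else t (i - m))"

lemma glue_Rn: "t \<in> Rn d \<Longrightarrow> glue m z t \<in> Rn (m + d)"
  by (auto simp: glue_def Rn_def)

lemma first_coords_glue: "z \<in> Rn m \<Longrightarrow> first_coords m (glue m z t) = z"
  by (auto simp: glue_def Rn_def first_coords_def fun_eq_iff)

lemma last_coords_glue: "last_coords m (glue m z t) = t"
  by (auto simp: glue_def last_coords_def)

lemma glue_first_last: "glue m (first_coords m y) (last_coords m y) = y"
  by (auto simp: glue_def last_coords_def first_coords_def)

lemma glue_upd: "i < m \<Longrightarrow> glue m (z(i := t)) u = (glue m z u)(i := t)"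
  by (auto simp: glue_def)

lemma last_coords_Rn: "y \<in> Rn (m + d) \<Longrightarrow> last_coords m y \<in> Rn d"
  by (auto simp: last_coords_def Rn_def)

lemma iter_partial_glue:
  assumes "set is \<subseteq> {..<m}"
  shows "iter_partial is (\<lambda>z. J (glue m z t)) z = iter_partial is J (glue m z t)"
  using assms
proof (induction "is" arbitrary: z)
  case (Cons i "is")
  have "partial_deriv i (iter_partial is (\<lambda>z. J (glue m z t))) z =
      partial_deriv i (\<lambda>z. iter_partial is J (glue m z t)) z"
    using Cons by (simp add: partial_deriv_def)
  also have "\<dots> = partial_deriv i (iter_partial is J) (glue m z t)"
    using Cons.prems by (simp add: partial_deriv_def glue_upd) (simp add: glue_def)
  finally show ?case by simp
qed simp

lemma continuous_map_RnI:
  assumes "\<And>i. i < n \<Longrightarrow> continuous_map T euclideanreal (\<lambda>x. f x i)"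
    and "\<And>x. x \<in> topspace T \<Longrightarrow> f x \<in> Rn n"
  shows "continuous_map T (Euclidean_space n) f"
proof -
  have "continuous_map T (Euclidean_space n) (\<lambda>x i. if i < n then f x i else 0)"
    using assms(1) continuous_map_componentwise_Euclidean_space by blast
  then show ?thesis
    by (rule continuous_map_eq) (use assms(2) in \<open>auto simp: Rn_def fun_eq_iff\<close>)
qed

lemma continuous_map_Rn_coord: "continuous_map (Euclidean_space n) euclideanreal (\<lambda>x. x i)"
  unfolding Euclidean_space_def
  by (rule continuous_map_from_subtopology) (rule continuous_map_product_projection, simp)

lemma continuous_map_coordD:
  "continuous_map T (Euclidean_space n) f \<Longrightarrow> continuous_map T euclideanreal (\<lambda>x. f x i)"
  using continuous_map_compose[OF _ continuous_map_Rn_coord] by (fastforce simp: o_def)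

lemma continuous_map_first_coords: "continuous_map (Euclidean_space n) (Euclidean_space m) (first_coords m)"
proof (rule continuous_map_RnI)
  fix i assume "i < m"
  then have "(\<lambda>x. first_coords m x i) = (\<lambda>x. x i)" by (auto simp: first_coords_def)
  then show "continuous_map (Euclidean_space n) euclideanreal (\<lambda>x. first_coords m x i)"
    using continuous_map_Rn_coord by simp
qed (rule first_coords_Rn)

lemma continuous_map_last_coords: "continuous_map (Euclidean_space (m + d)) (Euclidean_space d) (last_coords m)"
  by (rule continuous_map_RnI) (auto simp: last_coords_def[abs_def] last_coords_Rn continuous_map_Rn_coord Rn_def)

lemma continuous_map_glue:
  assumes "continuous_map T (Euclidean_space m) f" "continuous_map T (Euclidean_space d) g"
  shows "continuous_map T (Euclidean_space (m + d)) (\<lambda>x. glue m (f x) (g x))"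
proof (rule continuous_map_RnI)
  fix i
  show "continuous_map T euclideanreal (\<lambda>x. glue m (f x) (g x) i)"
    using continuous_map_coordD[OF assms(1)] continuous_map_coordD[OF assms(2)] by (simp add: glue_def)
next
  fix x assume "x \<in> topspace T"
  then have "g x \<in> Rn d" using continuous_map_image_subset_topspace[OF assms(2)] by auto
  then show "glue m (f x) (g x) \<in> Rn (m + d)" by (rule glue_Rn)
qed

definition cube :: "nat \<Rightarrow> real \<Rightarrow> point set" where
  "cube d e = box_nbhd d (\<lambda>_. 0) e"

lemma openin_cube: "openin (Euclidean_space d) (cube d e)"
  unfolding cube_def by (rule openin_box_nbhd)

lemma cube_iff: "t \<in> cube d e \<longleftrightarrow> t \<in> Rn d \<and> (\<forall>i<d. \<bar>t i\<bar> < e)"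
  by (simp add: cube_def box_nbhd_def)

lemma zero_in_cube: "e > 0 \<Longrightarrow> (\<lambda>_. 0) \<in> cube d e"
  by (auto simp: cube_iff Rn_def)

lemma cube_mono: "e \<le> e' \<Longrightarrow> cube d e \<subseteq> cube d e'"
  unfolding subset_iff cube_iff by (meson less_le_trans)

lemma cube_scale:
  assumes t: "t \<in> cube d e" and s: "s \<in> {0..1::real}"
  shows "(\<lambda>i. s * t i) \<in> cube d e"
proof -
  have "\<bar>s * t i\<bar> < e" if "i < d" for i
  proof -
    have "\<bar>s * t i\<bar> \<le> \<bar>t i\<bar>" using s by (auto simp: abs_mult intro: mult_left_le_one_le)
    then show ?thesis using t that by (auto simp: cube_iff)
  qed
  then show ?thesis using t by (auto simp: cube_iff Rn_def)
qed

text \<open>Cubes form a neighbourhood base at the parameter 0; \<open>e' \<le> e\<close> keeps the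
  result within the given parameter space.\<close>

lemma tube_cube:
  assumes W: "openin (prod_topology X (subtopology (Euclidean_space d) (cube d e))) W"
    and K: "compactin X K" "K \<times> {\<lambda>_. 0} \<subseteq> W" and e: "e > 0"
  shows "\<exists>e'>0. e' \<le> e \<and> K \<times> cube d e' \<subseteq> W"
proof -
  let ?T = "subtopology (Euclidean_space d) (cube d e)"
  have "(\<lambda>_. 0) \<in> topspace ?T" using zero_in_cube[OF e] by (auto simp: cube_iff)
  from tube_lemma_left[OF W K(1) this K(2)] obtain U V where
    UV: "openin ?T V" "K \<subseteq> U" "(\<lambda>_. 0) \<in> V" "U \<times> V \<subseteq> W" by blast
  have "openin (Euclidean_space d) V" using UV(1) openin_cube openin_trans_full by blast
  then obtain e' where e': "e' > 0" "box_nbhd d (\<lambda>_. 0) e' \<subseteq> V" using open_contains_box UV(3) by blast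
  have "cube d (min e e') \<subseteq> V" using e'(2) cube_mono[of "min e e'" e' d] by (auto simp: cube_def)
  then show ?thesis using UV e e' by (intro exI[of _ "min e e'"]) auto
qed

text \<open>A family of perturbations of \<open>\<phi>\<close> along the plaques of one chart, with parameters \<open>t\<close> in \<open>cube d \<delta>\<close>.
  The parameters are the last \<open>d\<close> coordinates of the argument of \<open>G\<close>: as the family is jointly of
  class $C^r$, all smallness conditions on \<open>t\<close> follow from compactness by the tube lemma.\<close>

locale leafwise_perturbation =
  fixes r :: enat and M :: "'a foliated" and N :: "'b foliated" and \<phi> :: "'a \<Rightarrow> 'b"
    and U \<theta> U' \<theta>' Q and G :: "point \<Rightarrow> point" and d :: nat and \<delta> :: real
  assumes MF: "Cr_foliation r M" and NF: "Cr_foliation r N"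
    and \<phi>: "\<phi> \<in> foliation_maps r M N"
    and c: "(U, \<theta>) \<in> atlas M" and c': "(U', \<theta>') \<in> fcharts N"
    and Q: "compactin (base_space M) Q" "Q \<subseteq> {x \<in> U. \<phi> x \<in> U'}"
    and \<delta>: "\<delta> > 0"
    and G_Ck: "\<And>k j. enat k \<le> r \<Longrightarrow> j < mdim N \<Longrightarrow> Ck k (mdim M + d)
      {y \<in> Rn (mdim M + d). first_coords (mdim M) y \<in> \<theta> ` {x \<in> U. \<phi> x \<in> U'} \<and> last_coords (mdim M) y \<in> cube d \<delta>}
      (\<lambda>y. G y j)"
    and G_supp: "\<And>y j. first_coords (mdim M) y \<in> \<theta> ` {x \<in> U. \<phi> x \<in> U'} \<Longrightarrow>
      first_coords (mdim M) y \<notin> \<theta> ` Q \<Longrightarrow> G y j = 0"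
    and G_0: "\<And>y j. y \<in> Rn (mdim M + d) \<Longrightarrow> last_coords (mdim M) y = (\<lambda>_. 0) \<Longrightarrow> G y j = 0"
    and G_q: "\<And>y j. j < codim N \<Longrightarrow> G y j = 0"
    and G_range: "\<And>y. y \<in> Rn (mdim M + d) \<Longrightarrow> first_coords (mdim M) y \<in> \<theta> ` {x \<in> U. \<phi> x \<in> U'} \<Longrightarrow>
      last_coords (mdim M) y \<in> cube d \<delta> \<Longrightarrow>
      (\<lambda>j. \<theta>' (\<phi> (inv_into U \<theta> (first_coords (mdim M) y))) j + G y j) \<in> \<theta>' ` U'"
begin

abbreviation "m \<equiv> mdim M"
abbreviation "n \<equiv> mdim N"
abbreviation "Dm \<equiv> {x \<in> U. \<phi> x \<in> U'}"
abbreviation "Y \<equiv> {y \<in> Rn (m + d). first_coords m y \<in> \<theta> ` Dm \<and> last_coords m y \<in> cube d \<delta>}"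

section \<open>The perturbed maps and their joint continuity\<close>

definition P :: "point \<Rightarrow> point" where
  "P y = (\<lambda>j. \<theta>' (\<phi> (inv_into U \<theta> (first_coords m y))) j + G y j)"

text \<open>The case distinction is on the compact set \<open>Q\<close> and not on the open set
  \<open>Dm\<close>: the complement of \<open>Q\<close> is open, and on \<open>Dm\<close> minus
  \<open>Q\<close> both formulas agree because \<open>G\<close> vanishes there.\<close>

definition \<psi> :: "point \<Rightarrow> 'a \<Rightarrow> 'b" where
  "\<psi> t x = (if x \<in> Q then inv_into U' \<theta>' (P (glue m (\<theta> x) t)) else \<phi> x)"

definition PX where "PX = prod_topology (base_space M) (subtopology (Euclidean_space d) (cube d \<delta>))"

lemma MM: "Cr_manifold r M" and NM: "Cr_manifold r N" and c'a: "(U', \<theta>') \<in> atlas N"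
  using foliation_manifold[OF MF] foliation_manifold[OF NF] fcharts_atlas[OF NF] c' by auto

lemma \<phi>_map: "Cr_map r M N \<phi>" and \<phi>_cont: "continuous_map (base_space M) (base_space N) \<phi>"
  using \<phi> by (auto simp: foliation_maps_def Cr_map_def)

lemmas chart_c = atlas_is_chart[OF MM c]
lemmas chart_c' = atlas_is_chart[OF NM c'a]

lemma Dm_open: "openin (base_space M) Dm" and \<Omega>_open: "openin (Euclidean_space m) (\<theta> ` Dm)"
  using Cr_map_dom_openin[OF MM NM \<phi>_map c c'a] by auto

lemma \<theta>_Rn: "x \<in> U \<Longrightarrow> \<theta> x \<in> Rn m" and \<theta>'_Rn: "y \<in> U' \<Longrightarrow> \<theta>' y \<in> Rn n"
  using open_Rn_subset[OF chart_image_openin[OF chart_c]] open_Rn_subset[OF chart_image_openin[OF chart_c']] by auto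

lemma U_top: "U \<subseteq> topspace (base_space M)"
  using openin_subset[OF chart_openin[OF chart_c]] .

lemma inv_\<theta>: "x \<in> U \<Longrightarrow> inv_into U \<theta> (\<theta> x) = x"
  using chart_inj[OF chart_c] by simp

lemma Y_open: "openin (Euclidean_space (m + d)) Y"
proof -
  have "openin (Euclidean_space (m + d)) {y \<in> topspace (Euclidean_space (m + d)). first_coords m y \<in> \<theta> ` Dm}"
    by (rule openin_continuous_map_preimage[OF continuous_map_first_coords \<Omega>_open])
  moreover have "openin (Euclidean_space (m + d)) {y \<in> topspace (Euclidean_space (m + d)). last_coords m y \<in> cube d \<delta>}"
    by (rule openin_continuous_map_preimage[OF continuous_map_last_coords openin_cube])
  ultimately have "openin (Euclidean_space (m + d)) ({y \<in> topspace (Euclidean_space (m + d)). first_coords m y \<in> \<theta> ` Dm}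
      \<inter> {y \<in> topspace (Euclidean_space (m + d)). last_coords m y \<in> cube d \<delta>})"
    by (rule openin_Int)
  moreover have "{y \<in> topspace (Euclidean_space (m + d)). first_coords m y \<in> \<theta> ` Dm}
      \<inter> {y \<in> topspace (Euclidean_space (m + d)). last_coords m y \<in> cube d \<delta>} = Y" by auto
  ultimately show ?thesis by simp
qed

lemma glue_Y: "x \<in> Dm \<Longrightarrow> t \<in> cube d \<delta> \<Longrightarrow> glue m (\<theta> x) t \<in> Y"
  using glue_Rn[of t d m "\<theta> x"] first_coords_glue[OF \<theta>_Rn, of x t] last_coords_glue[of m "\<theta> x" t]
  by (auto simp: cube_iff)

lemma P_range: "y \<in> Y \<Longrightarrow> P y \<in> \<theta>' ` U'"
  using G_range unfolding P_def by blast

lemma P_Ck: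
  assumes "enat k \<le> r" "j < n" shows "Ck k (m + d) Y (\<lambda>y. P y j)"
  unfolding P_def
proof (rule Ck_add[OF Y_open])
  show "Ck k (m + d) Y (\<lambda>y. \<theta>' (\<phi> (inv_into U \<theta> (first_coords m y))) j)"
    by (rule Ck_compose_first_coords[OF Y_open \<Omega>_open _ Cr_map_Ck[OF MM \<phi>_map c c'a assms]]) auto
  show "Ck k (m + d) Y (\<lambda>y. G y j)" by (rule G_Ck[OF assms])
qed

lemma P_outside: "x \<in> Dm \<Longrightarrow> x \<notin> Q \<Longrightarrow> P (glue m (\<theta> x) t) = \<theta>' (\<phi> x)"
proof -
  assume x: "x \<in> Dm" "x \<notin> Q"
  have f: "first_coords m (glue m (\<theta> x) t) = \<theta> x" by (rule first_coords_glue) (use x \<theta>_Rn in auto)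
  have "\<theta> x \<notin> \<theta> ` Q" using x Q(2) chart_inj[OF chart_c] by (auto dest: inj_onD)
  then have "G (glue m (\<theta> x) t) j = 0" for j by (intro G_supp) (use x f in auto)
  then show ?thesis using x f inv_\<theta> by (simp add: P_def)
qed

lemma P_0: "x \<in> Dm \<Longrightarrow> P (glue m (\<theta> x) (\<lambda>_. 0)) = \<theta>' (\<phi> x)"
proof -
  assume x: "x \<in> Dm"
  have f: "first_coords m (glue m (\<theta> x) (\<lambda>_. 0)) = \<theta> x" by (rule first_coords_glue) (use x \<theta>_Rn in auto)
  have "G (glue m (\<theta> x) (\<lambda>_. 0)) j = 0" for j
    by (rule G_0) (auto simp: last_coords_glue intro!: glue_Rn, auto simp: Rn_def)
  then show ?thesis using x f inv_\<theta> by (simp add: P_def)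
qed

lemma \<psi>_eq: "x \<in> Dm \<Longrightarrow> \<psi> t x = inv_into U' \<theta>' (P (glue m (\<theta> x) t))"
  using P_outside[of x t] chart_inj[OF chart_c'] by (auto simp: \<psi>_def)

lemma \<psi>_chart: "x \<in> Dm \<Longrightarrow> t \<in> cube d \<delta> \<Longrightarrow> \<psi> t x \<in> U' \<and> \<theta>' (\<psi> t x) = P (glue m (\<theta> x) t)"
  using P_range[OF glue_Y] unfolding \<psi>_eq
  by (metis (no_types, lifting) f_inv_into_f inv_into_into)

lemma \<psi>_0: "\<psi> (\<lambda>_. 0) x = \<phi> x"
  using P_0[of x] Q(2) chart_inj[OF chart_c'] by (auto simp: \<psi>_def)

lemma \<psi>_outside: "x \<notin> Q \<Longrightarrow> \<psi> t x = \<phi> x"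
  by (simp add: \<psi>_def)

lemma \<psi>_proj:
  assumes "x \<in> Dm" "t \<in> cube d \<delta>"
  shows "local_projection N (U', \<theta>') (\<psi> t x) = local_projection N (U', \<theta>') (\<phi> x)"
proof -
  have "first_coords m (glue m (\<theta> x) t) = \<theta> x" by (rule first_coords_glue) (use assms \<theta>_Rn in auto)
  then have "P (glue m (\<theta> x) t) j = \<theta>' (\<phi> x) j" if "j < codim N" for j
    using assms inv_\<theta> G_q[OF that] by (simp add: P_def)
  then show ?thesis using \<psi>_chart[OF assms] by (auto simp: local_projection_def first_coords_def)
qed

lemma topspace_PX: "topspace PX = topspace (base_space M) \<times> cube d \<delta>"
  using open_Rn_subset[OF openin_cube] by (auto simp: PX_def)

text \<open>Pasting over the open cover by \<open>Dm\<close> and the complement of \<open>Q\<close>,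
  each times the cube.\<close>

lemma \<psi>_joint_continuous: "continuous_map PX (base_space N) (\<lambda>p. \<psi> (snd p) (fst p))"
proof (rule pasting_lemma[where I = UNIV and T = "\<lambda>b. (if b then Dm else topspace (base_space M) - Q) \<times> cube d \<delta>"
      and f = "\<lambda>b p. if b then inv_into U' \<theta>' (P (glue m (\<theta> (fst p)) (snd p))) else \<phi> (fst p)"])
  have cube_open: "openin (subtopology (Euclidean_space d) (cube d \<delta>)) (cube d \<delta>)"
    using openin_open_subtopology[OF openin_cube] openin_cube by blast
  have Qc: "openin (base_space M) (topspace (base_space M) - Q)"
  proof -
    have "Hausdorff_space (base_space M)" using MM unfolding Cr_manifold_def by blast
    then show ?thesis using compactin_imp_closedin Q(1) closedin_def by blast
  qed
  show "openin PX ((if b then Dm else topspace (base_space M) - Q) \<times> cube d \<delta>)" for b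
    unfolding PX_def using Dm_open Qc cube_open by (auto simp: openin_prod_Times_iff)
  have PXsub: "continuous_map (subtopology PX (Dm \<times> cube d \<delta>)) (base_space N)
      (\<lambda>p. inv_into U' \<theta>' (P (glue m (\<theta> (fst p)) (snd p))))"
  proof -
    let ?T = "subtopology PX (Dm \<times> cube d \<delta>)"
    have tT: "topspace ?T = Dm \<times> cube d \<delta>" using topspace_PX U_top by auto
    have "continuous_map ?T (base_space M) fst"
      unfolding PX_def by (intro continuous_map_from_subtopology continuous_map_fst)
    then have "continuous_map ?T (subtopology (base_space M) U) fst"
      unfolding continuous_map_in_subtopology using tT by auto
    from continuous_map_compose[OF this chart_continuous[OF chart_c]]
    have 1: "continuous_map ?T (Euclidean_space m) (\<lambda>p. \<theta> (fst p))" by (simp add: o_def)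
    have "continuous_map PX (subtopology (Euclidean_space d) (cube d \<delta>)) snd"
      unfolding PX_def by (rule continuous_map_snd)
    then have 2: "continuous_map ?T (Euclidean_space d) snd"
      by (meson continuous_map_from_subtopology continuous_map_into_fulltopology)
    have 3: "continuous_map ?T (subtopology (Euclidean_space (m + d)) Y) (\<lambda>p. glue m (\<theta> (fst p)) (snd p))"
      unfolding continuous_map_in_subtopology using continuous_map_glue[OF 1 2] glue_Y tT by fastforce
    have PR: "P y \<in> Rn n" if "y \<in> Y" for y
      using P_range[OF that] \<theta>'_Rn by auto
    have "continuous_map (subtopology (Euclidean_space (m + d)) Y) (Euclidean_space n) P"
    proof (rule continuous_map_RnI)
      show "continuous_map (subtopology (Euclidean_space (m + d)) Y) euclideanreal (\<lambda>x. P x i)" if "i < n" for i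
        using P_Ck[of 0 i] that continuous_map_Rn[OF open_Rn_subset[OF Y_open]]
        by (simp add: zero_enat_def[symmetric])
      show "P x \<in> Rn n" if "x \<in> topspace (subtopology (Euclidean_space (m + d)) Y)" for x
        using that PR by auto
    qed
    then have 4: "continuous_map (subtopology (Euclidean_space (m + d)) Y) (subtopology (Euclidean_space n) (\<theta>' ` U')) P"
      unfolding continuous_map_in_subtopology using P_range by auto
    from continuous_map_compose[OF continuous_map_compose[OF 3 4] chart_inv_continuous[OF chart_c']]
    show ?thesis by (simp add: o_def)
  qed
  have "continuous_map PX (base_space N) (\<lambda>p. \<phi> (fst p))"
    using continuous_map_compose[OF continuous_map_fst \<phi>_cont] unfolding PX_def by (simp add: o_def)
  then show "continuous_map (subtopology PX ((if b then Dm else topspace (base_space M) - Q) \<times> cube d \<delta>))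
      (base_space N) (\<lambda>p. if b then inv_into U' \<theta>' (P (glue m (\<theta> (fst p)) (snd p))) else \<phi> (fst p))" for b
    using PXsub by (cases b) (auto intro: continuous_map_from_subtopology)
  have eq: "inv_into U' \<theta>' (P (glue m (\<theta> x) t)) = \<phi> x" if "x \<in> Dm" "x \<notin> Q" for x t
    using \<psi>_eq[OF that(1), of t] \<psi>_outside[OF that(2)] by simp
  show "(if b then inv_into U' \<theta>' (P (glue m (\<theta> (fst p)) (snd p))) else \<phi> (fst p)) =
    (if b' then inv_into U' \<theta>' (P (glue m (\<theta> (fst p)) (snd p))) else \<phi> (fst p))"
    if "p \<in> topspace PX \<inter> (if b then Dm else topspace (base_space M) - Q) \<times> cube d \<delta> \<inter>
      (if b' then Dm else topspace (base_space M) - Q) \<times> cube d \<delta>" for b b' p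
    using that eq by (cases b; cases b') auto
  show "\<exists>b. b \<in> UNIV \<and> p \<in> (if b then Dm else topspace (base_space M) - Q) \<times> cube d \<delta> \<and>
     \<psi> (snd p) (fst p) = (if b then inv_into U' \<theta>' (P (glue m (\<theta> (fst p)) (snd p))) else \<phi> (fst p))"
    if "p \<in> topspace PX" for p
  proof (cases "fst p \<in> Q")
    case True
    then show ?thesis using that Q(2) \<psi>_eq[of "fst p" "snd p"] unfolding topspace_PX
      by (intro exI[of _ True]) (auto simp: mem_Times_iff)
  next
    case False
    then show ?thesis using that \<psi>_outside[OF False] unfolding topspace_PX
      by (intro exI[of _ False]) (auto simp: mem_Times_iff)
  qed
qed

text \<open>The tube lemma around \<open>K\<close> times the parameter 0, where the perturbed map is
  \<phi>.\<close>

lemma compact_into_open: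
  assumes K: "compactin (base_space M) K" and V: "openin (base_space N) V" and KV: "\<phi> ` K \<subseteq> V"
  shows "\<exists>e>0. e \<le> \<delta> \<and> (\<forall>t\<in>cube d e. \<psi> t ` K \<subseteq> V)"
proof -
  let ?W = "{p \<in> topspace PX. \<psi> (snd p) (fst p) \<in> V}"
  have "openin PX ?W" by (rule openin_continuous_map_preimage[OF \<psi>_joint_continuous V])
  moreover have "K \<times> {\<lambda>_. 0} \<subseteq> ?W"
    using KV compactin_subset_topspace[OF K] zero_in_cube[OF \<delta>] by (auto simp: topspace_PX \<psi>_0)
  ultimately obtain e where "e > 0" "e \<le> \<delta>" "K \<times> cube d e \<subseteq> ?W"
    using tube_cube[of "base_space M" d \<delta> ?W K] K \<delta> unfolding PX_def by blast
  then show ?thesis by (intro exI[of _ e]) auto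
qed

end


section \<open>The perturbed maps in arbitrary charts\<close>

context leafwise_perturbation
begin

text \<open>A basic set of the sp-topology brings its own charts. \<open>J\<close> below is the
  perturbed map in such charts, jointly in point and parameter; \<open>Jdom\<close> is the part of
  \<open>E1\<close> where this expression makes sense.\<close>

definition E1 where
  "E1 U1 \<theta>1 = {y \<in> Rn (m + d). first_coords m y \<in> \<theta>1 ` U1 \<and> last_coords m y \<in> cube d \<delta>}"

definition Jdom where
  "Jdom U1 \<theta>1 U1' = {y \<in> E1 U1 \<theta>1. \<psi> (last_coords m y) (inv_into U1 \<theta>1 (first_coords m y)) \<in> U1'}"

definition J where
  "J U1 \<theta>1 \<theta>1' y = \<theta>1' (\<psi> (last_coords m y) (inv_into U1 \<theta>1 (first_coords m y)))"

lemma E1_open: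
  assumes c1: "(U1, \<theta>1) \<in> atlas M"
  shows "openin (Euclidean_space (m + d)) (E1 U1 \<theta>1)"
proof -
  have "openin (Euclidean_space (m + d)) {y \<in> topspace (Euclidean_space (m + d)). first_coords m y \<in> \<theta>1 ` U1}"
    by (rule openin_continuous_map_preimage[OF continuous_map_first_coords chart_image_openin[OF atlas_is_chart[OF MM c1]]])
  moreover have "openin (Euclidean_space (m + d)) {y \<in> topspace (Euclidean_space (m + d)). last_coords m y \<in> cube d \<delta>}"
    by (rule openin_continuous_map_preimage[OF continuous_map_last_coords openin_cube])
  ultimately have "openin (Euclidean_space (m + d)) ({y \<in> topspace (Euclidean_space (m + d)). first_coords m y \<in> \<theta>1 ` U1}
      \<inter> {y \<in> topspace (Euclidean_space (m + d)). last_coords m y \<in> cube d \<delta>})"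
    by (rule openin_Int)
  moreover have "{y \<in> topspace (Euclidean_space (m + d)). first_coords m y \<in> \<theta>1 ` U1}
      \<inter> {y \<in> topspace (Euclidean_space (m + d)). last_coords m y \<in> cube d \<delta>} = E1 U1 \<theta>1" by (auto simp: E1_def)
  ultimately show ?thesis by simp
qed

lemma E1_preimage_open:
  assumes c1: "(U1, \<theta>1) \<in> atlas M" and W: "openin PX W"
  shows "openin (Euclidean_space (m + d))
    {y \<in> E1 U1 \<theta>1. (inv_into U1 \<theta>1 (first_coords m y), last_coords m y) \<in> W}"
proof -
  let ?T = "subtopology (Euclidean_space (m + d)) (E1 U1 \<theta>1)"
  have tT: "topspace ?T = E1 U1 \<theta>1" using open_Rn_subset[OF E1_open[OF c1]] by auto
  have "continuous_map ?T (subtopology (Euclidean_space m) (\<theta>1 ` U1)) (first_coords m)"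
    unfolding continuous_map_in_subtopology
    using continuous_map_from_subtopology[OF continuous_map_first_coords] tT by (auto simp: E1_def)
  from continuous_map_compose[OF this chart_inv_continuous[OF atlas_is_chart[OF MM c1]]]
  have 1: "continuous_map ?T (base_space M) (\<lambda>y. inv_into U1 \<theta>1 (first_coords m y))" by (simp add: o_def)
  have 2: "continuous_map ?T (subtopology (Euclidean_space d) (cube d \<delta>)) (last_coords m)"
    unfolding continuous_map_in_subtopology
    using continuous_map_from_subtopology[OF continuous_map_last_coords] tT by (auto simp: E1_def)
  have "continuous_map ?T PX (\<lambda>y. (inv_into U1 \<theta>1 (first_coords m y), last_coords m y))"
    unfolding PX_def using 1 2 by (rule continuous_map_pairedI)
  from openin_continuous_map_preimage[OF this W] show ?thesis
    unfolding tT using openin_trans_full E1_open[OF c1] by blast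
qed

lemma E1_in_PX:
  assumes c1: "(U1, \<theta>1) \<in> atlas M" and y: "y \<in> E1 U1 \<theta>1"
  shows "inv_into U1 \<theta>1 (first_coords m y) \<in> U1" "\<theta>1 (inv_into U1 \<theta>1 (first_coords m y)) = first_coords m y"
    "(inv_into U1 \<theta>1 (first_coords m y), last_coords m y) \<in> topspace PX"
proof -
  have y1: "first_coords m y \<in> \<theta>1 ` U1" "last_coords m y \<in> cube d \<delta>" using y by (auto simp: E1_def)
  show 1: "inv_into U1 \<theta>1 (first_coords m y) \<in> U1" using y1 by (intro inv_into_into)
  show "\<theta>1 (inv_into U1 \<theta>1 (first_coords m y)) = first_coords m y" using y1 by (intro f_inv_into_f)
  show "(inv_into U1 \<theta>1 (first_coords m y), last_coords m y) \<in> topspace PX"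
    using 1 y1 openin_subset[OF chart_openin[OF atlas_is_chart[OF MM c1]]] by (auto simp: topspace_PX)
qed

lemma Jdom_open:
  assumes c1: "(U1, \<theta>1) \<in> atlas M" and c1': "(U1', \<theta>1') \<in> atlas N"
  shows "openin (Euclidean_space (m + d)) (Jdom U1 \<theta>1 U1')"
proof -
  have "openin PX {p \<in> topspace PX. \<psi> (snd p) (fst p) \<in> U1'}"
    by (rule openin_continuous_map_preimage[OF \<psi>_joint_continuous chart_openin[OF atlas_is_chart[OF NM c1']]])
  from E1_preimage_open[OF c1 this] show ?thesis
    unfolding Jdom_def using E1_in_PX(3)[OF c1] by (elim back_subst) auto
qed

text \<open>A local statement. Near a point of \<open>Q\<close> the expression passes through the
  charts of the locale and two transition maps; off \<open>Q\<close> it is that of \<phi> and does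
  not involve the parameter.\<close>

lemma J_Ck:
  assumes c1: "(U1, \<theta>1) \<in> atlas M" and c1': "(U1', \<theta>1') \<in> atlas N" and k: "enat k \<le> r" and j: "j < n"
  shows "Ck k (m + d) (Jdom U1 \<theta>1 U1') (\<lambda>y. J U1 \<theta>1 \<theta>1' y j)"
proof (rule Ck_local)
  show "Jdom U1 \<theta>1 U1' \<subseteq> Rn (m + d)" by (rule open_Rn_subset[OF Jdom_open[OF c1 c1']])
  fix y0 assume y0: "y0 \<in> Jdom U1 \<theta>1 U1'"
  then have y0E: "y0 \<in> E1 U1 \<theta>1" by (auto simp: Jdom_def)
  have cube_open: "openin (subtopology (Euclidean_space d) (cube d \<delta>)) (cube d \<delta>)"
    using openin_open_subtopology[OF openin_cube] openin_cube by blast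
  show "\<exists>V. openin (Euclidean_space (m + d)) V \<and> y0 \<in> V \<and> Ck k (m + d) (Jdom U1 \<theta>1 U1' \<inter> V) (\<lambda>y. J U1 \<theta>1 \<theta>1' y j)"
  proof (cases "inv_into U1 \<theta>1 (first_coords m y0) \<in> Q")
    case True
    define V where "V = {y \<in> E1 U1 \<theta>1. (inv_into U1 \<theta>1 (first_coords m y), last_coords m y) \<in> Dm \<times> cube d \<delta>}"
    have "openin PX (Dm \<times> cube d \<delta>)"
      unfolding PX_def openin_prod_Times_iff using Dm_open cube_open by blast
    from E1_preimage_open[OF c1 this] have V: "openin (Euclidean_space (m + d)) V" unfolding V_def .
    have y0V: "y0 \<in> V" using y0E True Q(2) unfolding V_def by (auto simp: E1_def)
    let ?O = "Jdom U1 \<theta>1 U1' \<inter> V"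
    have O: "openin (Euclidean_space (m + d)) ?O" using Jdom_open[OF c1 c1'] V by (rule openin_Int)
    define x where "x y = inv_into U1 \<theta>1 (first_coords m y)" for y
    define h where "h y = glue m (\<theta> (x y)) (last_coords m y)" for y
    have xO: "x y \<in> Dm" "last_coords m y \<in> cube d \<delta>" "x y \<in> U1" "\<theta>1 (x y) = first_coords m y"
      "\<psi> (last_coords m y) (x y) \<in> U1'" if "y \<in> ?O" for y
      using that E1_in_PX[OF c1, of y] by (auto simp: V_def Jdom_def x_def)
    have hY: "h y \<in> Y" if "y \<in> ?O" for y
      unfolding h_def by (rule glue_Y[OF xO(1,2)[OF that]])
    have h_Ck: "Ck k (m + d) ?O (\<lambda>y. h y i)" if "i < m + d" for i
    proof (cases "i < m")
      case True
      have "Ck k (m + d) ?O (\<lambda>y. \<theta> (inv_into U1 \<theta>1 (first_coords m y)) i)"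
      proof (rule Ck_compose_first_coords[OF O transition_openin[OF MM c1 c] _ transition_Ck[OF MM c1 c k True]])
        fix y assume y: "y \<in> ?O"
        then have "first_coords m y = \<theta>1 (x y)" "x y \<in> U1 \<inter> U" using xO[OF y] by auto
        then show "first_coords m y \<in> \<theta>1 ` (U1 \<inter> U)" by blast
      qed
      then show ?thesis using True by (simp add: h_def glue_def x_def)
    next
      case False
      then have "h y i = y i" for y by (simp add: h_def glue_def last_coords_def)
      then show ?thesis using Ck_coord[OF O] by simp
    qed
    have Ph_Ck: "Ck k (m + d) ?O (\<lambda>y. P (h y) i)" if "i < n" for i
      by (rule Ck_compose[OF O Y_open hY h_Ck P_Ck[OF k that]])
    have \<psi>x: "\<psi> (last_coords m y) (x y) \<in> U'" "\<theta>' (\<psi> (last_coords m y) (x y)) = P (h y)"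
      "inv_into U' \<theta>' (P (h y)) = \<psi> (last_coords m y) (x y)" if "y \<in> ?O" for y
      using \<psi>_chart[OF xO(1,2)[OF that]] \<psi>_eq[OF xO(1)[OF that], of "last_coords m y"] unfolding h_def by auto
    have "Ck k (m + d) ?O (\<lambda>y. \<theta>1' (inv_into U' \<theta>' (P (h y))) j)"
    proof (rule Ck_compose[OF O transition_openin[OF NM c'a c1'] _ Ph_Ck transition_Ck[OF NM c'a c1' k j]])
      fix y assume y: "y \<in> ?O"
      have "P (h y) = \<theta>' (\<psi> (last_coords m y) (x y))" using \<psi>x(2)[OF y] by simp
      moreover have "\<psi> (last_coords m y) (x y) \<in> U' \<inter> U1'" using \<psi>x(1)[OF y] xO(5)[OF y] by simp
      ultimately show "P (h y) \<in> \<theta>' ` (U' \<inter> U1')" by blast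
    qed
    then have "Ck k (m + d) ?O (\<lambda>y. J U1 \<theta>1 \<theta>1' y j)"
      by (rule Ck_cong[OF O, rotated]) (simp only: \<psi>x(3) J_def x_def)
    then show ?thesis using V y0V by blast
  next
    case False
    define V where "V = {y \<in> E1 U1 \<theta>1. (inv_into U1 \<theta>1 (first_coords m y), last_coords m y) \<in>
      (topspace (base_space M) - Q) \<times> cube d \<delta>}"
    have "Hausdorff_space (base_space M)" using MM unfolding Cr_manifold_def by blast
    then have "openin (base_space M) (topspace (base_space M) - Q)"
      using compactin_imp_closedin Q(1) closedin_def by blast
    then have "openin PX ((topspace (base_space M) - Q) \<times> cube d \<delta>)"
      unfolding PX_def openin_prod_Times_iff using cube_open by blast
    from E1_preimage_open[OF c1 this] have V: "openin (Euclidean_space (m + d)) V" unfolding V_def .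
    have y0V: "y0 \<in> V" using y0E False E1_in_PX(3)[OF c1 y0E] unfolding V_def by (auto simp: topspace_PX)
    let ?O = "Jdom U1 \<theta>1 U1' \<inter> V"
    have O: "openin (Euclidean_space (m + d)) ?O" using Jdom_open[OF c1 c1'] V by (rule openin_Int)
    have eq: "\<psi> (last_coords m y) (inv_into U1 \<theta>1 (first_coords m y)) = \<phi> (inv_into U1 \<theta>1 (first_coords m y))"
      if "y \<in> ?O" for y using that by (intro \<psi>_outside) (auto simp: V_def)
    have "Ck k (m + d) ?O (\<lambda>y. \<theta>1' (\<phi> (inv_into U1 \<theta>1 (first_coords m y))) j)"
    proof (rule Ck_compose_first_coords[OF O Cr_map_dom_openin(2)[OF MM NM \<phi>_map c1 c1'] _ Cr_map_Ck[OF MM \<phi>_map c1 c1' k j]])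
      fix y assume y: "y \<in> ?O"
      then have "y \<in> E1 U1 \<theta>1" by (auto simp: V_def)
      from E1_in_PX[OF c1 this] have "first_coords m y = \<theta>1 (inv_into U1 \<theta>1 (first_coords m y))"
        "inv_into U1 \<theta>1 (first_coords m y) \<in> U1" by auto
      moreover have "\<phi> (inv_into U1 \<theta>1 (first_coords m y)) \<in> U1'" using y eq[OF y] by (auto simp: Jdom_def)
      ultimately show "first_coords m y \<in> \<theta>1 ` {x \<in> U1. \<phi> x \<in> U1'}" by blast
    qed
    then have "Ck k (m + d) ?O (\<lambda>y. J U1 \<theta>1 \<theta>1' y j)"
      by (rule Ck_cong[OF O, rotated]) (simp only: eq J_def)
    then show ?thesis using V y0V by blast
  qed
qed

lemma slice_continuous:
  assumes t: "t \<in> cube d \<delta>" shows "continuous_map (base_space M) (base_space N) (\<psi> t)"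
proof -
  have "continuous_map (base_space M) PX (\<lambda>x. (x, t))"
    unfolding PX_def using t by (intro continuous_map_pairedI) (auto simp: cube_iff)
  from continuous_map_compose[OF this \<psi>_joint_continuous] show ?thesis by (simp add: o_def)
qed

lemma \<psi>_Cr_map:
  assumes t: "t \<in> cube d \<delta>" shows "Cr_map r M N (\<psi> t)"
  unfolding Cr_map_def
proof (intro conjI slice_continuous[OF t] ballI, clarify)
  fix U1 \<theta>1 U1' \<theta>1' assume c1: "(U1, \<theta>1) \<in> atlas M" and c1': "(U1', \<theta>1') \<in> atlas N"
  note ch = atlas_is_chart[OF MM c1] atlas_is_chart[OF NM c1']
  let ?D = "{x \<in> U1. \<psi> t x \<in> U1'}"
  have "openin (base_space M) ?D"
    by (rule openin_continuous_map_preimage_gen[OF slice_continuous[OF t] chart_openin[OF ch(1)] chart_openin[OF ch(2)]])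
  then have O: "openin (Euclidean_space m) (\<theta>1 ` ?D)" by (rule chart_image_open[OF ch(1)]) auto
  have tR: "t \<in> Rn d" using t by (simp add: cube_iff)
  have zR: "z \<in> Rn m" if "z \<in> \<theta>1 ` ?D" for z using that open_Rn_subset[OF O] by auto
  have mJ: "glue m z t \<in> Jdom U1 \<theta>1 U1'" if z: "z \<in> \<theta>1 ` ?D" for z
    using z t glue_Rn[OF tR, of m z] first_coords_glue[OF zR[OF z], of t] last_coords_glue[of m z t]
      chart_inj[OF ch(1)] by (auto simp: Jdom_def E1_def)
  have "Ck k m (\<theta>1 ` ?D) (\<lambda>z. \<theta>1' (\<psi> t (inv_into U1 \<theta>1 z)) j)" if k: "enat k \<le> r" and j: "j < n" for k j
  proof -
    have "Ck k m (\<theta>1 ` ?D) (\<lambda>z. J U1 \<theta>1 \<theta>1' (glue m z t) j)"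
    proof (rule Ck_compose[OF O Jdom_open[OF c1 c1'] mJ _ J_Ck[OF c1 c1' k j]])
      show "Ck k m (\<theta>1 ` ?D) (\<lambda>w. glue m w t i)" for i
        by (cases "i < m") (simp_all add: glue_def Ck_coord[OF O] Ck_const)
    qed
    then show ?thesis
      by (rule Ck_cong[OF O, rotated]) (simp add: J_def first_coords_glue[OF zR] last_coords_glue)
  qed
  then show "Cr_on r m n (\<theta>1 ` ?D) (\<theta>1' \<circ> \<psi> t \<circ> inv_into U1 \<theta>1)"
    unfolding Cr_on_iff[OF open_Rn_subset[OF O]] by (simp add: o_def)
qed

text \<open>The track of a point is leafwise continuous because it moves in one plaque.\<close>

lemma track_continuous:
  assumes x: "x \<in> topspace (base_space M)" and t: "t \<in> cube d \<delta>"
  shows "continuous_map (top_of_set {0..1::real}) (leaf_topology N) (\<lambda>s. \<psi> (\<lambda>i. s * t i) x)"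
proof (cases "x \<in> Q")
  case True
  have "continuous_map (top_of_set {0..1::real}) (Euclidean_space d) (\<lambda>s i. s * t i)"
  proof (rule continuous_map_RnI)
    show "continuous_map (top_of_set {0..1}) euclideanreal (\<lambda>s. s * t i)" for i
      by (auto intro!: continuous_intros)
  qed (use t in \<open>auto simp: cube_iff Rn_def\<close>)
  then have "continuous_map (top_of_set {0..1::real}) (subtopology (Euclidean_space d) (cube d \<delta>)) (\<lambda>s i. s * t i)"
    unfolding continuous_map_in_subtopology using cube_scale[OF t] by auto
  then have "continuous_map (top_of_set {0..1::real}) PX (\<lambda>s. (x, \<lambda>i. s * t i))"
    unfolding PX_def using x by (intro continuous_map_pairedI) auto
  from continuous_map_compose[OF this \<psi>_joint_continuous]
  have "continuous_map (top_of_set {0..1::real}) (base_space N) (\<lambda>s. \<psi> (\<lambda>i. s * t i) x)" by (simp add: o_def)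
  then show ?thesis
    by (rule continuous_map_into_plaque[OF NF _ c'])
      (use \<psi>_chart[OF _ cube_scale[OF t]] \<psi>_proj[OF _ cube_scale[OF t]] True Q(2) in auto)
next
  case False
  then have "\<psi> t' x = \<phi> x" for t' by (rule \<psi>_outside)
  moreover have "\<phi> x \<in> topspace (leaf_topology N)"
    using x \<phi>_cont continuous_map_image_subset_topspace unfolding topspace_leaf_topology[OF NF] by blast
  ultimately show ?thesis by simp
qed

text \<open>Applied with \<open>V = UNIV\<close> to see that the leaf does not change, and with the
  neighbourhood that defines a local saturation to see that points do not leave the
  saturation.\<close>

lemma track_connected:
  assumes x: "x \<in> topspace (base_space M)" and t: "t \<in> cube d \<delta>"
    and V: "\<And>s. s \<in> {0..1} \<Longrightarrow> \<psi> (\<lambda>i. s * t i) x \<in> V"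
  shows "\<exists>S. connectedin (subtopology (leaf_topology N) V) S \<and> \<phi> x \<in> S \<and> \<psi> t x \<in> S"
proof -
  let ?g = "\<lambda>s. \<psi> (\<lambda>i. s * t i) x"
  have "continuous_map (top_of_set {0..1::real}) (subtopology (leaf_topology N) V) ?g"
    unfolding continuous_map_in_subtopology using track_continuous[OF x t] V by auto
  moreover have "connectedin (top_of_set {0..1::real}) {0..1}"
    by (simp add: connectedin_subtopology connectedin_iff_connected)
  ultimately have "connectedin (subtopology (leaf_topology N) V) (?g ` {0..1})"
    by (rule connectedin_continuous_map_image)
  moreover have "\<phi> x \<in> ?g ` {0..1}" using \<psi>_0[of x] by (intro image_eqI[of _ _ 0]) auto
  moreover have "\<psi> t x \<in> ?g ` {0..1}" by (intro image_eqI[of _ _ 1]) auto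
  ultimately show ?thesis by blast
qed

lemma \<psi>_foliation_map:
  assumes t: "t \<in> cube d \<delta>" shows "\<psi> t \<in> foliation_maps r M N"
  unfolding foliation_maps_def
proof (intro CollectI conjI \<psi>_Cr_map[OF t] ballI)
  show "\<psi> t \<in> extensional (topspace (base_space M))"
    using \<phi> Q(2) U_top unfolding foliation_maps_def extensional_def by (auto simp: \<psi>_def)
  fix L assume L: "L \<in> leaves M"
  then obtain L' where L': "L' \<in> leaves N" "\<phi> ` L \<subseteq> L'" using \<phi> unfolding foliation_maps_def by blast
  have "\<psi> t x \<in> L'" if x: "x \<in> L" for x
  proof -
    have "L \<subseteq> topspace (leaf_topology M)"
      using L unfolding leaves_def by (rule connected_components_of_subset)
    then have "x \<in> topspace (leaf_topology M)" using x by blast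
    then have "x \<in> topspace (base_space M)" using topspace_leaf_topology[OF MF] by simp
    from track_connected[OF this t, of UNIV] obtain S where S: "connectedin (leaf_topology N) S" "\<phi> x \<in> S" "\<psi> t x \<in> S"
      by auto
    then have "S \<subseteq> L'" using connected_components_of_maximal[of L' "leaf_topology N" S] L' x
      unfolding leaves_def disjnt_def by blast
    then show ?thesis using S by blast
  qed
  then show "\<exists>L'\<in>leaves N. \<psi> t ` L \<subseteq> L'" using L' by blast
qed

end


text \<open>The conditions that a single index imposes in \<open>sp_nbhd\<close>. The centre \<phi>
  and the tested map \<open>f\<close> are separate arguments because a basic set containing a map
  need not be centred at it.\<close>

definition sp_cond where
  "sp_cond s M N c c' K \<epsilon> \<phi> f \<longleftrightarrow> f ` K \<subseteq> fst c' \<and>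
     (\<forall>x\<in>K. local_projection N c' (f x) = local_projection N c' (\<phi> x) \<and>
       (\<forall>k\<le>s. deriv_dist k (mdim M) (mdim N) (snd c' \<circ> f \<circ> inv_into (fst c) (snd c))
          (snd c' \<circ> \<phi> \<circ> inv_into (fst c) (snd c)) (snd c x) < \<epsilon>))"

lemma sp_nbhd_eq:
  "sp_nbhd s M N \<phi> I \<Theta> \<Theta>' K \<epsilon> =
    {f \<in> foliation_maps (enat s) M N. \<forall>i\<in>I. sp_cond s M N (\<Theta> i) (\<Theta>' i) (K i) (\<epsilon> i) \<phi> f}"
  unfolding sp_nbhd_def sp_cond_def ..

lemma finite_lists_below: "finite {is. length is = k \<and> set is \<subseteq> {..<m::nat}}"
  using finite_lists_length_eq[of "{..<m}" k] by (simp add: conj_commute)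

lemma locally_finite_compact:
  assumes lf: "\<And>x. x \<in> topspace X \<Longrightarrow> \<exists>W. openin X W \<and> x \<in> W \<and> finite {i\<in>I. S i \<inter> W \<noteq> {}}"
    and Q: "compactin X Q"
  shows "finite {i\<in>I. S i \<inter> Q \<noteq> {}}"
proof -
  let ?\<W> = "{W. openin X W \<and> finite {i\<in>I. S i \<inter> W \<noteq> {}}}"
  have "Q \<subseteq> \<Union>?\<W>" using lf compactin_subset_topspace[OF Q] by fast
  then obtain \<F> where F: "finite \<F>" "\<F> \<subseteq> ?\<W>" "Q \<subseteq> \<Union>\<F>"
    using Q unfolding compactin_def by (metis (no_types, lifting) mem_Collect_eq)
  have "{i\<in>I. S i \<inter> Q \<noteq> {}} \<subseteq> (\<Union>W\<in>\<F>. {i\<in>I. S i \<inter> W \<noteq> {}})" using F(3) by auto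
  moreover have "finite (\<Union>W\<in>\<F>. {i\<in>I. S i \<inter> W \<noteq> {}})" using F by (intro finite_UN_I) auto
  ultimately show ?thesis by (rule finite_subset)
qed

section \<open>Stability of sp-open sets under small parameters\<close>

context leafwise_perturbation
begin

lemma iter_partial_slice:
  assumes c1: "(U1, \<theta>1) \<in> atlas M" and x: "x \<in> U1" and "is": "set is \<subseteq> {..<m}"
  shows "iter_partial is (\<lambda>z. \<theta>1' (\<psi> t (inv_into U1 \<theta>1 z)) j) (\<theta>1 x) =
    iter_partial is (\<lambda>y. J U1 \<theta>1 \<theta>1' y j) (glue m (\<theta>1 x) t)"
proof -
  have xR: "\<theta>1 x \<in> Rn m" using open_Rn_subset[OF chart_image_openin[OF atlas_is_chart[OF MM c1]]] x by auto
  have "iter_partial is (\<lambda>z. \<theta>1' (\<psi> t (inv_into U1 \<theta>1 z)) j) (\<theta>1 x) =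
      iter_partial is (\<lambda>z. J U1 \<theta>1 \<theta>1' (glue m z t) j) (\<theta>1 x)"
    by (rule iter_partial_cong[OF openin_Rn xR "is"]) (simp add: J_def first_coords_glue last_coords_glue)
  also have "\<dots> = iter_partial is (\<lambda>y. J U1 \<theta>1 \<theta>1' y j) (glue m (\<theta>1 x) t)"
    by (rule iter_partial_glue[OF "is", of "\<lambda>y. J U1 \<theta>1 \<theta>1' y j"])
  finally show ?thesis .
qed

text \<open>The derivatives of the perturbed map are partial derivatives of \<open>J\<close> in the
  directions of the point only. They are jointly continuous in point and parameter, so a strict
  inequality cuts out an open set.\<close>

lemma deriv_dist_open:
  assumes c1: "(U1, \<theta>1) \<in> atlas M" and c1': "(U1', \<theta>1') \<in> atlas N"
    and s: "enat s \<le> r" and k: "k \<le> s" and \<phi>1: "Cr_map (enat s) M N \<phi>1"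
  shows "openin PX {p \<in> topspace PX. fst p \<in> U1 \<and> \<phi>1 (fst p) \<in> U1' \<and> \<psi> (snd p) (fst p) \<in> U1' \<and>
     deriv_dist k m n (\<theta>1' \<circ> \<psi> (snd p) \<circ> inv_into U1 \<theta>1) (\<theta>1' \<circ> \<phi>1 \<circ> inv_into U1 \<theta>1) (\<theta>1 (fst p)) < \<epsilon>}"
proof -
  note ch = atlas_is_chart[OF MM c1] atlas_is_chart[OF NM c1']
  let ?A1 = "{x \<in> U1. \<phi>1 x \<in> U1'}"
  have A1: "openin (base_space M) ?A1" "openin (Euclidean_space m) (\<theta>1 ` ?A1)"
    using Cr_map_dom_openin[OF MM NM \<phi>1 c1 c1'] by auto
  define A where "A = {p \<in> topspace PX. fst p \<in> ?A1} \<inter> {p \<in> topspace PX. \<psi> (snd p) (fst p) \<in> U1'}"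
  have A: "openin PX A" unfolding A_def
  proof (rule openin_Int)
    show "openin PX {p \<in> topspace PX. fst p \<in> ?A1}"
      by (rule openin_continuous_map_preimage[OF _ A1(1)]) (simp add: PX_def continuous_map_fst)
    show "openin PX {p \<in> topspace PX. \<psi> (snd p) (fst p) \<in> U1'}"
      by (rule openin_continuous_map_preimage[OF \<psi>_joint_continuous chart_openin[OF ch(2)]])
  qed
  let ?T = "subtopology PX A"
  have tT: "topspace ?T = A" using openin_subset[OF A] by (rule topspace_subtopology_subset)
  have Ain: "fst p \<in> U1" "\<phi>1 (fst p) \<in> U1'" "\<psi> (snd p) (fst p) \<in> U1'" "snd p \<in> cube d \<delta>" if "p \<in> A" for p
    using that by (auto simp: A_def topspace_PX)
  have "continuous_map ?T (base_space M) fst"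
    unfolding PX_def by (intro continuous_map_from_subtopology continuous_map_fst)
  then have "continuous_map ?T (subtopology (base_space M) U1) fst"
    unfolding continuous_map_in_subtopology using tT Ain by auto
  from continuous_map_compose[OF this chart_continuous[OF ch(1)]]
  have 1: "continuous_map ?T (Euclidean_space m) (\<lambda>p. \<theta>1 (fst p))" by (simp add: o_def)
  have "continuous_map PX (subtopology (Euclidean_space d) (cube d \<delta>)) snd"
    unfolding PX_def by (rule continuous_map_snd)
  then have 2: "continuous_map ?T (Euclidean_space d) snd"
    by (meson continuous_map_from_subtopology continuous_map_into_fulltopology)
  have \<theta>1R: "\<theta>1 x \<in> Rn m" if "x \<in> U1" for x
    using open_Rn_subset[OF chart_image_openin[OF ch(1)]] that by auto
  have mJ: "glue m (\<theta>1 (fst p)) (snd p) \<in> Jdom U1 \<theta>1 U1'" if p: "p \<in> A" for p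
    using Ain[OF p] glue_Rn[of "snd p" d m "\<theta>1 (fst p)"] first_coords_glue[OF \<theta>1R, of "fst p" "snd p"]
      last_coords_glue[of m "\<theta>1 (fst p)" "snd p"] chart_inj[OF ch(1)]
    by (auto simp: Jdom_def E1_def cube_iff)
  have 3: "continuous_map ?T (subtopology (Euclidean_space (m + d)) (Jdom U1 \<theta>1 U1')) (\<lambda>p. glue m (\<theta>1 (fst p)) (snd p))"
    unfolding continuous_map_in_subtopology using continuous_map_glue[OF 1 2] mJ tT by fastforce
  have 4: "continuous_map ?T (subtopology (Euclidean_space m) (\<theta>1 ` ?A1)) (\<lambda>p. \<theta>1 (fst p))"
    unfolding continuous_map_in_subtopology using 1 Ain tT by auto
  let ?D = "\<lambda>is j p. iter_partial is (\<lambda>y. J U1 \<theta>1 \<theta>1' y j) (glue m (\<theta>1 (fst p)) (snd p)) -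
      iter_partial is (\<lambda>z. \<theta>1' (\<phi>1 (inv_into U1 \<theta>1 z)) j) (\<theta>1 (fst p))"
  have D: "continuous_map ?T euclideanreal (?D is j)"
    if "is": "length is = k" "set is \<subseteq> {..<m}" and j: "j < n" for "is" j
  proof (rule continuous_map_diff)
    have kr: "enat k \<le> r" using s k by (meson enat_ord_simps(1) order_trans)
    have "continuous_on (Jdom U1 \<theta>1 U1') (iter_partial is (\<lambda>y. J U1 \<theta>1 \<theta>1' y j))"
      using J_Ck[OF c1 c1' kr j] "is" unfolding Ck_iff by fastforce
    then have "continuous_map (subtopology (Euclidean_space (m + d)) (Jdom U1 \<theta>1 U1')) euclideanreal (iter_partial is (\<lambda>y. J U1 \<theta>1 \<theta>1' y j))"
      using continuous_map_Rn[OF open_Rn_subset[OF Jdom_open[OF c1 c1']]] by blast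
    from continuous_map_compose[OF 3 this]
    show "continuous_map ?T euclideanreal (\<lambda>p. iter_partial is (\<lambda>y. J U1 \<theta>1 \<theta>1' y j) (glue m (\<theta>1 (fst p)) (snd p)))"
      by (simp add: o_def)
    have "continuous_on (\<theta>1 ` ?A1) (iter_partial is (\<lambda>z. \<theta>1' (\<phi>1 (inv_into U1 \<theta>1 z)) j))"
      using Cr_map_Ck[OF MM \<phi>1 c1 c1' _ j, of k] "is" k unfolding Ck_iff by auto
    then have "continuous_map (subtopology (Euclidean_space m) (\<theta>1 ` ?A1)) euclideanreal (iter_partial is (\<lambda>z. \<theta>1' (\<phi>1 (inv_into U1 \<theta>1 z)) j))"
      using continuous_map_Rn[OF open_Rn_subset[OF A1(2)]] by blast
    from continuous_map_compose[OF 4 this]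
    show "continuous_map ?T euclideanreal (\<lambda>p. iter_partial is (\<lambda>z. \<theta>1' (\<phi>1 (inv_into U1 \<theta>1 z)) j) (\<theta>1 (fst p)))"
      by (simp add: o_def)
  qed
  let ?f = "\<lambda>p. sqrt (\<Sum>is\<in>{is. length is = k \<and> set is \<subseteq> {..<m}}. \<Sum>j<n. (?D is j p)\<^sup>2)"
  have "continuous_map ?T euclideanreal ?f"
    by (intro continuous_map_sqrt continuous_map_sum continuous_map_real_pow D) (auto simp: finite_lists_below)
  then have "openin ?T {p \<in> topspace ?T. ?f p \<in> {..<\<epsilon>}}"
    by (rule openin_continuous_map_preimage) simp
  then have "openin PX {p \<in> A. ?f p < \<epsilon>}"
    unfolding tT using openin_trans_full A by auto
  moreover have "{p \<in> A. ?f p < \<epsilon>} = {p \<in> topspace PX. fst p \<in> U1 \<and> \<phi>1 (fst p) \<in> U1' \<and> \<psi> (snd p) (fst p) \<in> U1' \<and>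
     deriv_dist k m n (\<theta>1' \<circ> \<psi> (snd p) \<circ> inv_into U1 \<theta>1) (\<theta>1' \<circ> \<phi>1 \<circ> inv_into U1 \<theta>1) (\<theta>1 (fst p)) < \<epsilon>}"
  proof -
    have "deriv_dist k m n (\<theta>1' \<circ> \<psi> (snd p) \<circ> inv_into U1 \<theta>1) (\<theta>1' \<circ> \<phi>1 \<circ> inv_into U1 \<theta>1) (\<theta>1 (fst p)) = ?f p"
      if "fst p \<in> U1" for p
      unfolding deriv_dist_def o_def
      by (intro arg_cong[where f = sqrt] sum.cong refl) (simp add: iter_partial_slice[OF c1 that])
    then show ?thesis by (auto simp: A_def)
  qed
  ultimately show ?thesis by simp
qed

text \<open>The inclusion and the inequalities hold for small \<open>t\<close> by compactness. The
  equality of local projections is no open condition; it holds because the track of each point is a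
  leafwise path that stays inside the domain of \<open>c1'\<close>.\<close>

lemma sp_cond_stable:
  assumes c1: "c1 \<in> fcharts M" and c1': "c1' \<in> fcharts N" and K: "compactin (base_space M) K" "K \<subseteq> fst c1"
    and s: "enat s \<le> r" and \<phi>1: "Cr_map (enat s) M N \<phi>1" "\<phi>1 ` K \<subseteq> fst c1'"
    and cond: "sp_cond s M N c1 c1' K \<epsilon> \<phi>1 \<phi>"
  shows "\<exists>e>0. e \<le> \<delta> \<and> (\<forall>t\<in>cube d e. sp_cond s M N c1 c1' K \<epsilon> \<phi>1 (\<psi> t))"
proof -
  obtain U1 \<theta>1 U1' \<theta>1' where eq: "c1 = (U1, \<theta>1)" "c1' = (U1', \<theta>1')" by fastforce
  have a: "(U1, \<theta>1) \<in> atlas M" "(U1', \<theta>1') \<in> atlas N"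
    using c1 c1' fcharts_atlas[OF MF] fcharts_atlas[OF NF] eq by auto
  note ch = atlas_is_chart[OF MM a(1)] atlas_is_chart[OF NM a(2)]
  have "\<phi> ` K \<subseteq> U1'" using cond eq by (simp add: sp_cond_def)
  then obtain e1 where e1: "e1 > 0" "e1 \<le> \<delta>" "\<And>t. t \<in> cube d e1 \<Longrightarrow> \<psi> t ` K \<subseteq> U1'"
    using compact_into_open[OF K(1) chart_openin[OF ch(2)]] by blast
  define W where "W k = {p \<in> topspace PX. fst p \<in> U1 \<and> \<phi>1 (fst p) \<in> U1' \<and> \<psi> (snd p) (fst p) \<in> U1' \<and>
     deriv_dist k m n (\<theta>1' \<circ> \<psi> (snd p) \<circ> inv_into U1 \<theta>1) (\<theta>1' \<circ> \<phi>1 \<circ> inv_into U1 \<theta>1) (\<theta>1 (fst p)) < \<epsilon>}" for k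
  have "openin PX (\<Inter>k\<in>{..s}. W k)"
    unfolding W_def by (intro openin_INT2) (auto intro!: deriv_dist_open[OF a s _ \<phi>1(1)])
  moreover have "K \<times> {\<lambda>_. 0} \<subseteq> (\<Inter>k\<in>{..s}. W k)"
  proof clarify
    fix x k assume x: "x \<in> K" and k: "k \<le> s"
    have "x \<in> U1" "\<phi>1 x \<in> U1'" "\<phi> x \<in> U1'" "x \<in> topspace (base_space M)"
      using x K \<phi>1(2) \<open>\<phi> ` K \<subseteq> U1'\<close> eq compactin_subset_topspace[OF K(1)] by auto
    moreover have "\<psi> (\<lambda>_. 0) = \<phi>" using \<psi>_0 by auto
    moreover have "deriv_dist k m n (\<theta>1' \<circ> \<phi> \<circ> inv_into U1 \<theta>1) (\<theta>1' \<circ> \<phi>1 \<circ> inv_into U1 \<theta>1) (\<theta>1 x) < \<epsilon>"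
      using cond x k eq by (simp add: sp_cond_def)
    ultimately show "(x, \<lambda>_. 0) \<in> W k"
      using zero_in_cube[OF \<delta>] by (simp add: W_def topspace_PX)
  qed
  ultimately obtain e2 where e2: "e2 > 0" "e2 \<le> \<delta>" "K \<times> cube d e2 \<subseteq> (\<Inter>k\<in>{..s}. W k)"
    using tube_cube[of "base_space M" d \<delta> _ K] K(1) \<delta> unfolding PX_def by metis
  define e where "e = min e1 e2"
  have e: "e > 0" "e \<le> \<delta>" using e1 e2 by (auto simp: e_def)
  have "sp_cond s M N c1 c1' K \<epsilon> \<phi>1 (\<psi> t)" if t: "t \<in> cube d e" for t
    unfolding sp_cond_def
  proof (intro conjI ballI allI impI)
    have t1: "t \<in> cube d e1" and t2: "t \<in> cube d e2" and t\<delta>: "t \<in> cube d \<delta>"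
      using t cube_mono[of e e1 d] cube_mono[of e e2 d] cube_mono[of e \<delta> d] e by (auto simp: e_def)
    show "\<psi> t ` K \<subseteq> fst c1'" using e1(3)[OF t1] eq by simp
    fix x assume x: "x \<in> K"
    have xt: "x \<in> topspace (base_space M)" using x compactin_subset_topspace[OF K(1)] by auto
    have "local_projection N c1' (\<psi> (\<lambda>i. 1 * t i) x) = local_projection N c1' (\<psi> (\<lambda>i. 0 * t i) x)"
    proof (rule local_projection_constant[OF NF c1' track_continuous[OF xt t\<delta>]])
      have "connectedin euclidean {0..1::real}" by (simp add: connectedin_iff_connected)
      then show "connected_space (top_of_set {0..1::real})" unfolding connectedin_def by blast
      show "\<psi> (\<lambda>i. s * t i) x \<in> fst c1'" if "s \<in> topspace (top_of_set {0..1})" for s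
        using e1(3)[OF cube_scale[OF t1, of s]] that x eq by auto
    qed auto
    then have "local_projection N c1' (\<psi> t x) = local_projection N c1' (\<phi> x)" by (simp add: \<psi>_0)
    then show "local_projection N c1' (\<psi> t x) = local_projection N c1' (\<phi>1 x)"
      using cond x by (simp add: sp_cond_def)
    fix k assume "k \<le> s"
    then have "(x, t) \<in> W k" using e2(3) x t2 by auto
    then show "deriv_dist k m n (snd c1' \<circ> \<psi> t \<circ> inv_into (fst c1) (snd c1)) (snd c1' \<circ> \<phi>1 \<circ> inv_into (fst c1) (snd c1)) (snd c1 x) < \<epsilon>"
      by (simp add: W_def eq)
  qed
  then show ?thesis using e by blast
qed

text \<open>The whole chart domain misses \<open>Q\<close>, not just \<open>K\<close>: the two maps
  agree on an open set, and so do their derivatives on \<open>K\<close>.\<close>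

lemma sp_cond_away:
  assumes c1: "c1 \<in> fcharts M" and K: "K \<subseteq> fst c1" and dis: "fst c1 \<inter> Q = {}"
    and cond: "sp_cond s M N c1 c1' K \<epsilon> \<phi>1 \<phi>"
  shows "sp_cond s M N c1 c1' K \<epsilon> \<phi>1 (\<psi> t)"
proof -
  obtain U1 \<theta>1 where eq: "c1 = (U1, \<theta>1)" by fastforce
  have a: "(U1, \<theta>1) \<in> atlas M" using c1 fcharts_atlas[OF MF] eq by auto
  note ch = atlas_is_chart[OF MM a(1)]
  have same: "\<psi> t x = \<phi> x" if "x \<in> U1" for x using dis that eq by (intro \<psi>_outside) auto
  have dd: "deriv_dist k m n (snd c1' \<circ> \<psi> t \<circ> inv_into U1 \<theta>1) g (\<theta>1 x) =
      deriv_dist k m n (snd c1' \<circ> \<phi> \<circ> inv_into U1 \<theta>1) g (\<theta>1 x)" if x: "x \<in> U1" for k g x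
  proof -
    have "iter_partial is (\<lambda>y. snd c1' (\<psi> t (inv_into U1 \<theta>1 y)) j) (\<theta>1 x) =
        iter_partial is (\<lambda>y. snd c1' (\<phi> (inv_into U1 \<theta>1 y)) j) (\<theta>1 x)" if "set is \<subseteq> {..<m}" for "is" j
      by (rule iter_partial_cong[OF chart_image_openin[OF ch] _ that])
        (use x same inv_into_into[of _ \<theta>1 U1] in auto)
    then show ?thesis unfolding deriv_dist_def o_def by (intro arg_cong[where f = sqrt] sum.cong refl) simp
  qed
  show ?thesis
    using cond same dd K unfolding sp_cond_def eq by (auto simp: subset_iff image_subset_iff)
qed

lemma sp_base_stable:
  assumes S: "S \<in> sp_base r M N" and \<phi>S: "\<phi> \<in> S"
  shows "\<exists>e>0. e \<le> \<delta> \<and> (\<forall>t\<in>cube d e. \<psi> t \<in> S)"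
proof -
  obtain s \<phi>1 I \<Theta> \<Theta>' K \<epsilon> where S: "S = foliation_maps r M N \<inter> sp_nbhd s M N \<phi>1 I \<Theta> \<Theta>' K \<epsilon>"
    and rs: "r = \<infinity> \<or> r = enat s" and \<phi>1: "\<phi>1 \<in> foliation_maps (enat s) M N" and dat: "sp_data M N \<phi>1 I \<Theta> \<Theta>' K \<epsilon>"
    using S unfolding sp_base_def by auto
  have sr: "enat s \<le> r" using rs by auto
  have \<phi>1m: "Cr_map (enat s) M N \<phi>1" using \<phi>1 by (simp add: foliation_maps_def)
  have cond: "sp_cond s M N (\<Theta> i) (\<Theta>' i) (K i) (\<epsilon> i) \<phi>1 \<phi>" if "i \<in> I" for i
    using \<phi>S that unfolding S sp_nbhd_eq by auto
  have dat_i: "\<Theta> i \<in> fcharts M" "\<Theta>' i \<in> fcharts N" "compactin (base_space M) (K i)" "K i \<subseteq> fst (\<Theta> i)" "\<phi>1 ` K i \<subseteq> fst (\<Theta>' i)"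
    if "i \<in> I" for i using dat that by (auto simp: sp_data_def)
  \<comment> \<open>By local finiteness only finitely many chart domains meet \<open>Q\<close>,
    outside which nothing moves.\<close>
  define I0 where "I0 = {i\<in>I. fst (\<Theta> i) \<inter> Q \<noteq> {}}"
  have fin: "finite I0" unfolding I0_def
    by (rule locally_finite_compact[OF _ Q(1)]) (use dat in \<open>auto simp: sp_data_def\<close>)
  have "\<exists>e>0. e \<le> \<delta> \<and> (\<forall>t\<in>cube d e. sp_cond s M N (\<Theta> i) (\<Theta>' i) (K i) (\<epsilon> i) \<phi>1 (\<psi> t))" if "i \<in> I0" for i
    by (rule sp_cond_stable[OF dat_i(1-4) sr \<phi>1m dat_i(5) cond]) (use that in \<open>auto simp: I0_def\<close>)
  then obtain e where e: "\<And>i. i \<in> I0 \<Longrightarrow> e i > 0" 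
    "\<And>i t. i \<in> I0 \<Longrightarrow> t \<in> cube d (e i) \<Longrightarrow> sp_cond s M N (\<Theta> i) (\<Theta>' i) (K i) (\<epsilon> i) \<phi>1 (\<psi> t)"
    by metis
  define e0 where "e0 = Min (insert \<delta> (e ` I0))"
  have e0: "e0 > 0" unfolding e0_def using fin e(1) \<delta> by (subst Min_gr_iff) auto
  have e0\<delta>: "e0 \<le> \<delta>" unfolding e0_def using fin by (intro Min_le) auto
  have e0i: "e0 \<le> e i" if "i \<in> I0" for i unfolding e0_def using fin that by (intro Min_le) auto
  have "\<psi> t \<in> S" if t: "t \<in> cube d e0" for t
  proof -
    have fm: "\<psi> t \<in> foliation_maps r M N" using \<psi>_foliation_map cube_mono[OF e0\<delta>, of d] t by blast
    then have "\<psi> t \<in> foliation_maps (enat s) M N" using foliation_maps_mono[OF sr] by blast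
    moreover have "sp_cond s M N (\<Theta> i) (\<Theta>' i) (K i) (\<epsilon> i) \<phi>1 (\<psi> t)" if i: "i \<in> I" for i
    proof (cases "i \<in> I0")
      case True
      then show ?thesis using e(2)[OF True] cube_mono[OF e0i[OF True], of d] t by blast
    next
      case False
      then show ?thesis using sp_cond_away[OF dat_i(1,4) _ cond] i by (auto simp: I0_def)
    qed
    ultimately show ?thesis using fm unfolding S sp_nbhd_eq by blast
  qed
  then show ?thesis using e0 e0\<delta> by blast
qed

text \<open>Induction over the generation of the topology: an intersection takes the smaller radius,
  a union the radius of a member that contains \<phi>.\<close>

lemma sp_open_stable:
  assumes "openin (sp_topology r M N) S" "\<phi> \<in> S"
  shows "\<exists>e>0. e \<le> \<delta> \<and> (\<forall>t\<in>cube d e. \<psi> t \<in> S)"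
proof -
  have "generate_topology_on (sp_base r M N) S"
    using assms(1) unfolding sp_topology_def by (rule openin_topology_generated_by)
  then show ?thesis using assms(2)
  proof (induction rule: generate_topology_on.induct)
    case (Int a b)
    then obtain e1 e2 where "e1 > 0" "e1 \<le> \<delta>" "\<And>t. t \<in> cube d e1 \<Longrightarrow> \<psi> t \<in> a"
      "e2 > 0" "e2 \<le> \<delta>" "\<And>t. t \<in> cube d e2 \<Longrightarrow> \<psi> t \<in> b" by auto
    then show ?case using cube_mono[of "min e1 e2" e1 d] cube_mono[of "min e1 e2" e2 d]
      by (intro exI[of _ "min e1 e2"]) auto
  next
    case (UN K)
    then show ?case by (meson UnionE UnionI)
  qed (use sp_base_stable in auto)
qed

end

section \<open>Straight charts\<close>


lemma Ck_last_coords: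
  assumes U: "openin (Euclidean_space n) U" and V: "openin (Euclidean_space p) V"
    and "\<And>y. y \<in> U \<Longrightarrow> g y \<in> Rn n \<and> last_coords q (g y) \<in> V" and n: "n = q + p"
    and g: "\<And>i. i < n \<Longrightarrow> Ck k n U (\<lambda>y. g y i)" and f: "Ck k p V f"
  shows "Ck k n U (\<lambda>y. f (last_coords q (g y)))"
proof (rule Ck_compose[OF U V _ _ f])
  show "Ck k n U (\<lambda>w. last_coords q (g w) j)" if "j < p" for j
    using g[of "q + j"] that n by (simp add: last_coords_def)
qed (use assms in auto)

lemma coord_product_box:
  assumes "n = q + p" "w \<in> Rn n"
  shows "coord_product q (box_nbhd q (first_coords q w) e) (box_nbhd p (last_coords q w) e) = box_nbhd n w e"
proof (intro set_eqI iffI)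
  fix z assume z: "z \<in> coord_product q (box_nbhd q (first_coords q w) e) (box_nbhd p (last_coords q w) e)"
  have 1: "\<bar>z i - w i\<bar> < e" if "i < q" for i
    using z that by (auto simp: coord_product_def box_nbhd_def first_coords_def)
  have l: "last_coords q z \<in> box_nbhd p (last_coords q w) e" using z by (auto simp: coord_product_def)
  have 2: "\<bar>z i - w i\<bar> < e" if "q \<le> i" "i < n" for i
  proof -
    have "i - q < p" using that assms by auto
    then have "\<bar>last_coords q z (i - q) - last_coords q w (i - q)\<bar> < e" using l by (auto simp: box_nbhd_def)
    then show ?thesis using that by (simp add: last_coords_def)
  qed
  have "z i = 0" if "i \<ge> n" for i
  proof -
    have "last_coords q z (i - q) = 0" using l that assms by (auto simp: box_nbhd_def Rn_def)
    then show ?thesis using that assms by (simp add: last_coords_def)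
  qed
  then show "z \<in> box_nbhd n w e" using 1 2 by (auto simp: box_nbhd_def Rn_def not_less)
      (metis 1 2 not_less)
next
  fix z assume z: "z \<in> box_nbhd n w e"
  then show "z \<in> coord_product q (box_nbhd q (first_coords q w) e) (box_nbhd p (last_coords q w) e)"
    using assms by (auto simp: coord_product_def box_nbhd_def first_coords_def last_coords_def Rn_def)
qed

lemma convex_points_box: "convex_points (box_nbhd p w e)"
  unfolding convex_points_def
proof (intro ballI)
  fix y z and u :: real assume y: "y \<in> box_nbhd p w e" and z: "z \<in> box_nbhd p w e" and u: "u \<in> {0..1}"
  have "\<bar>(1 - u) * y i + u * z i - w i\<bar> < e" if "i < p" for i
  proof -
    have "y i \<in> {w i - e<..<w i + e}" "z i \<in> {w i - e<..<w i + e}"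
      using y z that by (auto simp: box_nbhd_def abs_less_iff)
    moreover have "convex {w i - e<..<w i + e}" by simp
    ultimately have "(1 - u) *\<^sub>R y i + u *\<^sub>R z i \<in> {w i - e<..<w i + e}"
      using u by (intro convexD_alt) auto
    then show ?thesis by (auto simp: abs_less_iff)
  qed
  then show "(\<lambda>i. (1 - u) * y i + u * z i) \<in> box_nbhd p w e"
    using y z by (auto simp: box_nbhd_def Rn_def)
qed

lemma Ck_homeo_continuous:
  assumes "\<And>i. i < p \<Longrightarrow> Ck 0 p V (\<lambda>z. f z i)" "V \<subseteq> Rn p" "\<And>z. z \<in> V \<Longrightarrow> f z \<in> Rn p"
  shows "continuous_map (subtopology (Euclidean_space p) V) (Euclidean_space p) f"
  by (rule continuous_map_RnI) (use assms continuous_map_Rn[OF assms(2)] in auto)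

text \<open>A $C^r$ change \<kappa> of the leafwise coordinates leaves the local projection alone.
  Plaque compatibility is therefore inherited, and maximality of the atlas and of the set of
  foliation charts admits the new chart. Its domain is shrunk so that the image is a product with
  convex second factor.\<close>

lemma new_fchart:
  assumes NF: "Cr_foliation r N" and c: "(U, \<theta>) \<in> fcharts N" and y: "y \<in> U" "y \<in> V" and V: "openin (base_space N) V"
    and B1: "openin (Euclidean_space (ldim N)) B1" "openin (Euclidean_space (ldim N)) (\<kappa> ` B1)" "inj_on \<kappa> B1"
    and \<kappa>: "\<And>k i. enat k \<le> r \<Longrightarrow> i < ldim N \<Longrightarrow> Ck k (ldim N) B1 (\<lambda>z. \<kappa> z i)"
    and \<kappa>': "\<And>k i. enat k \<le> r \<Longrightarrow> i < ldim N \<Longrightarrow> Ck k (ldim N) (\<kappa> ` B1) (\<lambda>z. inv_into B1 \<kappa> z i)"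
    and yB: "last_coords (codim N) (\<theta> y) \<in> B1"
  shows "\<exists>U'. y \<in> U' \<and> U' \<subseteq> {x \<in> U \<inter> V. last_coords (codim N) (\<theta> x) \<in> B1} \<and>
    (U', \<lambda>x. glue (codim N) (\<theta> x) (\<kappa> (last_coords (codim N) (\<theta> x)))) \<in> fcharts N"
proof -
  let ?q = "codim N" and ?p = "ldim N" and ?n = "mdim N" and ?X = "base_space N"
  have n: "?n = ?q + ?p" using foliation_dim[OF NF] .
  note NM = foliation_manifold[OF NF]
  have ca: "(U, \<theta>) \<in> atlas N" using c fcharts_atlas[OF NF] by auto
  note ch = atlas_is_chart[OF NM ca]
  define K where "K = (\<lambda>x. glue ?q (\<theta> x) (\<kappa> (last_coords ?q (\<theta> x))))"
  \<comment> \<open>\<open>L\<close> recovers the old coordinates from the new ones, which are given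
    by \<open>K\<close>.\<close>
  define L where "L z = glue ?q z (inv_into B1 \<kappa> (last_coords ?q z))" for z
  have \<theta>R: "\<theta> x \<in> Rn ?n" if "x \<in> U" for x using open_Rn_subset[OF chart_image_openin[OF ch]] that by auto
  have B1R: "B1 \<subseteq> Rn ?p" "\<kappa> ` B1 \<subseteq> Rn ?p" using open_Rn_subset B1 by auto
  have r0: "enat 0 \<le> r" by (simp add: zero_enat_def[symmetric])
  have \<kappa>c: "continuous_map (subtopology (Euclidean_space ?p) B1) (Euclidean_space ?p) \<kappa>"
    by (rule Ck_homeo_continuous) (use \<kappa>[OF r0] B1R in auto)
  have \<kappa>'c: "continuous_map (subtopology (Euclidean_space ?p) (\<kappa> ` B1)) (Euclidean_space ?p) (inv_into B1 \<kappa>)"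
    by (rule Ck_homeo_continuous) (use \<kappa>'[OF r0] B1R inv_into_into[of _ \<kappa> B1] in auto)
  have last_c: "continuous_map (Euclidean_space ?n) (Euclidean_space ?p) (last_coords ?q)"
    unfolding n by (rule continuous_map_last_coords)
  have id_first: "continuous_map (Euclidean_space ?n) (Euclidean_space ?n) (\<lambda>z. z)" by simp
  have glue_c: "continuous_map T (Euclidean_space ?n) (\<lambda>x. glue ?q (f x) (g x))"
    if "continuous_map T (Euclidean_space ?n) f" "continuous_map T (Euclidean_space ?p) g" for T :: "'x topology" and f g
  proof -
    have "continuous_map T (Euclidean_space ?q) (\<lambda>x. first_coords ?q (f x))"
      using continuous_map_compose[OF that(1) continuous_map_first_coords] by (simp add: o_def)
    from continuous_map_glue[OF this that(2)] show ?thesis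
      unfolding n by (elim continuous_map_eq) (auto simp: glue_def first_coords_def)
  qed
  have mR: "glue ?q z b \<in> Rn ?n" if "b \<in> Rn ?p" for z b using glue_Rn[OF that] n by simp
  define OL where "OL = {z \<in> Rn ?n. last_coords ?q z \<in> \<kappa> ` B1}"
  have OLo: "openin (Euclidean_space ?n) OL"
    using openin_continuous_map_preimage[OF last_c B1(2)] by (simp add: OL_def)
  have tOL: "topspace (subtopology (Euclidean_space ?n) OL) = OL" using open_Rn_subset[OF OLo] by auto
  have LB: "last_coords ?q (L z) = inv_into B1 \<kappa> (last_coords ?q z)" for z by (simp add: L_def last_coords_glue)
  have Lc: "continuous_map (subtopology (Euclidean_space ?n) OL) (Euclidean_space ?n) L"
    unfolding L_def
  proof (rule glue_c)
    show "continuous_map (subtopology (Euclidean_space ?n) OL) (Euclidean_space ?n) (\<lambda>x. x)"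
      by (rule continuous_map_from_subtopology[OF id_first])
    have "continuous_map (subtopology (Euclidean_space ?n) OL) (subtopology (Euclidean_space ?p) (\<kappa> ` B1)) (last_coords ?q)"
      unfolding continuous_map_in_subtopology using continuous_map_from_subtopology[OF last_c] tOL by (auto simp: OL_def)
    from continuous_map_compose[OF this \<kappa>'c]
    show "continuous_map (subtopology (Euclidean_space ?n) OL) (Euclidean_space ?p) (\<lambda>x. inv_into B1 \<kappa> (last_coords ?q x))"
      by (simp add: o_def)
  qed
  define O1 where "O1 = {z \<in> OL. L z \<in> \<theta> ` (U \<inter> V)}"
  have UV: "openin ?X (U \<inter> V)" using chart_openin[OF ch] V by (rule openin_Int)
  have O1o: "openin (Euclidean_space ?n) O1"
    using openin_continuous_map_preimage[OF Lc chart_image_open[OF ch UV]] OLo openin_trans_full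
    unfolding tOL O1_def by blast
  define U1 where "U1 = {x \<in> U \<inter> V. last_coords ?q (\<theta> x) \<in> B1}"
  have U1o: "openin ?X U1"
  proof -
    have "openin ?X {x \<in> U. \<theta> x \<in> {z \<in> topspace (Euclidean_space ?n). last_coords ?q z \<in> B1}}"
      by (rule chart_preimage_open[OF ch openin_continuous_map_preimage[OF last_c B1(1)]])
    then have "openin ?X ({x \<in> U. \<theta> x \<in> {z \<in> topspace (Euclidean_space ?n). last_coords ?q z \<in> B1}} \<inter> V)"
      using V by (rule openin_Int)
    moreover have "{x \<in> U. \<theta> x \<in> {z \<in> topspace (Euclidean_space ?n). last_coords ?q z \<in> B1}} \<inter> V = U1"
      using \<theta>R by (auto simp: U1_def)
    ultimately show ?thesis by simp
  qed
  have K_OL: "K x \<in> OL" "last_coords ?q (K x) = \<kappa> (last_coords ?q (\<theta> x))" "first_coords ?q (K x) = first_coords ?q (\<theta> x)"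
    "L (K x) = \<theta> x" if "x \<in> U1" for x
  proof -
    have b: "last_coords ?q (\<theta> x) \<in> B1" using that by (auto simp: U1_def)
    show l: "last_coords ?q (K x) = \<kappa> (last_coords ?q (\<theta> x))" by (simp add: K_def last_coords_glue)
    show "first_coords ?q (K x) = first_coords ?q (\<theta> x)" by (auto simp: K_def glue_def first_coords_def)
    show "K x \<in> OL" using l b B1R mR unfolding OL_def K_def by auto
    have "L (K x) = glue ?q (K x) (last_coords ?q (\<theta> x))" unfolding L_def l using b B1(3) by simp
    also have "\<dots> = \<theta> x" by (auto simp: K_def glue_def last_coords_def)
    finally show "L (K x) = \<theta> x" .
  qed
  have yU1: "y \<in> U1" using y yB by (auto simp: U1_def)
  have Ky: "K y \<in> O1" using K_OL[OF yU1] y by (auto simp: O1_def)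
  obtain e where e: "e > 0" "box_nbhd ?n (K y) e \<subseteq> O1" using open_contains_box[OF O1o Ky] .
  \<comment> \<open>A box is at once a product and convex in the leafwise factor.\<close>
  define Bx where "Bx = box_nbhd ?n (K y) e"
  define U' where "U' = {x \<in> U1. K x \<in> Bx}"
  have KyR: "K y \<in> Rn ?n" using K_OL(1)[OF yU1] by (simp add: OL_def)
  have yU': "y \<in> U'" using yU1 e(1) KyR by (auto simp: U'_def Bx_def box_nbhd_def)
  have KU': "K ` U' = Bx" and invK: "\<And>w. w \<in> Bx \<Longrightarrow> L w \<in> \<theta> ` U \<and> inv_into U \<theta> (L w) \<in> U' \<and> K (inv_into U \<theta> (L w)) = w"
  proof -
    show *: "L w \<in> \<theta> ` U \<and> inv_into U \<theta> (L w) \<in> U' \<and> K (inv_into U \<theta> (L w)) = w" if w: "w \<in> Bx" for w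
    proof -
      have w1: "w \<in> OL" "L w \<in> \<theta> ` (U \<inter> V)" using w e(2) by (auto simp: Bx_def O1_def)
      then obtain x where x: "x \<in> U \<inter> V" "L w = \<theta> x" by auto
      have ix: "inv_into U \<theta> (L w) = x" using x chart_inj[OF ch] by simp
      have lw: "last_coords ?q w \<in> \<kappa> ` B1" using w1(1) by (simp add: OL_def)
      have lx: "last_coords ?q (\<theta> x) = inv_into B1 \<kappa> (last_coords ?q w)" using LB[of w] x(2) by simp
      have xU1: "x \<in> U1" using x(1) lx inv_into_into[OF lw] by (auto simp: U1_def)
      have "K x = glue ?q (L w) (last_coords ?q w)" unfolding K_def lx using f_inv_into_f[OF lw] x(2) by simp
      also have "\<dots> = w" by (auto simp: L_def glue_def last_coords_def)
      finally have "K x = w" .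
      then show ?thesis using ix xU1 w x by (auto simp: U'_def)
    qed
    show "K ` U' = Bx"
    proof
      show "K ` U' \<subseteq> Bx" by (auto simp: U'_def)
      show "Bx \<subseteq> K ` U'" using * by (metis image_eqI subsetI)
    qed
  qed
  have U'U: "U' \<subseteq> U1" "U' \<subseteq> U" by (auto simp: U'_def U1_def)
  have injK: "inj_on K U'"
  proof (rule inj_onI)
    fix a b assume ab: "a \<in> U'" "b \<in> U'" "K a = K b"
    have "L (K a) = \<theta> a" "L (K b) = \<theta> b" using K_OL(4) ab(1,2) U'U(1) by blast+
    then have "\<theta> a = \<theta> b" using ab(3) by simp
    then show "a = b" using chart_inj[OF ch] ab U'U by (auto dest: inj_onD)
  qed
  have inv_K: "inv_into U' K w = inv_into U \<theta> (L w)" if "w \<in> Bx" for w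
    using invK[OF that] injK by (metis inv_into_f_f)
  have tU1: "topspace (subtopology ?X U1) = U1" using openin_subset[OF U1o] by (rule topspace_subtopology_subset)
  have \<theta>c: "continuous_map (subtopology ?X U1) (Euclidean_space ?n) \<theta>"
    using continuous_map_from_subtopology_mono[OF chart_continuous[OF ch]] by (auto simp: U1_def)
  have Kc: "continuous_map (subtopology ?X U1) (Euclidean_space ?n) K"
    unfolding K_def
  proof (rule glue_c[OF \<theta>c])
    have "continuous_map (subtopology ?X U1) (Euclidean_space ?p) (\<lambda>x. last_coords ?q (\<theta> x))"
      using continuous_map_compose[OF \<theta>c last_c] by (simp add: o_def)
    then have "continuous_map (subtopology ?X U1) (subtopology (Euclidean_space ?p) B1) (\<lambda>x. last_coords ?q (\<theta> x))"
      unfolding continuous_map_in_subtopology tU1 by (auto simp: U1_def)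
    from continuous_map_compose[OF this \<kappa>c]
    show "continuous_map (subtopology ?X U1) (Euclidean_space ?p) (\<lambda>x. \<kappa> (last_coords ?q (\<theta> x)))" by (simp add: o_def)
  qed
  have Bxo: "openin (Euclidean_space ?n) Bx" unfolding Bx_def by (rule openin_box_nbhd)
  have U'o: "openin ?X U'"
    using openin_continuous_map_preimage[OF Kc Bxo] U1o openin_trans_full unfolding tU1 U'_def by blast
  have tU': "topspace (subtopology ?X U') = U'" using openin_subset[OF U'o] by (rule topspace_subtopology_subset)
  have tBx: "topspace (subtopology (Euclidean_space ?n) Bx) = Bx" using open_Rn_subset[OF Bxo] by auto
  have "homeomorphic_maps (subtopology ?X U') (subtopology (Euclidean_space ?n) Bx) K (\<lambda>w. inv_into U \<theta> (L w))"
    unfolding homeomorphic_maps_def tU' tBx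
  proof (intro conjI ballI)
    show "continuous_map (subtopology ?X U') (subtopology (Euclidean_space ?n) Bx) K"
      unfolding continuous_map_in_subtopology tU'
      using continuous_map_from_subtopology_mono[OF Kc U'U(1)] by (auto simp: U'_def)
    have "continuous_map (subtopology (Euclidean_space ?n) Bx) (Euclidean_space ?n) L"
      by (rule continuous_map_from_subtopology_mono[OF Lc]) (use e(2) in \<open>auto simp: Bx_def O1_def\<close>)
    then have "continuous_map (subtopology (Euclidean_space ?n) Bx) (subtopology (Euclidean_space ?n) (\<theta> ` U)) L"
      unfolding continuous_map_in_subtopology tBx using invK by auto
    from continuous_map_compose[OF this chart_inv_continuous[OF ch]]
    show "continuous_map (subtopology (Euclidean_space ?n) Bx) (subtopology ?X U') (\<lambda>w. inv_into U \<theta> (L w))"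
      unfolding continuous_map_in_subtopology tBx using invK by (simp add: o_def)
    show "inv_into U \<theta> (L (K x)) = x" if "x \<in> U'" for x
    proof -
      have "L (K x) = \<theta> x" "x \<in> U" using K_OL(4) that U'U by blast+
      then show ?thesis using chart_inj[OF ch] by simp
    qed
    show "K (inv_into U \<theta> (L w)) = w" if "w \<in> Bx" for w using invK[OF that] by simp
  qed
  then have chart': "is_chart ?X ?n (U', K)"
    unfolding is_chart_def using U'o Bxo KU' homeomorphic_map_maps by auto
  have compat: "Cr_compatible r ?n (U', K) (U2, \<theta>2)" if c2: "(U2, \<theta>2) \<in> atlas N" for U2 \<theta>2
  proof -
    note ch2 = atlas_is_chart[OF NM c2]
    have oi: "openin ?X (U' \<inter> U2)" using U'o chart_openin[OF ch2] by (rule openin_Int)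
    have o1: "openin (Euclidean_space ?n) (K ` (U' \<inter> U2))" by (rule chart_image_open[OF chart' oi]) auto
    have o2: "openin (Euclidean_space ?n) (\<theta>2 ` (U' \<inter> U2))" by (rule chart_image_open[OF ch2 oi]) auto
    have "Ck k ?n (K ` (U' \<inter> U2)) (\<lambda>w. \<theta>2 (inv_into U' K w) j)" if k: "enat k \<le> r" and j: "j < ?n" for k j
    proof -
      have wB: "w \<in> Bx" "inv_into U' K w \<in> U' \<inter> U2" "w \<in> Rn ?n" if "w \<in> K ` (U' \<inter> U2)" for w
        using that injK open_Rn_subset[OF o1] by (auto simp: U'_def)
      have LC: "Ck k ?n (K ` (U' \<inter> U2)) (\<lambda>w. L w i)" if i: "i < ?n" for i
      proof (cases "i < ?q")
        case True
        then show ?thesis using Ck_coord[OF o1] by (simp add: L_def glue_def)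
      next
        case False
        have "Ck k ?n (K ` (U' \<inter> U2)) (\<lambda>w. inv_into B1 \<kappa> (last_coords ?q w) (i - ?q))"
        proof (rule Ck_last_coords[OF o1 B1(2) _ n Ck_coord[OF o1] \<kappa>'[OF k]])
          show "w \<in> Rn ?n \<and> last_coords ?q w \<in> \<kappa> ` B1" if "w \<in> K ` (U' \<inter> U2)" for w
            using wB[OF that] e(2) by (auto simp: Bx_def O1_def OL_def)
        qed (use False i n in auto)
        then show ?thesis using False by (simp add: L_def glue_def)
      qed
      have "Ck k ?n (K ` (U' \<inter> U2)) (\<lambda>w. \<theta>2 (inv_into U \<theta> (L w)) j)"
      proof (rule Ck_compose[OF o1 transition_openin[OF NM ca c2] _ LC transition_Ck[OF NM ca c2 k j]])
        fix w assume w: "w \<in> K ` (U' \<inter> U2)"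
        have "\<theta> (inv_into U \<theta> (L w)) = L w" using invK[OF wB(1)[OF w]] by (auto intro: f_inv_into_f)
        moreover have "inv_into U \<theta> (L w) \<in> U \<inter> U2" using wB(2)[OF w] inv_K[OF wB(1)[OF w]] U'U by auto
        ultimately show "L w \<in> \<theta> ` (U \<inter> U2)" by (metis imageI)
      qed
      then show ?thesis by (rule Ck_cong[OF o1, rotated]) (simp add: inv_K wB(1))
    qed
    moreover have "Ck k ?n (\<theta>2 ` (U' \<inter> U2)) (\<lambda>z. K (inv_into U2 \<theta>2 z) j)" if k: "enat k \<le> r" and j: "j < ?n" for k j
    proof -
      have zU: "inv_into U2 \<theta>2 z \<in> U' \<inter> U2" if "z \<in> \<theta>2 ` (U' \<inter> U2)" for z
        using that chart_inj[OF ch2] by auto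
      have sub: "\<theta>2 ` (U' \<inter> U2) \<subseteq> \<theta>2 ` (U2 \<inter> U)" using U'U by auto
      have T: "Ck k ?n (\<theta>2 ` (U' \<inter> U2)) (\<lambda>z. \<theta> (inv_into U2 \<theta>2 z) i)" if "i < ?n" for i
        using Ck_subset[OF transition_Ck[OF NM c2 ca k that] sub] .
      show ?thesis
      proof (cases "j < ?q")
        case True
        then show ?thesis using T[OF j] by (simp add: K_def glue_def)
      next
        case False
        have "Ck k ?n (\<theta>2 ` (U' \<inter> U2)) (\<lambda>z. \<kappa> (last_coords ?q (\<theta> (inv_into U2 \<theta>2 z))) (j - ?q))"
        proof (rule Ck_last_coords[OF o2 B1(1) _ n T \<kappa>[OF k]])
          show "\<theta> (inv_into U2 \<theta>2 z) \<in> Rn ?n \<and> last_coords ?q (\<theta> (inv_into U2 \<theta>2 z)) \<in> B1" if "z \<in> \<theta>2 ` (U' \<inter> U2)" for z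
            using zU[OF that] U'U \<theta>R by (auto simp: U1_def)
        qed (use False j n in auto)
        then show ?thesis using False by (simp add: K_def glue_def)
      qed
    qed
    ultimately show ?thesis
      unfolding Cr_compatible_def
      by (simp add: Cr_on_iff[OF open_Rn_subset[OF o1]] Cr_on_iff[OF open_Rn_subset[OF o2]] o_def)
  qed
  have inA: "(U', K) \<in> atlas N"
  proof -
    have "\<forall>c. is_chart ?X ?n c \<and> (\<forall>c'\<in>atlas N. Cr_compatible r ?n c c') \<longrightarrow> c \<in> atlas N"
      using NM[unfolded Cr_manifold_def] by (elim conjE)
    then show ?thesis using chart' compat by (metis prod.exhaust_sel)
  qed
  have proj: "local_projection N (U', K) x = local_projection N (U, \<theta>) x" if "x \<in> U'" for x
    using K_OL(3)[of x] that U'U by (auto simp: local_projection_def)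
  have pi: "product_image N (U', K) (box_nbhd ?q (first_coords ?q (K y)) e) (box_nbhd ?p (last_coords ?q (K y)) e)"
    unfolding product_image_def
    using openin_box_nbhd convex_points_box KU' coord_product_box[OF n KyR] by (auto simp: Bx_def)
  have pc: "plaque_compatible N (U', K) c2 \<and> plaque_compatible N c2 (U', K)" if c2: "c2 \<in> fcharts N" for c2
  proof -
    have "plaque_compatible N (U, \<theta>) c2" "plaque_compatible N c2 (U, \<theta>)" using fcharts_plaque[OF NF] c c2 by auto
    then have A: "\<And>x. x \<in> U \<inter> fst c2 \<Longrightarrow> \<exists>W. openin ?X W \<and> x \<in> W \<and> W \<subseteq> U \<inter> fst c2 \<and>
        (\<forall>y\<in>W. \<forall>z\<in>W. local_projection N (U, \<theta>) y = local_projection N (U, \<theta>) z \<longrightarrow>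
           local_projection N c2 y = local_projection N c2 z)"
      and B: "\<And>x. x \<in> U \<inter> fst c2 \<Longrightarrow> \<exists>W. openin ?X W \<and> x \<in> W \<and> W \<subseteq> fst c2 \<inter> U \<and>
        (\<forall>y\<in>W. \<forall>z\<in>W. local_projection N c2 y = local_projection N c2 z \<longrightarrow>
           local_projection N (U, \<theta>) y = local_projection N (U, \<theta>) z)"
      unfolding plaque_compatible_def by auto
    show ?thesis unfolding plaque_compatible_def fst_conv
    proof (intro conjI ballI)
      fix x assume x: "x \<in> U' \<inter> fst c2"
      then have xU: "x \<in> U \<inter> fst c2" using U'U(2) by blast
      obtain W where W: "openin ?X W" "x \<in> W" "W \<subseteq> U \<inter> fst c2"
        "\<And>y z. y\<in>W \<Longrightarrow> z\<in>W \<Longrightarrow> local_projection N (U, \<theta>) y = local_projection N (U, \<theta>) z \<Longrightarrow>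
           local_projection N c2 y = local_projection N c2 z" using A[OF xU] by (elim exE conjE) blast
      show "\<exists>W. openin ?X W \<and> x \<in> W \<and> W \<subseteq> U' \<inter> fst c2 \<and>
        (\<forall>y\<in>W. \<forall>z\<in>W. local_projection N (U', K) y = local_projection N (U', K) z \<longrightarrow>
           local_projection N c2 y = local_projection N c2 z)"
      proof (intro exI[of _ "W \<inter> U'"] conjI ballI impI)
        fix y z assume yz: "y \<in> W \<inter> U'" "z \<in> W \<inter> U'" "local_projection N (U', K) y = local_projection N (U', K) z"
        then have "local_projection N (U, \<theta>) y = local_projection N (U, \<theta>) z" using proj by simp
        then show "local_projection N c2 y = local_projection N c2 z" using W(4) yz by blast
      qed (use W(2,3) x openin_Int[OF W(1) U'o] in auto)
    next
      fix x assume x: "x \<in> fst c2 \<inter> U'"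
      then have xU: "x \<in> U \<inter> fst c2" using U'U(2) by blast
      obtain W where W: "openin ?X W" "x \<in> W" "W \<subseteq> fst c2 \<inter> U"
        "\<And>y z. y\<in>W \<Longrightarrow> z\<in>W \<Longrightarrow> local_projection N c2 y = local_projection N c2 z \<Longrightarrow>
           local_projection N (U, \<theta>) y = local_projection N (U, \<theta>) z" using B[OF xU] by (elim exE conjE) blast
      show "\<exists>W. openin ?X W \<and> x \<in> W \<and> W \<subseteq> fst c2 \<inter> U' \<and>
        (\<forall>y\<in>W. \<forall>z\<in>W. local_projection N c2 y = local_projection N c2 z \<longrightarrow>
           local_projection N (U', K) y = local_projection N (U', K) z)"
      proof (intro exI[of _ "W \<inter> U'"] conjI ballI impI)
        fix y z assume yz: "y \<in> W \<inter> U'" "z \<in> W \<inter> U'" "local_projection N c2 y = local_projection N c2 z"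
        then have "local_projection N (U, \<theta>) y = local_projection N (U, \<theta>) z" using W(4) by blast
        then show "local_projection N (U', K) y = local_projection N (U', K) z" using yz proj by simp
      qed (use W(2,3) x openin_Int[OF W(1) U'o] in auto)
    qed
  qed
  have "(U', K) \<in> fcharts N"
  proof -
    have "\<forall>c\<in>atlas N. (\<exists>T B. product_image N c T B) \<and>
        (\<forall>c'\<in>fcharts N. plaque_compatible N c c' \<and> plaque_compatible N c' c) \<longrightarrow> c \<in> fcharts N"
      using NF[unfolded Cr_foliation_def] by (elim conjE)
    then show ?thesis using inA pi pc by blast
  qed
  then show ?thesis using yU' U'U(1) unfolding K_def U1_def by blast
qed

text \<open>\<open>new_fchart\<close> with the identity as change of coordinates.\<close>

lemma shrink_fchart:
  assumes NF: "Cr_foliation r N" and y: "y \<in> V" and V: "openin (base_space N) V"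
  obtains U \<theta> where "(U, \<theta>) \<in> fcharts N" "y \<in> U" "U \<subseteq> V"
proof -
  have "y \<in> \<Union> (fst ` fcharts N)" using fcharts_cover[OF NF] y openin_subset[OF V] by auto
  then obtain U0 \<theta>0 where c: "(U0, \<theta>0) \<in> fcharts N" "y \<in> U0" by auto
  have ch: "is_chart (base_space N) (mdim N) (U0, \<theta>0)"
    using atlas_is_chart[OF foliation_manifold[OF NF]] c fcharts_atlas[OF NF] by auto
  have "\<theta>0 y \<in> Rn (codim N + ldim N)"
    using open_Rn_subset[OF chart_image_openin[OF ch]] c foliation_dim[OF NF] by auto
  then have yl: "last_coords (codim N) (\<theta>0 y) \<in> Rn (ldim N)" by (rule last_coords_Rn)
  let ?i = "\<lambda>z::point. z"
  have inv: "inv_into (Rn (ldim N)) ?i z = z" if "z \<in> Rn (ldim N)" for z using that by (simp add: inv_into_f_eq inj_on_def)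
  have "Ck k (ldim N) (?i ` Rn (ldim N)) (\<lambda>z. inv_into (Rn (ldim N)) ?i z i)" for k i
    using Ck_cong[OF openin_Rn _ Ck_coord[OF openin_Rn, of k "ldim N" i]] inv by simp
  then obtain U' where "y \<in> U'" "U' \<subseteq> {x \<in> U0 \<inter> V. last_coords (codim N) (\<theta>0 x) \<in> Rn (ldim N)}"
    "(U', \<lambda>x. glue (codim N) (\<theta>0 x) (?i (last_coords (codim N) (\<theta>0 x)))) \<in> fcharts N"
    using new_fchart[OF NF c y V openin_Rn _ _ _ _ yl, of ?i] Ck_coord[OF openin_Rn] openin_Rn by auto
  then show ?thesis using that by blast
qed

text \<open>Only the leafwise factor of \<open>A\<close> is straightened, to the vanishing of the
  coordinates from \<open>e\<close> on. The bound \<open>codim N \<le> e\<close> says that these are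
  leafwise coordinates, which a perturbation may move; the transverse factor \<open>T0\<close> stays
  an arbitrary set.\<close>

definition straight_chart where
  "straight_chart N A e c \<longleftrightarrow> c \<in> fcharts N \<and> codim N \<le> e \<and> e \<le> mdim N \<and>
    (\<exists>T0. \<forall>x\<in>fst c. x \<in> A \<longleftrightarrow> first_coords (codim N) (snd c x) \<in> T0 \<and> (\<forall>i\<ge>e. snd c x i = 0))"

text \<open>A clean chart shows \<open>A\<close> as a product. A slice chart of the leafwise factor
  \<open>B0\<close>, used as change of leafwise coordinates, straightens it; \<open>e\<close> is the
  codimension of the foliation plus the dimension of \<open>B0\<close>.\<close>

lemma ex_straight_chart:
  assumes NF: "Cr_foliation r N" and cl: "clean_intersection r N A" and y: "y \<in> A"
  shows "\<exists>c e. straight_chart N A e c \<and> y \<in> fst c"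
proof -
  let ?q = "codim N" and ?p = "ldim N" and ?n = "mdim N"
  obtain U \<theta> T0 B0 dB where c: "(U, \<theta>) \<in> fcharts N" "y \<in> U"
    and B0: "regular_submanifold (Euclidean_manifold r ?p) dB B0" and A: "\<theta> ` (U \<inter> A) = coord_product ?q T0 B0"
    using bspec[OF cl[unfolded clean_intersection_def] y] by (auto split: prod.splits)
  have ch: "is_chart (base_space N) ?n (U, \<theta>)"
    using atlas_is_chart[OF foliation_manifold[OF NF]] c fcharts_atlas[OF NF] by auto
  have AU: "x \<in> A \<longleftrightarrow> first_coords ?q (\<theta> x) \<in> T0 \<and> last_coords ?q (\<theta> x) \<in> B0" if "x \<in> U" for x
  proof -
    have "x \<in> A \<longleftrightarrow> \<theta> x \<in> \<theta> ` (U \<inter> A)" using that chart_inj[OF ch] by (auto dest: inj_onD)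
    then show ?thesis unfolding A by (simp add: coord_product_def)
  qed
  have yB0: "last_coords ?q (\<theta> y) \<in> B0" using AU[OF c(2)] y by simp
  obtain B1 \<kappa> where sl: "(B1, \<kappa>) \<in> slice_charts (Euclidean_manifold r ?p) dB B0" "last_coords ?q (\<theta> y) \<in> B1"
    using B0 yB0 unfolding regular_submanifold_def by fast
  have dB: "dB \<le> ?p" using B0 by (simp add: regular_submanifold_def Euclidean_manifold_def)
  have \<kappa>: "is_chart (Euclidean_space ?p) ?p (B1, \<kappa>)" "Cr_compatible r ?p (B1, \<kappa>) (Rn ?p, \<lambda>z. z)"
    "\<kappa> ` (B1 \<inter> B0) = \<kappa> ` B1 \<inter> {z. \<forall>i\<ge>dB. z i = 0}"
    using sl(1) by (auto simp: slice_charts_def Euclidean_manifold_def)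
  have B1: "openin (Euclidean_space ?p) B1" "openin (Euclidean_space ?p) (\<kappa> ` B1)" "inj_on \<kappa> B1"
    using chart_openin[OF \<kappa>(1)] chart_image_openin[OF \<kappa>(1)] chart_inj[OF \<kappa>(1)] by auto
  have int: "B1 \<inter> Rn ?p = B1" using open_Rn_subset[OF B1(1)] by auto
  have inv: "inv_into (Rn ?p) (\<lambda>z. z) z = z" if "z \<in> B1" for z
    using that open_Rn_subset[OF B1(1)] by (auto intro!: inv_into_f_eq)
  have cr: "Cr_on r ?p ?p (\<kappa> ` B1) ((\<lambda>z. z) \<circ> inv_into B1 \<kappa>)" "Cr_on r ?p ?p ((\<lambda>z. z) ` B1) (\<kappa> \<circ> inv_into (Rn ?p) (\<lambda>z. z))"
    using \<kappa>(2) unfolding Cr_compatible_def split int by auto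
  have k1: "Ck k ?p (\<kappa> ` B1) (\<lambda>z. inv_into B1 \<kappa> z i)" if "enat k \<le> r" "i < ?p" for k i
    using cr(1) that unfolding Cr_on_iff[OF open_Rn_subset[OF B1(2)]] by (simp add: o_def)
  have k2: "Ck k ?p B1 (\<lambda>z. \<kappa> z i)" if "enat k \<le> r" "i < ?p" for k i
  proof -
    have "Ck k ?p B1 (\<lambda>z. \<kappa> (inv_into (Rn ?p) (\<lambda>z. z) z) i)"
      using cr(2) that unfolding image_ident Cr_on_iff[OF open_Rn_subset[OF B1(1)]] by (simp add: o_def)
    then show ?thesis by (rule Ck_cong[OF B1(1), rotated]) (simp add: inv)
  qed
  have yt: "y \<in> topspace (base_space N)" using openin_subset[OF chart_openin[OF ch]] c by auto
  let ?K = "\<lambda>x. glue ?q (\<theta> x) (\<kappa> (last_coords ?q (\<theta> x)))"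
  obtain U' where U': "y \<in> U'" "U' \<subseteq> {x \<in> U \<inter> topspace (base_space N). last_coords ?q (\<theta> x) \<in> B1}" "(U', ?K) \<in> fcharts N"
    using new_fchart[OF NF c yt openin_topspace B1 k2 k1 sl(2)] by blast
  have "straight_chart N A (?q + dB) (U', ?K)"
    unfolding straight_chart_def fst_conv snd_conv
  proof (intro conjI exI[of _ T0] ballI)
    show "?q + dB \<le> ?n" using dB foliation_dim[OF NF] by simp
    fix x assume x: "x \<in> U'"
    then have xU: "x \<in> U" "last_coords ?q (\<theta> x) \<in> B1" using U'(2) by auto
    let ?b = "last_coords ?q (\<theta> x)"
    have f: "first_coords ?q (?K x) = first_coords ?q (\<theta> x)" by (auto simp: glue_def first_coords_def)
    have "?b \<in> B0 \<longleftrightarrow> \<kappa> ?b \<in> \<kappa> ` (B1 \<inter> B0)" using xU(2) B1(3) by (auto dest: inj_onD)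
    also have "\<dots> \<longleftrightarrow> (\<forall>i\<ge>dB. \<kappa> ?b i = 0)" unfolding \<kappa>(3) using xU(2) by auto
    also have "\<dots> \<longleftrightarrow> (\<forall>i\<ge>?q + dB. ?K x i = 0)"
    proof (intro iffI allI impI)
      fix i assume "\<forall>i\<ge>dB. \<kappa> ?b i = 0" "?q + dB \<le> i"
      then show "?K x i = 0" by (auto simp: glue_def)
    next
      fix i assume a: "\<forall>i\<ge>?q + dB. ?K x i = 0" "dB \<le> i"
      then have "?K x (?q + i) = 0" by auto
      then show "\<kappa> ?b i = 0" by (simp add: glue_def)
    qed
    finally show "x \<in> A \<longleftrightarrow> first_coords ?q (?K x) \<in> T0 \<and> (\<forall>i\<ge>?q + dB. ?K x i = 0)"
      using AU[OF xU(1)] f by simp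
  qed (use U' in auto)
  then show ?thesis using U'(1) by (intro exI[of _ "(U', ?K)"] exI[of _ "?q + dB"]) simp
qed

section \<open>Tangent vectors and transversality\<close>


lemma C1_chain:
  assumes V: "openin (Euclidean_space n) V" and f: "Ck 1 n V f"
    and c: "\<forall>\<^sub>F t in nhds t0. c t \<in> V"
    and d: "\<And>j. j < n \<Longrightarrow> \<forall>\<^sub>F t in nhds t0. ((\<lambda>s. c s j) has_real_derivative d j t) (at t)"
    and dc: "\<And>j. j < n \<Longrightarrow> isCont (d j) t0"
  shows "\<forall>\<^sub>F t in nhds t0. ((\<lambda>s. f (c s)) has_real_derivative (\<Sum>j<n. partial_deriv j f (c t) * d j t)) (at t)"
    and "isCont (\<lambda>t. \<Sum>j<n. partial_deriv j f (c t) * d j t) t0"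
proof -
  have all: "\<forall>\<^sub>F t in nhds t0. \<forall>j\<in>{..<n}. ((\<lambda>s. c s j) has_real_derivative d j t) (at t)"
    by (intro eventually_ball_finite ballI d) auto
  have "\<forall>\<^sub>F t in nhds t0. \<forall>\<^sub>F s in nhds t. c s \<in> V" using c by (simp add: eventually_eventually)
  with all show "\<forall>\<^sub>F t in nhds t0. ((\<lambda>s. f (c s)) has_real_derivative (\<Sum>j<n. partial_deriv j f (c t) * d j t)) (at t)"
  proof eventually_elim
    case (elim t)
    then show ?case by (intro chain_rule_curve[OF V f]) (auto dest: eventually_nhds_x_imp_x)
  qed
  have c0: "c t0 \<in> V" using c by (rule eventually_nhds_x_imp_x)
  have cl: "(c \<longlongrightarrow> c t0) (at t0)"
  proof (rule tendsto_pointwise)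
    fix i
    show "((\<lambda>s. c s i) \<longlongrightarrow> c t0 i) (at t0)"
    proof (cases "i < n")
      case True
      have "((\<lambda>s. c s i) has_real_derivative d i t0) (at t0)" using d[OF True] by (rule eventually_nhds_x_imp_x)
      then show ?thesis using DERIV_isCont isCont_def by blast
    next
      case False
      have "\<forall>\<^sub>F s in nhds t0. c s i = c t0 i"
        using c
      proof eventually_elim
        case (elim s)
        then have "c s \<in> Rn n" "c t0 \<in> Rn n" using c0 open_Rn_subset[OF V] by auto
        then show ?case using False by (simp add: Rn_def)
      qed
      then have "\<forall>\<^sub>F s in at t0. c s i = c t0 i" by (auto simp: eventually_at_filter elim: eventually_mono)
      then show ?thesis by (rule tendsto_eventually)
    qed
  qed
  have "\<forall>\<^sub>F t in at t0. c t \<in> V" using c by (auto simp: eventually_at_filter elim: eventually_mono)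
  then have "isCont (\<lambda>t. partial_deriv j f (c t)) t0" if "j < n" for j
    unfolding isCont_def using f that by (intro continuous_on_tendsto_compose[OF _ cl c0]) auto
  then show "isCont (\<lambda>t. \<Sum>j<n. partial_deriv j f (c t) * d j t) t0"
    using dc by (intro continuous_intros) auto
qed

abbreviation "I1 \<equiv> {-1<..<1::real}"

lemma curve_eventually:
  assumes \<gamma>: "continuous_map (top_of_set I1) X \<gamma>" and V: "openin X V" and t: "t0 \<in> I1" "\<gamma> t0 \<in> V"
  shows "\<forall>\<^sub>F t in nhds t0. t \<in> I1 \<and> \<gamma> t \<in> V"
proof -
  have "openin (top_of_set I1) {t \<in> topspace (top_of_set I1). \<gamma> t \<in> V}"
    by (rule openin_continuous_map_preimage[OF \<gamma> V])
  then have "open {t \<in> I1. \<gamma> t \<in> V}" using openin_open_eq[of I1] by simp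
  from eventually_nhds_in_open[OF this, of t0] t show ?thesis by auto
qed

lemma C1_curve_deriv:
  assumes \<gamma>: "C1_curve N X \<gamma>" and c: "(U, \<theta>) \<in> atlas N" and U: "openin (base_space N) U"
    and t: "t0 \<in> I1" "\<gamma> t0 \<in> U" and i: "i < mdim N"
  shows "\<forall>\<^sub>F t in nhds t0. ((\<lambda>s. \<theta> (\<gamma> s) i) has_real_derivative deriv (\<lambda>s. \<theta> (\<gamma> s) i) t) (at t)"
    and "isCont (deriv (\<lambda>s. \<theta> (\<gamma> s) i)) t0"
proof -
  let ?J = "{t\<in>I1. \<gamma> t \<in> U}"
  have \<gamma>c: "continuous_map (top_of_set I1) (base_space N) \<gamma>" using \<gamma> by (simp add: C1_curve_def)
  have d: "\<And>t. t \<in> ?J \<Longrightarrow> (\<lambda>s. \<theta> (\<gamma> s) i) differentiable (at t)" and ct: "continuous_on ?J (deriv (\<lambda>s. \<theta> (\<gamma> s) i))"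
    using \<gamma> c i unfolding C1_curve_def Let_def by fast+
  have ev: "\<forall>\<^sub>F t in nhds t0. t \<in> ?J" using curve_eventually[OF \<gamma>c U t] by simp
  then show "\<forall>\<^sub>F t in nhds t0. ((\<lambda>s. \<theta> (\<gamma> s) i) has_real_derivative deriv (\<lambda>s. \<theta> (\<gamma> s) i) t) (at t)"
    by eventually_elim (use d DERIV_deriv_iff_real_differentiable in blast)
  have "open ?J"
    using openin_continuous_map_preimage[OF \<gamma>c U] openin_open_eq[of I1] by simp
  then show "isCont (deriv (\<lambda>s. \<theta> (\<gamma> s) i)) t0" using ct t continuous_on_eq_continuous_at by blast
qed

text \<open>The definition tests all charts. One chart around each time is enough because transition
  maps are $C^1$, which is where \<open>1 \<le> r\<close> enters.\<close>

lemma C1_curveI: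
  assumes N: "Cr_manifold r N" and r: "1 \<le> r" and \<gamma>: "continuous_map (top_of_set I1) (base_space N) \<gamma>"
    and loc: "\<And>t0. t0 \<in> I1 \<Longrightarrow> \<exists>U1 \<theta>1 d. (U1, \<theta>1) \<in> atlas N \<and> \<gamma> t0 \<in> U1 \<and>
      (\<forall>j<mdim N. (\<forall>\<^sub>F t in nhds t0. ((\<lambda>s. \<theta>1 (\<gamma> s) j) has_real_derivative d j t) (at t)) \<and> isCont (d j) t0)"
  shows "C1_curve N (base_space N) \<gamma>"
proof -
  let ?n = "mdim N"
  have main: "(\<lambda>s. \<theta> (\<gamma> s) i) differentiable (at t0) \<and> isCont (deriv (\<lambda>s. \<theta> (\<gamma> s) i)) t0"
    if c: "(U, \<theta>) \<in> atlas N" and i: "i < ?n" and t0: "t0 \<in> I1" "\<gamma> t0 \<in> U" for U \<theta> i t0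
  proof -
    obtain U1 \<theta>1 d where c1: "(U1, \<theta>1) \<in> atlas N" "\<gamma> t0 \<in> U1"
      and d: "\<And>j. j < ?n \<Longrightarrow> \<forall>\<^sub>F t in nhds t0. ((\<lambda>s. \<theta>1 (\<gamma> s) j) has_real_derivative d j t) (at t)"
        "\<And>j. j < ?n \<Longrightarrow> isCont (d j) t0"
      using loc[OF t0(1)] by blast
    note ch = atlas_is_chart[OF N c] and ch1 = atlas_is_chart[OF N c1(1)]
    let ?f = "\<lambda>z. \<theta> (inv_into U1 \<theta>1 z) i"
    have f: "Ck 1 ?n (\<theta>1 ` (U1 \<inter> U)) ?f"
      using transition_Ck[OF N c1(1) c _ i, of 1] r by (simp add: one_enat_def)
    have ev: "\<forall>\<^sub>F t in nhds t0. \<gamma> t \<in> U1 \<inter> U"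
      using curve_eventually[OF \<gamma> openin_Int[OF chart_openin[OF ch1] chart_openin[OF ch]] t0(1)] c1 t0
      by (auto elim: eventually_mono)
    have ev': "\<forall>\<^sub>F t in nhds t0. \<theta>1 (\<gamma> t) \<in> \<theta>1 ` (U1 \<inter> U)" using ev by eventually_elim auto
    let ?D = "\<lambda>t. \<Sum>j<?n. partial_deriv j ?f (\<theta>1 (\<gamma> t)) * d j t"
    have ch: "\<forall>\<^sub>F t in nhds t0. ((\<lambda>s. ?f (\<theta>1 (\<gamma> s))) has_real_derivative ?D t) (at t)" "isCont ?D t0"
      by (rule C1_chain[OF transition_openin[OF N c1(1) c] f ev' d]; assumption)+
    have "\<forall>\<^sub>F t in nhds t0. \<forall>\<^sub>F s in nhds t. \<gamma> s \<in> U1 \<inter> U" using ev by (simp add: eventually_eventually)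
    then have D: "\<forall>\<^sub>F t in nhds t0. ((\<lambda>s. \<theta> (\<gamma> s) i) has_real_derivative ?D t) (at t)"
      using ch(1)
    proof eventually_elim
      case (elim t)
      have "\<forall>\<^sub>F s in nhds t. ?f (\<theta>1 (\<gamma> s)) = \<theta> (\<gamma> s) i"
        using elim(1) by eventually_elim (use chart_inj[OF ch1] in auto)
      then show ?case using elim(2) DERIV_cong_ev[OF refl _ refl, of "\<lambda>s. ?f (\<theta>1 (\<gamma> s))" "\<lambda>s. \<theta> (\<gamma> s) i" t] by blast
    qed
    then have "((\<lambda>s. \<theta> (\<gamma> s) i) has_real_derivative ?D t0) (at t0)" by (rule eventually_nhds_x_imp_x)
    moreover have "\<forall>\<^sub>F t in nhds t0. ?D t = deriv (\<lambda>s. \<theta> (\<gamma> s) i) t"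
      using D by eventually_elim (auto dest: DERIV_imp_deriv)
    then have "isCont (deriv (\<lambda>s. \<theta> (\<gamma> s) i)) t0"
      using ch(2) isCont_cong[of ?D "deriv (\<lambda>s. \<theta> (\<gamma> s) i)" t0] by blast
    ultimately show ?thesis using real_differentiable_def by blast
  qed
  show ?thesis
    unfolding C1_curve_def Let_def
    by (auto simp: \<gamma> intro!: main[THEN conjunct1] continuous_at_imp_continuous_on main[THEN conjunct2])
qed

lemma C1_curve_compose:
  assumes M: "Cr_manifold r M" and N: "Cr_manifold r N" and r: "1 \<le> r" and f: "Cr_map r M N f"
    and \<gamma>: "C1_curve M X \<gamma>"
  shows "C1_curve N (base_space N) (f \<circ> \<gamma>)"
proof (rule C1_curveI[OF N r])
  have \<gamma>c: "continuous_map (top_of_set I1) (base_space M) \<gamma>" using \<gamma> by (simp add: C1_curve_def)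
  have fc: "continuous_map (base_space M) (base_space N) f" using f by (simp add: Cr_map_def)
  show fg: "continuous_map (top_of_set I1) (base_space N) (f \<circ> \<gamma>)" by (rule continuous_map_compose[OF \<gamma>c fc])
  fix t0 assume t0: "t0 \<in> I1"
  have "\<gamma> t0 \<in> topspace (base_space M)" "(f \<circ> \<gamma>) t0 \<in> topspace (base_space N)"
    using continuous_map_image_subset_topspace[OF \<gamma>c] continuous_map_image_subset_topspace[OF fg] t0 by auto
  then obtain U \<theta> U' \<theta>' where c: "(U, \<theta>) \<in> atlas M" "\<gamma> t0 \<in> U" and c': "(U', \<theta>') \<in> atlas N" "(f \<circ> \<gamma>) t0 \<in> U'"
    using atlas_cover[OF M] atlas_cover[OF N] by metis
  note ch = atlas_is_chart[OF M c(1)]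
  let ?D = "{x \<in> U. f x \<in> U'}"
  have O: "openin (base_space M) ?D" "openin (Euclidean_space (mdim M)) (\<theta> ` ?D)" using Cr_map_dom_openin[OF M N f c(1) c'(1)] by auto
  have ev: "\<forall>\<^sub>F t in nhds t0. \<gamma> t \<in> ?D"
    using curve_eventually[OF \<gamma>c O(1) t0] c c' by (auto elim: eventually_mono)
  then have ev': "\<forall>\<^sub>F t in nhds t0. \<theta> (\<gamma> t) \<in> \<theta> ` ?D" by eventually_elim auto
  let ?f = "\<lambda>j z. \<theta>' (f (inv_into U \<theta> z)) j"
  let ?d = "\<lambda>j. deriv (\<lambda>s. \<theta> (\<gamma> s) j)"
  let ?E = "\<lambda>j t. \<Sum>i<mdim M. partial_deriv i (?f j) (\<theta> (\<gamma> t)) * ?d i t"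
  have "(\<forall>\<^sub>F t in nhds t0. ((\<lambda>s. \<theta>' ((f \<circ> \<gamma>) s) j) has_real_derivative ?E j t) (at t)) \<and> isCont (?E j) t0" if j: "j < mdim N" for j
  proof -
    have f1: "Ck 1 (mdim M) (\<theta> ` ?D) (?f j)" using Cr_map_Ck[OF M f c(1) c'(1) _ j, of 1] r by (simp add: one_enat_def)
    have cc: "\<forall>\<^sub>F t in nhds t0. ((\<lambda>s. ?f j (\<theta> (\<gamma> s))) has_real_derivative ?E j t) (at t)" "isCont (?E j) t0"
      by (rule C1_chain[OF O(2) f1 ev', of ?d, OF C1_curve_deriv[OF \<gamma> c(1) chart_openin[OF ch] t0 c(2)]]; assumption)+
    have "\<forall>\<^sub>F t in nhds t0. \<forall>\<^sub>F s in nhds t. \<gamma> s \<in> ?D" using ev by (simp add: eventually_eventually)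
    then have "\<forall>\<^sub>F t in nhds t0. ((\<lambda>s. \<theta>' ((f \<circ> \<gamma>) s) j) has_real_derivative ?E j t) (at t)"
      using cc(1)
    proof eventually_elim
      case (elim t)
      have "\<forall>\<^sub>F s in nhds t. ?f j (\<theta> (\<gamma> s)) = \<theta>' ((f \<circ> \<gamma>) s) j"
        using elim(1) by eventually_elim (use chart_inj[OF ch] in auto)
      then show ?case using elim(2) DERIV_cong_ev[OF refl _ refl, of "\<lambda>s. ?f j (\<theta> (\<gamma> s))" "\<lambda>s. \<theta>' ((f \<circ> \<gamma>) s) j" t] by blast
    qed
    then show ?thesis using cc(2) by blast
  qed
  then show "\<exists>U1 \<theta>1 d. (U1, \<theta>1) \<in> atlas N \<and> (f \<circ> \<gamma>) t0 \<in> U1 \<and>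
      (\<forall>j<mdim N. (\<forall>\<^sub>F t in nhds t0. ((\<lambda>s. \<theta>1 ((f \<circ> \<gamma>) s) j) has_real_derivative d j t) (at t)) \<and> isCont (d j) t0)"
    using c' by (intro exI[of _ U'] exI[of _ \<theta>'] exI[of _ ?E]) simp
qed

text \<open>The tangent vector at \<open>y\<close> with components \<open>\<xi>\<close> in the chart \<open>(U, \<theta>)\<close>.\<close>

definition push :: "('a, 'b) manifold_scheme \<Rightarrow> 'a chart \<Rightarrow> 'a \<Rightarrow> point \<Rightarrow> 'a tangent" where
  "push N c y \<xi> = (\<lambda>c2 i. if c2 \<in> atlas N \<and> y \<in> fst c2 \<and> i < mdim N then
     \<Sum>j<mdim N. partial_deriv j (\<lambda>z. snd c2 (inv_into (fst c) (snd c) z) i) (snd c y) * \<xi> j else 0)"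

lemma push_add: "push N c y (\<lambda>j. \<xi> j + \<eta> j) = (\<lambda>c2 i. push N c y \<xi> c2 i + push N c y \<eta> c2 i)"
  by (auto simp: push_def fun_eq_iff distrib_left sum.distrib)

lemma push_uminus: "push N c y (\<lambda>j. - \<xi> j) = (\<lambda>c2 i. - push N c y \<xi> c2 i)"
  by (auto simp: push_def fun_eq_iff sum_negf)

lemma push_cong: "(\<And>j. j < mdim N \<Longrightarrow> \<xi> j = \<eta> j) \<Longrightarrow> push N c y \<xi> = push N c y \<eta>"
  by (auto simp: push_def fun_eq_iff intro!: sum.cong)

text \<open>A tangent vector lists its components in all charts, but by the chain rule those in one
  chart determine the others. Equality of tangent vectors thus becomes equality of finitely many
  numbers.\<close>

lemma velocity_push:
  assumes N: "Cr_manifold r N" and r: "1 \<le> r" and \<gamma>: "C1_curve N X \<gamma>" and c: "(U, \<theta>) \<in> atlas N" "\<gamma> 0 \<in> U"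
  shows "velocity N \<gamma> = push N (U, \<theta>) (\<gamma> 0) (\<lambda>j. deriv (\<lambda>t. \<theta> (\<gamma> t) j) 0)"
proof (intro ext)
  fix c2 i
  show "velocity N \<gamma> c2 i = push N (U, \<theta>) (\<gamma> 0) (\<lambda>j. deriv (\<lambda>t. \<theta> (\<gamma> t) j) 0) c2 i"
  proof (cases "c2 \<in> atlas N \<and> \<gamma> 0 \<in> fst c2 \<and> i < mdim N")
    case True
    obtain U2 \<theta>2 where eq: "c2 = (U2, \<theta>2)" by fastforce
    have c2: "(U2, \<theta>2) \<in> atlas N" "\<gamma> 0 \<in> U2" and i: "i < mdim N" using True eq by auto
    note ch = atlas_is_chart[OF N c(1)] and ch2 = atlas_is_chart[OF N c2(1)]
    have \<gamma>c: "continuous_map (top_of_set I1) (base_space N) \<gamma>" using \<gamma> by (simp add: C1_curve_def)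
    let ?f = "\<lambda>z. \<theta>2 (inv_into U \<theta> z) i"
    have ev: "\<forall>\<^sub>F t in nhds 0. \<gamma> t \<in> U \<inter> U2"
      using curve_eventually[OF \<gamma>c openin_Int[OF chart_openin[OF ch] chart_openin[OF ch2]], of 0] c c2
      by (auto elim: eventually_mono)
    have f: "Ck 1 (mdim N) (\<theta> ` (U \<inter> U2)) ?f"
      using transition_Ck[OF N c(1) c2(1) _ i, of 1] r by (simp add: one_enat_def)
    have "((\<lambda>t. ?f (\<theta> (\<gamma> t))) has_real_derivative (\<Sum>j<mdim N. partial_deriv j ?f (\<theta> (\<gamma> 0)) * deriv (\<lambda>t. \<theta> (\<gamma> t) j) 0)) (at 0)"
    proof (rule chain_rule_curve[OF transition_openin[OF N c(1) c2(1)] f])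
      show "\<theta> (\<gamma> 0) \<in> \<theta> ` (U \<inter> U2)" using c c2 by auto
      show "\<forall>\<^sub>F s in nhds 0. \<theta> (\<gamma> s) \<in> \<theta> ` (U \<inter> U2)" using ev by eventually_elim auto
      show "((\<lambda>s. \<theta> (\<gamma> s) j) has_real_derivative deriv (\<lambda>t. \<theta> (\<gamma> t) j) 0) (at 0)" if "j < mdim N" for j
        by (rule eventually_nhds_x_imp_x[OF C1_curve_deriv(1)[OF \<gamma> c(1) chart_openin[OF ch] _ c(2) that]]) simp
    qed
    moreover have "\<forall>\<^sub>F t in nhds 0. ?f (\<theta> (\<gamma> t)) = \<theta>2 (\<gamma> t) i"
      using ev by eventually_elim (use chart_inj[OF ch] in auto)
    ultimately have "((\<lambda>t. \<theta>2 (\<gamma> t) i) has_real_derivative (\<Sum>j<mdim N. partial_deriv j ?f (\<theta> (\<gamma> 0)) * deriv (\<lambda>t. \<theta> (\<gamma> t) j) 0)) (at 0)"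
      using DERIV_cong_ev[OF refl _ refl, of "\<lambda>t. ?f (\<theta> (\<gamma> t))" "\<lambda>t. \<theta>2 (\<gamma> t) i" 0] by blast
    from DERIV_imp_deriv[OF this] show ?thesis using True by (simp add: velocity_def push_def eq)
  next
    case False
    then show ?thesis by (auto simp: velocity_def push_def)
  qed
qed

text \<open>In the chart the curve oscillates on a line segment. A coordinate that is 0 at
  \<open>y\<close> and in which \<xi> vanishes is therefore 0 along the whole curve, and this is how
  curves inside \<open>S\<close> or \<open>A\<close> are produced.\<close>

lemma ex_curve:
  assumes N: "Cr_manifold r N" and r: "1 \<le> r" and c: "(U, \<theta>) \<in> atlas N" "y \<in> U"
    and V: "openin (base_space N) V" "y \<in> V" and \<xi>: "\<xi> \<in> Rn (mdim N)"
  obtains \<gamma> where "C1_curve N (base_space N) \<gamma>" "\<gamma> 0 = y"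
    "\<And>t. \<gamma> t \<in> U \<inter> V" "\<And>t. \<exists>s. \<forall>i. \<theta> (\<gamma> t) i = \<theta> y i + s * \<xi> i"
    "velocity N \<gamma> = push N (U, \<theta>) y \<xi>"
proof -
  note ch = atlas_is_chart[OF N c(1)]
  let ?n = "mdim N" and ?O = "\<theta> ` (U \<inter> V)"
  have O: "openin (Euclidean_space ?n) ?O"
    by (rule chart_image_open[OF ch]) (auto intro: openin_Int chart_openin[OF ch] V)
  have yO: "\<theta> y \<in> ?O" using c V by auto
  obtain e where e: "e > 0" "box_nbhd ?n (\<theta> y) e \<subseteq> ?O" using open_contains_box[OF O yO] .
  have yR: "\<theta> y \<in> Rn ?n" using yO open_Rn_subset[OF O] by auto
  define B where "B = 1 + (\<Sum>i<?n. \<bar>\<xi> i\<bar>)"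
  have B: "B \<ge> 1" unfolding B_def by (simp add: sum_nonneg)
  have Bi: "\<bar>\<xi> i\<bar> < B" if "i < ?n" for i
    unfolding B_def using member_le_sum[of i "{..<?n}" "\<lambda>i. \<bar>\<xi> i\<bar>"] that by auto
  define \<delta> where "\<delta> = e / B"
  have \<delta>: "\<delta> > 0" using e B by (simp add: \<delta>_def)
  \<comment> \<open>The factor \<open>\<delta> * sin (t / \<delta>)\<close> has derivative 1 at 0
    and is bounded by \<delta>, so the curve stays in the box for every \<open>t\<close> without any
    rescaling of the velocity.\<close>
  define z where "z t = (\<lambda>i. \<theta> y i + \<delta> * sin (t / \<delta>) * \<xi> i)" for t :: real
  have zb: "z t \<in> box_nbhd ?n (\<theta> y) e" for t
  proof -
    have "\<bar>\<delta> * sin (t / \<delta>) * \<xi> i\<bar> < e" if "i < ?n" for i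
    proof -
      have "\<bar>\<delta> * sin (t / \<delta>) * \<xi> i\<bar> \<le> \<delta> * 1 * \<bar>\<xi> i\<bar>"
        unfolding abs_mult using \<delta> by (intro mult_mono) auto
      also have "\<dots> < \<delta> * B" using Bi[OF that] \<delta> by simp
      also have "\<dots> = e" using B by (simp add: \<delta>_def)
      finally show ?thesis .
    qed
    then show ?thesis using yR \<xi> by (auto simp: z_def box_nbhd_def Rn_def)
  qed
  then have zO: "z t \<in> ?O" for t using e(2) by blast
  have zR: "z t \<in> Rn ?n" for t using zO open_Rn_subset[OF O] by blast
  define \<gamma> where "\<gamma> t = inv_into U \<theta> (z t)" for t
  have \<gamma>: "\<gamma> t \<in> U \<inter> V" "\<theta> (\<gamma> t) = z t" for t
    using zO[of t] chart_inj[OF ch] by (auto simp: \<gamma>_def)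
  have zd: "((\<lambda>s. \<theta> (\<gamma> s) j) has_real_derivative cos (t / \<delta>) * \<xi> j) (at t)" for j t
    unfolding \<gamma>(2) z_def using \<delta> by (auto intro!: derivative_eq_intros)
  have \<gamma>0: "\<gamma> 0 = y" using c chart_inj[OF ch] by (simp add: \<gamma>_def z_def)
  have C1: "C1_curve N (base_space N) \<gamma>"
  proof (rule C1_curveI[OF N r])
    have "continuous_map (top_of_set I1) (Euclidean_space ?n) z"
    proof (rule continuous_map_RnI[OF _ zR])
      show "continuous_map (top_of_set I1) euclideanreal (\<lambda>x. z x i)" for i
        using \<delta> by (auto simp: z_def intro!: continuous_intros)
    qed
    then have "continuous_map (top_of_set I1) (subtopology (Euclidean_space ?n) (\<theta> ` U)) z"
      unfolding continuous_map_in_subtopology using zO by auto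
    from continuous_map_compose[OF this chart_inv_continuous[OF ch]]
    show "continuous_map (top_of_set I1) (base_space N) \<gamma>" by (simp add: \<gamma>_def[abs_def] o_def)
    show "\<exists>U1 \<theta>1 d. (U1, \<theta>1) \<in> atlas N \<and> \<gamma> t0 \<in> U1 \<and>
      (\<forall>j<?n. (\<forall>\<^sub>F t in nhds t0. ((\<lambda>s. \<theta>1 (\<gamma> s) j) has_real_derivative d j t) (at t)) \<and> isCont (d j) t0)" for t0
      using c \<gamma>(1) zd \<delta>
      by (intro exI[of _ U] exI[of _ \<theta>] exI[of _ "\<lambda>j t. cos (t / \<delta>) * \<xi> j"]) (auto intro!: continuous_intros)
  qed
  have "deriv (\<lambda>t. \<theta> (\<gamma> t) j) 0 = \<xi> j" for j using DERIV_imp_deriv[OF zd, of j 0] by simp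
  then have "velocity N \<gamma> = push N (U, \<theta>) y \<xi>"
    using velocity_push[OF N r C1 c(1)] \<gamma>0 c by simp
  moreover have "\<exists>s. \<forall>i. \<theta> (\<gamma> t) i = \<theta> y i + s * \<xi> i" for t unfolding \<gamma>(2) z_def by blast
  ultimately show ?thesis using that C1 \<gamma>0 \<gamma>(1) by blast
qed

lemma C1_curve_subtopology:
  "C1_curve N (base_space N) \<gamma> \<Longrightarrow> (\<And>t. t \<in> I1 \<Longrightarrow> \<gamma> t \<in> A) \<Longrightarrow> C1_curve N (subtopology (base_space N) A) \<gamma>"
  unfolding C1_curve_def continuous_map_in_subtopology by auto

lemma tangent_vanishing_component:
  assumes \<gamma>: "C1_curve N (subtopology (base_space N) A) \<gamma>" and U: "openin (base_space N) U" "\<gamma> 0 \<in> U"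
    and const: "\<And>x. x \<in> A \<inter> U \<Longrightarrow> \<theta> x i = k"
  shows "deriv (\<lambda>t. \<theta> (\<gamma> t) i) 0 = 0"
proof -
  have g: "continuous_map (top_of_set I1) (base_space N) \<gamma>" "\<And>t. t \<in> I1 \<Longrightarrow> \<gamma> t \<in> A"
    using \<gamma> unfolding C1_curve_def continuous_map_in_subtopology by auto
  have "\<forall>\<^sub>F t in nhds 0. t \<in> I1 \<and> \<gamma> t \<in> U" using curve_eventually[OF g(1) U(1), of 0] U(2) by simp
  then have "\<forall>\<^sub>F t in nhds 0. \<theta> (\<gamma> t) i = k"
    by eventually_elim (use g(2) const in blast)
  then have "deriv (\<lambda>t. \<theta> (\<gamma> t) i) 0 = deriv (\<lambda>_. k) 0" by (intro deriv_cong_ev) auto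
  then show ?thesis by simp
qed

text \<open>Tangent spaces are defined as sets of velocities. A sum becomes a velocity again by
  moving along a line in a slice chart, where \<open>S\<close> is a coordinate subspace.\<close>

lemma tangent_space_add:
  assumes N: "Cr_manifold r N" and r: "1 \<le> r" and S: "regular_submanifold N d S" and y: "y \<in> S"
    and v: "v \<in> tangent_space N (subtopology (base_space N) S) y" and w: "w \<in> tangent_space N (subtopology (base_space N) S) y"
  shows "(\<lambda>c i. v c i + w c i) \<in> tangent_space N (subtopology (base_space N) S) y"
proof -
  obtain U \<theta> where sl: "(U, \<theta>) \<in> slice_charts N d S" "y \<in> U" using S y unfolding regular_submanifold_def by fast
  then have c: "(U, \<theta>) \<in> atlas N" and im: "\<theta> ` (U \<inter> S) = \<theta> ` U \<inter> {z. \<forall>i\<ge>d. z i = 0}" by (auto simp: slice_charts_def)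
  note ch = atlas_is_chart[OF N c]
  have SU: "x \<in> S \<longleftrightarrow> (\<forall>i\<ge>d. \<theta> x i = 0)" if "x \<in> U" for x
  proof -
    have "x \<in> S \<longleftrightarrow> \<theta> x \<in> \<theta> ` (U \<inter> S)" using that chart_inj[OF ch] by (auto dest: inj_onD)
    then show ?thesis using im that by auto
  qed
  obtain \<gamma> \<eta> where g: "C1_curve N (subtopology (base_space N) S) \<gamma>" "\<gamma> 0 = y" "v = velocity N \<gamma>"
    and h: "C1_curve N (subtopology (base_space N) S) \<eta>" "\<eta> 0 = y" "w = velocity N \<eta>"
    using v w unfolding tangent_space_def by blast
  define \<xi> where "\<xi> j = (if j < mdim N then deriv (\<lambda>t. \<theta> (\<gamma> t) j) 0 + deriv (\<lambda>t. \<theta> (\<eta> t) j) 0 else 0)" for j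
  have \<xi>0: "\<xi> j = 0" if "j \<ge> d" for j
  proof -
    have "\<theta> x j = 0" if "x \<in> S \<inter> U" for x using SU that \<open>j \<ge> d\<close> by auto
    then have "deriv (\<lambda>t. \<theta> (\<gamma> t) j) 0 = 0" "deriv (\<lambda>t. \<theta> (\<eta> t) j) 0 = 0"
      using tangent_vanishing_component[OF g(1) chart_openin[OF ch], of \<theta> j 0]
        tangent_vanishing_component[OF h(1) chart_openin[OF ch], of \<theta> j 0] g(2) h(2) sl(2) by metis+
    then show ?thesis by (simp add: \<xi>_def)
  qed
  have "\<xi> \<in> Rn (mdim N)" by (auto simp: \<xi>_def Rn_def)
  from ex_curve[OF N r c sl(2) openin_topspace _ this] openin_subset[OF chart_openin[OF ch]] sl(2)
  obtain \<zeta> where z: "C1_curve N (base_space N) \<zeta>" "\<zeta> 0 = y" "\<And>t. \<zeta> t \<in> U" "\<And>t. \<exists>s. \<forall>i. \<theta> (\<zeta> t) i = \<theta> y i + s * \<xi> i"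
    "velocity N \<zeta> = push N (U, \<theta>) y \<xi>" by (metis IntD1 subsetD)
  have "\<zeta> t \<in> S" for t
    using z(4)[of t] SU[OF z(3)[of t]] SU[OF sl(2)] y \<xi>0 by auto
  then have "C1_curve N (subtopology (base_space N) S) \<zeta>" using C1_curve_subtopology[OF z(1)] by blast
  moreover have "velocity N \<zeta> = (\<lambda>c i. v c i + w c i)"
  proof -
    have "push N (U, \<theta>) y \<xi> = push N (U, \<theta>) y (\<lambda>j. deriv (\<lambda>t. \<theta> (\<gamma> t) j) 0 + deriv (\<lambda>t. \<theta> (\<eta> t) j) 0)"
      by (rule push_cong) (simp add: \<xi>_def)
    then show ?thesis
      using velocity_push[OF N r g(1) c] velocity_push[OF N r h(1) c] g h sl(2) z(5) by (simp add: push_add)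
  qed
  ultimately show ?thesis unfolding tangent_space_def using z(2) by (metis (mono_tags, lifting) mem_Collect_eq)
qed


text \<open>In a straight chart of the target, the rows with index at least \<open>e\<close> of the Jacobian matrix
  represent the differential of \<open>\<phi>\<close> modulo the tangent space of \<open>A\<close>.\<close>

definition rank_cond where
  "rank_cond M N e c c' \<phi> x \<longleftrightarrow> indep_rows {e..<mdim N} (mdim M)
     (\<lambda>i j. partial_deriv j (\<lambda>z. snd c' (\<phi> (inv_into (fst c) (snd c) z)) i) (snd c x))"

section \<open>From the rank condition to transversality\<close>

lemma local_saturation_superset:
  assumes NF: "Cr_foliation r N" and S: "local_saturation N A S" and y: "y \<in> A"
  shows "y \<in> S"
proof -
  obtain V where V: "openin (base_space N) V" "A \<subseteq> V" "S = \<Union> {C \<in> leaves_on N V. C \<inter> A \<noteq> {}}"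
    using S unfolding local_saturation_def by blast
  have "y \<in> topspace (leaf_topology N)"
    using y V(2) openin_subset[OF V(1)] unfolding topspace_leaf_topology[OF NF] by auto
  then obtain L where L: "L \<in> leaves N" "y \<in> L"
    using Union_connected_components_of[of "leaf_topology N"] unfolding leaves_def by (metis UnionE)
  have "y \<in> topspace (subtopology (leaf_topology N) (L \<inter> V))" using \<open>y \<in> topspace _\<close> L y V by auto
  then obtain C where C: "C \<in> connected_components_of (subtopology (leaf_topology N) (L \<inter> V))" "y \<in> C"
    using Union_connected_components_of[of "subtopology (leaf_topology N) (L \<inter> V)"] by (metis UnionE)
  then have "C \<in> leaves_on N V" unfolding leaves_on_def using L by blast
  then show ?thesis using C y V(3) by blast
qed

text \<open>Surjectivity on the quotients writes every vector of \<open>V'\<close> as a sum from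
  \<open>V\<close> and \<open>W'\<close>; the zero vector in \<open>W'\<close> places
  \<open>s\<close> in its own coset.\<close>

lemma iso_surj:
  assumes "inclusion_induces_iso V W V' W'" and s: "s \<in> V'" and 0: "(\<lambda>c i. 0) \<in> W'"
  obtains u w where "u \<in> V" "w \<in> W'" "s = (\<lambda>c i. u c i + w c i)"
proof -
  obtain f where f: "\<forall>v\<in>V. f (tangent_coset v W) = tangent_coset v W'"
    "bij_betw f (quotient_space V W) (quotient_space V' W')"
    using assms(1) unfolding inclusion_induces_iso_def by blast
  have "tangent_coset s W' \<in> quotient_space V' W'" using s unfolding quotient_space_def by blast
  then obtain X where X: "X \<in> quotient_space V W" "f X = tangent_coset s W'"
    using f(2) unfolding bij_betw_def by (metis imageE)
  then obtain u where u: "u \<in> V" "X = tangent_coset u W" unfolding quotient_space_def by blast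
  have "s \<in> tangent_coset s W'" unfolding tangent_coset_def using 0 by (auto intro!: exI[of _ "\<lambda>c i. 0"])
  also have "tangent_coset s W' = tangent_coset u W'" using f(1) u X by metis
  finally obtain w where "w \<in> W'" "s = (\<lambda>c i. u c i + w c i)" unfolding tangent_coset_def by blast
  then show ?thesis using that u by blast
qed

lemma zero_tangent:
  assumes "Cr_manifold r N" "1 \<le> r" "y \<in> A" "y \<in> topspace (base_space N)"
  shows "(\<lambda>c i. 0) \<in> tangent_space N (subtopology (base_space N) A) y"
proof -
  have "C1_curve N (base_space N) (\<lambda>_. y)"
    unfolding C1_curve_def Let_def using assms(4) by (auto intro!: continuous_on_const)
  then have "C1_curve N (subtopology (base_space N) A) (\<lambda>_. y)" by (rule C1_curve_subtopology) (use assms in auto)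
  moreover have "velocity N (\<lambda>_. y) = (\<lambda>c i. 0)" by (auto simp: velocity_def fun_eq_iff)
  ultimately show ?thesis unfolding tangent_space_def by (metis (mono_tags, lifting) mem_Collect_eq)
qed

text \<open>Modulo $T_yA$ every vector of $T_yS$ is a leafwise \<open>u\<close>. By the rank
  condition the components of \<open>u\<close> from \<open>e\<close> on are those of the image of
  some \<open>v\<close>. That image may have transverse components, so the remainder
  \<open>w\<close> need not be leafwise; but it lies in $T_yS$ and is decomposed once more. Its
  leafwise part has no components from \<open>e\<close> on and is therefore tangent to
  \<open>A\<close>.\<close>

lemma rank_cond_transverse:
  assumes MF: "Cr_foliation r M" and NF: "Cr_foliation r N" and r: "1 \<le> r" and A: "regular_submanifold N a A"
    and \<phi>: "Cr_map r M N \<phi>" and S: "good_local_saturation r N A S"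
    and W: "openin (base_space M) W" "W \<subseteq> {x \<in> topspace (base_space M). \<phi> x \<in> S}"
    and x: "x \<in> W" "\<phi> x \<in> A" and c: "(U, \<theta>) \<in> atlas M" "x \<in> U"
    and c': "straight_chart N A e (U', \<theta>')" "\<phi> x \<in> U'" and rk: "rank_cond M N e (U, \<theta>) (U', \<theta>') \<phi> x"
  shows "{(\<lambda>c i. v c i + w c i) |v w.
           v \<in> {velocity N (\<phi> \<circ> \<gamma>) |\<gamma>. C1_curve M (subtopology (base_space M) W) \<gamma> \<and> \<gamma> 0 = x} \<and>
           w \<in> tangent_space N (subtopology (base_space N) A) (\<phi> x)}
        = tangent_space N (subtopology (base_space N) S) (\<phi> x)" (is "?L = ?TS")
proof -
  let ?y = "\<phi> x" and ?n = "mdim N" and ?m = "mdim M"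
  note MM = foliation_manifold[OF MF] and NM = foliation_manifold[OF NF]
  let ?TA = "tangent_space N (subtopology (base_space N) A) ?y"
  let ?TF = "tangent_space N (leaf_topology N) ?y"
  obtain d where d: "regular_submanifold N d S" and lS: "local_saturation N A S"
    and iso: "inclusion_induces_iso ?TF (tangent_space N (subtopology (leaf_topology N) A) ?y) ?TS ?TA"
    using S x(2) unfolding good_local_saturation_def by blast
  have AS: "A \<subseteq> S" using local_saturation_superset[OF NF lS] by blast
  have yS: "?y \<in> S" using AS x by auto
  have TFS: "?TF \<subseteq> ?TS" using iso unfolding inclusion_induces_iso_def by blast
  have TAS: "?TA \<subseteq> ?TS"
  proof
    fix w assume "w \<in> ?TA"
    then obtain \<gamma> where g: "C1_curve N (subtopology (base_space N) A) \<gamma>" "\<gamma> 0 = ?y" "w = velocity N \<gamma>"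
      unfolding tangent_space_def by blast
    then have "C1_curve N (subtopology (base_space N) S) \<gamma>"
      using AS unfolding C1_curve_def continuous_map_in_subtopology by auto
    then show "w \<in> ?TS" unfolding tangent_space_def using g by blast
  qed
  have im: "velocity N (\<phi> \<circ> \<gamma>) \<in> ?TS" if g: "C1_curve M (subtopology (base_space M) W) \<gamma>" "\<gamma> 0 = x" for \<gamma>
  proof -
    have "\<gamma> t \<in> W" if "t \<in> I1" for t using g(1) that unfolding C1_curve_def continuous_map_in_subtopology by auto
    then have "C1_curve N (subtopology (base_space N) S) (\<phi> \<circ> \<gamma>)"
      using C1_curve_subtopology[OF C1_curve_compose[OF MM NM r \<phi> g(1)]] W(2) by auto
    then show ?thesis unfolding tangent_space_def using g(2) by auto
  qed
  have addS: "(\<lambda>c i. v c i + w c i) \<in> ?TS" if "v \<in> ?TS" "w \<in> ?TS" for v w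
    by (rule tangent_space_add[OF NM r d yS that])
  have addA: "(\<lambda>c i. v c i + w c i) \<in> ?TA" if "v \<in> ?TA" "w \<in> ?TA" for v w
    by (rule tangent_space_add[OF NM r A x(2) that])
  have cf: "(U', \<theta>') \<in> fcharts N" and eq: "codim N \<le> e" "e \<le> ?n"
    and "\<exists>T0. \<forall>x\<in>U'. x \<in> A \<longleftrightarrow> first_coords (codim N) (\<theta>' x) \<in> T0 \<and> (\<forall>i\<ge>e. \<theta>' x i = 0)"
    using c'(1) unfolding straight_chart_def by auto
  then obtain T0 where AT: "\<And>x. x \<in> U' \<Longrightarrow> x \<in> A \<longleftrightarrow> first_coords (codim N) (\<theta>' x) \<in> T0 \<and> (\<forall>i\<ge>e. \<theta>' x i = 0)" by blast
  have ca: "(U', \<theta>') \<in> atlas N" using cf fcharts_atlas[OF NF] by auto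
  note ch' = atlas_is_chart[OF NM ca]
  have yt: "?y \<in> topspace (base_space N)" using c'(2) openin_subset[OF chart_openin[OF ch']] by blast
  have comp: "velocity N \<gamma> (U', \<theta>') i = deriv (\<lambda>t. \<theta>' (\<gamma> t) i) 0" if "\<gamma> 0 = ?y" "i < ?n" for \<gamma> i
    using that ca c'(2) by (simp add: velocity_def)
  have TA_comp: "w (U', \<theta>') i = 0" if w: "w \<in> ?TA" and i: "e \<le> i" "i < ?n" for w i
  proof -
    obtain \<gamma> where g: "C1_curve N (subtopology (base_space N) A) \<gamma>" "\<gamma> 0 = ?y" "w = velocity N \<gamma>"
      using w unfolding tangent_space_def by blast
    have "deriv (\<lambda>t. \<theta>' (\<gamma> t) i) 0 = 0"
      by (rule tangent_vanishing_component[OF g(1) chart_openin[OF ch'], of \<theta>' i 0]) (use g(2) c'(2) AT i in auto)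
    then show ?thesis using comp[of \<gamma> i] g(2,3) i(2) by simp
  qed
  \<comment> \<open>A curve that is continuous for the leaf topology stays in its plaque for a
    while, so its transverse coordinates are locally constant.\<close>
  have TF_comp: "u (U', \<theta>') i = 0" if u: "u \<in> ?TF" and i: "i < codim N" for u i
  proof -
    obtain \<gamma> where g: "C1_curve N (leaf_topology N) \<gamma>" "\<gamma> 0 = ?y" "u = velocity N \<gamma>"
      using u unfolding tangent_space_def by blast
    let ?P = "{z \<in> U'. local_projection N (U', \<theta>') z = local_projection N (U', \<theta>') ?y}"
    have "openin (leaf_topology N) ?P" using plaque_openin_leaf[OF NF cf, of "local_projection N (U', \<theta>') ?y"] by simp
    moreover have "continuous_map (top_of_set I1) (leaf_topology N) \<gamma>" using g(1) by (simp add: C1_curve_def)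
    ultimately have "\<forall>\<^sub>F t in nhds 0. t \<in> I1 \<and> \<gamma> t \<in> ?P" using curve_eventually[of "leaf_topology N" \<gamma> ?P 0] g(2) c'(2) by auto
    then have "\<forall>\<^sub>F t in nhds 0. \<theta>' (\<gamma> t) i = \<theta>' ?y i"
    proof eventually_elim
      case (elim t)
      then have "first_coords (codim N) (\<theta>' (\<gamma> t)) i = first_coords (codim N) (\<theta>' ?y) i" by (simp add: local_projection_def)
      then show ?case using i by (simp add: first_coords_def)
    qed
    then have "deriv (\<lambda>t. \<theta>' (\<gamma> t) i) 0 = deriv (\<lambda>_. \<theta>' ?y i) 0" by (intro deriv_cong_ev) auto
    then show ?thesis using comp[of \<gamma> i] i eq g(2,3) by simp
  qed
  \<comment> \<open>The line in direction \<open>u\<close> fixes the transverse coordinates, as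
    \<open>u\<close> is leafwise, and keeps the coordinates from \<open>e\<close> on at 0; so it
    runs inside \<open>A\<close>.\<close>
  have to_TA: "u \<in> ?TA" if u: "u \<in> ?TF" "\<And>i. e \<le> i \<Longrightarrow> i < ?n \<Longrightarrow> u (U', \<theta>') i = 0" for u
  proof -
    obtain \<gamma> where g: "C1_curve N (leaf_topology N) \<gamma>" "\<gamma> 0 = ?y" "u = velocity N \<gamma>"
      using u unfolding tangent_space_def by blast
    define \<xi> where "\<xi> i = (if i < ?n then u (U', \<theta>') i else 0)" for i
    have \<xi>R: "\<xi> \<in> Rn ?n" by (auto simp: \<xi>_def Rn_def)
    have "u = push N (U', \<theta>') ?y (\<lambda>j. deriv (\<lambda>t. \<theta>' (\<gamma> t) j) 0)"
      using velocity_push[OF NM r g(1) ca] g c'(2) by simp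
    also have "\<dots> = push N (U', \<theta>') ?y \<xi>"
      by (rule push_cong) (use comp[of \<gamma>] g(2,3) in \<open>simp add: \<xi>_def\<close>)
    finally have up: "u = push N (U', \<theta>') ?y \<xi>" .
    obtain \<zeta> where z: "C1_curve N (base_space N) \<zeta>" "\<zeta> 0 = ?y" "\<And>t. \<zeta> t \<in> U' \<inter> topspace (base_space N)"
      "\<And>t. \<exists>s. \<forall>i. \<theta>' (\<zeta> t) i = \<theta>' ?y i + s * \<xi> i" "velocity N \<zeta> = push N (U', \<theta>') ?y \<xi>"
      by (rule ex_curve[OF NM r ca c'(2) openin_topspace yt \<xi>R]) (rule that)
    have "\<zeta> t \<in> A" for t
    proof -
      obtain s where s: "\<And>i. \<theta>' (\<zeta> t) i = \<theta>' ?y i + s * \<xi> i" using z(4) by blast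
      have "first_coords (codim N) (\<theta>' (\<zeta> t)) = first_coords (codim N) (\<theta>' ?y)"
        using s TF_comp[OF u(1)] by (auto simp: first_coords_def \<xi>_def)
      moreover have "\<theta>' (\<zeta> t) i = \<theta>' ?y i" if "i \<ge> e" for i using s u(2) that by (simp add: \<xi>_def)
      ultimately show ?thesis using AT[of "\<zeta> t"] AT[OF c'(2)] x(2) z(3) by auto
    qed
    then have "C1_curve N (subtopology (base_space N) A) \<zeta>" using C1_curve_subtopology[OF z(1)] by blast
    then show ?thesis unfolding tangent_space_def using z(2,5) up by (metis (mono_tags, lifting) mem_Collect_eq)
  qed
  show ?thesis
  proof (intro equalityI subsetI)
    fix s assume "s \<in> ?L"
    then obtain \<gamma> w where "C1_curve M (subtopology (base_space M) W) \<gamma>" "\<gamma> 0 = x" "w \<in> ?TA"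
      "s = (\<lambda>c i. velocity N (\<phi> \<circ> \<gamma>) c i + w c i)" by blast
    then show "s \<in> ?TS" using addS im TAS by blast
  next
    fix s assume "s \<in> ?TS"
    then obtain u w0 where u: "u \<in> ?TF" "w0 \<in> ?TA" "s = (\<lambda>c i. u c i + w0 c i)"
      by (rule iso_surj[OF iso _ zero_tangent[OF NM r x(2) yt]])
    let ?a = "\<lambda>i j. partial_deriv j (\<lambda>z. \<theta>' (\<phi> (inv_into U \<theta> z)) i) (\<theta> x)"
    have "indep_rows {e..<?n} ?m ?a" using rk by (simp add: rank_cond_def)
    then obtain v0 where v0: "\<forall>i\<in>{e..<?n}. (\<Sum>j<?m. ?a i j * v0 j) = u (U', \<theta>') i"
      using indep_rows_onto[of "{e..<?n}" ?m ?a "\<lambda>i. u (U', \<theta>') i"] by auto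
    define v where "v = first_coords ?m v0"
    have vR: "v \<in> Rn ?m" unfolding v_def by (rule first_coords_Rn)
    have v: "(\<Sum>j<?m. ?a i j * v j) = u (U', \<theta>') i" if "i \<in> {e..<?n}" for i
      using v0 that by (simp add: v_def first_coords_def)
    \<comment> \<open>Stated for arbitrary \<open>v\<close> because it is applied to the solution
      and to its negative.\<close>
    have vel: "\<exists>\<gamma>. C1_curve M (subtopology (base_space M) W) \<gamma> \<and> \<gamma> 0 = x \<and>
        velocity N (\<phi> \<circ> \<gamma>) = push N (U', \<theta>') ?y (\<lambda>i. \<Sum>j<?m. ?a i j * v j)" if vR: "v \<in> Rn ?m" for v
    proof -
      note ch = atlas_is_chart[OF MM c(1)]
      obtain \<gamma> where g: "C1_curve M (base_space M) \<gamma>" "\<gamma> 0 = x" "\<And>t. \<gamma> t \<in> U \<inter> W" "velocity M \<gamma> = push M (U, \<theta>) x v"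
        and lin: "\<And>t. \<exists>s. \<forall>i. \<theta> (\<gamma> t) i = \<theta> x i + s * v i"
        by (rule ex_curve[OF MM r c W(1) x(1) vR]) (rule that)
      have gW: "C1_curve M (subtopology (base_space M) W) \<gamma>" using C1_curve_subtopology[OF g(1)] g(3) by blast
      have fg: "C1_curve N (base_space N) (\<phi> \<circ> \<gamma>)" by (rule C1_curve_compose[OF MM NM r \<phi> g(1)])
      let ?D = "{x \<in> U. \<phi> x \<in> U'}"
      have O: "openin (base_space M) ?D" "openin (Euclidean_space ?m) (\<theta> ` ?D)" using Cr_map_dom_openin[OF MM NM \<phi> c(1) ca] by auto
      have gc: "continuous_map (top_of_set I1) (base_space M) \<gamma>" using g(1) by (simp add: C1_curve_def)
      have ev: "\<forall>\<^sub>F t in nhds 0. \<gamma> t \<in> ?D"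
        using curve_eventually[OF gc O(1), of 0] c(2) c'(2) g(2) by (auto elim: eventually_mono)
      have dv: "((\<lambda>s. \<theta> (\<gamma> s) j) has_real_derivative v j) (at 0)" if j: "j < ?m" for j
      proof -
        have "velocity M \<gamma> (U, \<theta>) j = deriv (\<lambda>t. \<theta> (\<gamma> t) j) 0" using c g(2) j by (simp add: velocity_def)
        moreover have "push M (U, \<theta>) x v (U, \<theta>) j = v j"
        proof -
          have "partial_deriv i (\<lambda>z. \<theta> (inv_into U \<theta> z) j) (\<theta> x) = (if i = j then 1 else 0)" if "i < ?m" for i
          proof -
            have "partial_deriv i (\<lambda>z. \<theta> (inv_into U \<theta> z) j) (\<theta> x) = partial_deriv i (\<lambda>z. z j) (\<theta> x)"
              by (rule partial_deriv_cong[OF chart_image_openin[OF ch] _ that])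
                (use c(2) in \<open>auto simp: f_inv_into_f inv_into_f_f[OF chart_inj[OF ch]]\<close>)
            also have "\<dots> = (if i = j then 1 else 0)"
              by (rule partial_derivI) (cases "i = j", auto intro!: derivative_eq_intros)
            finally show ?thesis .
          qed
          then have "push M (U, \<theta>) x v (U, \<theta>) j = (\<Sum>i<?m. (if i = j then 1 else 0) * v i)"
            using c j by (simp add: push_def)
          also have "\<dots> = (\<Sum>i<?m. if i = j then v i else 0)" by (intro sum.cong) auto
          also have "\<dots> = v j" using j by simp
          finally show ?thesis .
        qed
        moreover have "((\<lambda>s. \<theta> (\<gamma> s) j) has_real_derivative deriv (\<lambda>t. \<theta> (\<gamma> t) j) 0) (at 0)"
          by (rule eventually_nhds_x_imp_x[OF C1_curve_deriv(1)[OF g(1) c(1) chart_openin[OF ch] _ _ j]]) (use g(2) c(2) in auto)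
        ultimately show ?thesis using g(4) by simp
      qed
      have "deriv (\<lambda>t. \<theta>' ((\<phi> \<circ> \<gamma>) t) i) 0 = (\<Sum>j<?m. ?a i j * v j)" if i: "i < ?n" for i
      proof -
        let ?f = "\<lambda>z. \<theta>' (\<phi> (inv_into U \<theta> z)) i"
        have f1: "Ck 1 ?m (\<theta> ` ?D) ?f" using Cr_map_Ck[OF MM \<phi> c(1) ca _ i, of 1] r by (simp add: one_enat_def)
        have "((\<lambda>t. ?f (\<theta> (\<gamma> t))) has_real_derivative (\<Sum>j<?m. partial_deriv j ?f (\<theta> (\<gamma> 0)) * v j)) (at 0)"
        proof (rule chain_rule_curve[OF O(2) f1])
          show "\<theta> (\<gamma> 0) \<in> \<theta> ` ?D" using c c' g(2) by auto
          show "\<forall>\<^sub>F s in nhds 0. \<theta> (\<gamma> s) \<in> \<theta> ` ?D" using ev by eventually_elim auto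
        qed (rule dv)
        moreover have "\<forall>\<^sub>F t in nhds 0. ?f (\<theta> (\<gamma> t)) = \<theta>' ((\<phi> \<circ> \<gamma>) t) i"
          using ev by eventually_elim (use chart_inj[OF ch] in auto)
        ultimately have "((\<lambda>t. \<theta>' ((\<phi> \<circ> \<gamma>) t) i) has_real_derivative (\<Sum>j<?m. partial_deriv j ?f (\<theta> (\<gamma> 0)) * v j)) (at 0)"
          using DERIV_cong_ev[OF refl _ refl, of "\<lambda>t. ?f (\<theta> (\<gamma> t))" "\<lambda>t. \<theta>' ((\<phi> \<circ> \<gamma>) t) i" 0] by blast
        from DERIV_imp_deriv[OF this] show ?thesis using g(2) by simp
      qed
      then have "velocity N (\<phi> \<circ> \<gamma>) = push N (U', \<theta>') ?y (\<lambda>i. \<Sum>j<?m. ?a i j * v j)"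
        using velocity_push[OF NM r fg ca] g(2) c'(2) push_cong[of N "\<lambda>j. deriv (\<lambda>t. \<theta>' ((\<phi> \<circ> \<gamma>) t) j) 0"] by simp
      then show ?thesis using gW g(2) by blast
    qed
    obtain \<gamma> where g: "C1_curve M (subtopology (base_space M) W) \<gamma>" "\<gamma> 0 = x"
      "velocity N (\<phi> \<circ> \<gamma>) = push N (U', \<theta>') ?y (\<lambda>i. \<Sum>j<?m. ?a i j * v j)" using vel[OF vR] by blast
    \<comment> \<open>Subtraction is realised by a curve in the opposite direction, since tangent
      spaces have only been shown to be closed under sums.\<close>
    have "(\<lambda>i. - v i) \<in> Rn ?m" using vR by (simp add: Rn_def)
    from vel[OF this] obtain \<gamma>' where g': "C1_curve M (subtopology (base_space M) W) \<gamma>'" "\<gamma>' 0 = x"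
      "velocity N (\<phi> \<circ> \<gamma>') = push N (U', \<theta>') ?y (\<lambda>i. \<Sum>j<?m. ?a i j * - v j)" by blast
    have neg: "velocity N (\<phi> \<circ> \<gamma>') = (\<lambda>c i. - velocity N (\<phi> \<circ> \<gamma>) c i)"
      unfolding g(3) g'(3) push_uminus[symmetric] by (simp add: sum_negf)
    define w where "w = (\<lambda>c i. u c i + velocity N (\<phi> \<circ> \<gamma>') c i)"
    have wS: "w \<in> ?TS" unfolding w_def using addS im[OF g'(1,2)] TFS u(1) by blast
    have gi: "velocity N (\<phi> \<circ> \<gamma>) (U', \<theta>') i = u (U', \<theta>') i" if i: "i \<in> {e..<?n}" for i
    proof -
      have "partial_deriv j (\<lambda>z. \<theta>' (inv_into U' \<theta>' z) i) (\<theta>' ?y) = (if j = i then 1 else 0)" if "j < ?n" for j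
      proof -
        have "partial_deriv j (\<lambda>z. \<theta>' (inv_into U' \<theta>' z) i) (\<theta>' ?y) = partial_deriv j (\<lambda>z. z i) (\<theta>' ?y)"
          by (rule partial_deriv_cong[OF chart_image_openin[OF ch'] _ that])
            (use c'(2) in \<open>auto simp: f_inv_into_f inv_into_f_f[OF chart_inj[OF ch']]\<close>)
        also have "\<dots> = (if j = i then 1 else 0)"
          by (rule partial_derivI) (cases "j = i", auto intro!: derivative_eq_intros)
        finally show ?thesis .
      qed
      then have "velocity N (\<phi> \<circ> \<gamma>) (U', \<theta>') i = (\<Sum>j<?n. (if j = i then 1 else 0) * (\<Sum>k<?m. ?a j k * v k))"
        unfolding g(3) using ca c'(2) i by (simp add: push_def)
      also have "\<dots> = (\<Sum>j<?n. if j = i then (\<Sum>k<?m. ?a j k * v k) else 0)" by (intro sum.cong) auto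
      also have "\<dots> = u (U', \<theta>') i" using i v[OF i] by simp
      finally show ?thesis .
    qed
    \<comment> \<open>The second decomposition. The components from \<open>e\<close> on vanish for
      \<open>w\<close> and for \<open>w'\<close>, hence for \<open>u'\<close>.\<close>
    obtain u' w' where uw: "u' \<in> ?TF" "w' \<in> ?TA" "w = (\<lambda>c i. u' c i + w' c i)"
      using wS by (rule iso_surj[OF iso _ zero_tangent[OF NM r x(2) yt]])
    have "u' (U', \<theta>') i = 0" if "e \<le> i" "i < ?n" for i
    proof -
      have "w (U', \<theta>') i = 0" using gi[of i] that by (simp add: w_def neg)
      then show ?thesis using TA_comp[OF uw(2) that] uw(3) by simp
    qed
    then have "u' \<in> ?TA" by (rule to_TA[OF uw(1)])
    then have "w \<in> ?TA" using addA uw by blast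
    then have wA: "(\<lambda>c i. w c i + w0 c i) \<in> ?TA" using addA u(2) by blast
    have seq: "s = (\<lambda>c i. velocity N (\<phi> \<circ> \<gamma>) c i + (w c i + w0 c i))" unfolding u(3) w_def neg by auto
    have vi: "velocity N (\<phi> \<circ> \<gamma>) \<in> {velocity N (\<phi> \<circ> \<gamma>) |\<gamma>. C1_curve M (subtopology (base_space M) W) \<gamma> \<and> \<gamma> 0 = x}"
      using g(1,2) by blast
    have sumI: "(\<lambda>c i. v c i + w c i) \<in> {(\<lambda>c i. v c i + w c i) |v w. v \<in> X \<and> w \<in> ?TA}" if "v \<in> X" "w \<in> ?TA" for v w X
      using that by blast
    show "s \<in> ?L" unfolding seq by (rule sumI[OF vi wA])
  qed
qed

text \<open>The neighbourhood \<open>W\<close> and the saturation \<open>S\<close> that witness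
  membership in \<open>foliation_maps_rel\<close> serve for ls-transversality as well.\<close>

lemma ls_transverseI:
  assumes MF: "Cr_foliation r M" and NF: "Cr_foliation r N" and r: "1 \<le> r" and A: "regular_submanifold N a A"
    and \<phi>: "\<phi> \<in> foliation_maps_rel r M N A"
    and rk: "\<And>x. x \<in> topspace (base_space M) \<Longrightarrow> \<phi> x \<in> A \<Longrightarrow> \<exists>U \<theta> U' \<theta>' e. (U, \<theta>) \<in> atlas M \<and> x \<in> U \<and>
      straight_chart N A e (U', \<theta>') \<and> \<phi> x \<in> U' \<and> rank_cond M N e (U, \<theta>) (U', \<theta>') \<phi> x"
  shows "ls_transverse r M N A \<phi>"
proof -
  obtain S W where S: "good_local_saturation r N A S" and W: "openin (base_space M) W"
    "{x \<in> topspace (base_space M). \<phi> x \<in> A} \<subseteq> W" "W \<subseteq> {x \<in> topspace (base_space M). \<phi> x \<in> S}"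
    and \<phi>m: "Cr_map r M N \<phi>"
    using \<phi> unfolding foliation_maps_rel_def foliation_maps_def mem_Collect_eq by (elim conjE exE) (rule that)
  have "transverse_into M N \<phi> W S A"
    unfolding transverse_into_def
  proof (intro conjI ballI impI)
    show "\<phi> ` W \<subseteq> S" using W(3) by auto
    fix x assume x: "x \<in> W" "\<phi> x \<in> A"
    then have "x \<in> topspace (base_space M)" using W(3) by auto
    from rk[OF this x(2)] obtain U \<theta> U' \<theta>' e where "(U, \<theta>) \<in> atlas M" "x \<in> U"
      "straight_chart N A e (U', \<theta>')" "\<phi> x \<in> U'" "rank_cond M N e (U, \<theta>) (U', \<theta>') \<phi> x" by blast
    from rank_cond_transverse[OF MF NF r A \<phi>m S W(1,3) x this]
    show "{(\<lambda>c i. v c i + w c i) |v w.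
           v \<in> {velocity N (\<phi> \<circ> \<gamma>) |\<gamma>. C1_curve M (subtopology (base_space M) W) \<gamma> \<and> \<gamma> 0 = x} \<and>
           w \<in> tangent_space N (subtopology (base_space N) A) (\<phi> x)}
        = tangent_space N (subtopology (base_space N) S) (\<phi> x)" .
  qed
  then show ?thesis unfolding ls_transverse_def using S W by blast
qed

section \<open>Openness\<close>


lemma compact_nbhd:
  assumes M: "Cr_manifold r M" and x: "x \<in> V" and V: "openin (base_space M) V"
  obtains K G where "compactin (base_space M) K" "openin (base_space M) G" "x \<in> G" "G \<subseteq> K" "K \<subseteq> V"
proof -
  have "x \<in> topspace (base_space M)" using x openin_subset[OF V] by auto
  then obtain U \<theta> where c: "(U, \<theta>) \<in> atlas M" "x \<in> U" by (rule atlas_cover[OF M])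
  note ch = atlas_is_chart[OF M c(1)]
  let ?m = "mdim M"
  have O: "openin (Euclidean_space ?m) (\<theta> ` (U \<inter> V))"
    by (rule chart_image_open[OF ch]) (auto intro: openin_Int chart_openin[OF ch] V)
  obtain e where e: "e > 0" "box_nbhd ?m (\<theta> x) e \<subseteq> \<theta> ` (U \<inter> V)"
    by (rule open_contains_box[OF O, of "\<theta> x"]) (use x c in auto)
  define B where "B = {z\<in>Rn ?m. \<forall>i<?m. \<bar>z i - \<theta> x i\<bar> \<le> e / 2}"
  have "B \<subseteq> box_nbhd ?m (\<theta> x) e"
    unfolding B_def box_nbhd_def using e(1) by (auto intro: le_less_trans)
  then have B: "B \<subseteq> \<theta> ` (U \<inter> V)" using e(2) by blast
  have "compact B" unfolding B_def by (rule compact_closed_box)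
  then have "compactin (Euclidean_space ?m) B"
    unfolding Euclidean_space_eq by (auto simp: compactin_subtopology B_def)
  then have "compactin (subtopology (Euclidean_space ?m) (\<theta> ` U)) B"
    using B by (auto simp: compactin_subtopology)
  from image_compactin[OF this chart_inv_continuous[OF ch]]
  have K: "compactin (base_space M) (inv_into U \<theta> ` B)" .
  let ?G = "{y \<in> U. \<theta> y \<in> box_nbhd ?m (\<theta> x) (e / 2)}"
  have "openin (base_space M) ?G" by (rule chart_preimage_open[OF ch openin_box_nbhd])
  moreover have "x \<in> ?G"
    using c e open_Rn_subset[OF chart_image_openin[OF ch]] by (auto simp: box_nbhd_def)
  moreover have "?G \<subseteq> inv_into U \<theta> ` B"
  proof
    fix y assume y: "y \<in> ?G"
    then have "\<theta> y \<in> B" by (auto simp: B_def box_nbhd_def less_imp_le)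
    moreover have "inv_into U \<theta> (\<theta> y) = y" using y chart_inj[OF ch] by auto
    ultimately show "y \<in> inv_into U \<theta> ` B" by (metis imageI)
  qed
  moreover have "inv_into U \<theta> ` B \<subseteq> V" using B chart_inj[OF ch] by fastforce
  ultimately show ?thesis using that K by blast
qed

lemma compact_nbhd_compact:
  assumes M: "Cr_manifold r M" and C: "compactin (base_space M) C" "C \<subseteq> V" and V: "openin (base_space M) V"
  obtains K G where "compactin (base_space M) K" "openin (base_space M) G" "C \<subseteq> G" "G \<subseteq> K" "K \<subseteq> V"
proof -
  define R where "R x K G \<longleftrightarrow> compactin (base_space M) K \<and> openin (base_space M) G \<and> x \<in> G \<and> G \<subseteq> K \<and> K \<subseteq> V" for x K G
  have "\<exists>K G. R x K G" if "x \<in> C" for x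
    unfolding R_def by (rule compact_nbhd[OF M _ V, of x]) (use that C in auto)
  then obtain K G where R: "\<And>x. x \<in> C \<Longrightarrow> R x (K x) (G x)" by metis
  have "\<And>U. U \<in> G ` C \<Longrightarrow> openin (base_space M) U" "C \<subseteq> \<Union> (G ` C)" using R unfolding R_def by auto
  then obtain \<F> where "finite \<F>" "\<F> \<subseteq> G ` C" "C \<subseteq> \<Union> \<F>" using compactinD[OF C(1), of "G ` C"] by auto
  then obtain F where F: "finite F" "F \<subseteq> C" "C \<subseteq> (\<Union>x\<in>F. G x)" by (metis finite_subset_image)
  show ?thesis
  proof
    show "compactin (base_space M) (\<Union>x\<in>F. K x)" using F R unfolding R_def by (intro compactin_Union) auto
    show "openin (base_space M) (\<Union>x\<in>F. G x)" using F R unfolding R_def by (intro openin_Union) auto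
    show "C \<subseteq> (\<Union>x\<in>F. G x)" by fact
    show "(\<Union>x\<in>F. G x) \<subseteq> (\<Union>x\<in>F. K x)" "(\<Union>x\<in>F. K x) \<subseteq> V" using F(2) R unfolding R_def by blast+
  qed
qed

text \<open>The basic set with a single index, centred at \<phi>; a family of one chart is trivially
  locally finite.\<close>

lemma sp_cond_open:
  assumes rs: "r = \<infinity> \<or> r = enat s" and c: "c \<in> fcharts M" "c' \<in> fcharts N"
    and K: "compactin (base_space M) K" "K \<subseteq> fst c" and \<phi>: "\<phi> \<in> foliation_maps r M N" "\<phi> ` K \<subseteq> fst c'" and \<epsilon>: "\<epsilon> > 0"
  shows "openin (sp_topology r M N) {f \<in> foliation_maps r M N. sp_cond s M N c c' K \<epsilon> \<phi> f}"
    and "sp_cond s M N c c' K \<epsilon> \<phi> \<phi>"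
proof -
  have sub: "foliation_maps r M N \<subseteq> foliation_maps (enat s) M N" using rs by (intro foliation_maps_mono) auto
  have dat: "sp_data M N \<phi> {0} (\<lambda>_. c) (\<lambda>_. c') (\<lambda>_. K) (\<lambda>_. \<epsilon>)"
    unfolding sp_data_def using assms by (auto intro!: exI[of _ "topspace (base_space M)"])
  have eq: "{f \<in> foliation_maps r M N. sp_cond s M N c c' K \<epsilon> \<phi> f} =
      foliation_maps r M N \<inter> sp_nbhd s M N \<phi> {0} (\<lambda>_. c) (\<lambda>_. c') (\<lambda>_. K) (\<lambda>_. \<epsilon>)"
    unfolding sp_nbhd_eq using sub by auto
  have "\<dots> \<in> sp_base r M N" unfolding sp_base_def using rs sub \<phi> dat by blast
  then show "openin (sp_topology r M N) {f \<in> foliation_maps r M N. sp_cond s M N c c' K \<epsilon> \<phi> f}"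
    unfolding eq sp_topology_def by (rule topology_generated_by_Basis)
  show "sp_cond s M N c c' K \<epsilon> \<phi> \<phi>"
    unfolding sp_cond_def using \<phi>(2) \<epsilon> by (simp add: deriv_dist_def)
qed

lemma deriv_dist_entry:
  assumes "j < m" "i < n"
  shows "\<bar>partial_deriv j (\<lambda>y. f y i) z - partial_deriv j (\<lambda>y. g y i) z\<bar> \<le> deriv_dist 1 m n f g z"
proof -
  let ?S = "{is. length is = 1 \<and> set is \<subseteq> {..<m}}"
  let ?h = "\<lambda>is j. (iter_partial is (\<lambda>y. f y j) z - iter_partial is (\<lambda>y. g y j) z)\<^sup>2"
  have "?h [j] i \<le> (\<Sum>i<n. ?h [j] i)" using assms by (intro member_le_sum) auto
  also have "\<dots> \<le> (\<Sum>is\<in>?S. \<Sum>i<n. ?h is i)"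
    using assms finite_lists_below[of 1 m]
    by (intro member_le_sum[of "[j]" ?S "\<lambda>is. \<Sum>i<n. ?h is i"]) (auto intro: sum_nonneg)
  finally have "sqrt (?h [j] i) \<le> deriv_dist 1 m n f g z" unfolding deriv_dist_def by (rule real_sqrt_le_mono)
  then show ?thesis by simp
qed

text \<open>No local saturation occurs here, so the same countably many sets serve all maps.\<close>

definition good_set where
  "good_set r M N e c c' K L = {\<phi> \<in> foliation_maps r M N. \<forall>x\<in>K. \<phi> x \<in> L \<longrightarrow> rank_cond M N e c c' \<phi> x}"

text \<open>A point of \<open>K\<close> is either sent off the closed set \<open>L\<close>, and
  nearby maps do the same around it, or the rank is full there and stays full for nearby points and
  first derivatives. Compactness of \<open>K\<close> leaves finitely many neighbourhoods to
  intersect.\<close>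

lemma good_set_open:
  assumes MF: "Cr_foliation r M" and NF: "Cr_foliation r N" and r: "1 \<le> r"
    and c: "c \<in> fcharts M" and c': "c' \<in> fcharts N"
    and K: "compactin (base_space M) K" "K \<subseteq> fst c" and L: "closedin (base_space N) L" "L \<subseteq> fst c'"
  shows "openin (sp_topology r M N) (good_set r M N e c c' K L)"
proof -
  note MM = foliation_manifold[OF MF] and NM = foliation_manifold[OF NF]
  obtain U \<theta> U' \<theta>' where eq: "c = (U, \<theta>)" "c' = (U', \<theta>')" by fastforce
  have ca: "(U, \<theta>) \<in> atlas M" "(U', \<theta>') \<in> atlas N"
    using c c' fcharts_atlas[OF MF] fcharts_atlas[OF NF] eq by auto
  note ch = atlas_is_chart[OF MM ca(1)] and ch' = atlas_is_chart[OF NM ca(2)]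
  let ?m = "mdim M" and ?n = "mdim N" and ?X = "base_space M"
  \<comment> \<open>For infinite \<open>r\<close> order 1 is enough, since the rank condition sees
    first derivatives only.\<close>
  obtain s where s: "r = \<infinity> \<or> r = enat s" "1 \<le> s"
  proof (cases r)
    case (enat k)
    then show ?thesis using r that[of k] by (simp add: one_enat_def)
  next
    case infinity
    then show ?thesis using that[of 1] by simp
  qed
  have "\<exists>O'. openin (sp_topology r M N) O' \<and> \<phi> \<in> O' \<and> O' \<subseteq> good_set r M N e c c' K L"
    if \<phi>: "\<phi> \<in> good_set r M N e c c' K L" for \<phi>
  proof -
    have \<phi>f: "\<phi> \<in> foliation_maps r M N" and \<phi>m: "Cr_map r M N \<phi>" and \<phi>c: "continuous_map ?X (base_space N) \<phi>"
      using \<phi> by (auto simp: good_set_def foliation_maps_def Cr_map_def)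
    define R where "R x G O' \<longleftrightarrow> openin ?X G \<and> x \<in> G \<and> openin (sp_topology r M N) O' \<and> \<phi> \<in> O' \<and> O' \<subseteq> foliation_maps r M N \<and>
        (\<forall>\<psi>\<in>O'. \<forall>x'\<in>G. \<psi> x' \<in> L \<longrightarrow> rank_cond M N e c c' \<psi> x')" for x G O'
    have "\<exists>G O'. R x G O'" if x: "x \<in> K" for x
    proof (cases "\<phi> x \<in> L")
      case False
      have xt: "x \<in> topspace ?X" using x compactin_subset_topspace[OF K(1)] by auto
      have "openin (base_space N) (topspace (base_space N) - L)" using L(1) by (simp add: openin_diff)
      moreover have "\<phi> x \<in> topspace (base_space N) - L" using False xt continuous_map_image_subset_topspace[OF \<phi>c] by auto
      ultimately obtain U1 \<theta>1 where c1: "(U1, \<theta>1) \<in> fcharts N" "\<phi> x \<in> U1" "U1 \<subseteq> topspace (base_space N) - L"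
        by (elim shrink_fchart[OF NF, rotated])
      have "(U1, \<theta>1) \<in> atlas N" using c1 fcharts_atlas[OF NF] by auto
      then have "openin ?X {x \<in> U. \<phi> x \<in> U1}" using Cr_map_dom_openin(1)[OF MM NM \<phi>m ca(1)] by blast
      then obtain K1 G where K1: "compactin ?X K1" "openin ?X G" "x \<in> G" "G \<subseteq> K1" "K1 \<subseteq> {x \<in> U. \<phi> x \<in> U1}"
        by (rule compact_nbhd[OF MM, rotated]) (use x K(2) eq c1 in auto)
      let ?O = "{f \<in> foliation_maps r M N. sp_cond s M N c (U1, \<theta>1) K1 1 \<phi> f}"
      have O: "openin (sp_topology r M N) ?O" "sp_cond s M N c (U1, \<theta>1) K1 1 \<phi> \<phi>"
        using sp_cond_open[OF s(1) c c1(1) K1(1) _ \<phi>f, of 1] K1(5) eq by auto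
      have "\<psi> x' \<notin> L" if "\<psi> \<in> ?O" "x' \<in> G" for \<psi> x'
        using that K1(4) c1(3) by (auto simp: sp_cond_def)
      then have "R x G ?O" unfolding R_def using O K1 \<phi>f by auto
      then show ?thesis by blast
    next
      case True
      let ?D = "{x \<in> U. \<phi> x \<in> U'}"
      let ?a = "\<lambda>\<psi> i j z. partial_deriv j (\<lambda>z. \<theta>' (\<psi> (inv_into U \<theta> z)) i) z"
      have xD: "x \<in> ?D" using x K(2) True L(2) eq by auto
      have O: "openin ?X ?D" "openin (Euclidean_space ?m) (\<theta> ` ?D)" using Cr_map_dom_openin[OF MM NM \<phi>m ca] by auto
      have "indep_rows {e..<?n} ?m (\<lambda>i j. ?a \<phi> i j (\<theta> x))"
        using \<phi> x True eq by (auto simp: good_set_def rank_cond_def)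
      then obtain \<epsilon> where \<epsilon>: "\<epsilon> > 0" "\<And>b. (\<forall>i\<in>{e..<?n}. \<forall>j<?m. \<bar>b i j - ?a \<phi> i j (\<theta> x)\<bar> < \<epsilon>) \<Longrightarrow> indep_rows {e..<?n} ?m b"
        using indep_rows_open[of "{e..<?n}" ?m "\<lambda>i j. ?a \<phi> i j (\<theta> x)"] by auto
      \<comment> \<open>One half of \<epsilon> is for moving the point under \<phi>, the other for
        passing from \<phi> to a nearby map.\<close>
      let ?E = "\<lambda>i j. {z \<in> \<theta> ` ?D. \<bar>?a \<phi> i j z - ?a \<phi> i j (\<theta> x)\<bar> < \<epsilon> / 2}"
      have Eo: "openin (Euclidean_space ?m) (?E i j)" if "i < ?n" "j < ?m" for i j
      proof -
        have "Ck 1 ?m (\<theta> ` ?D) (\<lambda>z. \<theta>' (\<phi> (inv_into U \<theta> z)) i)"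
          using Cr_map_Ck[OF MM \<phi>m ca _ that(1), of 1] r by (simp add: one_enat_def)
        then have "continuous_on (\<theta> ` ?D) (?a \<phi> i j)" using that by simp
        then have "continuous_map (subtopology (Euclidean_space ?m) (\<theta> ` ?D)) euclideanreal (?a \<phi> i j)"
          using continuous_map_Rn[OF open_Rn_subset[OF O(2)]] by blast
        from openin_continuous_map_preimage[OF this, of "ball (?a \<phi> i j (\<theta> x)) (\<epsilon> / 2)"]
        have "openin (Euclidean_space ?m) {z \<in> topspace (subtopology (Euclidean_space ?m) (\<theta> ` ?D)). ?a \<phi> i j z \<in> ball (?a \<phi> i j (\<theta> x)) (\<epsilon> / 2)}"
          using openin_trans_full O(2) by auto
        moreover have "{z \<in> topspace (subtopology (Euclidean_space ?m) (\<theta> ` ?D)). ?a \<phi> i j z \<in> ball (?a \<phi> i j (\<theta> x)) (\<epsilon> / 2)} = ?E i j"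
          using open_Rn_subset[OF O(2)] by (auto simp: dist_real_def abs_minus_commute)
        ultimately show ?thesis by simp
      qed
      let ?P = "{e..<?n} \<times> {..<?m}"
      \<comment> \<open>The domain is intersected in explicitly because \<open>?P\<close> may be
        empty.\<close>
      have "openin (Euclidean_space ?m) (\<theta> ` ?D \<inter> \<Inter> ((\<lambda>(i, j). ?E i j) ` ?P))"
      proof (rule openin_Int_Inter[OF _ O(2)])
        fix X assume "X \<in> (\<lambda>(i, j). ?E i j) ` ?P"
        then obtain i j where "X = ?E i j" "i < ?n" "j < ?m" by auto
        then show "openin (Euclidean_space ?m) X" using Eo by simp
      qed auto
      from chart_preimage_open[OF ch this]
      have "openin ?X {x' \<in> U. \<theta> x' \<in> \<theta> ` ?D \<inter> \<Inter> ((\<lambda>(i, j). ?E i j) ` ?P)}" .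
      then obtain K1 G where K1: "compactin ?X K1" "openin ?X G" "x \<in> G" "G \<subseteq> K1"
          "K1 \<subseteq> {x' \<in> U. \<theta> x' \<in> \<theta> ` ?D \<inter> \<Inter> ((\<lambda>(i, j). ?E i j) ` ?P)}"
        by (rule compact_nbhd[OF MM, rotated]) (use xD \<epsilon>(1) in auto)
      have K1D: "x' \<in> ?D" if "x' \<in> K1" for x'
      proof -
        have "x' \<in> U" "\<theta> x' \<in> \<theta> ` ?D" using K1(5) that by auto
        then show ?thesis using chart_inj[OF ch] by (auto dest: inj_onD)
      qed
      let ?O = "{f \<in> foliation_maps r M N. sp_cond s M N c c' K1 (\<epsilon> / 2) \<phi> f}"
      have O: "openin (sp_topology r M N) ?O" "sp_cond s M N c c' K1 (\<epsilon> / 2) \<phi> \<phi>"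
        using sp_cond_open[OF s(1) c c' K1(1) _ \<phi>f, of "\<epsilon> / 2"] K1D \<epsilon>(1) eq by auto
      have "rank_cond M N e c c' \<psi> x'" if \<psi>: "\<psi> \<in> ?O" and x': "x' \<in> G" for \<psi> x'
      proof -
        have x'K: "x' \<in> K1" using x' K1(4) by auto
        have "\<bar>?a \<psi> i j (\<theta> x') - ?a \<phi> i j (\<theta> x)\<bar> < \<epsilon>" if ij: "i \<in> {e..<?n}" "j < ?m" for i j
        proof -
          have "\<bar>?a \<psi> i j (\<theta> x') - ?a \<phi> i j (\<theta> x')\<bar> \<le> deriv_dist 1 ?m ?n (\<theta>' \<circ> \<psi> \<circ> inv_into U \<theta>) (\<theta>' \<circ> \<phi> \<circ> inv_into U \<theta>) (\<theta> x')"
            using deriv_dist_entry[of j ?m i ?n "\<theta>' \<circ> \<psi> \<circ> inv_into U \<theta>" "\<theta> x'" "\<theta>' \<circ> \<phi> \<circ> inv_into U \<theta>"] ij by simp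
          also have "\<dots> < \<epsilon> / 2" using \<psi> x'K s(2) eq by (auto simp: sp_cond_def)
          finally have 1: "\<bar>?a \<psi> i j (\<theta> x') - ?a \<phi> i j (\<theta> x')\<bar> < \<epsilon> / 2" .
          have "(i, j) \<in> ?P" using ij by simp
          then have "\<theta> x' \<in> ?E i j" using K1(5) x'K by blast
          then have "\<bar>?a \<phi> i j (\<theta> x') - ?a \<phi> i j (\<theta> x)\<bar> < \<epsilon> / 2" by simp
          with 1 show ?thesis by linarith
        qed
        then show ?thesis unfolding rank_cond_def eq fst_conv snd_conv by (intro \<epsilon>(2)) blast
      qed
      then have "R x G ?O" unfolding R_def using O K1 \<phi>f by auto
      then show ?thesis by blast
    qed
    then obtain G O' where R: "\<And>x. x \<in> K \<Longrightarrow> R x (G x) (O' x)" by metis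
    have "\<And>V. V \<in> G ` K \<Longrightarrow> openin ?X V" "K \<subseteq> \<Union> (G ` K)" using R unfolding R_def by auto
    then obtain \<F> where "finite \<F>" "\<F> \<subseteq> G ` K" "K \<subseteq> \<Union> \<F>" 
      using compactinD[OF K(1), of "G ` K"] by auto
    then obtain F where F: "finite F" "F \<subseteq> K" "K \<subseteq> (\<Union>x\<in>F. G x)" by (metis finite_subset_image)
    let ?O = "foliation_maps r M N \<inter> \<Inter> (O' ` F)"
    have "openin (sp_topology r M N) ?O"
    proof (rule openin_Int_Inter)
      show "openin (sp_topology r M N) (foliation_maps r M N)" using openin_topspace topspace_sp_topology by metis
    qed (use F R in \<open>auto simp: R_def\<close>)
    moreover have "\<phi> \<in> ?O" using \<phi>f R F(2) unfolding R_def by blast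
    moreover have "?O \<subseteq> good_set r M N e c c' K L"
    proof
      fix \<psi> assume \<psi>: "\<psi> \<in> ?O"
      have "rank_cond M N e c c' \<psi> x'" if x': "x' \<in> K" "\<psi> x' \<in> L" for x'
      proof -
        obtain x where x: "x \<in> F" "x' \<in> G x" using F(3) x' by blast
        then have "R x (G x) (O' x)" "\<psi> \<in> O' x" using R F(2) \<psi> by auto
        then show ?thesis using x x' unfolding R_def by blast
      qed
      then show "\<psi> \<in> good_set r M N e c c' K L" using \<psi> by (simp add: good_set_def)
    qed
    ultimately show ?thesis by blast
  qed
  then show ?thesis by (subst openin_subopen) blast
qed

section \<open>Density\<close>


text \<open>Averaging shifts points and the Lipschitz estimates compare distant ones, so the
  coordinate functions are first extended to all of $R^m$, without changing them on
  \<open>C\<close>.\<close>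

lemma cutoff_Ck:
  assumes \<Omega>: "openin (Euclidean_space m) \<Omega>" and f: "\<And>k. enat k \<le> r \<Longrightarrow> Ck k m \<Omega> f" and C: "compact C" "C \<subseteq> \<Omega>"
  shows "\<exists>F Q. (\<forall>k. enat k \<le> r \<longrightarrow> Ck k m (Rn m) F) \<and> compact Q \<and> Q \<subseteq> Rn m \<and>
    (\<forall>z\<in>Rn m. z \<notin> Q \<longrightarrow> F z = 0) \<and> (\<forall>z\<in>C. F z = f z)"
proof -
  obtain b Q O' where b: "\<And>k. Ck k m (Rn m) b" and Q: "compact Q" "Q \<subseteq> \<Omega>" and O': "C \<subseteq> O'"
    and b0: "\<And>z. z \<in> Rn m \<Longrightarrow> z \<notin> Q \<Longrightarrow> b z = 0" and b1: "\<And>z. z \<in> O' \<Longrightarrow> b z = 1"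
    by (rule ex_bump[OF \<Omega> C]) (rule that)
  define F where "F z = (if z \<in> \<Omega> then b z * f z else 0)" for z
  have QR: "Q \<subseteq> Rn m" using Q open_Rn_subset[OF \<Omega>] by auto
  have F0: "F z = 0" if "z \<in> Rn m" "z \<notin> Q" for z using b0[OF that] by (simp add: F_def)
  have "Ck k m (Rn m) F" if k: "enat k \<le> r" for k
  proof (rule Ck_local[OF _ order_refl])
    fix z assume z: "z \<in> Rn m"
    show "\<exists>V. openin (Euclidean_space m) V \<and> z \<in> V \<and> Ck k m (Rn m \<inter> V) F"
    proof (cases "z \<in> \<Omega>")
      case True
      have "Ck k m \<Omega> (\<lambda>z. b z * f z)"
        by (rule Ck_mult[OF \<Omega> Ck_subset[OF b open_Rn_subset[OF \<Omega>]] f[OF k]])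
      then have "Ck k m \<Omega> F" by (rule Ck_cong[OF \<Omega>, rotated]) (simp add: F_def)
      moreover have "Rn m \<inter> \<Omega> = \<Omega>" using open_Rn_subset[OF \<Omega>] by auto
      ultimately show ?thesis using \<Omega> True by auto
    next
      case False
      have O: "openin (Euclidean_space m) (Rn m - Q)" by (rule closed_diff_openin[OF compact_imp_closed[OF Q(1)]])
      have "Ck k m (Rn m - Q) F"
        by (rule Ck_cong[OF O _ Ck_const[of _ _ _ 0]]) (use F0 in auto)
      moreover have "Rn m \<inter> (Rn m - Q) = Rn m - Q" by auto
      ultimately show ?thesis using O z False Q(2) by (intro exI[of _ "Rn m - Q"]) auto
    qed
  qed
  moreover have "F z = f z" if "z \<in> C" for z
    using that b1[of z] O' C(2) by (auto simp: F_def)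
  ultimately show ?thesis using Q(1) QR F0 by blast
qed

lemma compact_coord_bound:
  fixes Q :: "point set"
  assumes "compact Q"
  obtains R :: nat where "\<And>z j. z \<in> Q \<Longrightarrow> j < m \<Longrightarrow> \<bar>z j\<bar> \<le> real R"
proof -
  have "\<exists>B. \<forall>z\<in>Q. \<bar>z j\<bar> \<le> B" for j
  proof -
    have "continuous_on Q (\<lambda>z. z j)" by (rule continuous_on_subset[OF continuous_on_product_coordinates]) auto
    then have "bounded ((\<lambda>z. z j) ` Q)" using assms compact_continuous_image compact_imp_bounded by blast
    then show ?thesis unfolding bounded_iff by auto
  qed
  then obtain B where B: "\<And>z j. z \<in> Q \<Longrightarrow> \<bar>z j\<bar> \<le> B j" by metis
  obtain R :: nat where R: "(\<Sum>j<m. \<bar>B j\<bar>) \<le> real R" using real_arch_simple by blast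
  have "\<bar>z j\<bar> \<le> real R" if "z \<in> Q" "j < m" for z j
  proof -
    have "\<bar>B j\<bar> \<le> (\<Sum>j<m. \<bar>B j\<bar>)" using that by (intro member_le_sum) auto
    then show ?thesis using B[OF that(1), of j] R by linarith
  qed
  then show ?thesis using that by blast
qed

text \<open>\<open>G\<close> is the cut off sum of \<open>g - F\<close> and the affine map, where
  \<open>F\<close> equals \<open>f\<close> on \<open>Q1\<close>, outside which the cut-off vanishes,
  and \<open>g\<close> is the smoothing of \<open>F\<close> with parameter \<open>h\<close>. So
  nothing changes at parameter 0, while on \<open>O1\<close>, where the cut-off is 1,
  \<open>f + G\<close> is the smoothed function plus the affine map: the situation of
  \<open>generic_affine\<close>.\<close>

lemma ex_transverse_family:
  assumes r: "1 \<le> r" and \<Omega>: "openin (Euclidean_space m) \<Omega>"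
    and f: "\<And>k i. enat k \<le> r \<Longrightarrow> i < n \<Longrightarrow> Ck k m \<Omega> (f i)" and C: "compact C" "C \<subseteq> \<Omega>"
  obtains d G Q1 O1 where "compact Q1" "Q1 \<subseteq> \<Omega>" "openin (Euclidean_space m) O1" "C \<subseteq> O1" "O1 \<subseteq> Q1"
    "\<And>k j. enat k \<le> r \<Longrightarrow> Ck k (m + d) (Rn (m + d)) (\<lambda>y. G y j)"
    "\<And>y j. first_coords m y \<notin> Q1 \<Longrightarrow> G y j = 0"
    "\<And>y j. last_coords m y = (\<lambda>_. 0) \<Longrightarrow> G y j = 0"
    "\<And>y j. j < e \<or> n \<le> j \<Longrightarrow> G y j = (0::real)"
    "\<And>\<epsilon>. \<epsilon> > 0 \<Longrightarrow> \<exists>t\<in>cube d \<epsilon>. \<forall>z\<in>O1. (\<forall>i\<in>{e..<n}. f i z + G (glue m z t) i = 0) \<longrightarrow>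
       indep_rows {e..<n} m (\<lambda>i j. partial_deriv j (\<lambda>z. f i z + G (glue m z t) i) z)"
proof -
  obtain b Q1 O1 where b: "\<And>k. Ck k m (Rn m) b" and Q1: "compact Q1" "Q1 \<subseteq> \<Omega>"
    and O1: "openin (Euclidean_space m) O1" "C \<subseteq> O1" "O1 \<subseteq> Q1"
    and b0: "\<And>z. z \<in> Rn m \<Longrightarrow> z \<notin> Q1 \<Longrightarrow> b z = 0" and b1: "\<And>z. z \<in> O1 \<Longrightarrow> b z = 1"
    by (rule ex_bump[OF \<Omega> C]) (rule that)
  define R where "R i F g \<longleftrightarrow> (\<forall>k. enat k \<le> r \<longrightarrow> Ck k m (Rn m) F) \<and> (\<forall>z\<in>Q1. F z = f i z) \<and>
    (\<forall>k. enat k \<le> r \<longrightarrow> Ck k (Suc m) (Rn (Suc m)) g) \<and> (\<forall>y\<in>Rn (Suc m). y m = 0 \<longrightarrow> g y = F y) \<and>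
    (\<forall>h. h \<noteq> 0 \<longrightarrow> (\<exists>\<Lambda>. slice_Lipschitz m h \<Lambda> g) \<and> (\<forall>j<m. \<exists>\<Lambda>. slice_Lipschitz m h \<Lambda> (partial_deriv j g)))" for i F g
  have "\<exists>F g. R i F g" if i: "i < n" for i
  proof -
    obtain F Q where F: "\<And>k. enat k \<le> r \<Longrightarrow> Ck k m (Rn m) F" "compact Q" "Q \<subseteq> Rn m"
      "\<And>z. z \<in> Rn m \<Longrightarrow> z \<notin> Q \<Longrightarrow> F z = 0" "\<forall>z\<in>Q1. F z = f i z"
      using cutoff_Ck[OF \<Omega> f[OF _ i] Q1, of r] by blast
    from smoothing_family[OF r F(1-4)] show ?thesis unfolding R_def using F(1,5) by blast
  qed
  then obtain F g where Rg: "\<And>i. i < n \<Longrightarrow> R i (F i) (g i)" by metis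
  have F: "\<And>k i. i < n \<Longrightarrow> enat k \<le> r \<Longrightarrow> Ck k m (Rn m) (F i)" "\<And>i z. i < n \<Longrightarrow> z \<in> Q1 \<Longrightarrow> F i z = f i z"
    and g: "\<And>k i. i < n \<Longrightarrow> enat k \<le> r \<Longrightarrow> Ck k (Suc m) (Rn (Suc m)) (g i)"
      "\<And>i y. i < n \<Longrightarrow> y \<in> Rn (Suc m) \<Longrightarrow> y m = 0 \<Longrightarrow> g i y = F i y"
      "\<And>i h. i < n \<Longrightarrow> h \<noteq> 0 \<Longrightarrow> \<exists>\<Lambda>. slice_Lipschitz m h \<Lambda> (g i)"
      "\<And>i h j. i < n \<Longrightarrow> h \<noteq> 0 \<Longrightarrow> j < m \<Longrightarrow> \<exists>\<Lambda>. slice_Lipschitz m h \<Lambda> (partial_deriv j (g i))"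
    using Rg unfolding R_def by blast+
  \<comment> \<open>One parameter for \<open>h\<close> and \<open>m + 1\<close> for each of the
    \<open>n\<close> rows; providing for the rows below \<open>e\<close> as well keeps the indexing
    uniform.\<close>
  define d where "d = Suc (n * Suc m)"
  define idx where "idx i j = Suc (i * Suc m + j)" for i j
  have idx: "idx i j < d" if "i < n" "j \<le> m" for i j
  proof -
    have "i * Suc m + j < Suc i * Suc m" using that by simp
    also have "\<dots> \<le> n * Suc m" using that by (intro mult_le_mono1) simp
    finally show ?thesis by (simp add: idx_def d_def)
  qed
  \<comment> \<open>The parameters are \<open>h\<close> (coordinate \<open>m\<close> of \<open>y\<close>), the matrix \<open>L\<close> and the vector \<open>v\<close>, stored as its
    column \<open>m\<close>.\<close>
  define G where "G y i = (if e \<le> i \<and> i < n then b (first_coords m y) *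
      (g i (first_coords (Suc m) y) - F i (first_coords m y) +
        (y (m + idx i m) + (\<Sum>j<m. y (m + idx i j) * y j))) else 0)" for y i
  note Oo = openin_Rn[of "m + d"]
  show ?thesis
  proof
    show "compact Q1" "Q1 \<subseteq> \<Omega>" "openin (Euclidean_space m) O1" "C \<subseteq> O1" "O1 \<subseteq> Q1" by fact+
    show "Ck k (m + d) (Rn (m + d)) (\<lambda>y. G y j)" if k: "enat k \<le> r" for k j
    proof (cases "e \<le> j \<and> j < n")
      case True
      then have jn: "j < n" by simp
      have "Ck k (m + d) (Rn (m + d)) (\<lambda>y. b (first_coords m y) *
        (g j (first_coords (Suc m) y) - F j (first_coords m y) +
        (y (m + idx j m) + (\<Sum>i<m. y (m + idx j i) * y i))))"
        by (intro Ck_mult[OF Oo] Ck_add[OF Oo] Ck_diff[OF Oo] Ck_sum[OF Oo] Ck_coord[OF Oo]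
            Ck_compose_first_coords[OF Oo openin_Rn first_coords_Rn b]
            Ck_compose_first_coords[OF Oo openin_Rn first_coords_Rn g(1)[OF jn k]]
            Ck_compose_first_coords[OF Oo openin_Rn first_coords_Rn F(1)[OF jn k]])
      then show ?thesis using True by (simp add: G_def)
    next
      case False
      then have "(\<lambda>y. G y j) = (\<lambda>y. 0)" by (auto simp: G_def)
      then show ?thesis using Ck_const[of k "m + d" "Rn (m + d)" 0] by simp
    qed
    show "G y j = 0" if "first_coords m y \<notin> Q1" for y j
      using b0[OF first_coords_Rn that] by (simp add: G_def)
    show "G y j = 0" if y: "last_coords m y = (\<lambda>_. 0)" for y j
    proof (cases "e \<le> j \<and> j < n")
      case True
      have y0: "y (m + k) = 0" for k using fun_cong[OF y, of k] by (simp add: last_coords_def)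
      have ym: "y m = 0" using y0[of 0] by simp
      have "g j (first_coords (Suc m) y) = F j (first_coords (Suc m) y)"
        by (rule g(2)) (use True ym first_coords_Rn in \<open>auto simp: first_coords_def\<close>)
      moreover have "first_coords (Suc m) y = first_coords m y"
        using ym by (auto simp: first_coords_def less_Suc_eq)
      ultimately show ?thesis using y0 by (simp add: G_def)
    next
      case False
      then show ?thesis by (auto simp: G_def)
    qed
    show "G y j = 0" if "j < e \<or> n \<le> j" for y j using that by (auto simp: G_def)
    fix \<epsilon> :: real assume \<epsilon>: "\<epsilon> > 0"
    \<comment> \<open>Any nonzero value of modulus below \<epsilon> would do; being nonzero gives
      the derivatives their Lipschitz constants.\<close>
    define h where "h = \<epsilon> / 2"
    have h: "h \<noteq> 0" "\<bar>h\<bar> < \<epsilon>" using \<epsilon> by (auto simp: h_def)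
    define I where "I = {e..<n}"
    have In: "i < n" if "i \<in> I" for i using that by (simp add: I_def)
    \<comment> \<open>The Jacobian matrix of the smoothed functions on the slice with parameter
      \<open>h\<close>.\<close>
    define p where "p i j z = partial_deriv j (g i) (z(m := h))" for i j and z :: point
    obtain Lg where Lg: "\<And>i. i < n \<Longrightarrow> slice_Lipschitz m h (Lg i) (g i)" using g(3)[OF _ h(1)] by metis
    obtain Lp where Lp: "\<And>i j. i < n \<Longrightarrow> j < m \<Longrightarrow> slice_Lipschitz m h (Lp i j) (partial_deriv j (g i))" using g(4)[OF _ h(1)] by metis
    obtain R :: nat where R: "\<And>z j. z \<in> Q1 \<Longrightarrow> j < m \<Longrightarrow> \<bar>z j\<bar> \<le> real R" by (rule compact_coord_bound[OF Q1(1)]) (rule that)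
    have Q1R: "z \<in> Rn m" if "z \<in> Q1" for z using that Q1(2) open_Rn_subset[OF \<Omega>] by auto
    have up: "z(m := h) \<in> Rn (Suc m)" if "z \<in> Rn m" for z using that by (auto simp: Rn_def)
    have sl: "\<bar>F (z(m := h)) - F (w(m := h))\<bar> \<le> \<bar>\<Lambda>\<bar> * (\<Sum>j<m. \<bar>z j - w j\<bar>)"
      if "slice_Lipschitz m h \<Lambda> F" "z \<in> Rn m" "w \<in> Rn m" for F z w \<Lambda>
    proof -
      have "\<bar>F (z(m := h)) - F (w(m := h))\<bar> \<le> \<Lambda> * (\<Sum>j<m. \<bar>(z(m := h)) j - (w(m := h)) j\<bar>)"
        using that(1) up[OF that(2)] up[OF that(3)] unfolding slice_Lipschitz_def by (metis fun_upd_same)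
      also have "(\<Sum>j<m. \<bar>(z(m := h)) j - (w(m := h)) j\<bar>) = (\<Sum>j<m. \<bar>z j - w j\<bar>)" by (intro sum.cong) auto
      also have "\<Lambda> * (\<Sum>j<m. \<bar>z j - w j\<bar>) \<le> \<bar>\<Lambda>\<bar> * (\<Sum>j<m. \<bar>z j - w j\<bar>)"
        by (intro mult_right_mono sum_nonneg) auto
      finally show ?thesis .
    qed
    define z0 :: point where "z0 = (\<lambda>_. 0)"
    have z0: "z0 \<in> Rn m" by (simp add: z0_def Rn_def)
    \<comment> \<open>\<open>B\<close> bounds the entries of \<open>p\<close> on \<open>Q1\<close>
      by their value at 0 and their Lipschitz constant; \<Lambda> then dominates all constants that
      \<open>generic_affine\<close> asks for.\<close>
    define B where "B i j = \<bar>p i j z0\<bar> + \<bar>Lp i j\<bar> * (m * real R)" for i j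
    define \<Lambda> where "\<Lambda> = (\<Sum>i\<in>I. \<bar>Lg i\<bar> + (\<Sum>j<m. \<bar>Lp i j\<bar> + B i j))"
    have B0: "B i j \<ge> 0" for i j by (simp add: B_def)
    have \<Lambda>i: "\<bar>Lg i\<bar> + (\<Sum>j<m. \<bar>Lp i j\<bar> + B i j) \<le> \<Lambda>" if "i \<in> I" for i
      unfolding \<Lambda>_def using that B0 by (intro member_le_sum) (auto simp: I_def intro!: add_nonneg_nonneg sum_nonneg)
    have \<Lambda>ij: "\<bar>Lp i j\<bar> + B i j \<le> (\<Sum>j<m. \<bar>Lp i j\<bar> + B i j)" if "j < m" for i j
      using that B0 by (intro member_le_sum) auto
    have \<Lambda>0: "\<Lambda> \<ge> 0" unfolding \<Lambda>_def using B0 by (intro sum_nonneg add_nonneg_nonneg) auto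
    have LgL: "\<bar>Lg i\<bar> \<le> \<Lambda>" if "i \<in> I" for i
    proof -
      have "(\<Sum>j<m. \<bar>Lp i j\<bar> + B i j) \<ge> 0" using B0 by (intro sum_nonneg add_nonneg_nonneg) auto
      then show ?thesis using \<Lambda>i[OF that] by linarith
    qed
    have LpL: "\<bar>Lp i j\<bar> \<le> \<Lambda>" "B i j \<le> \<Lambda>" if "i \<in> I" "j < m" for i j
      using \<Lambda>i[OF that(1)] \<Lambda>ij[OF that(2), of i] B0[of i j] by linarith+
    have s0: "(\<Sum>j<m. \<bar>z j - w j\<bar>) \<ge> 0" for z w :: point by (intro sum_nonneg) auto
    have "\<exists>v L. (\<forall>i. \<bar>v i\<bar> < \<epsilon>) \<and> (\<forall>i j. \<bar>L i j\<bar> < \<epsilon>) \<and>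
      (\<forall>z\<in>Q1. (\<forall>i\<in>I. g i (z(m := h)) + (v i + (\<Sum>j<m. L i j * z j)) = 0) \<longrightarrow> indep_rows I m (\<lambda>i j. p i j z + L i j))"
    proof (rule generic_affine[where R = R and \<Lambda> = \<Lambda>])
      show "\<bar>z j\<bar> \<le> real R" if "z \<in> Q1" "j < m" for z j using R[OF that] .
      show "finite I" by (simp add: I_def)
      show "\<bar>g i (z(m := h)) - g i (w(m := h))\<bar> \<le> \<Lambda> * (\<Sum>j<m. \<bar>z j - w j\<bar>)"
        if "i \<in> I" "z \<in> Q1" "w \<in> Q1" for i z w
        using sl[OF Lg[OF In[OF that(1)]] Q1R[OF that(2)] Q1R[OF that(3)]] mult_right_mono[OF LgL[OF that(1)] s0[of z w]] by linarith
      show "\<bar>p i j z - p i j w\<bar> \<le> \<Lambda> * (\<Sum>j<m. \<bar>z j - w j\<bar>)" if "i \<in> I" "j < m" "z \<in> Q1" "w \<in> Q1" for i j z w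
        using sl[OF Lp[OF In[OF that(1)] that(2)] Q1R[OF that(3)] Q1R[OF that(4)]] mult_right_mono[OF LpL(1)[OF that(1,2)] s0[of z w]]
        unfolding p_def by linarith
      show "\<bar>p i j z\<bar> \<le> \<Lambda>" if "i \<in> I" "j < m" "z \<in> Q1" for i j z
      proof -
        have "(\<Sum>j<m. \<bar>z j - z0 j\<bar>) \<le> (\<Sum>j<m. real R)" using R[OF that(3)] by (intro sum_mono) (auto simp: z0_def)
        then have "\<bar>Lp i j\<bar> * (\<Sum>j<m. \<bar>z j - z0 j\<bar>) \<le> \<bar>Lp i j\<bar> * (m * real R)" by (intro mult_left_mono) auto
        then have "\<bar>p i j z\<bar> \<le> B i j"
          using sl[OF Lp[OF In[OF that(1)] that(2)] Q1R[OF that(3)] z0] unfolding B_def p_def by linarith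
        then show ?thesis using LpL(2)[OF that(1,2)] by linarith
      qed
    qed (use \<epsilon> \<Lambda>0 in auto)
    then obtain v L where v: "\<And>i. \<bar>v i\<bar> < \<epsilon>" and L: "\<And>i j. \<bar>L i j\<bar> < \<epsilon>"
      and gen: "\<And>z. z \<in> Q1 \<Longrightarrow> (\<forall>i\<in>I. g i (z(m := h)) + (v i + (\<Sum>j<m. L i j * z j)) = 0) \<Longrightarrow> indep_rows I m (\<lambda>i j. p i j z + L i j)"
      by blast
    \<comment> \<open>Inverts \<open>idx\<close>: row and column are quotient and remainder for
      \<open>Suc m\<close>, and the last column holds \<open>v\<close>.\<close>
    define t where "t k = (if k = 0 then h else if k < d then
        (if (k - 1) mod Suc m < m then L ((k - 1) div Suc m) ((k - 1) mod Suc m) else v ((k - 1) div Suc m)) else 0)" for k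
    have td: "t \<in> cube d \<epsilon>" using v L h(2) by (auto simp: cube_iff Rn_def t_def d_def)
    have tidx: "t (idx i j) = (if j < m then L i j else v i)" if "i < n" "j \<le> m" for i j
    proof -
      have "(i * Suc m + j) mod Suc m = j" using that by (metis le_imp_less_Suc mod_less mod_mult_self3)
      moreover have "(i * Suc m + j) div Suc m = i" using that
        by (metis add.right_neutral div_less div_mult_self3 le_imp_less_Suc nat.distinct(1))
      ultimately show ?thesis using idx[OF that] by (simp add: t_def idx_def)
    qed
    have val: "f i z + G (glue m z t) i = g i (z(m := h)) + (v i + (\<Sum>j<m. L i j * z j))"
      if i: "i \<in> I" and z: "z \<in> O1" for i z
    proof -
      have zQ: "z \<in> Q1" using z O1(3) by auto
      have f1: "first_coords m (glue m z t) = z" by (rule first_coords_glue[OF Q1R[OF zQ]])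
      have f2: "first_coords (Suc m) (glue m z t) = z(m := h)"
        using Q1R[OF zQ] by (auto simp: first_coords_def glue_def Rn_def t_def less_Suc_eq)
      have m1: "glue m z t (m + idx i j) = (if j < m then L i j else v i)" if "j \<le> m" for j
        using tidx[OF In[OF i] that] by (simp add: glue_def)
      have m2: "(\<Sum>j<m. glue m z t (m + idx i j) * glue m z t j) = (\<Sum>j<m. L i j * z j)"
        by (intro sum.cong refl) (auto simp: m1, auto simp: glue_def)
      show ?thesis using i b1[OF z] F(2)[OF In[OF i] zQ] m1[of m] m2 unfolding G_def f1 f2 by (simp add: I_def)
    qed
    have pd: "partial_deriv j (\<lambda>z. f i z + G (glue m z t) i) z = p i j z + L i j"
      if i: "i \<in> I" and z: "z \<in> O1" and j: "j < m" for i j z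
    proof -
      have "partial_deriv j (\<lambda>z. f i z + G (glue m z t) i) z =
          partial_deriv j (\<lambda>z. g i (z(m := h)) + (v i + (\<Sum>j<m. L i j * z j))) z"
        by (rule partial_deriv_cong[OF O1(1) z j]) (rule val[OF i])
      also have "\<dots> = p i j z + (0 + L i j)"
      proof (rule partial_derivI, intro DERIV_add DERIV_const)
        have g1: "Ck 1 (Suc m) (Rn (Suc m)) (g i)" using g(1)[OF In[OF i], of 1] r by (simp add: one_enat_def)
        have "z(m := h) \<in> Rn (Suc m)" using z O1(3) Q1R up by blast
        from Ck_has_partial[OF g1 _ _ this, of j] j
        have "((\<lambda>s. g i ((z(m := h))(j := s))) has_real_derivative p i j z) (at (z j))" by (simp add: p_def)
        moreover have "(z(j := s))(m := h) = (z(m := h))(j := s)" for s using j by (auto simp: fun_eq_iff)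
        ultimately show "((\<lambda>s. g i ((z(j := s))(m := h))) has_real_derivative p i j z) (at (z j))" by simp
        have "((\<lambda>s. \<Sum>l<m. L i l * (z(j := s)) l) has_real_derivative (\<Sum>l<m. if l = j then L i l else 0)) (at (z j))"
        proof (rule DERIV_sum)
          show "((\<lambda>s. L i l * (z(j := s)) l) has_real_derivative (if l = j then L i l else 0)) (at (z j))" for l
            by (cases "l = j") (auto intro!: derivative_eq_intros)
        qed
        then show "((\<lambda>s. \<Sum>l<m. L i l * (z(j := s)) l) has_real_derivative L i j) (at (z j))" using j by simp
      qed
      finally show ?thesis by simp
    qed
    have "indep_rows {e..<n} m (\<lambda>i j. partial_deriv j (\<lambda>z. f i z + G (glue m z t) i) z)"
      if z: "z \<in> O1" and 0: "\<forall>i\<in>{e..<n}. f i z + G (glue m z t) i = 0" for z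
    proof -
      have "indep_rows I m (\<lambda>i j. p i j z + L i j)"
        by (rule gen) (use z O1(3) 0 val[OF _ z] in \<open>auto simp: I_def\<close>)
      moreover have "indep_rows I m (\<lambda>i j. p i j z + L i j) \<longleftrightarrow> indep_rows I m (\<lambda>i j. partial_deriv j (\<lambda>z. f i z + G (glue m z t) i) z)"
        unfolding indep_rows_def using pd[OF _ z] by simp
      ultimately show ?thesis by (simp add: I_def)
    qed
    then show "\<exists>t\<in>cube d \<epsilon>. \<forall>z\<in>O1. (\<forall>i\<in>{e..<n}. f i z + G (glue m z t) i = 0) \<longrightarrow>
       indep_rows {e..<n} m (\<lambda>i j. partial_deriv j (\<lambda>z. f i z + G (glue m z t) i) z)" using td by blast
  qed
qed


text \<open>The track joins both points leafwise inside \<open>V\<close>, hence inside one component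
  of the intersection of a leaf with \<open>V\<close>, and a local saturation is a union of such
  components.\<close>

lemma (in leafwise_perturbation) \<psi>_in_saturation:
  assumes x: "x \<in> topspace (base_space M)" and t: "t \<in> cube d \<delta>"
    and V: "\<And>s. s \<in> {0..1} \<Longrightarrow> \<psi> (\<lambda>i. s * t i) x \<in> V"
    and S: "S = \<Union> {C \<in> leaves_on N V. C \<inter> A \<noteq> {}}" and \<phi>S: "\<phi> x \<in> S"
  shows "\<psi> t x \<in> S"
proof -
  obtain C where C: "C \<in> leaves_on N V" "C \<inter> A \<noteq> {}" "\<phi> x \<in> C" using \<phi>S S by blast
  then obtain L where L: "L \<in> leaves N" "C \<in> connected_components_of (subtopology (leaf_topology N) (L \<inter> V))"
    unfolding leaves_on_def by blast
  obtain S' where S': "connectedin (subtopology (leaf_topology N) V) S'" "\<phi> x \<in> S'" "\<psi> t x \<in> S'"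
    using track_connected[OF x t V] by blast
  have "C \<subseteq> L \<inter> V" using connected_components_of_subset[OF L(2)] by auto
  then have "\<phi> x \<in> L" using C(3) by auto
  then have "S' \<subseteq> L"
    using connected_components_of_maximal[of L "leaf_topology N" S'] L(1) S' 
    unfolding leaves_def disjnt_def connectedin_subtopology by blast
  then have "connectedin (subtopology (leaf_topology N) (L \<inter> V)) S'"
    using S'(1) by (auto simp: connectedin_subtopology)
  then have "S' \<subseteq> C" using connected_components_of_maximal[OF L(2)] S'(2) C(3) unfolding disjnt_def by blast
  then show ?thesis using S'(3) C S by blast
qed

text \<open>The saturation \<open>S\<close> is kept, only the neighbourhood of the preimage of
  \<open>A\<close> changes. The points of \<open>Q\<close> sent into \<open>A\<close> have a compact
  neighbourhood \<open>K3\<close> whose tracks stay in \<open>V\<close>, so it is still sent into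
  \<open>S\<close>. The rest of \<open>Q\<close> is sent off the closed set \<open>A\<close>, and
  stays off for small \<open>t\<close>.\<close>

lemma (in leafwise_perturbation) \<psi>_foliation_maps_rel:
  assumes \<phi>Y: "\<phi> \<in> foliation_maps_rel r M N A" and A: "closedin (base_space N) A"
  shows "\<exists>\<epsilon>>0. \<epsilon> \<le> \<delta> \<and> (\<forall>t\<in>cube d \<epsilon>. \<psi> t \<in> foliation_maps_rel r M N A)"
proof -
  let ?X = "base_space M"
  obtain S W where S: "good_local_saturation r N A S" and W: "openin ?X W"
    "{x \<in> topspace ?X. \<phi> x \<in> A} \<subseteq> W" "W \<subseteq> {x \<in> topspace ?X. \<phi> x \<in> S}"
    using \<phi>Y unfolding foliation_maps_rel_def mem_Collect_eq by (elim conjE exE) (rule that)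
  obtain V where V: "openin (base_space N) V" "A \<subseteq> V" "S = \<Union> {C \<in> leaves_on N V. C \<inter> A \<noteq> {}}"
    using S unfolding good_local_saturation_def local_saturation_def by blast
  have Qt: "Q \<subseteq> topspace ?X" using compactin_subset_topspace[OF Q(1)] .
  let ?A = "{x \<in> topspace ?X. \<phi> x \<in> A}"
  have "closedin ?X ?A" by (rule closedin_continuous_map_preimage[OF \<phi>_cont A])
  then have AQ: "compactin ?X (?A \<inter> Q)" using Q(1) by (rule closed_Int_compactin)
  have WV: "openin ?X (W \<inter> {x \<in> topspace ?X. \<phi> x \<in> V})"
    by (intro openin_Int W(1) openin_continuous_map_preimage[OF \<phi>_cont V(1)])
  have AW: "?A \<inter> Q \<subseteq> W \<inter> {x \<in> topspace ?X. \<phi> x \<in> V}" using W(2) V(2) by auto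
  obtain K3 G3 where K3: "compactin ?X K3" "openin ?X G3" "?A \<inter> Q \<subseteq> G3" "G3 \<subseteq> K3"
      "K3 \<subseteq> W \<inter> {x \<in> topspace ?X. \<phi> x \<in> V}"
    by (rule compact_nbhd_compact[OF MM AQ AW WV])
  have QG: "compactin ?X ((topspace ?X - G3) \<inter> Q)"
    by (rule closed_Int_compactin[OF _ Q(1)]) (use K3(2) in blast)
  have NA: "openin (base_space N) (topspace (base_space N) - A)" using A by (simp add: openin_diff)
  have QA: "\<phi> ` ((topspace ?X - G3) \<inter> Q) \<subseteq> topspace (base_space N) - A"
    using K3(3) continuous_map_image_subset_topspace[OF \<phi>_cont] by auto
  obtain e2 where e2: "e2 > 0" "e2 \<le> \<delta>"
    "\<And>t. t \<in> cube d e2 \<Longrightarrow> \<psi> t ` ((topspace ?X - G3) \<inter> Q) \<subseteq> topspace (base_space N) - A"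
    using compact_into_open[OF QG NA QA] by blast
  have "\<phi> ` K3 \<subseteq> V" using K3(5) by auto
  then obtain e3 where e3: "e3 > 0" "e3 \<le> \<delta>" "\<And>t. t \<in> cube d e3 \<Longrightarrow> \<psi> t ` K3 \<subseteq> V"
    using compact_into_open[OF K3(1) V(1)] by blast
  define \<epsilon> where "\<epsilon> = min e2 e3"
  have \<epsilon>: "\<epsilon> > 0" "\<epsilon> \<le> \<delta>" using e2 e3 by (auto simp: \<epsilon>_def)
  have "\<psi> t \<in> foliation_maps_rel r M N A" if t: "t \<in> cube d \<epsilon>" for t
  proof -
    have t\<delta>: "t \<in> cube d \<delta>" and t2: "t \<in> cube d e2" and t3: "t \<in> cube d e3"
      using t \<epsilon>(2) cube_mono[of \<epsilon> \<delta> d] cube_mono[of \<epsilon> e2 d] cube_mono[of \<epsilon> e3 d] by (auto simp: \<epsilon>_def)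
    \<comment> \<open>Off \<open>Q\<close> nothing has moved; on \<open>Q\<close> only the part in
      \<open>G3\<close> is kept, where the tracks are controlled.\<close>
    define W' where "W' = (W - Q) \<union> G3"
    have Qcl: "closedin ?X Q"
    proof -
      have "Hausdorff_space ?X" using MM unfolding Cr_manifold_def by blast
      then show ?thesis using compactin_imp_closedin Q(1) by blast
    qed
    have "openin ?X W'" unfolding W'_def using W(1) Qcl K3(2) by (intro openin_Un openin_diff)
    moreover have "{x \<in> topspace ?X. \<psi> t x \<in> A} \<subseteq> W'"
    proof
      fix x assume x: "x \<in> {x \<in> topspace ?X. \<psi> t x \<in> A}"
      show "x \<in> W'"
      proof (cases "x \<in> Q")
        case True
        then have "x \<in> G3" using e2(3)[OF t2] x by auto
        then show ?thesis by (simp add: W'_def)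
      next
        case False
        then show ?thesis using \<psi>_outside[OF False, of t] x W(2) by (auto simp: W'_def)
      qed
    qed
    moreover have "W' \<subseteq> {x \<in> topspace ?X. \<psi> t x \<in> S}"
    proof
      fix x assume x: "x \<in> W'"
      show "x \<in> {x \<in> topspace ?X. \<psi> t x \<in> S}"
      proof (cases "x \<in> G3")
        case True
        then have xK: "x \<in> K3" using K3(4) by auto
        then have xt: "x \<in> topspace ?X" and xS: "\<phi> x \<in> S" using K3(5) W(3) by auto
        have "\<psi> t x \<in> S"
        proof (rule \<psi>_in_saturation[OF xt t\<delta> _ V(3) xS])
          show "\<psi> (\<lambda>i. s * t i) x \<in> V" if "s \<in> {0..1}" for s
            using e3(3)[OF cube_scale[OF t3 that]] xK by auto
        qed
        then show ?thesis using xt by simp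
      next
        case False
        then have "x \<in> W" "x \<notin> Q" using x by (auto simp: W'_def)
        then show ?thesis using \<psi>_outside[of x t] W(3) by auto
      qed
    qed
    ultimately show ?thesis
      unfolding foliation_maps_rel_def using \<psi>_foliation_map[OF t\<delta>] S by blast
  qed
  then show ?thesis using \<epsilon> by blast
qed

text \<open>Only the compact set of points of \<open>K\<close> sent into \<open>L\<close> has to be
  treated: the generic perturbation is carried by a neighbourhood of it, and the rest of
  \<open>K\<close> stays off \<open>L\<close> for small \<open>t\<close>. A point sent into
  \<open>L\<close> by the perturbed map lands in \<open>A\<close>, so its coordinates from
  \<open>e\<close> on vanish, which is the premise of the genericity statement.\<close>

lemma good_set_dense:
  assumes MF: "Cr_foliation r M" and NF: "Cr_foliation r N" and r: "1 \<le> r"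
    and \<phi>Y: "\<phi> \<in> foliation_maps_rel r M N A" and A: "closedin (base_space N) A"
    and c: "(U, \<theta>) \<in> atlas M" and st: "straight_chart N A e (U', \<theta>')"
    and K: "compactin (base_space M) K" "K \<subseteq> U" and L: "closedin (base_space N) L" "L \<subseteq> A \<inter> U'"
    and O: "openin (sp_topology r M N) S" "\<phi> \<in> S"
  shows "\<exists>\<psi>\<in>S. \<psi> \<in> foliation_maps_rel r M N A \<and> \<psi> \<in> good_set r M N e (U, \<theta>) (U', \<theta>') K L"
proof -
  let ?m = "mdim M" and ?n = "mdim N" and ?X = "base_space M"
  note MM = foliation_manifold[OF MF] and NM = foliation_manifold[OF NF]
  have \<phi>f: "\<phi> \<in> foliation_maps r M N" using \<phi>Y by (simp add: foliation_maps_rel_def)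
  then have \<phi>m: "Cr_map r M N \<phi>" and \<phi>c: "continuous_map ?X (base_space N) \<phi>"
    by (auto simp: foliation_maps_def Cr_map_def)
  have c': "(U', \<theta>') \<in> fcharts N" and e: "codim N \<le> e" "e \<le> ?n"
    and AU': "\<And>y. y \<in> U' \<Longrightarrow> y \<in> A \<Longrightarrow> \<forall>i\<ge>e. \<theta>' y i = 0"
    using st unfolding straight_chart_def by auto
  have c'a: "(U', \<theta>') \<in> atlas N" using c' fcharts_atlas[OF NF] by auto
  note ch = atlas_is_chart[OF MM c] and ch' = atlas_is_chart[OF NM c'a]
  define Dm where "Dm = {x \<in> U. \<phi> x \<in> U'}"
  define f where "f i z = \<theta>' (\<phi> (inv_into U \<theta> z)) i" for i z
  have \<Omega>: "openin (Euclidean_space ?m) (\<theta> ` Dm)" unfolding Dm_def by (rule Cr_map_dom_openin(2)[OF MM NM \<phi>m c c'a])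
  have fCk: "Ck k ?m (\<theta> ` Dm) (f i)" if "enat k \<le> r" "i < ?n" for k i
    using Cr_map_Ck[OF MM \<phi>m c c'a that] by (simp add: f_def[abs_def] Dm_def)
  have inv\<theta>: "inv_into U \<theta> (\<theta> x) = x" if "x \<in> U" for x using chart_inj[OF ch] that by simp
  have DmU: "Dm \<subseteq> U" by (auto simp: Dm_def)
  let ?C = "{x \<in> topspace ?X. \<phi> x \<in> L} \<inter> K"
  have C: "compactin ?X ?C" by (rule closed_Int_compactin[OF closedin_continuous_map_preimage[OF \<phi>c L(1)] K(1)])
  have CD: "?C \<subseteq> Dm" using K(2) L(2) by (auto simp: Dm_def)
  have "compactin (subtopology ?X U) ?C" using C CD DmU by (auto simp: compactin_subtopology)
  from image_compactin[OF this chart_continuous[OF ch]]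
  have \<theta>C: "compact (\<theta> ` ?C)" by (simp add: Euclidean_space_eq compactin_subtopology)
  obtain d G Q1 O1 where Q1: "compact Q1" "Q1 \<subseteq> \<theta> ` Dm" and O1: "openin (Euclidean_space ?m) O1" "\<theta> ` ?C \<subseteq> O1" "O1 \<subseteq> Q1"
    and G: "\<And>k j. enat k \<le> r \<Longrightarrow> Ck k (?m + d) (Rn (?m + d)) (\<lambda>y. G y j)"
    "\<And>y j. first_coords ?m y \<notin> Q1 \<Longrightarrow> G y j = 0" "\<And>y j. last_coords ?m y = (\<lambda>_. 0) \<Longrightarrow> G y j = 0"
    "\<And>y j. j < e \<or> ?n \<le> j \<Longrightarrow> G y j = (0::real)"
    and gen: "\<And>\<epsilon>. \<epsilon> > 0 \<Longrightarrow> \<exists>t\<in>cube d \<epsilon>. \<forall>z\<in>O1. (\<forall>i\<in>{e..<?n}. f i z + G (glue ?m z t) i = 0) \<longrightarrow>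
       indep_rows {e..<?n} ?m (\<lambda>i j. partial_deriv j (\<lambda>z. f i z + G (glue ?m z t) i) z)"
    by (rule ex_transverse_family[OF r \<Omega> fCk \<theta>C image_mono[OF CD], where e = e]) (assumption, assumption, rule that)
  have Q1U: "Q1 \<subseteq> \<theta> ` U" using Q1(2) DmU by auto
  have Q1R: "z \<in> Rn ?m" if "z \<in> Q1" for z using that Q1(2) open_Rn_subset[OF \<Omega>] by auto
  define Q where "Q = inv_into U \<theta> ` Q1"
  have \<theta>Q: "\<theta> ` Q = Q1" unfolding Q_def using Q1U by (rule image_inv_into_cancel[OF refl])
  have QD: "Q \<subseteq> Dm"
  proof
    fix x assume "x \<in> Q"
    then obtain x' where "x' \<in> Dm" "x = inv_into U \<theta> (\<theta> x')" unfolding Q_def using Q1(2) by blast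
    then show "x \<in> Dm" using inv\<theta> DmU by auto
  qed
  have "compactin (subtopology (Euclidean_space ?m) (\<theta> ` U)) Q1"
    using Q1(1) Q1U Q1R by (auto simp: Euclidean_space_eq compactin_subtopology)
  from image_compactin[OF this chart_inv_continuous[OF ch]]
  have Qc: "compactin ?X Q" unfolding Q_def .
  define P where "P y = (\<lambda>j. f j (first_coords ?m y) + G y j)" for y
  \<comment> \<open>The perturbed coordinates must remain in the image of the target chart; a tube
    around the parameter 0 provides this on \<open>Q1\<close>, and off \<open>Q1\<close> nothing is
    added.\<close>
  have "\<exists>\<delta>>0. \<forall>z\<in>Q1. \<forall>t\<in>cube d \<delta>. P (glue ?m z t) \<in> \<theta>' ` U'"
  proof -
    let ?Z = "subtopology (Euclidean_space ?m) (\<theta> ` Dm)" and ?T = "subtopology (Euclidean_space d) (cube d 1)"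
    let ?p = "\<lambda>p. P (glue ?m (fst p) (snd p))"
    have tZ: "topspace ?Z = \<theta> ` Dm" using open_Rn_subset[OF \<Omega>] by auto
    have 1: "continuous_map (prod_topology ?Z ?T) ?Z fst" by (rule continuous_map_fst)
    then have 10: "continuous_map (prod_topology ?Z ?T) (Euclidean_space ?m) fst" using continuous_map_into_fulltopology by blast
    have "continuous_map (prod_topology ?Z ?T) ?T snd" by (rule continuous_map_snd)
    then have 2: "continuous_map (prod_topology ?Z ?T) (Euclidean_space d) snd" using continuous_map_into_fulltopology by blast
    have 3: "continuous_map (prod_topology ?Z ?T) (Euclidean_space (?m + d)) (\<lambda>p. glue ?m (fst p) (snd p))"
      by (rule continuous_map_glue[OF 10 2])
    have r0: "enat 0 \<le> r" by (simp add: zero_enat_def[symmetric])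
    have eqP: "?p p j = f j (fst p) + G (glue ?m (fst p) (snd p)) j" if "p \<in> topspace (prod_topology ?Z ?T)" for p j
    proof -
      have "fst p \<in> Rn ?m" using that open_Rn_subset[OF \<Omega>] by auto
      then show ?thesis by (simp add: P_def first_coords_glue)
    qed
    have "continuous_map (prod_topology ?Z ?T) (Euclidean_space ?n) ?p"
    proof (rule continuous_map_RnI)
      fix j assume j: "j < ?n"
      have "continuous_map ?Z euclideanreal (f j)"
        using fCk[OF r0 j] continuous_map_Rn[OF open_Rn_subset[OF \<Omega>]] by simp
      from continuous_map_compose[OF 1 this]
      have a: "continuous_map (prod_topology ?Z ?T) euclideanreal (\<lambda>p. f j (fst p))" by (simp add: o_def)
      have "continuous_map (Euclidean_space (?m + d)) euclideanreal (\<lambda>y. G y j)"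
        using G(1)[OF r0, of j] continuous_map_Rn[of "Rn (?m + d)" "?m + d"] subtopology_topspace[of "Euclidean_space (?m + d)"] by simp
      from continuous_map_compose[OF 3 this]
      have b: "continuous_map (prod_topology ?Z ?T) euclideanreal (\<lambda>p. G (glue ?m (fst p) (snd p)) j)" by (simp add: o_def)
      show "continuous_map (prod_topology ?Z ?T) euclideanreal (\<lambda>p. ?p p j)"
        by (rule continuous_map_eq[OF continuous_map_add[OF a b]]) (use eqP in simp)
    next
      fix p assume p: "p \<in> topspace (prod_topology ?Z ?T)"
      then obtain x where x: "x \<in> Dm" "fst p = \<theta> x" by auto
      then have "\<theta>' (\<phi> x) \<in> Rn ?n" using open_Rn_subset[OF chart_image_openin[OF ch']] by (auto simp: Dm_def)
      then show "?p p \<in> Rn ?n" using eqP[OF p] x inv\<theta> DmU G(4) by (auto simp: Rn_def f_def)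
    qed
    then have W1: "openin (prod_topology ?Z ?T) {p \<in> topspace (prod_topology ?Z ?T). ?p p \<in> \<theta>' ` U'}"
      by (rule openin_continuous_map_preimage) (rule chart_image_openin[OF ch'])
    have W2: "compactin ?Z Q1" using Q1 Q1R by (auto simp: Euclidean_space_eq compactin_subtopology)
    have W3: "Q1 \<times> {\<lambda>_. 0} \<subseteq> {p \<in> topspace (prod_topology ?Z ?T). ?p p \<in> \<theta>' ` U'}"
    proof clarify
      fix z assume z: "z \<in> Q1"
      then obtain x where x: "x \<in> Dm" "z = \<theta> x" using Q1(2) by auto
      have pt: "(z, \<lambda>_. 0) \<in> topspace (prod_topology ?Z ?T)"
        using z Q1(2) tZ zero_in_cube[of 1 d] open_Rn_subset[OF openin_cube[of d 1]] by auto
      have "inv_into U \<theta> z = x" using x inv\<theta> DmU by auto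
      then have "?p (z, \<lambda>_. 0) j = \<theta>' (\<phi> x) j" for j
        using eqP[OF pt, of j] G(3)[of "glue ?m z (\<lambda>_. 0)" j] by (simp add: last_coords_glue f_def)
      then have "?p (z, \<lambda>_. 0) = \<theta>' (\<phi> x)" by (rule ext)
      then show "(z, \<lambda>_. 0) \<in> topspace (prod_topology ?Z ?T) \<and> ?p (z, \<lambda>_. 0) \<in> \<theta>' ` U'" using pt x by (auto simp: Dm_def)
    qed
    obtain \<delta> where "\<delta> > 0" "\<delta> \<le> 1" "Q1 \<times> cube d \<delta> \<subseteq> {p \<in> topspace (prod_topology ?Z ?T). ?p p \<in> \<theta>' ` U'}"
      using tube_cube[OF W1 W2 W3 zero_less_one] by blast
    then show ?thesis by (intro exI[of _ \<delta>]) auto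
  qed
  then obtain \<delta> where \<delta>: "\<delta> > 0" "\<And>z t. z \<in> Q1 \<Longrightarrow> t \<in> cube d \<delta> \<Longrightarrow> P (glue ?m z t) \<in> \<theta>' ` U'" by blast
  interpret pert: leafwise_perturbation r M N \<phi> U \<theta> U' \<theta>' Q G d \<delta>
  proof unfold_locales
    show "Cr_foliation r M" "Cr_foliation r N" "\<phi> \<in> foliation_maps r M N" "(U, \<theta>) \<in> atlas M" "(U', \<theta>') \<in> fcharts N"
      "compactin ?X Q" "0 < \<delta>" by fact+
    show "Q \<subseteq> {x \<in> U. \<phi> x \<in> U'}" using QD by (simp add: Dm_def)
    show "Ck k (?m + d) {y \<in> Rn (?m + d). first_coords ?m y \<in> \<theta> ` {x \<in> U. \<phi> x \<in> U'} \<and> last_coords ?m y \<in> cube d \<delta>} (\<lambda>y. G y j)"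
      if "enat k \<le> r" for k j by (rule Ck_subset[OF G(1)[OF that]]) auto
    show "G y j = 0" if "first_coords ?m y \<notin> \<theta> ` Q" for y j using G(2) that unfolding \<theta>Q by blast
    show "G y j = 0" if "last_coords ?m y = (\<lambda>_. 0)" for y j using G(3) that by blast
    show "G y j = 0" if "j < codim N" for y j using G(4)[of j y] that e by auto
    show "(\<lambda>j. \<theta>' (\<phi> (inv_into U \<theta> (first_coords ?m y))) j + G y j) \<in> \<theta>' ` U'"
      if y: "first_coords ?m y \<in> \<theta> ` {x \<in> U. \<phi> x \<in> U'}" "last_coords ?m y \<in> cube d \<delta>" for y
    proof (cases "first_coords ?m y \<in> Q1")
      case True
      then show ?thesis using \<delta>(2)[OF True y(2)] unfolding glue_first_last by (simp add: P_def f_def)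
    next
      case False
      then have "G y j = 0" for j by (rule G(2))
      then show ?thesis using y(1) inv\<theta> by auto
    qed
  qed
  obtain e1 where e1: "e1 > 0" "e1 \<le> \<delta>" "\<And>t. t \<in> cube d e1 \<Longrightarrow> pert.\<psi> t \<in> S"
    using pert.sp_open_stable[OF O] by blast
  obtain e2 where e2: "e2 > 0" "e2 \<le> \<delta>" "\<And>t. t \<in> cube d e2 \<Longrightarrow> pert.\<psi> t \<in> foliation_maps_rel r M N A"
    using pert.\<psi>_foliation_maps_rel[OF \<phi>Y A] by blast
  let ?G = "{x \<in> U. \<theta> x \<in> O1}"
  have Go: "openin ?X ?G" by (rule chart_preimage_open[OF ch O1(1)])
  have KG: "compactin ?X ((topspace ?X - ?G) \<inter> K)"
    by (rule closed_Int_compactin[OF _ K(1)]) (use Go in blast)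
  have NL: "openin (base_space N) (topspace (base_space N) - L)" using L(1) by (simp add: openin_diff)
  have KL: "\<phi> ` ((topspace ?X - ?G) \<inter> K) \<subseteq> topspace (base_space N) - L"
    using O1(2) K(2) continuous_map_image_subset_topspace[OF \<phi>c] by auto
  obtain e3 where e3: "e3 > 0" "e3 \<le> \<delta>"
    "\<And>t. t \<in> cube d e3 \<Longrightarrow> pert.\<psi> t ` ((topspace ?X - ?G) \<inter> K) \<subseteq> topspace (base_space N) - L"
    using pert.compact_into_open[OF KG NL KL] by blast
  define \<epsilon> where "\<epsilon> = min e1 (min e2 e3)"
  have \<epsilon>: "\<epsilon> > 0" using e1 e2 e3 by (auto simp: \<epsilon>_def)
  obtain t where t: "t \<in> cube d \<epsilon>" and tg: "\<And>z. z \<in> O1 \<Longrightarrow> (\<forall>i\<in>{e..<?n}. f i z + G (glue ?m z t) i = 0) \<Longrightarrow>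
       indep_rows {e..<?n} ?m (\<lambda>i j. partial_deriv j (\<lambda>z. f i z + G (glue ?m z t) i) z)"
    using gen[OF \<epsilon>] by blast
  have t1: "t \<in> cube d e1" "t \<in> cube d e2" "t \<in> cube d e3" and t\<delta>: "t \<in> cube d \<delta>"
  proof -
    have "\<epsilon> \<le> e1" "\<epsilon> \<le> e2" "\<epsilon> \<le> e3" "\<epsilon> \<le> \<delta>" using e1(2) by (auto simp: \<epsilon>_def)
    then show "t \<in> cube d e1" "t \<in> cube d e2" "t \<in> cube d e3" "t \<in> cube d \<delta>"
      using t cube_mono by blast+
  qed
  have form: "\<theta>' (pert.\<psi> t (inv_into U \<theta> z)) i = f i z + G (glue ?m z t) i" if z: "z \<in> O1" for z i
  proof -
    have zQ: "z \<in> Q1" using z O1(3) by auto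
    then obtain x where x: "x \<in> Dm" "z = \<theta> x" using Q1(2) by auto
    have "\<theta>' (pert.\<psi> t x) = pert.P (glue ?m (\<theta> x) t)" using pert.\<psi>_chart[OF _ t\<delta>, of x] x by (simp add: Dm_def)
    then show ?thesis using x inv\<theta> DmU Q1R[OF zQ] by (auto simp: pert.P_def f_def first_coords_glue)
  qed
  have "rank_cond M N e (U, \<theta>) (U', \<theta>') (pert.\<psi> t) x" if x: "x \<in> K" "pert.\<psi> t x \<in> L" for x
  proof -
    have xt: "x \<in> topspace ?X" using x(1) compactin_subset_topspace[OF K(1)] by auto
    have xG: "x \<in> ?G" using e3(3)[OF t1(3)] x xt by auto
    have z: "\<theta> x \<in> O1" and xU: "x \<in> U" using xG by auto
    have "pert.\<psi> t x \<in> U'" "pert.\<psi> t x \<in> A" using x(2) L(2) by auto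
    then have "\<forall>i\<ge>e. \<theta>' (pert.\<psi> t x) i = 0" by (rule AU')
    then have "\<forall>i\<in>{e..<?n}. f i (\<theta> x) + G (glue ?m (\<theta> x) t) i = 0"
      using form[OF z] inv\<theta>[OF xU] by auto
    then have "indep_rows {e..<?n} ?m (\<lambda>i j. partial_deriv j (\<lambda>z. f i z + G (glue ?m z t) i) (\<theta> x))" by (rule tg[OF z])
    moreover have "partial_deriv j (\<lambda>z. f i z + G (glue ?m z t) i) (\<theta> x) =
        partial_deriv j (\<lambda>z. \<theta>' (pert.\<psi> t (inv_into U \<theta> z)) i) (\<theta> x)" if "j < ?m" for i j
      by (rule partial_deriv_cong[OF O1(1) z that]) (simp add: form)
    ultimately show ?thesis unfolding rank_cond_def indep_rows_def by simp
  qed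
  then have "pert.\<psi> t \<in> good_set r M N e (U, \<theta>) (U', \<theta>') K L"
    unfolding good_set_def using pert.\<psi>_foliation_map[OF t\<delta>] by blast
  then show ?thesis using e1(3)[OF t1(1)] e2(3)[OF t1(2)] by blast
qed

section \<open>Countable covers and the residual intersection\<close>

theorem theorem7p2:
  fixes r :: enat
    and M :: "'a foliated"
    and M' :: "'b foliated"
    and A :: "'b set"
    and a :: nat
  assumes "1 \<le> r"
    and "Cr_foliation r M"
    and "Cr_foliation r M'"
    and "regular_submanifold M' a A"
    and "clean_intersection r M' A"
    and "closedin (base_space M') A"
  shows "residual_in (subtopology (sp_topology r M M') (foliation_maps_rel r M M' A))
           {\<phi> \<in> foliation_maps r M M'. ls_transverse r M M' A \<phi>}"
proof -
  let ?X = "base_space M" and ?Y = "base_space M'"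
  let ?F = "foliation_maps_rel r M M' A" and ?R = "{\<phi> \<in> foliation_maps r M M'. ls_transverse r M M' A \<phi>}"
  let ?T = "subtopology (sp_topology r M M') ?F"
  note MM = foliation_manifold[OF assms(2)] and NM = foliation_manifold[OF assms(3)]
  have tT: "topspace ?T = ?F" by (auto simp: topspace_sp_topology foliation_maps_rel_def)
  have XY1: "second_countable ?X" using MM[unfolded Cr_manifold_def] by (elim conjE)
  have XY2: "second_countable ?Y" using NM[unfolded Cr_manifold_def] by (elim conjE)
  have XY3: "Hausdorff_space ?Y" using NM[unfolded Cr_manifold_def] by (elim conjE)
  have "\<exists>c K G. c \<in> fcharts M \<and> compactin ?X K \<and> openin ?X G \<and> x \<in> G \<and> G \<subseteq> K \<and> K \<subseteq> fst c" if x: "x \<in> topspace ?X" for x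
  proof -
    have "x \<in> \<Union> (fst ` fcharts M)" using fcharts_cover[OF assms(2)] x by simp
    then obtain c where c: "c \<in> fcharts M" "x \<in> fst c" by auto
    have "openin ?X (fst c)"
      using chart_openin[OF atlas_is_chart[OF MM, of "fst c" "snd c"]] c fcharts_atlas[OF assms(2)] by auto
    then obtain K G where "compactin ?X K" "openin ?X G" "x \<in> G" "G \<subseteq> K" "K \<subseteq> fst c"
      by (rule compact_nbhd[OF MM c(2)])
    then show ?thesis using c by blast
  qed
  then obtain c K G where cKG: "\<And>x. x \<in> topspace ?X \<Longrightarrow> c x \<in> fcharts M \<and> compactin ?X (K x) \<and> openin ?X (G x) \<and> x \<in> G x \<and> G x \<subseteq> K x \<and> K x \<subseteq> fst (c x)"
    by metis
  have "Lindelof_space ?X" using XY1 second_countable_imp_Lindelof_space by blast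
  moreover have "\<forall>U\<in>G ` topspace ?X. openin ?X U" "\<Union> (G ` topspace ?X) = topspace ?X"
    using cKG openin_subset by fastforce+
  ultimately obtain \<V> where \<V>: "countable \<V>" "\<V> \<subseteq> G ` topspace ?X" "\<Union> \<V> = topspace ?X"
    unfolding Lindelof_space_def by meson
  then obtain X0 where X0: "countable X0" "X0 \<subseteq> topspace ?X" "\<V> = G ` X0"
    by (metis countable_subset_image)
  have "\<exists>c e K G. straight_chart M' A e c \<and> compactin ?Y K \<and> openin ?Y G \<and> y \<in> G \<and> G \<subseteq> K \<and> K \<subseteq> fst c" if y: "y \<in> A" for y
  proof -
    obtain c e where c: "straight_chart M' A e c" "y \<in> fst c" using ex_straight_chart[OF assms(3,5) y] by blast
    then have "c \<in> fcharts M'" by (simp add: straight_chart_def)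
    then have "openin ?Y (fst c)"
      using chart_openin[OF atlas_is_chart[OF NM, of "fst c" "snd c"]] fcharts_atlas[OF assms(3)] by auto
    then obtain K G where "compactin ?Y K" "openin ?Y G" "y \<in> G" "G \<subseteq> K" "K \<subseteq> fst c"
      by (rule compact_nbhd[OF NM c(2)])
    then show ?thesis using c by blast
  qed
  then obtain c' e K' G' where cKG': "\<And>y. y \<in> A \<Longrightarrow> straight_chart M' A (e y) (c' y) \<and> compactin ?Y (K' y) \<and> openin ?Y (G' y) \<and> y \<in> G' y \<and> G' y \<subseteq> K' y \<and> K' y \<subseteq> fst (c' y)"
    by metis
  have At: "A \<subseteq> topspace ?Y" using closedin_subset[OF assms(6)] .
  have "Lindelof_space ?Y" using XY2 second_countable_imp_Lindelof_space by blast
  \<comment> \<open>The complement of the closed set \<open>A\<close> completes the neighbourhoods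
    to a cover of the whole space, to which the Lindelof property applies; it is removed from the
    countable subcover afterwards.\<close>
  moreover have "\<forall>U\<in>insert (topspace ?Y - A) (G' ` A). openin ?Y U"
    using cKG' assms(6) by auto
  moreover have "\<Union> (insert (topspace ?Y - A) (G' ` A)) = topspace ?Y"
  proof (intro equalityI subsetI)
    fix z assume "z \<in> \<Union> (insert (topspace ?Y - A) (G' ` A))"
    then consider "z \<in> topspace ?Y - A" | y where "y \<in> A" "z \<in> G' y" by auto
    then show "z \<in> topspace ?Y"
    proof cases
      case 2
      then have "openin ?Y (G' y)" using cKG' by blast
      then show ?thesis using 2 openin_subset by blast
    qed auto
  next
    fix z assume "z \<in> topspace ?Y"
    then show "z \<in> \<Union> (insert (topspace ?Y - A) (G' ` A))" using cKG'[of z] by auto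
  qed
  ultimately obtain \<V>' where \<V>': "countable \<V>'" "\<V>' \<subseteq> insert (topspace ?Y - A) (G' ` A)" "\<Union> \<V>' = topspace ?Y"
    unfolding Lindelof_space_def by meson
  then have "countable (\<V>' - {topspace ?Y - A})" "\<V>' - {topspace ?Y - A} \<subseteq> G' ` A" by auto
  then obtain Y0 where Y0: "countable Y0" "Y0 \<subseteq> A" "\<V>' - {topspace ?Y - A} = G' ` Y0"
    by (metis countable_subset_image)
  have AY0: "\<exists>y\<in>Y0. z \<in> G' y" if "z \<in> A" for z
  proof -
    obtain V where "V \<in> \<V>'" "z \<in> V" using \<V>'(3) At \<open>z \<in> A\<close> by blast
    then have "V \<in> G' ` Y0" using Y0(3) that by blast
    then show ?thesis using \<open>z \<in> V\<close> by blast
  qed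
  \<comment> \<open>The pieces \<open>A \<inter> K' y\<close> are closed, lie in one straight chart
    each, and cover \<open>A\<close> as \<open>y\<close> ranges over \<open>Y0\<close>.\<close>
  define D where "D x y = good_set r M M' (e y) (c x) (c' y) (K x) (A \<inter> K' y) \<inter> ?F" for x y
  have Lcl: "closedin ?Y (A \<inter> K' y)" "A \<inter> K' y \<subseteq> A \<inter> fst (c' y)" "c' y \<in> fcharts M'" if "y \<in> A" for y
    using cKG'[OF that] compactin_imp_closedin[OF XY3] assms(6) by (auto simp: straight_chart_def)
  have Dopen: "openin ?T (D x y)" if "x \<in> topspace ?X" "y \<in> A" for x y
    unfolding D_def using cKG[OF that(1)] Lcl[OF that(2)]
    by (intro openin_subtopology_Int good_set_open[OF assms(2,3,1)]) auto
  have Ddense: "?T closure_of (D x y) = topspace ?T" if x: "x \<in> topspace ?X" and y: "y \<in> A" for x y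
  proof (intro equalityI subsetI)
    fix \<phi> assume "\<phi> \<in> topspace ?T"
    then have \<phi>: "\<phi> \<in> ?F" using tT by simp
    show "\<phi> \<in> ?T closure_of (D x y)"
      unfolding in_closure_of
    proof (intro conjI allI impI)
      show "\<phi> \<in> topspace ?T" by fact
      fix V assume V: "\<phi> \<in> V \<and> openin ?T V"
      then obtain S where S: "openin (sp_topology r M M') S" "V = S \<inter> ?F" by (auto simp: openin_subtopology)
      obtain U \<theta> U' \<theta>' where eq: "c x = (U, \<theta>)" "c' y = (U', \<theta>')" by fastforce
      have "(U, \<theta>) \<in> atlas M" "straight_chart M' A (e y) (U', \<theta>')" "compactin ?X (K x)" "K x \<subseteq> U"
        using cKG[OF x] cKG'[OF y] fcharts_atlas[OF assms(2)] eq by auto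
      from good_set_dense[OF assms(2,3,1) \<phi> assms(6) this Lcl(1)[OF y] _ S(1)]
      obtain \<psi> where "\<psi> \<in> S" "\<psi> \<in> ?F" "\<psi> \<in> good_set r M M' (e y) (U, \<theta>) (U', \<theta>') (K x) (A \<inter> K' y)"
        using Lcl(2)[OF y] eq V S(2) by auto
      then show "\<exists>\<psi>. \<psi> \<in> D x y \<and> \<psi> \<in> V" unfolding D_def eq using S(2) by blast
    qed
  qed (auto simp: in_closure_of)
  have final: "\<phi> \<in> ?R" if \<phi>: "\<phi> \<in> ?F" "\<And>x y. x \<in> X0 \<Longrightarrow> y \<in> Y0 \<Longrightarrow> \<phi> \<in> D x y" for \<phi>
  proof -
    have "ls_transverse r M M' A \<phi>"
    proof (rule ls_transverseI[OF assms(2,3,1,4) \<phi>(1)])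
      fix z assume z: "z \<in> topspace ?X" "\<phi> z \<in> A"
      obtain x where x: "x \<in> X0" "z \<in> G x" using \<V>(3) X0(3) z(1) by blast
      obtain y where y: "y \<in> Y0" "\<phi> z \<in> G' y" using AY0[OF z(2)] by blast
      have xt: "x \<in> topspace ?X" and yA: "y \<in> A" using x y X0 Y0 by auto
      have zK: "z \<in> K x" "\<phi> z \<in> A \<inter> K' y" using cKG[OF xt] cKG'[OF yA] x y z by auto
      have "rank_cond M M' (e y) (c x) (c' y) \<phi> z"
        using \<phi>(2)[OF x(1) y(1)] zK by (auto simp: D_def good_set_def)
      moreover have "c x \<in> atlas M" "z \<in> fst (c x)" "straight_chart M' A (e y) (c' y)" "\<phi> z \<in> fst (c' y)"
        using cKG[OF xt] cKG'[OF yA] zK fcharts_atlas[OF assms(2)] by auto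
      ultimately show "\<exists>U \<theta> U' \<theta>' e. (U, \<theta>) \<in> atlas M \<and> z \<in> U \<and>
          straight_chart M' A e (U', \<theta>') \<and> \<phi> z \<in> U' \<and> rank_cond M M' e (U, \<theta>) (U', \<theta>') \<phi> z"
        by (metis prod.collapse)
    qed
    then show ?thesis using \<phi>(1) by (simp add: foliation_maps_rel_def)
  qed
  \<comment> \<open>The witnesses \<open>U\<close> and \<open>S\<close> of ls-transversality also
    witness membership in \<open>?F\<close>.\<close>
  have "?R \<subseteq> topspace ?T"
  proof
    fix \<phi> assume \<phi>: "\<phi> \<in> ?R"
    then obtain U S where US: "openin ?X U" "{x \<in> topspace ?X. \<phi> x \<in> A} \<subseteq> U" "good_local_saturation r M' A S"
      "transverse_into M M' \<phi> U S A" unfolding ls_transverse_def by blast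
    have "U \<subseteq> {x \<in> topspace ?X. \<phi> x \<in> S}" using US(4) openin_subset[OF US(1)] by (auto simp: transverse_into_def)
    then have "\<phi> \<in> ?F" unfolding foliation_maps_rel_def using US \<phi> by blast
    then show "\<phi> \<in> topspace ?T" unfolding tT .
  qed
  moreover have "countable ((\<lambda>(x, y). D x y) ` (X0 \<times> Y0))" using X0(1) Y0(1) by auto
  moreover have "\<forall>D'\<in>(\<lambda>(x, y). D x y) ` (X0 \<times> Y0). openin ?T D' \<and> ?T closure_of D' = topspace ?T"
  proof (intro ballI)
    fix D' assume "D' \<in> (\<lambda>(x, y). D x y) ` (X0 \<times> Y0)"
    then obtain x y where "D' = D x y" "x \<in> topspace ?X" "y \<in> A" using X0(2) Y0(2) by auto
    then show "openin ?T D' \<and> ?T closure_of D' = topspace ?T" using Dopen Ddense by simp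
  qed
  moreover have "topspace ?T \<inter> \<Inter> ((\<lambda>(x, y). D x y) ` (X0 \<times> Y0)) \<subseteq> ?R"
    unfolding tT using final by blast
  ultimately show ?thesis unfolding residual_in_def by blast
qed

end
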